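(* Let $n\ge 1$ be an integer with $n\neq 2$, and let $E>0$. Let $$P=P_h:=-h^2\Delta+V-E,\qquad h>0,$$ where, using polar coordinates $(r,\omega)\in(0,\infty)\times\mathbb S^{n-1}$, the real-valued potential $V=V_h(r,\omega)$ and its distributional derivative $\partial_r V$ are in $L^\infty((0,\infty)\times\mathbb S^{n-1})$. Suppose further that $$V\le (1+r)^{-\delta_0},\qquad \partial_r V\le (1+r)^{-1-\delta_0},$$ for some $\delta_0>0$. Then for any $s>1/2$ there are $C,R_0,h_0>0$ such that $$\left\|(1+r)^{-s}(P-i\varepsilon)^{-1}(1+r)^{-s}\right\|_{L^2(\mathbb R^n)\to L^2(\mathbb R^n)}\le e^{C/h}$$ and $$\left\|(1+r)^{-s}\,\mathbf 1_{\ge R_0}(P-i\varepsilon)^{-1}\mathbf 1_{\ge R_0}(1+r)^{-s}\right\|_{L^2(\mathbb R^n)\to L^2(\mathbb R^n)}\le C/h$$ for all $\varepsilon>0$ and all $h\in(0,h_0]$.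
   Context: $\Delta\le 0$ is the Laplacian on $\mathbb R^n$. Polar coordinates are $r=|x|$, $\omega=x/|x|$; for $n=1$, $\mathbb S^0=\{\pm1\}$. The potential $V=V_h$ may depend on the semiclassical parameter $h$. Since $V\in L^\infty(\mathbb R^n)$, the resolvent $(P-i\varepsilon)^{-1}$ is defined $L^2(\mathbb R^n)\to H^2(\mathbb R^n)$ for $\varepsilon>0$ by the Kato–Rellich theorem. $\mathbf 1_{\ge R_0}$ denotes (multiplication by) the characteristic function of $\{x\in\mathbb R^n:|x|\ge R_0\}$, and $(1+r)^{-s}$ denotes multiplication by $(1+|x|)^{-s}$.
   Formalization: The potentials V_h are assumed bounded in L^∞ uniformly in h; with bounds depending arbitrarily on h the claim fails (n=1: V_h=0 for |x|<1, dropping steeply to -M_h outside, with M_h growing very fast as h→0). *)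

theory Defs
  imports "HOL-Analysis.Analysis"
begin

section \<open>Square-integrable functions and operators on them\<close>

text \<open>
  Elements of \<open>L\<^sup>2\<close> are represented by Borel functions, equality being equality almost everywhere.
\<close>

definition L2 :: "('a::euclidean_space \<Rightarrow> complex) set" where
  "L2 = {f \<in> borel_measurable borel. integrable lborel (\<lambda>x. (norm (f x))\<^sup>2)}"

definition L2norm :: "('a::euclidean_space \<Rightarrow> complex) \<Rightarrow> real" where
  "L2norm f = sqrt (\<integral>x. (norm (f x))\<^sup>2 \<partial>lborel)"

text \<open>
  The value is \<open>\<infinity>\<close> (the infimum of the empty set) if the operator is not bounded on \<open>L\<^sup>2\<close>.
\<close>

definition L2_opnorm ::
  "(('a::euclidean_space \<Rightarrow> complex) \<Rightarrow> ('a \<Rightarrow> complex)) \<Rightarrow> ennreal" where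
  "L2_opnorm T = Inf {ennreal K | K. 0 \<le> K \<and>
     (\<forall>f\<in>L2. T f \<in> L2 \<and> L2norm (T f) \<le> K * L2norm f)}"

definition mult_op ::
  "('a \<Rightarrow> real) \<Rightarrow> ('a \<Rightarrow> complex) \<Rightarrow> ('a \<Rightarrow> complex)" where
  "mult_op m f = (\<lambda>x. complex_of_real (m x) * f x)"

definition weight :: "real \<Rightarrow> ('a::euclidean_space \<Rightarrow> complex) \<Rightarrow> ('a \<Rightarrow> complex)" where
  "weight s = mult_op (\<lambda>x. (1 + norm x) powr (- s))"

definition exterior :: "real \<Rightarrow> ('a::euclidean_space \<Rightarrow> complex) \<Rightarrow> ('a \<Rightarrow> complex)" where
  "exterior R = mult_op (indicator {x. norm x \<ge> R})"


section \<open>Test functions and weak derivatives\<close>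

primrec C_k :: "nat \<Rightarrow> ('a::euclidean_space \<Rightarrow> real) \<Rightarrow> bool" where
  "C_k 0 f \<longleftrightarrow> continuous_on UNIV f"
| "C_k (Suc k) f \<longleftrightarrow> (\<forall>x. f differentiable (at x)) \<and>
     (\<forall>b\<in>Basis. C_k k (\<lambda>x. frechet_derivative f (at x) b))"

definition test_function :: "'a::euclidean_space set \<Rightarrow> ('a \<Rightarrow> real) \<Rightarrow> bool" where
  "test_function \<Omega> \<phi> \<longleftrightarrow> (\<forall>k. C_k k \<phi>) \<and>
     compact (closure {x. \<phi> x \<noteq> 0}) \<and> closure {x. \<phi> x \<noteq> 0} \<subseteq> \<Omega>"

definition locally_integrable :: "('a::euclidean_space \<Rightarrow> complex) \<Rightarrow> bool" where
  "locally_integrable f \<longleftrightarrow> f \<in> borel_measurable borel \<and>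
     (\<forall>K. compact K \<longrightarrow> set_integrable lborel K f)"

definition has_weak_partial ::
  "'a::euclidean_space \<Rightarrow> ('a \<Rightarrow> complex) \<Rightarrow> ('a \<Rightarrow> complex) \<Rightarrow> bool" where
  "has_weak_partial b u w \<longleftrightarrow> locally_integrable u \<and> locally_integrable w \<and>
     (\<forall>\<phi>. test_function UNIV \<phi> \<longrightarrow>
        (\<integral>x. frechet_derivative \<phi> (at x) b *\<^sub>R u x \<partial>lborel)
          = - (\<integral>x. \<phi> x *\<^sub>R w x \<partial>lborel))"

text \<open>If a weak partial derivative exists, it is unique up to a null set.\<close>

definition weak_partial ::
  "'a::euclidean_space \<Rightarrow> ('a \<Rightarrow> complex) \<Rightarrow> ('a \<Rightarrow> complex)" where
  "weak_partial b u = (SOME w. has_weak_partial b u w)"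

definition H2 :: "('a::euclidean_space \<Rightarrow> complex) set" where
  "H2 = {u \<in> L2. \<forall>b\<in>Basis. \<exists>v\<in>L2. has_weak_partial b u v \<and>
           (\<forall>c\<in>Basis. \<exists>w\<in>L2. has_weak_partial c v w)}"

definition laplacian :: "('a::euclidean_space \<Rightarrow> complex) \<Rightarrow> ('a \<Rightarrow> complex)" where
  "laplacian u = (\<lambda>x. \<Sum>b\<in>Basis. weak_partial b (weak_partial b u) x)"


section \<open>The Schroedinger operator and its resolvent\<close>

definition schroedinger ::
  "real \<Rightarrow> ('a::euclidean_space \<Rightarrow> real) \<Rightarrow> real \<Rightarrow> ('a \<Rightarrow> complex) \<Rightarrow> ('a \<Rightarrow> complex)" where
  "schroedinger h V E u =
     (\<lambda>x. - complex_of_real (h\<^sup>2) * laplacian u x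
            + complex_of_real (V x) * u x - complex_of_real E * u x)"

text \<open>
  \<open>resolvent P z f\<close> represents \<open>(P - z)\<inverse> f\<close>: the function in \<open>H\<^sup>2\<close>, unique up to a null set when
  \<open>z\<close> is in the resolvent set, that \<open>P - z\<close> maps to \<open>f\<close>.
\<close>

definition resolvent ::
  "(('a::euclidean_space \<Rightarrow> complex) \<Rightarrow> ('a \<Rightarrow> complex)) \<Rightarrow> complex
     \<Rightarrow> ('a \<Rightarrow> complex) \<Rightarrow> ('a \<Rightarrow> complex)" where
  "resolvent P z f = (SOME u. u \<in> H2 \<and> (AE x in lborel. P u x - z * u x = f x))"


section \<open>Bounded potentials and the radial derivative\<close>

definition Linfty :: "('a::euclidean_space \<Rightarrow> real) set" where
  "Linfty = {f \<in> borel_measurable borel. \<exists>M. AE x in lborel. \<bar>f x\<bar> \<le> M}"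

text \<open>
  A function of \<open>(r, \<omega>) \<in> (0,\<infinity>) \<times> S\<^sup>n\<^sup>-\<^sup>1\<close> is written as a function of \<open>x = r\<omega> \<noteq> 0\<close>. Polar
  coordinates identify the two domains, with the same null sets and the same compactly supported
  smooth functions, and \<open>dr d\<omega> = \<bar>x\<bar>\<^sup>1\<^sup>-\<^sup>n dx\<close>. The definition below is therefore
  \<open>\<integral>\<integral> V \<partial>\<^sub>r\<phi> dr d\<omega> = - \<integral>\<integral> W \<phi> dr d\<omega>\<close> for all test functions \<open>\<phi>\<close> on \<open>(0,\<infinity>) \<times> S\<^sup>n\<^sup>-\<^sup>1\<close>, that is,
  \<open>W = \<partial>\<^sub>r V\<close> as distributions there; nothing is required across the origin.
\<close>

definition has_distributional_radial_derivative ::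
  "('a::euclidean_space \<Rightarrow> real) \<Rightarrow> ('a \<Rightarrow> real) \<Rightarrow> bool" where
  "has_distributional_radial_derivative V W \<longleftrightarrow>
     (\<forall>\<phi>. test_function (- {0}) \<phi> \<longrightarrow>
        (\<integral>x. V x * frechet_derivative \<phi> (at x) (x /\<^sub>R norm x)
              * norm x powr (1 - real DIM('a)) \<partial>lborel)
          = - (\<integral>x. W x * \<phi> x * norm x powr (1 - real DIM('a)) \<partial>lborel))"

text \<open>
  For a family \<open>V\<^sub>h\<close> of potentials, boundedness is understood uniformly in \<open>h\<close>. Bounds depending on
  \<open>h\<close> would not suffice for estimates with constants independent of \<open>h\<close>: in dimension one, let
  \<open>V\<^sub>h\<close> be \<open>0\<close> for \<open>\<bar>x\<bar> < 1\<close> and drop steeply to \<open>- M\<^sub>h\<close> at \<open>\<bar>x\<bar> = 1\<close>. For \<open>h = \<surd>E / (\<pi> m)\<close> the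
  outgoing resolvent is then at least of order \<open>\<surd>M\<^sub>h / h\<close>, with \<open>M\<^sub>h\<close> arbitrary.
\<close>

definition uniformly_bounded_potential :: "(real \<Rightarrow> 'a::euclidean_space \<Rightarrow> real) \<Rightarrow> bool" where
  "uniformly_bounded_potential V \<longleftrightarrow> (\<forall>h>0. V h \<in> borel_measurable borel) \<and>
     (\<exists>M. \<forall>h>0. AE x in lborel. \<bar>V h x\<bar> \<le> M)"

end

(*
  Let M = d/dr + (n-1)/(2r), w(r) = 1 - (1+r)^(-\<delta>) with \<delta> small, and \<phi> a nondecreasing function
  that is constant for r \<ge> R0. For u in C_c^\<infinity> and v = e^(\<phi>/h) u, pairing e^(\<phi>/h) (P - i\<epsilon>) u with
  w M v and integrating by parts in r gives, up to a term controlled by \<epsilon>, the Carleman estimate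
    |w'^(1/2) e^(\<phi>/h) u|^2  <=  C h^(-2) |(1+r)^s e^(\<phi>/h) (P - i\<epsilon>) u|^2,
  provided that (w (E + \<phi>'^2 - h \<phi>''))' dominates E w'/2 + w' (1+r)^(-\<delta>0) + w (1+r)^(-1-\<delta>0):
  only the upper bounds on V and on its radial derivative enter. Boundary terms at the origin
  disappear because w(0) = 0, and the zeroth order term has the factor (n-1)(n-3) \<ge> 0.
  The term with \<epsilon> is absorbed by the energy identity \<epsilon> |u|^2 = Im <(P - i\<epsilon>) u, u>.
  Since e^(\<phi>/h) lies between 1 and e^(\<phi>(R0)/h), the first estimate loses a factor e^(C/h); for data
  and observation in r \<ge> R0 the weight is a constant, which cancels.

  The estimate passes from C_c^\<infinity> to the resolvent because (P - i\<epsilon>) maps C_c^\<infinity> onto a dense subspace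
  and is bounded below there.
*)

theory Submission
  imports Defs
begin

text \<open>The bound on the radial derivative of V is one-sided and distributional, so it can be
  tested only against nonnegative functions supported away from the origin; hence w >= 0, and a
  cutoff at the origin stays until all integrations by parts are done. On a bounded region the
  contribution of V and its derivative is not small compared with E. There phi'^2 has to outweigh
  it, and further out phi' must fall to zero so slowly that w (phi'^2)' costs only a fraction of E
  w'. This is possible because the size required of phi' does not depend on \<delta>, which is
  chosen last. The resolvent is a choice among H2 functions. So a solution must be shown to exist,
  and the chosen one must be a limit of test functions together with its gradient: the term with
  \<epsilon> contains a radial derivative of u, which the real part of the energy identity controls
  for \<epsilon> <= 1. For \<epsilon> > 1 the imaginary part alone suffices. The \<epsilon> term is
  kept as the integral of |f| |u|. Weights and cutoffs can be moved from f to u under it, and this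
  saves the exterior estimate from an exponential loss.\<close>

section \<open>Smooth functions\<close>

text \<open>On the real line \<open>pd 1 f\<close> is the ordinary derivative, so radial profiles
  and functions on the whole space share one calculus.\<close>

definition pd :: "'a::real_normed_vector \<Rightarrow> ('a \<Rightarrow> 'b::real_normed_vector) \<Rightarrow> 'a \<Rightarrow> 'b" where
  "pd b f = (\<lambda>x. frechet_derivative f (at x) b)"

text \<open>Localised to a set because the norm and the radial weights are smooth only off the
  origin. The derivatives are full ones, not derivatives within S, so the notion is meant for open
  S.\<close>

primrec Ck_on :: "'a::euclidean_space set \<Rightarrow> nat \<Rightarrow> ('a \<Rightarrow> real) \<Rightarrow> bool" where
  "Ck_on S 0 f \<longleftrightarrow> continuous_on S f"
| "Ck_on S (Suc k) f \<longleftrightarrow> (\<forall>x\<in>S. f differentiable (at x)) \<and> (\<forall>b\<in>Basis. Ck_on S k (pd b f))"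

definition smooth_on :: "'a::euclidean_space set \<Rightarrow> ('a \<Rightarrow> real) \<Rightarrow> bool" where
  "smooth_on S f \<longleftrightarrow> (\<forall>k. Ck_on S k f)"

section \<open>Closure properties of C^k functions on open sets\<close>

lemma C_k_eq_Ck_on: "C_k k f \<longleftrightarrow> Ck_on UNIV k f"
  by (induction k arbitrary: f) (auto simp: pd_def)

lemma pd_eqI: "(f has_derivative f') (at x) \<Longrightarrow> pd b f x = f' b"
  unfolding pd_def using frechet_derivative_at by metis

lemma pd_cong:
  assumes "open S" "x \<in> S" "\<And>x. x \<in> S \<Longrightarrow> f x = g x"
  shows "pd b f x = pd b g x"
proof -
  have "(f has_derivative F) (at x) = (g has_derivative F) (at x)" for F
    using has_derivative_transform_within_open[OF _ assms(1,2)] assms(3) by metis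
  then show ?thesis unfolding pd_def frechet_derivative_def by simp
qed

lemma differentiable_cong_open:
  assumes "f differentiable (at x)" "open S" "x \<in> S" "\<And>x. x \<in> S \<Longrightarrow> f x = g x"
  shows "g differentiable (at x)"
  using assms has_derivative_transform_within_open unfolding differentiable_def by metis

lemma Ck_on_cong:
  assumes "open S" "\<And>x. x \<in> S \<Longrightarrow> f x = g x" "Ck_on S k f"
  shows "Ck_on S k g"
  using assms(2,3)
proof (induction k arbitrary: f g)
  case 0
  then show ?case using continuous_on_cong by fastforce
next
  case (Suc k)
  have "Ck_on S k (pd b g)" if "b \<in> Basis" for b
    using Suc.IH[of "pd b f" "pd b g"] pd_cong[OF assms(1)] Suc.prems that by (metis Ck_on.simps(2))
  then show ?case using Suc.prems differentiable_cong_open[OF _ assms(1)] by (metis Ck_on.simps(2))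
qed

lemma Ck_on_SucD: "Ck_on S (Suc k) f \<Longrightarrow> Ck_on S k f"
proof (induction k arbitrary: f)
  case 0
  then show ?case
    by (auto intro!: continuous_at_imp_continuous_on differentiable_imp_continuous_within)
qed auto

text \<open>Lets the derivative be given by a formula. It agrees with \<open>pd\<close> only on S,
  hence the passage through \<open>Ck_on_cong\<close>.\<close>

lemma Ck_on_SucI:
  assumes "open S" "\<And>x. x \<in> S \<Longrightarrow> (f has_derivative f' x) (at x)"
    "\<And>b. b \<in> Basis \<Longrightarrow> Ck_on S k (\<lambda>x. f' x b)"
  shows "Ck_on S (Suc k) f"
proof -
  have "Ck_on S k (pd b f)" if "b \<in> Basis" for b
    by (rule Ck_on_cong[OF assms(1) _ assms(3)[OF that]]) (simp add: pd_eqI[OF assms(2)])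
  then show ?thesis using assms(2) unfolding Ck_on.simps differentiable_def by blast
qed

lemma Ck_on_deriv:
  assumes "Ck_on S (Suc k) f" "x \<in> S"
  shows "(f has_derivative (\<lambda>h. pd h f x)) (at x)"
  using assms unfolding pd_def by (simp add: frechet_derivative_works[symmetric])

lemma Ck_on_pd: "Ck_on S (Suc k) f \<Longrightarrow> b \<in> Basis \<Longrightarrow> Ck_on S k (pd b f)"
  by simp

lemma Ck_on_const: "open S \<Longrightarrow> Ck_on S k (\<lambda>x. c)"
proof (induction k arbitrary: c)
  case (Suc k)
  show ?case by (rule Ck_on_SucI[OF Suc.prems, where f' = "\<lambda>x h. 0"]) (use Suc in auto)
qed auto

lemma Ck_on_add: "open S \<Longrightarrow> Ck_on S k f \<Longrightarrow> Ck_on S k g \<Longrightarrow> Ck_on S k (\<lambda>x. f x + g x)"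
proof (induction k arbitrary: f g)
  case (Suc k)
  show ?case
    by (rule Ck_on_SucI[OF \<open>open S\<close>, where f' = "\<lambda>x h. pd h f x + pd h g x"])
      (use Suc Ck_on_deriv[of S k] in \<open>auto intro!: has_derivative_add\<close>)
qed (auto intro: continuous_on_add)

lemma Ck_on_mult: "open S \<Longrightarrow> Ck_on S k f \<Longrightarrow> Ck_on S k g \<Longrightarrow> Ck_on S k (\<lambda>x. f x * g x)"
proof (induction k arbitrary: f g)
  case (Suc k)
  show ?case
  proof (rule Ck_on_SucI[OF \<open>open S\<close>, where f' = "\<lambda>x h. f x * pd h g x + pd h f x * g x"])
    show "((\<lambda>x. f x * g x) has_derivative (\<lambda>h. f x * pd h g x + pd h f x * g x)) (at x)" if "x \<in> S" for x
      by (rule has_derivative_mult) (use Ck_on_deriv[OF _ that] Suc.prems in auto)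
    show "Ck_on S k (\<lambda>x. f x * pd b g x + pd b f x * g x)" if "b \<in> Basis" for b
      using Suc.prems Suc.prems(2,3)[THEN Ck_on_SucD] that by (intro Ck_on_add Suc.IH Ck_on_pd)
  qed
qed (auto intro: continuous_on_mult)

lemma Ck_on_inner: "open S \<Longrightarrow> Ck_on S k (\<lambda>x. x \<bullet> c)"
proof (cases k)
  case (Suc j)
  assume "open S"
  show ?thesis unfolding Suc
    by (rule Ck_on_SucI[OF \<open>open S\<close>, where f' = "\<lambda>x h. h \<bullet> c"])
      (auto intro!: derivative_eq_intros Ck_on_const \<open>open S\<close>)
qed (auto intro!: continuous_intros)

text \<open>By the chain rule the derivative is the composition of \<open>pd 1 h\<close> with
  \<open>f\<close>, times a derivative of \<open>f\<close>. So the induction generalises over the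
  outer function while \<open>f\<close> stays fixed.\<close>

lemma Ck_on_compose:
  fixes h :: "real \<Rightarrow> real"
  assumes "open S" "open T" "\<And>x. x \<in> S \<Longrightarrow> f x \<in> T" "Ck_on T k h" "Ck_on S k f"
  shows "Ck_on S k (\<lambda>x. h (f x))"
  using assms(4,5)
proof (induction k arbitrary: h)
  case 0
  then show ?case using assms(3) by (auto intro!: continuous_on_compose2[of T h])
next
  case (Suc k)
  show ?case
  proof (rule Ck_on_SucI[OF \<open>open S\<close>, where f' = "\<lambda>x b. pd 1 h (f x) * pd b f x"])
    fix x assume x: "x \<in> S"
    have l: "linear (\<lambda>b. pd b h (f x))"
      using Ck_on_deriv[OF Suc.prems(1) assms(3)[OF x]] has_derivative_linear by blast
    have *: "pd (pd b f x) h (f x) = pd 1 h (f x) * pd b f x" for b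
      using linear_scale[OF l, of "pd b f x" 1] by (metis mult.commute mult_1_right real_scaleR_def)
    show "((\<lambda>x. h (f x)) has_derivative (\<lambda>b. pd 1 h (f x) * pd b f x)) (at x)"
      using has_derivative_compose[OF Ck_on_deriv[OF Suc.prems(2) x] Ck_on_deriv[OF Suc.prems(1) assms(3)[OF x]]]
      by (simp only: *)
  next
    fix b :: 'a assume b: "b \<in> Basis"
    show "Ck_on S k (\<lambda>x. pd 1 h (f x) * pd b f x)"
      by (rule Ck_on_mult[OF assms(1) Suc.IH[OF Ck_on_pd[OF Suc.prems(1)] Ck_on_SucD[OF Suc.prems(2)]]
          Ck_on_pd[OF Suc.prems(2) b]]) simp
  qed
qed

lemma Ck_on_Un: "Ck_on S k f \<Longrightarrow> Ck_on T k f \<Longrightarrow> open S \<Longrightarrow> open T \<Longrightarrow> Ck_on (S \<union> T) k f"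
  by (induction k arbitrary: f) (auto intro: continuous_on_open_Un)

lemma Ck_on_subset: "Ck_on S k f \<Longrightarrow> T \<subseteq> S \<Longrightarrow> Ck_on T k f"
  by (induction k arbitrary: f) (auto intro: continuous_on_subset)

lemma smooth_on_cong: "open S \<Longrightarrow> (\<And>x. x \<in> S \<Longrightarrow> f x = g x) \<Longrightarrow> smooth_on S f \<Longrightarrow> smooth_on S g"
  unfolding smooth_on_def using Ck_on_cong by blast

lemma smooth_on_deriv: "smooth_on S f \<Longrightarrow> x \<in> S \<Longrightarrow> (f has_derivative (\<lambda>h. pd h f x)) (at x)"
  unfolding smooth_on_def using Ck_on_deriv by blast

lemma smooth_on_DERIV: "smooth_on S f \<Longrightarrow> x \<in> S \<Longrightarrow> (f has_real_derivative pd 1 f x) (at x)"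
  for f :: "real \<Rightarrow> real"
proof -
  assume a: "smooth_on S f" "x \<in> S"
  note d = smooth_on_deriv[OF a]
  have "pd h f x = pd 1 f x * h" for h
    using linear_scale[OF has_derivative_linear[OF d], of h 1] by simp
  then have "(\<lambda>h. pd h f x) = (\<lambda>h. pd 1 f x * h)" by blast
  then show ?thesis using d unfolding has_field_derivative_def by metis
qed

lemma smooth_on_continuous: "smooth_on S f \<Longrightarrow> continuous_on S f"
  unfolding smooth_on_def by (metis Ck_on.simps(1))

lemma smooth_on_pd: "smooth_on S f \<Longrightarrow> b \<in> Basis \<Longrightarrow> smooth_on S (pd b f)"
  unfolding smooth_on_def using Ck_on_pd by blast

lemma smooth_on_DERIV_I:
  fixes f :: "real \<Rightarrow> real"
  assumes "open S" "\<And>x. x \<in> S \<Longrightarrow> (f has_real_derivative f' x) (at x)" "smooth_on S f'"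
  shows "smooth_on S f"
  unfolding smooth_on_def
proof
  fix k show "Ck_on S k f"
    \<comment> \<open>Order k is read off from order k + 1, which spares a separate treatment of
      order zero.\<close>
    by (rule Ck_on_SucD, rule Ck_on_SucI[OF assms(1), where f' = "\<lambda>x h. f' x * h"])
      (use assms in \<open>auto simp: has_field_derivative_def smooth_on_def\<close>)
qed

lemma smooth_on_const [intro]: "open S \<Longrightarrow> smooth_on S (\<lambda>x. c)"
  by (simp add: smooth_on_def Ck_on_const)
lemma smooth_on_add [intro]: "open S \<Longrightarrow> smooth_on S f \<Longrightarrow> smooth_on S g \<Longrightarrow> smooth_on S (\<lambda>x. f x + g x)"
  by (simp add: smooth_on_def Ck_on_add)
lemma smooth_on_mult [intro]: "open S \<Longrightarrow> smooth_on S f \<Longrightarrow> smooth_on S g \<Longrightarrow> smooth_on S (\<lambda>x. f x * g x)"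
  by (simp add: smooth_on_def Ck_on_mult)
lemma smooth_on_uminus [intro]: "open S \<Longrightarrow> smooth_on S f \<Longrightarrow> smooth_on S (\<lambda>x. - f x)"
  using smooth_on_mult[OF _ smooth_on_const[of S "-1"], of f] by simp
lemma smooth_on_diff [intro]: "open S \<Longrightarrow> smooth_on S f \<Longrightarrow> smooth_on S g \<Longrightarrow> smooth_on S (\<lambda>x. f x - g x)"
  using smooth_on_add[of S f "\<lambda>x. - g x"] by auto
lemma smooth_on_sum [intro]:
  "open S \<Longrightarrow> (\<And>i. i \<in> I \<Longrightarrow> smooth_on S (f i)) \<Longrightarrow> smooth_on S (\<lambda>x. \<Sum>i\<in>I. f i x)"
  by (induction I rule: infinite_finite_induct) auto
lemma smooth_on_prod [intro]:
  "open S \<Longrightarrow> (\<And>i. i \<in> I \<Longrightarrow> smooth_on S (f i)) \<Longrightarrow> smooth_on S (\<lambda>x. \<Prod>i\<in>I. f i x)"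
  by (induction I rule: infinite_finite_induct) auto
lemma smooth_on_power [intro]:
  "open S \<Longrightarrow> smooth_on S f \<Longrightarrow> smooth_on S (\<lambda>x. f x ^ n)"
  by (induction n) auto
lemma smooth_on_inner [intro]: "open S \<Longrightarrow> smooth_on S (\<lambda>x. x \<bullet> c)"
  by (simp add: smooth_on_def Ck_on_inner)
lemma smooth_on_id [intro]: "open S \<Longrightarrow> smooth_on S (\<lambda>x::real. x)"
  using smooth_on_inner[of S 1] by simp
lemma smooth_on_compose:
  fixes h :: "real \<Rightarrow> real"
  assumes "smooth_on T h" "smooth_on S f" "open S" "open T" "\<And>x. x \<in> S \<Longrightarrow> f x \<in> T"
  shows "smooth_on S (\<lambda>x. h (f x))"
  using assms by (simp add: smooth_on_def Ck_on_compose)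
lemma smooth_on_Un: "smooth_on S f \<Longrightarrow> smooth_on T f \<Longrightarrow> open S \<Longrightarrow> open T \<Longrightarrow> smooth_on (S \<union> T) f"
  by (simp add: smooth_on_def Ck_on_Un)
lemma smooth_on_subset: "smooth_on S f \<Longrightarrow> T \<subseteq> S \<Longrightarrow> smooth_on T f"
  using Ck_on_subset unfolding smooth_on_def by blast

lemma smooth_on_powr: "smooth_on {0<..} (\<lambda>t::real. t powr a)"
  unfolding smooth_on_def
proof
  fix k show "Ck_on {0<..} k (\<lambda>t::real. t powr a)"
  proof (induction k arbitrary: a)
    case (Suc k)
    show ?case
    proof (rule Ck_on_SucI[where f' = "\<lambda>t h. (a * t powr (a - 1)) * h"])
      show "((\<lambda>t. t powr a) has_derivative (\<lambda>h. (a * t powr (a - 1)) * h)) (at t)" if "t \<in> {0<..}" for t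
        using that by (auto intro!: derivative_eq_intros simp: has_field_derivative_def[symmetric])
      show "Ck_on {0<..} k (\<lambda>t. a * t powr (a - 1) * b)" for b
        by (intro Ck_on_mult Ck_on_const Suc.IH) auto
    qed auto
  qed (auto intro!: continuous_intros)
qed

lemma smooth_on_exp: "smooth_on UNIV (exp :: real \<Rightarrow> real)"
  unfolding smooth_on_def
proof
  fix k show "Ck_on UNIV k (exp :: real \<Rightarrow> real)"
  proof (induction k)
    case (Suc k)
    show ?case
    proof (rule Ck_on_SucI[where f' = "\<lambda>t h. exp t * h"])
      show "(exp has_derivative (\<lambda>h. (exp t) * h)) (at t)" for t :: real
        by (auto intro!: derivative_eq_intros simp: has_field_derivative_def[symmetric])
      show "Ck_on UNIV k (\<lambda>t::real. exp t * b)" for b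
        by (intro Ck_on_mult Ck_on_const Suc.IH) auto
    qed auto
  qed (auto intro!: continuous_intros)
qed

lemma smooth_on_inverse:
  assumes "smooth_on S f" "open S" "\<And>x. x \<in> S \<Longrightarrow> f x > 0"
  shows "smooth_on S (\<lambda>x. inverse (f x))"
  by (rule smooth_on_cong[OF assms(2) _ smooth_on_compose[OF smooth_on_powr[of "-1"] assms(1,2)]])
    (use assms(3) in \<open>auto simp: powr_minus less_imp_le\<close>)

lemma smooth_on_divide:
  assumes "smooth_on S g" "smooth_on S f" "open S" "\<And>x. x \<in> S \<Longrightarrow> f x > 0"
  shows "smooth_on S (\<lambda>x. g x / f x)"
  using smooth_on_mult[OF assms(3,1) smooth_on_inverse[OF assms(2-4)]] by (simp add: divide_inverse)

lemma smooth_on_ln: "smooth_on {0<..} (ln :: real \<Rightarrow> real)"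
  by (rule smooth_on_DERIV_I[where f' = "\<lambda>t. 1 / t"])
    (auto intro!: derivative_eq_intros smooth_on_divide)

text \<open>The norm is the square root of a polynomial that is positive off the origin, and powers
  are smooth on the positive half-line.\<close>

lemma smooth_on_norm: "smooth_on (- {0::'a::euclidean_space}) norm"
proof -
  have "smooth_on (- {0::'a}) (\<lambda>x. (\<Sum>b\<in>Basis. (x \<bullet> b)^2) powr (1/2))"
  proof (rule smooth_on_compose[OF smooth_on_powr])
    show "(\<Sum>b\<in>Basis. (x \<bullet> b)^2) \<in> {0<..}" if "x \<in> - {0}" for x :: 'a
    proof -
      have "(\<Sum>b\<in>Basis. (x \<bullet> b)^2) = x \<bullet> x"
        by (subst euclidean_inner) (simp add: power2_eq_square)
      then show ?thesis using that by auto
    qed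
  qed (auto intro!: smooth_on_sum smooth_on_power smooth_on_inner)
  moreover have "(\<Sum>b\<in>Basis. (x \<bullet> b)^2) powr (1/2) = norm x" for x :: 'a
  proof -
    have "(\<Sum>b\<in>Basis. (x \<bullet> b)^2) = x \<bullet> x"
      using euclidean_inner[of x x] by (simp add: power2_eq_square)
    then show ?thesis by (simp add: powr_half_sqrt norm_eq_sqrt_inner)
  qed
  ultimately show ?thesis by simp
qed

text \<open>The standard smooth function that is flat at 0. The approximate indicators of boxes, the
  cutoff at the origin and the ramp in the Carleman weight are all built from it.\<close>

definition bump :: "real \<Rightarrow> real" where
  "bump t = (if t > 0 then exp (- (1 / t)) else 0)"

text \<open>The functions t^(-j) exp (-1/t) span a space closed under differentiation, so this one
  formula gives smoothness of every order by induction. Only t = 0 needs a limit.\<close>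

lemma bump_family_deriv:
  defines "F \<equiv> \<lambda>j t. if t > 0 then (1 / t) ^ j * exp (- (1 / t)) else (0::real)"
  shows "(F j has_real_derivative F (j + 2) t - real j * F (j + 1) t) (at t)"
proof -
  consider "t > 0" | "t < 0" | "t = 0" by linarith
  then show ?thesis
  proof cases
    case 1
    have "((\<lambda>t. 1 / t) has_real_derivative - ((1 / t) ^ 2)) (at t)"
      using 1 by (auto intro!: derivative_eq_intros simp: power2_eq_square)
    from DERIV_power[OF this, of j]
    have "((\<lambda>t. (1 / t) ^ j) has_real_derivative - (real j * (1 / t) ^ (j + 1))) (at t)"
      by (rule DERIV_cong) (cases j, auto simp: power2_eq_square)
    moreover have "((\<lambda>t. exp (- (1 / t))) has_real_derivative (1 / t)\<^sup>2 * exp (- (1 / t))) (at t)"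
      using 1 by (auto intro!: derivative_eq_intros simp: power2_eq_square)
    ultimately have "((\<lambda>t. (1 / t) ^ j * exp (- (1 / t))) has_real_derivative F (j + 2) t - real j * F (j + 1) t) (at t)"
      by (rule DERIV_cong[OF DERIV_mult]) (use 1 in \<open>simp add: F_def power2_eq_square algebra_simps\<close>)
    then show ?thesis
      by (rule has_field_derivative_transform_within_open[of _ _ _ "{0<..}"]) (use 1 in \<open>auto simp: F_def\<close>)
  next
    case 2
    have "((\<lambda>t. 0) has_real_derivative F (j + 2) t - real j * F (j + 1) t) (at t)"
      using 2 by (auto simp: F_def)
    then show ?thesis
      by (rule has_field_derivative_transform_within_open[of _ _ _ "{..<0}"]) (use 2 in \<open>auto simp: F_def\<close>)
  next
    case 3
    \<comment> \<open>With y = 1/h the right-hand difference quotient at 0 is y^(j+1) / exp y, which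
      tends to 0 as y grows.\<close>
    have lim: "((\<lambda>h::real. (1 / h) ^ Suc j / exp (1 / h)) \<longlongrightarrow> 0) (at_right 0)"
      using filterlim_compose[OF tendsto_power_div_exp_0[of "Suc j"] filterlim_inverse_at_top_right]
      unfolding inverse_eq_divide .
    have "((\<lambda>h. F j h / h) \<longlongrightarrow> 0) (at 0)"
    proof (rule filterlim_split_at)
      show "((\<lambda>h. F j h / h) \<longlongrightarrow> 0) (at_left 0)"
        by (rule tendsto_eventually) (auto simp: eventually_at_left_field F_def intro!: exI[of _ "-1"])
      show "((\<lambda>h. F j h / h) \<longlongrightarrow> 0) (at_right 0)"
        by (rule Lim_transform_eventually[OF lim])
          (auto simp: eventually_at_right_field F_def exp_minus field_simps intro!: exI[of _ 1])
    qed
    then show ?thesis unfolding has_field_derivative_iff using 3 by (simp add: F_def)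
  qed
qed

lemma smooth_on_bump: "smooth_on UNIV bump"
proof -
  define F where "F = (\<lambda>(j::nat) t. if t > 0 then (1 / t) ^ j * exp (- (1 / t)) else (0::real))"
  have "Ck_on UNIV k (F j)" for k j
  proof (induction k arbitrary: j)
    case 0
    then show ?case
      using bump_family_deriv[of j] unfolding F_def
      by (auto intro!: DERIV_continuous_on)
  next
    case (Suc k)
    show ?case
    proof (rule Ck_on_SucI[where f' = "\<lambda>t h. (F (j + 2) t + (- real j) * F (j + 1) t) * h"])
      show "(F j has_derivative (\<lambda>h. (F (j + 2) t + - real j * F (j + 1) t) * h)) (at t)" for t
        using bump_family_deriv[of j t] unfolding has_field_derivative_def F_def by simp
      show "Ck_on UNIV k (\<lambda>x. (F (j + 2) x + - real j * F (j + 1) x) * b)" for b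
        by (intro Ck_on_mult Ck_on_add Ck_on_const Suc.IH) auto
    qed auto
  qed
  moreover have "F 0 = bump" by (auto simp: F_def bump_def)
  ultimately show ?thesis unfolding smooth_on_def by metis
qed

lemma bump_bounds: "0 \<le> bump t" "bump t \<le> 1" "t > 0 \<Longrightarrow> bump t > 0" "t \<le> 0 \<Longrightarrow> bump t = 0"
  by (auto simp: bump_def)

section \<open>Partial derivatives and integration by parts\<close>

lemma has_derivative_line:
  fixes f :: "'a::euclidean_space \<Rightarrow> real"
  assumes "smooth_on S f" "p + s *\<^sub>R b \<in> S"
  shows "((\<lambda>s. f (p + s *\<^sub>R b)) has_real_derivative pd b f (p + s *\<^sub>R b)) (at s)"
proof -
  have d: "(f has_derivative (\<lambda>h. pd h f (p + s *\<^sub>R b))) (at (p + s *\<^sub>R b))"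
    using smooth_on_deriv assms by blast
  have l: "((\<lambda>s. p + s *\<^sub>R b) has_derivative (\<lambda>h. h *\<^sub>R b)) (at s)"
    by (auto intro!: derivative_eq_intros)
  have "pd (h *\<^sub>R b) f (p + s *\<^sub>R b) = pd b f (p + s *\<^sub>R b) * h" for h
    using linear_scale[OF has_derivative_linear[OF d], of h b] by (metis mult.commute real_scaleR_def)
  then show ?thesis
    using has_derivative_compose[OF l d] unfolding has_field_derivative_def by simp
qed

lemma pd_smooth:
  assumes "smooth_on S f" "smooth_on S g" "x \<in> S"
  shows pd_smooth_add: "pd b (\<lambda>x. f x + g x) x = pd b f x + pd b g x"
    and pd_smooth_diff: "pd b (\<lambda>x. f x - g x) x = pd b f x - pd b g x"
    and pd_smooth_mult: "pd b (\<lambda>x. f x * g x) x = f x * pd b g x + pd b f x * g x"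
    and pd_smooth_cmult: "pd b (\<lambda>x. c * f x) x = c * pd b f x"
proof -
  note d = smooth_on_deriv[OF assms(1,3)] smooth_on_deriv[OF assms(2,3)]
  show "pd b (\<lambda>x. f x + g x) x = pd b f x + pd b g x" by (rule pd_eqI[OF has_derivative_add[OF d]])
  show "pd b (\<lambda>x. f x - g x) x = pd b f x - pd b g x" by (rule pd_eqI[OF has_derivative_diff[OF d]])
  show "pd b (\<lambda>x. f x * g x) x = f x * pd b g x + pd b f x * g x"
    by (rule pd_eqI[OF has_derivative_mult[OF d]])
  show "pd b (\<lambda>x. c * f x) x = c * pd b f x" by (rule pd_eqI[OF has_derivative_mult_right[OF d(1)]])
qed

lemma pd_smooth_sum:
  assumes "open S" "x \<in> S" "\<And>i. i \<in> I \<Longrightarrow> smooth_on S (f i)"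
  shows "pd b (\<lambda>x. \<Sum>i\<in>I. f i x) x = (\<Sum>i\<in>I. pd b (f i) x)"
  by (rule pd_eqI[OF has_derivative_sum]) (rule smooth_on_deriv[OF assms(3) assms(2)])

lemma pd_const [simp]: "pd b (\<lambda>x. c) x = 0"
  by (rule pd_eqI[of _ "\<lambda>_. 0"]) simp

text \<open>The second difference over a small parallelogram equals s^2 times either mixed
  derivative, each taken at some nearby point; continuity of both then forces equality at x.\<close>

lemma pd_commute:
  fixes f :: "'a::euclidean_space \<Rightarrow> real"
  assumes S: "open S" "x \<in> S" and f: "smooth_on S f" and bc: "b \<in> Basis" "c \<in> Basis"
  shows "pd b (pd c f) x = pd c (pd b f) x"
proof (rule ccontr)
  define A where "A = pd c (pd b f)"
  define B where "B = pd b (pd c f)"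
  \<comment> \<open>Half of the supposed gap: if both derivatives vary by less than \<open>e\<close>
    near x, their values at nearby points cannot coincide.\<close>
  define e where "e = \<bar>A x - B x\<bar> / 2"
  assume "\<not> ?thesis"
  then have "e > 0" by (simp add: e_def A_def B_def)
  have sm: "smooth_on S (pd b f)" "smooth_on S (pd c f)" "smooth_on S A" "smooth_on S B"
    unfolding A_def B_def using f bc by (auto intro!: smooth_on_pd)
  have "isCont A x" "isCont B x"
    using sm(3,4) S smooth_on_continuous continuous_on_eq_continuous_at by blast+
  then obtain d1 d2 where d: "d1 > 0" "d2 > 0" "\<And>y. dist y x < d1 \<Longrightarrow> dist (A y) (A x) < e"
    "\<And>y. dist y x < d2 \<Longrightarrow> dist (B y) (B x) < e"
    using \<open>e > 0\<close> unfolding continuous_at_eps_delta by metis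
  obtain d3 where d3: "d3 > 0" "ball x d3 \<subseteq> S" using S openE by blast
  define s where "s = min d1 (min d2 d3) / 3"
  have s: "s > 0" "2 * s < d1" "2 * s < d2" "2 * s < d3" using d d3 by (auto simp: s_def)
  have near: "dist (x + \<sigma> *\<^sub>R b + \<tau> *\<^sub>R c) x \<le> 2 * s" if "0 \<le> \<sigma>" "\<sigma> \<le> s" "0 \<le> \<tau>" "\<tau> \<le> s" for \<sigma> \<tau>
  proof -
    have "dist (x + \<sigma> *\<^sub>R b + \<tau> *\<^sub>R c) x = norm (\<sigma> *\<^sub>R b + \<tau> *\<^sub>R c)" by (simp add: dist_norm)
    also have "\<dots> \<le> norm (\<sigma> *\<^sub>R b) + norm (\<tau> *\<^sub>R c)" by (rule norm_triangle_ineq)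
    finally show ?thesis using that bc by simp
  qed
  have inS: "x + \<sigma> *\<^sub>R b + \<tau> *\<^sub>R c \<in> S" if "0 \<le> \<sigma>" "\<sigma> \<le> s" "0 \<le> \<tau>" "\<tau> \<le> s" for \<sigma> \<tau>
    using near[OF that] d3 s by (auto simp: dist_commute subset_eq)
  \<comment> \<open>The mean value theorem in direction \<open>p\<close>, applied to the increment
    in direction \<open>q\<close>, and then once more in direction \<open>q\<close>. Exchanging
    \<open>b\<close> and \<open>c\<close> leaves the second difference unchanged and yields the
    other mixed derivative.\<close>
  have key: "\<exists>\<sigma> \<tau>. 0 \<le> \<sigma> \<and> \<sigma> \<le> s \<and> 0 \<le> \<tau> \<and> \<tau> \<le> s \<and>
     f (x + s *\<^sub>R p + s *\<^sub>R q) - f (x + s *\<^sub>R p) - f (x + s *\<^sub>R q) + f x = s * s * pd q (pd p f) (x + \<sigma> *\<^sub>R p + \<tau> *\<^sub>R q)"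
    if smp: "smooth_on S (pd p f)" and inS': "\<And>\<sigma> \<tau>. 0 \<le> \<sigma> \<Longrightarrow> \<sigma> \<le> s \<Longrightarrow> 0 \<le> \<tau> \<Longrightarrow> \<tau> \<le> s \<Longrightarrow> x + \<sigma> *\<^sub>R p + \<tau> *\<^sub>R q \<in> S" for p q
  proof -
    have 1: "((\<lambda>\<sigma>. f ((x + s *\<^sub>R q) + \<sigma> *\<^sub>R p) - f (x + \<sigma> *\<^sub>R p)) has_real_derivative
        pd p f ((x + s *\<^sub>R q) + \<sigma> *\<^sub>R p) - pd p f (x + \<sigma> *\<^sub>R p)) (at \<sigma>)" if "0 \<le> \<sigma>" "\<sigma> \<le> s" for \<sigma>
      using inS'[OF that, of s] inS'[OF that, of 0] s(1)
      by (intro DERIV_diff has_derivative_line[OF f]) (simp_all add: ac_simps)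
    obtain \<sigma> where \<sigma>: "0 < \<sigma>" "\<sigma> < s" and eq1:
      "(f ((x + s *\<^sub>R q) + s *\<^sub>R p) - f (x + s *\<^sub>R p)) - (f ((x + s *\<^sub>R q) + 0 *\<^sub>R p) - f (x + 0 *\<^sub>R p))
         = (s - 0) * (pd p f ((x + s *\<^sub>R q) + \<sigma> *\<^sub>R p) - pd p f (x + \<sigma> *\<^sub>R p))"
      using MVT2[OF s(1) 1] by blast
    have 2: "((\<lambda>\<tau>. pd p f ((x + \<sigma> *\<^sub>R p) + \<tau> *\<^sub>R q)) has_real_derivative
        pd q (pd p f) ((x + \<sigma> *\<^sub>R p) + \<tau> *\<^sub>R q)) (at \<tau>)" if "0 \<le> \<tau>" "\<tau> \<le> s" for \<tau>
      using inS'[of \<sigma> \<tau>] that \<sigma> by (intro has_derivative_line[OF smp]) auto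
    obtain \<tau> where \<tau>: "0 < \<tau>" "\<tau> < s" and eq2:
      "pd p f ((x + \<sigma> *\<^sub>R p) + s *\<^sub>R q) - pd p f ((x + \<sigma> *\<^sub>R p) + 0 *\<^sub>R q) = (s - 0) * pd q (pd p f) ((x + \<sigma> *\<^sub>R p) + \<tau> *\<^sub>R q)"
      using MVT2[OF s(1) 2] by blast
    have c1: "x + s *\<^sub>R q + s *\<^sub>R p = x + s *\<^sub>R p + s *\<^sub>R q" and c2: "x + s *\<^sub>R q + \<sigma> *\<^sub>R p = x + \<sigma> *\<^sub>R p + s *\<^sub>R q"
      by (simp_all add: ac_simps)
    show ?thesis
      by (rule exI[of _ \<sigma>], rule exI[of _ \<tau>]) (use \<sigma> \<tau> eq1 eq2 in \<open>simp add: c1 c2\<close>)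
  qed
  obtain \<sigma> \<tau> where 1: "0 \<le> \<sigma>" "\<sigma> \<le> s" "0 \<le> \<tau>" "\<tau> \<le> s"
    "f (x + s *\<^sub>R b + s *\<^sub>R c) - f (x + s *\<^sub>R b) - f (x + s *\<^sub>R c) + f x = s * s * A (x + \<sigma> *\<^sub>R b + \<tau> *\<^sub>R c)"
    using key[OF sm(1) inS] unfolding A_def by blast
  have inS2: "x + \<sigma> *\<^sub>R c + \<tau> *\<^sub>R b \<in> S" if "0 \<le> \<sigma>" "\<sigma> \<le> s" "0 \<le> \<tau>" "\<tau> \<le> s" for \<sigma> \<tau>
    using inS[of \<tau> \<sigma>] that by (simp add: ac_simps)
  obtain \<sigma>' \<tau>' where 2: "0 \<le> \<sigma>'" "\<sigma>' \<le> s" "0 \<le> \<tau>'" "\<tau>' \<le> s"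
    "f (x + s *\<^sub>R c + s *\<^sub>R b) - f (x + s *\<^sub>R c) - f (x + s *\<^sub>R b) + f x = s * s * B (x + \<sigma>' *\<^sub>R c + \<tau>' *\<^sub>R b)"
    using key[OF sm(2) inS2] unfolding B_def by blast
  have "A (x + \<sigma> *\<^sub>R b + \<tau> *\<^sub>R c) = B (x + \<tau>' *\<^sub>R b + \<sigma>' *\<^sub>R c)"
  proof -
    have e: "x + s *\<^sub>R c + s *\<^sub>R b = x + s *\<^sub>R b + s *\<^sub>R c" "x + \<sigma>' *\<^sub>R c + \<tau>' *\<^sub>R b = x + \<tau>' *\<^sub>R b + \<sigma>' *\<^sub>R c"
      by (simp_all add: ac_simps)
    have "s * s * A (x + \<sigma> *\<^sub>R b + \<tau> *\<^sub>R c) = s * s * B (x + \<tau>' *\<^sub>R b + \<sigma>' *\<^sub>R c)"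
      using 1(5) 2(5)[unfolded e] by linarith
    then show ?thesis using s(1) by simp
  qed
  moreover have "dist (A (x + \<sigma> *\<^sub>R b + \<tau> *\<^sub>R c)) (A x) < e" using d(3) near[OF 1(1-4)] s by force
  moreover have "dist (B (x + \<tau>' *\<^sub>R b + \<sigma>' *\<^sub>R c)) (B x) < e" using d(4) near[OF 2(3,4,1,2)] s by force
  ultimately have "\<bar>A x - B x\<bar> < 2 * e" by (auto simp: dist_real_def)
  then show False by (simp add: e_def)
qed

section \<open>Integrals of derivatives of compactly supported functions\<close>

lemma integrable_compact_support:
  fixes f :: "'a::euclidean_space \<Rightarrow> real"
  assumes "continuous_on UNIV f" "\<And>x. norm x > R \<Longrightarrow> f x = 0"
  shows "integrable lborel f"
proof -
  have "integrable lborel (\<lambda>x. indicator (cball 0 R) x *\<^sub>R f x)"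
    by (rule borel_integrable_compact) (auto intro: continuous_on_subset[OF assms(1)])
  moreover have "(\<lambda>x. indicator (cball 0 R) x *\<^sub>R f x) = f"
    using assms(2) by (auto simp: indicator_def fun_eq_iff)
  ultimately show ?thesis by simp
qed

lemma bounded_compact_support:
  fixes f :: "'a::euclidean_space \<Rightarrow> real"
  assumes "continuous_on UNIV f" "\<And>x. norm x > R \<Longrightarrow> f x = 0"
  obtains M where "M \<ge> 0" "\<And>x. \<bar>f x\<bar> \<le> M"
proof -
  have "compact (f ` cball 0 R)"
    by (rule compact_continuous_image[OF continuous_on_subset[OF assms(1)]]) auto
  then have "bounded (f ` cball 0 R)" by (rule compact_imp_bounded)
  then obtain M where M: "\<And>x. x \<in> cball 0 R \<Longrightarrow> \<bar>f x\<bar> \<le> M" unfolding bounded_real by blast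
  have "\<bar>f x\<bar> \<le> max M 0" for x
  proof (cases "norm x > R")
    case False
    then show ?thesis using M[of x] by auto
  qed (use assms(2) in auto)
  then show thesis using that[of "max M 0"] by auto
qed

lemma pd_zero_outside:
  assumes "\<And>x. norm x > R \<Longrightarrow> f x = 0" "norm x > R"
  shows "pd b f x = 0"
proof -
  have "open {x. norm x > R}" by (intro open_Collect_less continuous_intros)
  then have "pd b f x = pd b (\<lambda>x. 0) x" by (rule pd_cong) (use assms in auto)
  then show ?thesis by simp
qed

lemma integral_lborel_translate:
  fixes f :: "'a::euclidean_space \<Rightarrow> real"
  assumes [measurable]: "f \<in> borel_measurable borel"
  shows "(\<integral>x. f (x + a) \<partial>lborel) = (\<integral>x. f x \<partial>lborel)"
proof -
  have "(\<integral>x. f x \<partial>lborel) = (\<integral>x. f x \<partial>distr lborel borel ((+) a))" by (simp add: lborel_distr_plus)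
  also have "\<dots> = (\<integral>x. f (a + x) \<partial>lborel)" by (rule integral_distr) auto
  finally show ?thesis by (simp add: add.commute)
qed

lemma integrable_lborel_translate:
  fixes f :: "'a::euclidean_space \<Rightarrow> real"
  assumes "integrable lborel f"
  shows "integrable lborel (\<lambda>x. f (x + a))"
proof -
  have "integrable (distr lborel borel ((+) a)) f" using assms by (simp add: lborel_distr_plus)
  then have "integrable lborel (\<lambda>x. f (a + x))" by (rule integrable_distr[rotated]) auto
  then show ?thesis by (simp add: add.commute)
qed

lemma smooth_on_measurable: "smooth_on UNIV f \<Longrightarrow> f \<in> borel_measurable borel"
  by (intro borel_measurable_continuous_onI smooth_on_continuous)

text \<open>Translation invariance makes the integral of every difference quotient vanish, and
  dominated convergence carries this over to the derivative. The mean value theorem supplies the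
  dominating function.\<close>

lemma integral_pd_eq_0:
  fixes F :: "'a::euclidean_space \<Rightarrow> real"
  assumes F: "smooth_on UNIV F" "\<And>x. norm x > R \<Longrightarrow> F x = 0" and b: "b \<in> Basis"
  shows "integrable lborel (pd b F)" and "(\<integral>x. pd b F x \<partial>lborel) = 0"
proof -
  have [measurable]: "F \<in> borel_measurable borel" by (rule smooth_on_measurable[OF F(1)])
  have c: "continuous_on UNIV (pd b F)" by (intro smooth_on_continuous smooth_on_pd F b)
  then have [measurable]: "pd b F \<in> borel_measurable borel" by (rule borel_measurable_continuous_onI)
  have z: "pd b F x = 0" if "norm x > R" for x using pd_zero_outside[OF F(2) that] .
  show "integrable lborel (pd b F)" by (rule integrable_compact_support[OF c z])
  obtain M where M: "M \<ge> 0" "\<And>x. \<bar>pd b F x\<bar> \<le> M" using bounded_compact_support[OF c z] by blast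
  define t where "t = (\<lambda>n. 1 / real (Suc n))"
  have t: "0 < t n" "t n \<le> 1" for n by (auto simp: t_def field_simps)
  have t0: "t \<longlonglongrightarrow> 0" unfolding t_def using LIMSEQ_inverse_real_of_nat by (simp add: inverse_eq_divide)
  have iF: "integrable lborel F" by (rule integrable_compact_support[OF smooth_on_continuous[OF F(1)] F(2)])
  define G where "G = (\<lambda>n x. (F (x + t n *\<^sub>R b) - F x) / t n)"
  have "(\<lambda>n. \<integral>x. G n x \<partial>lborel) \<longlonglongrightarrow> (\<integral>x. pd b F x \<partial>lborel)"
  proof (rule integral_dominated_convergence[where w = "\<lambda>x. M * indicator (cball 0 (R + 1)) x"])
    show "integrable lborel (\<lambda>x::'a. M * indicator (cball 0 (R + 1)) x)"
      by (intro integrable_mult_right integrable_real_indicator) (simp_all add: emeasure_lborel_cball_finite[unfolded infinity_ennreal_def])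
    show "AE x in lborel. (\<lambda>n. G n x) \<longlonglongrightarrow> pd b F x"
    proof (rule AE_I2)
      fix x
      have "((\<lambda>h. (F (x + (0 + h) *\<^sub>R b) - F (x + 0 *\<^sub>R b)) / h) \<longlongrightarrow> pd b F (x + 0 *\<^sub>R b)) (at 0)"
        using has_derivative_line[OF F(1), of x 0 b] unfolding DERIV_def by simp
      moreover have "filterlim t (at 0) sequentially"
        using t0 t(1) by (auto simp: filterlim_at less_imp_neq[THEN not_sym])
      ultimately show "(\<lambda>n. G n x) \<longlonglongrightarrow> pd b F x"
        unfolding G_def using filterlim_compose by fastforce
    qed
    show "AE x in lborel. norm (G n x) \<le> M * indicator (cball 0 (R + 1)) x" for n
    proof (rule AE_I2)
      fix x
      show "norm (G n x) \<le> M * indicator (cball 0 (R + 1)) x"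
      proof (cases "norm x > R + 1")
        case True
        have "norm (x + t n *\<^sub>R b) \<ge> norm x - norm (t n *\<^sub>R b)"
          by (metis norm_diff_ineq)
        then have "norm (x + t n *\<^sub>R b) > R" using True t[of n] b by simp
        then show ?thesis using F(2) True M by (simp add: G_def)
      next
        case False
        have "\<exists>z. 0 < z \<and> z < t n \<and> F (x + t n *\<^sub>R b) - F (x + 0 *\<^sub>R b) = (t n - 0) * pd b F (x + z *\<^sub>R b)"
          by (rule MVT2) (use t has_derivative_line[OF F(1)] in auto)
        then have "\<exists>z. G n x = pd b F (x + z *\<^sub>R b)" using t[of n] by (auto simp: G_def)
        then show ?thesis using M False by auto
      qed
    qed
  qed (simp_all add: G_def)
  moreover have "(\<integral>x. G n x \<partial>lborel) = 0" for n
  proof -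
    have "(\<integral>x. F (x + t n *\<^sub>R b) - F x \<partial>lborel) = (\<integral>x. F (x + t n *\<^sub>R b) \<partial>lborel) - (\<integral>x. F x \<partial>lborel)"
      by (rule Bochner_Integration.integral_diff[OF integrable_lborel_translate[OF iF] iF])
    then show ?thesis unfolding G_def by (simp add: integral_lborel_translate)
  qed
  ultimately show "(\<integral>x. pd b F x \<partial>lborel) = 0" by (simp add: LIMSEQ_const_iff)
qed

lemma smooth_on_glue_0:
  fixes F :: "'a::euclidean_space \<Rightarrow> real"
  assumes "smooth_on (- {0}) F" "\<And>x. norm x < \<eta> \<Longrightarrow> F x = 0" "\<eta> > 0"
  shows "smooth_on UNIV F"
proof -
  have "smooth_on (ball 0 \<eta>) F"
    by (rule smooth_on_cong[of _ "\<lambda>_. 0"]) (use assms in auto)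
  then have "smooth_on (- {0} \<union> ball 0 \<eta>) F" using assms by (intro smooth_on_Un) auto
  moreover have "- {0} \<union> ball 0 \<eta> = UNIV" using assms by auto
  ultimately show ?thesis by metis
qed

text \<open>The support is bounded by a radius, since this is the form in which dominating functions
  use it; \<open>test_function_iff_cc\<close> relates it to compactness of the closed
  support.\<close>

definition cc :: "('a::euclidean_space \<Rightarrow> real) \<Rightarrow> bool" where
  "cc \<phi> \<longleftrightarrow> smooth_on UNIV \<phi> \<and> (\<exists>R. \<forall>x. norm x > R \<longrightarrow> \<phi> x = 0)"

lemma test_function_iff_cc: "test_function UNIV \<phi> \<longleftrightarrow> cc \<phi>"
proof
  assume "test_function UNIV \<phi>"
  then have s: "smooth_on UNIV \<phi>" and "compact (closure {x. \<phi> x \<noteq> 0})"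
    unfolding test_function_def smooth_on_def C_k_eq_Ck_on by blast+
  then have "bounded (closure {x. \<phi> x \<noteq> 0})" using compact_imp_bounded by blast
  then obtain R where R: "\<forall>x \<in> closure {x. \<phi> x \<noteq> 0}. norm x \<le> R" unfolding bounded_iff by blast
  have "\<forall>x. norm x > R \<longrightarrow> \<phi> x = 0"
    using R closure_subset[of "{x. \<phi> x \<noteq> 0}"] by (metis (mono_tags) linorder_not_less mem_Collect_eq subsetD)
  with s show "cc \<phi>" unfolding cc_def by blast
next
  assume "cc \<phi>"
  then obtain R where s: "smooth_on UNIV \<phi>" and R: "\<And>x. norm x > R \<Longrightarrow> \<phi> x = 0" unfolding cc_def by blast
  have "{x. \<phi> x \<noteq> 0} \<subseteq> cball 0 R" using R by force
  then have "bounded {x. \<phi> x \<noteq> 0}" using bounded_subset bounded_cball by blast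
  then have "compact (closure {x. \<phi> x \<noteq> 0})" by (simp add: compact_closure)
  then show "test_function UNIV \<phi>" using s
    unfolding test_function_def smooth_on_def C_k_eq_Ck_on by blast
qed

lemma test_function_punctured:
  assumes "smooth_on UNIV \<phi>" "\<And>x. norm x > R \<Longrightarrow> \<phi> x = 0" "\<And>x. norm x < \<eta> \<Longrightarrow> \<phi> x = 0" "\<eta> > 0"
  shows "test_function (- {0}) \<phi>"
proof -
  have "test_function UNIV \<phi>" using assms unfolding test_function_iff_cc cc_def by blast
  moreover have "closure {x. \<phi> x \<noteq> 0} \<subseteq> {x. \<eta> \<le> norm x}"
  proof (rule closure_minimal)
    show "closed {x::'a. \<eta> \<le> norm x}" by (intro closed_Collect_le continuous_intros)
  qed (use assms(3) in force)
  ultimately show ?thesis using assms(4) unfolding test_function_def by force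
qed

lemma ccE:
  assumes "cc \<phi>"
  obtains R where "R > 0" "\<And>x. norm x > R \<Longrightarrow> \<phi> x = 0"
proof -
  obtain R where "\<And>x. norm x > R \<Longrightarrow> \<phi> x = 0" using assms unfolding cc_def by blast
  then show thesis using that[of "max R 1"] by auto
qed

lemma cc_smooth: "cc \<phi> \<Longrightarrow> smooth_on UNIV \<phi>" by (simp add: cc_def)

lemma cc_add: "cc f \<Longrightarrow> cc g \<Longrightarrow> cc (\<lambda>x. f x + g x)"
proof -
  assume a: "cc f" "cc g"
  obtain R S where R: "\<And>x. norm x > R \<Longrightarrow> f x = 0" "\<And>x. norm x > S \<Longrightarrow> g x = 0"
    using a unfolding cc_def by blast
  have "\<forall>x. norm x > max R S \<longrightarrow> f x + g x = 0" using R by auto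
  then show ?thesis using a unfolding cc_def by blast
qed

lemma cc_mult: "smooth_on UNIV f \<Longrightarrow> cc g \<Longrightarrow> cc (\<lambda>x. f x * g x)"
  unfolding cc_def by (auto simp: smooth_on_mult)
lemma cc_cmult: "cc g \<Longrightarrow> cc (\<lambda>x. c * g x)"
  by (rule cc_mult) auto
lemma cc_minus: "cc g \<Longrightarrow> cc (\<lambda>x. - g x)"
  using cc_cmult[of g "-1"] by simp
lemma cc_diff: "cc f \<Longrightarrow> cc g \<Longrightarrow> cc (\<lambda>x. f x - g x)"
  using cc_add[of f "\<lambda>x. - g x"] cc_minus[of g] by simp
lemma cc_zero: "cc (\<lambda>x. 0)" by (auto simp: cc_def)
lemma cc_pd: "cc f \<Longrightarrow> b \<in> Basis \<Longrightarrow> cc (pd b f)"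
  unfolding cc_def using smooth_on_pd pd_zero_outside by metis
lemma cc_sum: "(\<And>i. i \<in> I \<Longrightarrow> cc (f i)) \<Longrightarrow> cc (\<lambda>x. \<Sum>i\<in>I. f i x)"
  by (induction I rule: infinite_finite_induct) (auto intro: cc_add cc_zero)
lemma cc_continuous: "cc f \<Longrightarrow> continuous_on UNIV f"
  by (simp add: cc_def smooth_on_continuous)
lemma cc_measurable: "cc f \<Longrightarrow> f \<in> borel_measurable borel"
  by (simp add: cc_def smooth_on_measurable)
lemma cc_bounded: "cc f \<Longrightarrow> \<exists>M. \<forall>x. \<bar>f x\<bar> \<le> M"
  using bounded_compact_support cc_continuous unfolding cc_def by metis
lemma cc_integrable: "cc f \<Longrightarrow> integrable lborel f"
  using integrable_compact_support cc_continuous unfolding cc_def by metis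

section \<open>Integration by parts and second derivatives of test functions\<close>

lemma integral_by_parts:
  assumes "smooth_on UNIV f" "cc g" "b \<in> Basis"
  shows "(\<integral>x. f x * pd b g x \<partial>lborel) = - (\<integral>x. pd b f x * g x \<partial>lborel)"
proof -
  have c: "cc (\<lambda>x. f x * g x)" by (rule cc_mult[OF assms(1,2)])
  have e: "pd b (\<lambda>x. f x * g x) x = f x * pd b g x + pd b f x * g x" for x
    using pd_smooth_mult[OF assms(1) cc_smooth[OF assms(2)]] by simp
  have 0: "(\<integral>x. pd b (\<lambda>x. f x * g x) x \<partial>lborel) = 0"
    using c integral_pd_eq_0(2) assms(3) unfolding cc_def by blast
  have i: "integrable lborel (\<lambda>x. f x * pd b g x)" "integrable lborel (\<lambda>x. pd b f x * g x)"
    using assms by (auto intro!: cc_integrable cc_mult cc_pd smooth_on_pd)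
  have "(\<integral>x. f x * pd b g x + pd b f x * g x \<partial>lborel) = 0" using 0 by (simp add: e)
  then show ?thesis using i by (simp add: Bochner_Integration.integral_add)
qed

definition lap :: "('a::euclidean_space \<Rightarrow> real) \<Rightarrow> 'a \<Rightarrow> real" where
  "lap f x = (\<Sum>b\<in>Basis. pd b (pd b f) x)"

lemma cc_lap: "cc f \<Longrightarrow> cc (lap f)"
proof -
  assume "cc f"
  then have "cc (\<lambda>x. \<Sum>b\<in>Basis. pd b (pd b f) x)" by (intro cc_sum cc_pd)
  then show ?thesis by (simp add: lap_def[abs_def])
qed

lemma integral_lap_mult:
  assumes "smooth_on UNIV f" "cc g"
  shows "(\<integral>x. f x * lap g x \<partial>lborel) = - (\<Sum>b\<in>Basis. \<integral>x. pd b f x * pd b g x \<partial>lborel)"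
proof -
  have "(\<integral>x. f x * lap g x \<partial>lborel) = (\<Sum>b\<in>Basis. \<integral>x. f x * pd b (pd b g) x \<partial>lborel)"
    unfolding lap_def sum_distrib_left
    using assms by (intro Bochner_Integration.integral_sum cc_integrable cc_mult cc_pd)
  also have "\<dots> = (\<Sum>b\<in>Basis. - (\<integral>x. pd b f x * pd b g x \<partial>lborel))"
    by (intro sum.cong refl integral_by_parts assms cc_pd)
  finally show ?thesis by (simp add: sum_negf)
qed

text \<open>The integral of the squared Laplacian equals the sum of the integrals of all squared
  second derivatives, so it dominates each of them. This is the a priori bound behind membership in
  H2.\<close>

lemma integral_hessian_sq_le:
  assumes f: "cc f" and bc: "b \<in> Basis" "c \<in> Basis"
  shows "(\<integral>x. (pd c (pd b f) x)\<^sup>2 \<partial>lborel) \<le> (\<integral>x. (lap f x)\<^sup>2 \<partial>lborel)"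
proof -
  note s = smooth_on_pd[OF cc_smooth[OF f]]
  have comm: "pd i (pd j f) = pd j (pd i f)" if "i \<in> Basis" "j \<in> Basis" for i j
    using pd_commute[OF open_UNIV UNIV_I cc_smooth[OF f] that] by blast
  have comm3: "pd i (pd i (pd j f)) = pd j (pd i (pd i f))" if "i \<in> Basis" "j \<in> Basis" for i j
    using pd_commute[OF open_UNIV UNIV_I s, of i i j] that comm[OF that] by fastforce
  \<comment> \<open>Integration by parts in direction j, then in direction i, with the third
    derivatives commuted in between.\<close>
  have sw: "(\<integral>x. pd i (pd i f) x * pd j (pd j f) x \<partial>lborel) = (\<integral>x. (pd j (pd i f) x)\<^sup>2 \<partial>lborel)"
    if ij: "i \<in> Basis" "j \<in> Basis" for i j
  proof -
    have "(\<integral>x. pd i (pd i f) x * pd j (pd j f) x \<partial>lborel) = - (\<integral>x. pd j (pd i (pd i f)) x * pd j f x \<partial>lborel)"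
      using ij by (intro integral_by_parts smooth_on_pd cc_smooth[OF f] cc_pd f)
    also have "\<dots> = - (\<integral>x. pd j f x * pd i (pd i (pd j f)) x \<partial>lborel)"
      unfolding comm3[OF ij] by (simp add: mult.commute)
    also have "\<dots> = (\<integral>x. pd i (pd j f) x * pd i (pd j f) x \<partial>lborel)"
      using ij by (subst integral_by_parts) (auto intro!: smooth_on_pd cc_smooth[OF f] cc_pd f)
    finally show ?thesis by (simp add: comm[OF ij] power2_eq_square)
  qed
  have "(\<integral>x. (lap f x)\<^sup>2 \<partial>lborel) = (\<integral>x. (\<Sum>i\<in>Basis. \<Sum>j\<in>Basis. pd i (pd i f) x * pd j (pd j f) x) \<partial>lborel)"
    by (simp add: lap_def power2_eq_square sum_product)
  also have "\<dots> = (\<Sum>i\<in>Basis. \<Sum>j\<in>Basis. \<integral>x. pd i (pd i f) x * pd j (pd j f) x \<partial>lborel)"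
    by (subst Bochner_Integration.integral_sum)
      (auto intro!: sum.cong Bochner_Integration.integral_sum cc_integrable cc_sum cc_mult s cc_pd f smooth_on_pd)
  also have "\<dots> = (\<Sum>i\<in>Basis. \<Sum>j\<in>Basis. \<integral>x. (pd j (pd i f) x)\<^sup>2 \<partial>lborel)"
    by (intro sum.cong refl sw)
  also have "\<dots> \<ge> (\<Sum>j\<in>Basis. \<integral>x. (pd j (pd b f) x)\<^sup>2 \<partial>lborel)"
    using bc by (intro member_le_sum[of b Basis "\<lambda>i. \<Sum>j\<in>Basis. \<integral>x. (pd j (pd i f) x)\<^sup>2 \<partial>lborel"]) (auto intro!: sum_nonneg)
  finally have 1: "(\<Sum>j\<in>Basis. \<integral>x. (pd j (pd b f) x)\<^sup>2 \<partial>lborel) \<le> (\<integral>x. (lap f x)\<^sup>2 \<partial>lborel)" .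
  show ?thesis
    using bc by (intro order.trans[OF member_le_sum[of c Basis "\<lambda>j. \<integral>x. (pd j (pd b f) x)\<^sup>2 \<partial>lborel"] 1]) auto
qed

section \<open>Square-integrable functions\<close>

text \<open>The codomain is any Euclidean space, so that real and complex functions share one
  theory. For complex values the inner product is the real part of the Hermitian one.\<close>

definition sqi :: "('a::euclidean_space \<Rightarrow> 'b::euclidean_space) \<Rightarrow> bool" where
  "sqi f \<longleftrightarrow> f \<in> borel_measurable borel \<and> integrable lborel (\<lambda>x. (norm (f x))\<^sup>2)"

definition N2 :: "('a::euclidean_space \<Rightarrow> 'b::euclidean_space) \<Rightarrow> real" where
  "N2 f = (\<integral>x. (norm (f x))\<^sup>2 \<partial>lborel)"

definition lim2 :: "(nat \<Rightarrow> 'a::euclidean_space \<Rightarrow> 'b::euclidean_space) \<Rightarrow> ('a \<Rightarrow> 'b) \<Rightarrow> bool" where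
  "lim2 F f \<longleftrightarrow> (\<forall>n. sqi (F n)) \<and> sqi f \<and> (\<lambda>n. N2 (\<lambda>x. F n x - f x)) \<longlonglongrightarrow> 0"

lemma L2_iff_sqi: "f \<in> L2 \<longleftrightarrow> sqi f" by (auto simp: L2_def sqi_def)
lemma L2norm_eq: "L2norm f = sqrt (N2 f)" by (simp add: L2norm_def N2_def)
lemma N2_nonneg [simp]: "N2 f \<ge> 0" by (simp add: N2_def)

lemma sqi_measurable [measurable_dest]: "sqi f \<Longrightarrow> f \<in> borel_measurable borel" by (simp add: sqi_def)
lemma sqi_integrable: "sqi f \<Longrightarrow> integrable lborel (\<lambda>x. (norm (f x))\<^sup>2)" by (simp add: sqi_def)

lemma sqi_bound:
  fixes g :: "'a::euclidean_space \<Rightarrow> 'b::euclidean_space"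
  assumes "sqi f" "g \<in> borel_measurable borel" "AE x in lborel. norm (g x) \<le> C * norm (f x)"
  shows "sqi g" "N2 g \<le> C\<^sup>2 * N2 f"
proof -
  have [measurable]: "g \<in> borel_measurable borel" "f \<in> borel_measurable borel" using assms sqi_measurable by auto
  have le: "AE x in lborel. (norm (g x))\<^sup>2 \<le> C\<^sup>2 * (norm (f x))\<^sup>2"
    using assms(3)
  proof eventually_elim
    case (elim x)
    then have "(norm (g x))\<^sup>2 \<le> (C * norm (f x))\<^sup>2" by (intro power_mono) auto
    then show ?case by (simp add: power_mult_distrib)
  qed
  have i: "integrable lborel (\<lambda>x. C\<^sup>2 * (norm (f x))\<^sup>2)" using sqi_integrable[OF assms(1)] by simp
  have "integrable lborel (\<lambda>x. (norm (g x))\<^sup>2)"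
    by (rule Bochner_Integration.integrable_bound[OF i]) (use le in auto)
  then show "sqi g" by (simp add: sqi_def)
  show "N2 g \<le> C\<^sup>2 * N2 f"
    unfolding N2_def using integral_mono_AE[OF \<open>integrable lborel (\<lambda>x. (norm (g x))\<^sup>2)\<close> i le] by simp
qed

lemma sqi_norm: "sqi f \<Longrightarrow> sqi (\<lambda>x. norm (f x))"
  unfolding sqi_def by auto

lemma sqi_mult_norm_integrable:
  fixes f :: "'a::euclidean_space \<Rightarrow> 'b::euclidean_space" and g :: "'a \<Rightarrow> 'c::euclidean_space"
  assumes "sqi f" "sqi g"
  shows "integrable lborel (\<lambda>x. norm (f x) * norm (g x))"
proof -
  have [measurable]: "g \<in> borel_measurable borel" "f \<in> borel_measurable borel" using assms sqi_measurable by auto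
  show ?thesis
  proof (rule Bochner_Integration.integrable_bound[OF Bochner_Integration.integrable_add[OF sqi_integrable[OF assms(1)] sqi_integrable[OF assms(2)]]])
    show "AE x in lborel. norm (norm (f x) * norm (g x)) \<le> norm ((norm (f x))\<^sup>2 + (norm (g x))\<^sup>2)"
    proof (rule AE_I2)
      fix x
      have "2 * norm (f x) * norm (g x) \<le> (norm (f x))\<^sup>2 + (norm (g x))\<^sup>2" by (rule sum_squares_bound)
      moreover have "0 \<le> norm (f x) * norm (g x)" by simp
      ultimately have "norm (f x) * norm (g x) \<le> (norm (f x))\<^sup>2 + (norm (g x))\<^sup>2" by linarith
      then show "norm (norm (f x) * norm (g x)) \<le> norm ((norm (f x))\<^sup>2 + (norm (g x))\<^sup>2)" by simp
    qed
  qed auto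
qed

lemma sqi_inner_integrable:
  assumes "sqi f" "sqi g"
  shows "integrable lborel (\<lambda>x. f x \<bullet> g x)"
proof -
  have [measurable]: "g \<in> borel_measurable borel" "f \<in> borel_measurable borel" using assms sqi_measurable by auto
  show ?thesis
    by (rule Bochner_Integration.integrable_bound[OF sqi_mult_norm_integrable[OF assms]])
      (auto simp: Cauchy_Schwarz_ineq2)
qed

lemma sqi_add: "sqi f \<Longrightarrow> sqi g \<Longrightarrow> sqi (\<lambda>x. f x + g x)"
proof -
  assume a: "sqi f" "sqi g"
  then have [measurable]: "g \<in> borel_measurable borel" "f \<in> borel_measurable borel" using sqi_measurable by auto
  have "(norm (f x + g x))\<^sup>2 = (norm (f x))\<^sup>2 + 2 * (f x \<bullet> g x) + (norm (g x))\<^sup>2" for x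
    by (simp add: power2_norm_eq_inner inner_add inner_commute)
  then show ?thesis unfolding sqi_def
    using sqi_integrable[OF a(1)] sqi_integrable[OF a(2)] sqi_inner_integrable[OF a] by simp
qed

lemma sqi_scaleR: "sqi f \<Longrightarrow> sqi (\<lambda>x. c *\<^sub>R f x)"
  unfolding sqi_def by (auto simp: power_mult_distrib)
lemma sqi_cmult: "sqi f \<Longrightarrow> sqi (\<lambda>x. c * f x)" for f :: "'a::euclidean_space \<Rightarrow> real"
  using sqi_scaleR[of f c] by simp
lemma sqi_uminus: "sqi f \<Longrightarrow> sqi (\<lambda>x. - f x)"
  unfolding sqi_def by auto
lemma sqi_diff: "sqi f \<Longrightarrow> sqi g \<Longrightarrow> sqi (\<lambda>x. f x - g x)"
  using sqi_add[of f "\<lambda>x. - g x"] sqi_uminus[of g] by simp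
lemma sqi_zero: "sqi (\<lambda>x. 0)" by (simp add: sqi_def)
lemma sqi_sum: "(\<And>i. i \<in> I \<Longrightarrow> sqi (f i)) \<Longrightarrow> sqi (\<lambda>x. \<Sum>i\<in>I. f i x)"
  by (induction I rule: infinite_finite_induct) (auto intro: sqi_add sqi_zero)

lemma sqi_cc: "cc f \<Longrightarrow> sqi f"
  unfolding sqi_def using cc_integrable[OF cc_mult[OF cc_smooth], of f f] cc_measurable[of f]
  by (auto simp: power2_eq_square)

lemma sqi_bdd_scaleR:
  fixes m :: "'a::euclidean_space \<Rightarrow> real"
  assumes "m \<in> borel_measurable borel" "AE x in lborel. \<bar>m x\<bar> \<le> M" "sqi f"
  shows "sqi (\<lambda>x. m x *\<^sub>R f x)"
proof -
  have [measurable]: "f \<in> borel_measurable borel" using assms sqi_measurable by auto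
  note [measurable] = assms(1)
  show ?thesis
    by (rule sqi_bound(1)[OF assms(3), of _ M]) (use assms(2) in \<open>auto elim!: eventually_mono intro!: mult_right_mono\<close>)
qed

lemma N2_inner: "N2 f = (\<integral>x. f x \<bullet> f x \<partial>lborel)"
  by (simp add: N2_def power2_norm_eq_inner)

lemma N2_lincomb:
  assumes "sqi f" "sqi g"
  shows "N2 (\<lambda>x. a *\<^sub>R f x + b *\<^sub>R g x) = a\<^sup>2 * N2 f + 2 * a * b * (\<integral>x. f x \<bullet> g x \<partial>lborel) + b\<^sup>2 * N2 g"
proof -
  have "(norm (a *\<^sub>R f x + b *\<^sub>R g x))\<^sup>2 = a\<^sup>2 * (norm (f x))\<^sup>2 + 2 * a * b * (f x \<bullet> g x) + b\<^sup>2 * (norm (g x))\<^sup>2" for x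
    by (simp only: power2_norm_eq_inner) (simp add: inner_add inner_commute power2_eq_square algebra_simps)
  then show ?thesis unfolding N2_def
    using sqi_integrable[OF assms(1)] sqi_integrable[OF assms(2)] sqi_inner_integrable[OF assms] by simp
qed

lemma N2_cmult: "N2 (\<lambda>x. a *\<^sub>R f x) = a\<^sup>2 * N2 f"
  by (simp add: N2_def power_mult_distrib)

lemma N2_add_le: "sqi f \<Longrightarrow> sqi g \<Longrightarrow> N2 (\<lambda>x. f x + g x) \<le> 2 * N2 f + 2 * N2 g"
  using N2_lincomb[of f g 1 1] N2_lincomb[of f g 1 "-1"] N2_nonneg[of "\<lambda>x. 1 *\<^sub>R f x + (-1) *\<^sub>R g x"] by simp

lemma N2_diff_le: "sqi f \<Longrightarrow> sqi g \<Longrightarrow> N2 (\<lambda>x. f x - g x) \<le> 2 * N2 f + 2 * N2 g"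
  using N2_add_le[of f "\<lambda>x. - g x"] sqi_uminus[of g] by (simp add: N2_def)

lemma cauchy_schwarz_sqi:
  assumes "sqi f" "sqi g"
  shows "\<bar>\<integral>x. f x \<bullet> g x \<partial>lborel\<bar> \<le> sqrt (N2 f) * sqrt (N2 g)"
proof -
  define I where "I = (\<integral>x. f x \<bullet> g x \<partial>lborel)"
  have *: "0 \<le> a\<^sup>2 * N2 f + 2 * a * b * I + b\<^sup>2 * N2 g" for a b
    using N2_lincomb[OF assms, of a b] N2_nonneg unfolding I_def by metis
  have "I\<^sup>2 \<le> N2 f * N2 g"
  proof (cases "N2 f = 0")
    case True
    have "I = 0"
    proof (rule ccontr)
      assume "I \<noteq> 0"
      \<comment> \<open>For N2 f = 0 the quadratic form is affine in its first coefficient, and this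
        value of the coefficient makes it equal to -1.\<close>
      have "0 \<le> 2 * (- (N2 g + 1) / (2 * I)) * 1 * I + 1\<^sup>2 * N2 g"
        using *[of "- (N2 g + 1) / (2 * I)" 1] True by simp
      then show False using \<open>I \<noteq> 0\<close> by (simp add: field_simps)
    qed
    then show ?thesis using True by simp
  next
    case False
    then have p: "N2 f > 0" using N2_nonneg[of f] by linarith
    have "0 \<le> I\<^sup>2 * N2 f - 2 * I * N2 f * I + (N2 f)\<^sup>2 * N2 g"
      using *[of I "- N2 f"] by simp
    then have "0 \<le> N2 f * (N2 f * N2 g - I\<^sup>2)" by (simp add: power2_eq_square algebra_simps)
    then show ?thesis using p by (simp add: zero_le_mult_iff)
  qed
  then have "sqrt (I\<^sup>2) \<le> sqrt (N2 f * N2 g)" by (rule real_sqrt_le_mono)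
  then show ?thesis by (simp add: I_def real_sqrt_mult)
qed

lemma cauchy_schwarz_norm:
  fixes f :: "'a::euclidean_space \<Rightarrow> 'b::euclidean_space" and g :: "'a \<Rightarrow> 'c::euclidean_space"
  assumes "sqi f" "sqi g"
  shows "(\<integral>x. norm (f x) * norm (g x) \<partial>lborel) \<le> sqrt (N2 f) * sqrt (N2 g)"
  using cauchy_schwarz_sqi[OF sqi_norm[OF assms(1)] sqi_norm[OF assms(2)]] by (simp add: N2_def)

section \<open>Convergence in square mean\<close>

lemma lim2D: "lim2 F f \<Longrightarrow> sqi (F n)" "lim2 F f \<Longrightarrow> sqi f" "lim2 F f \<Longrightarrow> (\<lambda>n. N2 (\<lambda>x. F n x - f x)) \<longlonglongrightarrow> 0"
  by (auto simp: lim2_def)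

lemma lim2_bound:
  fixes F :: "nat \<Rightarrow> 'a::euclidean_space \<Rightarrow> 'b::euclidean_space" and G :: "nat \<Rightarrow> 'a \<Rightarrow> 'c::euclidean_space"
  assumes F: "lim2 F f" and G: "\<And>n. G n \<in> borel_measurable borel" "g \<in> borel_measurable borel"
    and le: "\<And>n. AE x in lborel. norm (G n x - g x) \<le> C * norm (F n x - f x)" "sqi g"
  shows "lim2 G g"
proof -
  note [measurable] = G
  have s: "sqi (\<lambda>x. G n x - g x)" and n: "N2 (\<lambda>x. G n x - g x) \<le> C\<^sup>2 * N2 (\<lambda>x. F n x - f x)" for n
    using sqi_bound[OF sqi_diff[OF lim2D(1)[OF F, of n] lim2D(2)[OF F]] _ le(1)[of n]] by auto
  have "sqi (G n)" for n using sqi_add[OF s[of n] le(2)] by simp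
  moreover have "(\<lambda>n. N2 (\<lambda>x. G n x - g x)) \<longlonglongrightarrow> 0"
    by (rule Lim_null_comparison[OF _ tendsto_mult_right_zero[OF lim2D(3)[OF F], of "C\<^sup>2"]])
      (simp add: n)
  ultimately show ?thesis using le(2) by (simp add: lim2_def)
qed

lemma lim2_const: "sqi f \<Longrightarrow> lim2 (\<lambda>n. f) f"
  by (simp add: lim2_def N2_def)

lemma lim2_add: "lim2 F f \<Longrightarrow> lim2 G g \<Longrightarrow> lim2 (\<lambda>n x. F n x + G n x) (\<lambda>x. f x + g x)"
proof -
  assume a: "lim2 F f" "lim2 G g"
  note s = lim2D(1,2)[OF a(1)] lim2D(1,2)[OF a(2)]
  have le: "N2 (\<lambda>x. (F n x + G n x) - (f x + g x)) \<le> 2 * N2 (\<lambda>x. F n x - f x) + 2 * N2 (\<lambda>x. G n x - g x)" for n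
    using N2_add_le[OF sqi_diff[OF s(1) s(2)] sqi_diff[OF s(3) s(4)], of n n] by (simp add: add_diff_add)
  have l: "(\<lambda>n. 2 * N2 (\<lambda>x. F n x - f x) + 2 * N2 (\<lambda>x. G n x - g x)) \<longlonglongrightarrow> 2 * 0 + 2 * 0"
    using lim2D(3)[OF a(1)] lim2D(3)[OF a(2)] by (intro tendsto_add tendsto_mult tendsto_const)
  have "(\<lambda>n. N2 (\<lambda>x. (F n x + G n x) - (f x + g x))) \<longlonglongrightarrow> 0"
  proof (rule Lim_null_comparison)
    show "\<forall>\<^sub>F n in sequentially. norm (N2 (\<lambda>x. (F n x + G n x) - (f x + g x)))
        \<le> 2 * N2 (\<lambda>x. F n x - f x) + 2 * N2 (\<lambda>x. G n x - g x)"
      unfolding real_norm_def abs_of_nonneg[OF N2_nonneg] by (rule always_eventually) (rule allI, rule le)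
  qed (use l in simp)
  then show ?thesis unfolding lim2_def using s sqi_add by blast
qed

lemma lim2_scaleR: "lim2 F f \<Longrightarrow> lim2 (\<lambda>n x. c *\<^sub>R F n x) (\<lambda>x. c *\<^sub>R f x)"
proof -
  assume a: "lim2 F f"
  have "N2 (\<lambda>x. c *\<^sub>R F n x - c *\<^sub>R f x) = c\<^sup>2 * N2 (\<lambda>x. F n x - f x)" for n
    using N2_cmult[of c "\<lambda>x. F n x - f x"] by (simp add: scaleR_diff_right)
  then show ?thesis using lim2D[OF a] tendsto_mult_right_zero[OF lim2D(3)[OF a], of "c\<^sup>2"]
    by (simp add: lim2_def sqi_scaleR)
qed

lemma lim2_diff: "lim2 F f \<Longrightarrow> lim2 G g \<Longrightarrow> lim2 (\<lambda>n x. F n x - G n x) (\<lambda>x. f x - g x)"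
  using lim2_add[of F f "\<lambda>n x. (-1) *\<^sub>R G n x" "\<lambda>x. (-1) *\<^sub>R g x"] lim2_scaleR[of G g "-1"] by simp

lemma lim2_bdd_scaleR:
  fixes m :: "'a::euclidean_space \<Rightarrow> real"
  assumes "m \<in> borel_measurable borel" "AE x in lborel. \<bar>m x\<bar> \<le> M" "lim2 F f"
  shows "lim2 (\<lambda>n x. m x *\<^sub>R F n x) (\<lambda>x. m x *\<^sub>R f x)"
proof (rule lim2_bound[OF assms(3)])
  note [measurable] = assms(1) sqi_measurable[OF lim2D(1)[OF assms(3)]] sqi_measurable[OF lim2D(2)[OF assms(3)]]
  show "(\<lambda>x. m x *\<^sub>R F n x) \<in> borel_measurable borel" for n by measurable
  show "(\<lambda>x. m x *\<^sub>R f x) \<in> borel_measurable borel" by measurable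
  show "AE x in lborel. norm (m x *\<^sub>R F n x - m x *\<^sub>R f x) \<le> M * norm (F n x - f x)" for n
    using assms(2) by eventually_elim (simp add: scaleR_diff_right[symmetric] mult_right_mono)
  show "sqi (\<lambda>x. m x *\<^sub>R f x)" by (rule sqi_bdd_scaleR[OF assms(1,2) lim2D(2)[OF assms(3)]])
qed

lemma lim2_integral_inner:
  assumes "lim2 F f" "lim2 G g"
  shows "(\<lambda>n. \<integral>x. F n x \<bullet> G n x \<partial>lborel) \<longlonglongrightarrow> (\<integral>x. f x \<bullet> g x \<partial>lborel)"
proof -
  define a where "a = (\<lambda>n. \<integral>x. (F n x - f x) \<bullet> g x \<partial>lborel)"
  define b where "b = (\<lambda>n. \<integral>x. (G n x - g x) \<bullet> f x \<partial>lborel)"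
  define c where "c = (\<lambda>n. \<integral>x. (F n x - f x) \<bullet> (G n x - g x) \<partial>lborel)"
  note s = lim2D(1,2)[OF assms(1)] lim2D(1,2)[OF assms(2)]
  note d = sqi_diff[OF s(1) s(2)] sqi_diff[OF s(3) s(4)]
  have eq: "(\<integral>x. F n x \<bullet> G n x \<partial>lborel) = (\<integral>x. f x \<bullet> g x \<partial>lborel) + a n + b n + c n" for n
  proof -
    have "(\<integral>x. F n x \<bullet> G n x \<partial>lborel) = (\<integral>x. ((f x \<bullet> g x + (F n x - f x) \<bullet> g x) + (G n x - g x) \<bullet> f x) + (F n x - f x) \<bullet> (G n x - g x) \<partial>lborel)"
      by (simp add: inner_diff inner_commute algebra_simps)
    also have "\<dots> = (\<integral>x. f x \<bullet> g x \<partial>lborel) + a n + b n + c n"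
      unfolding a_def b_def c_def
      using sqi_inner_integrable[OF s(2) s(4)] sqi_inner_integrable[OF d(1)[of n] s(4)]
        sqi_inner_integrable[OF d(2)[of n] s(2)] sqi_inner_integrable[OF d(1)[of n] d(2)[of n]] by simp
    finally show ?thesis .
  qed
  have sq: "(\<lambda>n. sqrt (N2 (\<lambda>x. F n x - f x))) \<longlonglongrightarrow> 0" "(\<lambda>n. sqrt (N2 (\<lambda>x. G n x - g x))) \<longlonglongrightarrow> 0"
    using tendsto_real_sqrt[OF lim2D(3)[OF assms(1)]] tendsto_real_sqrt[OF lim2D(3)[OF assms(2)]] by auto
  have "a \<longlonglongrightarrow> 0"
    by (rule Lim_null_comparison[OF _ tendsto_mult_left_zero[OF sq(1), of "sqrt (N2 g)"]])
      (auto simp: a_def intro!: always_eventually cauchy_schwarz_sqi d s)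
  moreover have "b \<longlonglongrightarrow> 0"
    by (rule Lim_null_comparison[OF _ tendsto_mult_left_zero[OF sq(2), of "sqrt (N2 f)"]])
      (auto simp: b_def intro!: always_eventually cauchy_schwarz_sqi d s)
  moreover have "c \<longlonglongrightarrow> 0"
    by (rule Lim_null_comparison[OF _ tendsto_mult_zero[OF sq]])
      (auto simp: c_def intro!: always_eventually cauchy_schwarz_sqi d s)
  ultimately have "(\<lambda>n. (\<integral>x. f x \<bullet> g x \<partial>lborel) + a n + b n + c n) \<longlonglongrightarrow> (\<integral>x. f x \<bullet> g x \<partial>lborel) + 0 + 0 + 0"
    by (intro tendsto_intros)
  then show ?thesis by (simp add: eq)
qed

lemma lim2_N2: "lim2 F f \<Longrightarrow> (\<lambda>n. N2 (F n)) \<longlonglongrightarrow> N2 f"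
  unfolding N2_inner by (rule lim2_integral_inner)

lemma N2_zero_AE: "sqi f \<Longrightarrow> N2 f = 0 \<Longrightarrow> AE x in lborel. f x = 0"
  unfolding N2_def using integral_nonneg_eq_0_iff_AE[OF sqi_integrable, of f] by auto

lemma sqi_AE_cong:
  assumes "sqi f" "g \<in> borel_measurable borel" "AE x in lborel. g x = f x"
  shows "sqi g"
proof (rule sqi_bound(1)[OF assms(1,2), of 1])
  show "AE x in lborel. norm (g x) \<le> 1 * norm (f x)" using assms(3) by eventually_elim simp
qed

lemma lim2_AE_cong:
  assumes "lim2 F f" "g \<in> borel_measurable borel" "AE x in lborel. g x = f x"
  shows "lim2 F g"
proof (rule lim2_bound[OF assms(1)])
  show "AE x in lborel. norm (F n x - g x) \<le> 1 * norm (F n x - f x)" for n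
    using assms(3) by eventually_elim simp
  show "sqi g" by (rule sqi_AE_cong[OF lim2D(2)[OF assms(1)] assms(2,3)])
qed (use assms sqi_measurable lim2D(1)[OF assms(1)] in auto)

text \<open>From t <= t^2 + 1 with t = 2^k d k, divided by 2^k. It turns square summability of the
  increments of a fast subsequence into absolute summability.\<close>

lemma summable_of_weighted_squares:
  fixes d :: "nat \<Rightarrow> real"
  assumes "\<And>k. 0 \<le> d k" "summable (\<lambda>k. 2 ^ k * (d k)\<^sup>2)"
  shows "summable d"
proof -
  have s: "summable (\<lambda>k. (1/2::real) ^ k)" by (rule summable_geometric) simp
  show ?thesis
  proof (rule summable_comparison_test[OF _ summable_add[OF s assms(2)]], intro exI[of _ 0] allI impI)
    fix k
    have "2 * (d k * 2 ^ k) * 1 \<le> (d k * 2 ^ k)\<^sup>2 + 1\<^sup>2" by (rule sum_squares_bound)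
    then have "d k * 2 ^ k \<le> (d k * 2 ^ k)\<^sup>2 + 1" using assms(1)[of k] by (smt (verit) mult_nonneg_nonneg zero_le_power one_power2)
    then have "(1/2) ^ k * (d k * 2 ^ k) \<le> (1/2) ^ k * ((d k * 2 ^ k)\<^sup>2 + 1)" by (intro mult_left_mono) auto
    then show "norm (d k) \<le> (1/2) ^ k + 2 ^ k * (d k)\<^sup>2"
      using assms(1)[of k] by (simp add: power_one_over field_simps power2_eq_square)
  qed
qed

text \<open>Completeness. Along a subsequence whose squared increments have integrals below 4^(-k),
  the sum of 2^k times the squared increments is integrable, hence finite almost everywhere, and the
  subsequence converges pointwise. Fatou's lemma turns the pointwise limit into a limit in
  norm.\<close>

theorem riesz_fischer:
  fixes F :: "nat \<Rightarrow> 'a::euclidean_space \<Rightarrow> 'b::euclidean_space"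
  assumes F: "\<And>n. sqi (F n)" and C: "\<And>e. e > 0 \<Longrightarrow> \<exists>N. \<forall>m\<ge>N. \<forall>n\<ge>N. N2 (\<lambda>x. F m x - F n x) < e"
  shows "\<exists>f. lim2 F f"
proof -
  have [measurable]: "F n \<in> borel_measurable borel" for n using F sqi_measurable by auto
  have "\<exists>N. \<forall>k. (\<forall>m\<ge>N k. \<forall>n\<ge>N k. N2 (\<lambda>x. F m x - F n x) < (1/4) ^ k)"
    by (rule choice) (use C in auto)
  then obtain N where N: "\<And>k m n. m \<ge> N k \<Longrightarrow> n \<ge> N k \<Longrightarrow> N2 (\<lambda>x. F m x - F n x) < (1/4) ^ k" by blast
  \<comment> \<open>The maximum makes \<open>r\<close> monotone and the summand \<open>k\<close>
    makes it unbounded.\<close>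
  define r where "r = (\<lambda>k. Max (N ` {..k}) + k)"
  have r: "N k \<le> r k" "r k \<le> r (Suc k)" "k \<le> r k" for k
  proof -
    show "r k \<le> r (Suc k)" unfolding r_def by (intro add_mono Max_mono) auto
    show "N k \<le> r k" unfolding r_def by (rule trans_le_add1) auto
  qed (simp add: r_def)
  define d where "d = (\<lambda>k x. norm (F (r (Suc k)) x - F (r k) x))"
  have [measurable]: "d k \<in> borel_measurable borel" for k by (simp add: d_def)
  have d: "(\<integral>\<^sup>+x. ennreal (2 ^ k * (d k x)\<^sup>2) \<partial>lborel) \<le> ennreal ((1/2) ^ k)" for k
  proof -
    have s: "sqi (\<lambda>x. F (r (Suc k)) x - F (r k) x)" by (intro sqi_diff F)
    have "(\<integral>\<^sup>+x. ennreal (2 ^ k * (d k x)\<^sup>2) \<partial>lborel) = ennreal (\<integral>x. 2 ^ k * (d k x)\<^sup>2 \<partial>lborel)"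
      by (rule nn_integral_eq_integral) (use sqi_integrable[OF s] in \<open>auto simp: d_def\<close>)
    moreover have "(\<integral>x. 2 ^ k * (d k x)\<^sup>2 \<partial>lborel) = 2 ^ k * N2 (\<lambda>x. F (r (Suc k)) x - F (r k) x)"
      by (simp add: N2_def d_def)
    moreover have "2 ^ k * N2 (\<lambda>x. F (r (Suc k)) x - F (r k) x) \<le> 2 ^ k * (1/4) ^ k"
      using N[OF order_trans[OF r(1)[of k] r(2)] r(1)[of k]] by (intro mult_left_mono) auto
    moreover have "2 ^ k * (1/4) ^ k = (1/2::real) ^ k" by (simp add: power_mult_distrib[symmetric])
    ultimately show ?thesis by (simp add: ennreal_leI)
  qed
  have "(\<integral>\<^sup>+x. (\<Sum>k. ennreal (2 ^ k * (d k x)\<^sup>2)) \<partial>lborel) = (\<Sum>k. \<integral>\<^sup>+x. ennreal (2 ^ k * (d k x)\<^sup>2) \<partial>lborel)"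
    by (rule nn_integral_suminf) auto
  also have "\<dots> \<le> (\<Sum>k. ennreal ((1/2) ^ k))" by (intro suminf_le d) auto
  also have "\<dots> = ennreal (\<Sum>k. (1/2) ^ k)" by (intro suminf_ennreal2) (auto intro!: summable_geometric)
  finally have "(\<integral>\<^sup>+x. (\<Sum>k. ennreal (2 ^ k * (d k x)\<^sup>2)) \<partial>lborel) \<noteq> \<infinity>"
    by (metis ennreal_less_top infinity_ennreal_def leD)
  then have "AE x in lborel. (\<Sum>k. ennreal (2 ^ k * (d k x)\<^sup>2)) \<noteq> \<infinity>"
    by (intro nn_integral_PInf_AE) auto
  then have conv: "AE x in lborel. convergent (\<lambda>k. F (r k) x)"
  proof eventually_elim
    case (elim x)
    have "summable (\<lambda>k. 2 ^ k * (d k x)\<^sup>2)"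
      by (rule summable_suminf_not_top[OF _ elim[unfolded infinity_ennreal_def]]) simp
    then have "summable (\<lambda>k. d k x)" by (rule summable_of_weighted_squares[rotated]) (simp add: d_def)
    then have "summable (\<lambda>k. F (r (Suc k)) x - F (r k) x)"
      unfolding d_def by (rule summable_norm_cancel)
    then have "convergent (\<lambda>m. F (r m) x - F (r 0) x)"
      unfolding summable_iff_convergent by (simp add: sum_lessThan_telescope[of "\<lambda>k. F (r k) x"])
    from convergent_add[OF this convergent_const[of "F (r 0) x"]] show ?case by simp
  qed
  define f where "f = (\<lambda>x. lim (\<lambda>k. F (r k) x))"
  have [measurable]: "f \<in> borel_measurable borel" unfolding f_def by (rule borel_measurable_lim_metric) auto
  have lim: "AE x in lborel. (\<lambda>k. F (r k) x) \<longlonglongrightarrow> f x"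
    using conv by eventually_elim (simp add: f_def convergent_LIMSEQ_iff)
  \<comment> \<open>Fatou's lemma is applied along the subsequence but for arbitrary
    \<open>n\<close>, so that the full sequence converges in norm.\<close>
  have le: "(\<integral>\<^sup>+x. ennreal ((norm (F n x - f x))\<^sup>2) \<partial>lborel) \<le> ennreal e"
    if e: "e > 0" and M: "\<And>m. m \<ge> M \<Longrightarrow> N2 (\<lambda>x. F n x - F m x) \<le> e" for n e M
  proof -
    have "(\<integral>\<^sup>+x. ennreal ((norm (F n x - f x))\<^sup>2) \<partial>lborel) = (\<integral>\<^sup>+x. liminf (\<lambda>k. ennreal ((norm (F n x - F (r k) x))\<^sup>2)) \<partial>lborel)"
    proof (rule nn_integral_cong_AE, use lim in eventually_elim)
      case (elim x)
      have "(\<lambda>k. ennreal ((norm (F n x - F (r k) x))\<^sup>2)) \<longlonglongrightarrow> ennreal ((norm (F n x - f x))\<^sup>2)"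
        by (intro tendsto_ennrealI tendsto_intros elim)
      then show ?case using lim_imp_Liminf[OF sequentially_bot] by metis
    qed
    also have "\<dots> \<le> liminf (\<lambda>k. \<integral>\<^sup>+x. ennreal ((norm (F n x - F (r k) x))\<^sup>2) \<partial>lborel)"
      by (rule nn_integral_liminf) auto
    also have "\<dots> = liminf (\<lambda>k. ennreal (N2 (\<lambda>x. F n x - F (r k) x)))"
      unfolding N2_def by (subst nn_integral_eq_integral) (auto intro!: sqi_integrable sqi_diff F)
    also have "\<dots> \<le> liminf (\<lambda>k::nat. ennreal e)"
    proof (rule Liminf_mono, rule eventually_sequentiallyI[of M])
      fix k assume "M \<le> k"
      then have "M \<le> r k" using r(3)[of k] by simp
      then show "ennreal (N2 (\<lambda>x. F n x - F (r k) x)) \<le> ennreal e" using M by (intro ennreal_leI)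
    qed
    also have "\<dots> = ennreal e" by (simp add: Liminf_const)
    finally show ?thesis .
  qed
  have ev: "\<exists>M. \<forall>n\<ge>M. sqi (\<lambda>x. F n x - f x) \<and> N2 (\<lambda>x. F n x - f x) \<le> e" if e: "e > 0" for e
  proof -
    obtain M where M: "\<And>m n. m \<ge> M \<Longrightarrow> n \<ge> M \<Longrightarrow> N2 (\<lambda>x. F m x - F n x) < e" using C[OF e] by blast
    have "sqi (\<lambda>x. F n x - f x) \<and> N2 (\<lambda>x. F n x - f x) \<le> e" if n: "n \<ge> M" for n
    proof -
      have *: "(\<integral>\<^sup>+x. ennreal ((norm (F n x - f x))\<^sup>2) \<partial>lborel) \<le> ennreal e"
        using le[OF e, of M n] M n less_imp_le by blast
      have i: "integrable lborel (\<lambda>x. (norm (F n x - f x))\<^sup>2)"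
        by (rule integrableI_nonneg) (use * in \<open>auto simp: le_less_trans[OF _ ennreal_less_top]\<close>)
      have "N2 (\<lambda>x. F n x - f x) \<le> e"
        using * nn_integral_eq_integral[OF i] e by (simp add: N2_def)
      then show ?thesis using i by (simp add: sqi_def)
    qed
    then show ?thesis by blast
  qed
  obtain M where "sqi (\<lambda>x. F M x - f x)" using ev[of 1] by auto
  from sqi_diff[OF F[of M] this] have "sqi f" by simp
  moreover have "(\<lambda>n. N2 (\<lambda>x. F n x - f x)) \<longlonglongrightarrow> 0"
  proof (rule LIMSEQ_I)
    fix e :: real assume "e > 0"
    then obtain M where "\<forall>n\<ge>M. N2 (\<lambda>x. F n x - f x) \<le> e / 2" using ev[of "e/2"] by auto
    then show "\<exists>M. \<forall>n\<ge>M. norm (N2 (\<lambda>x. F n x - f x) - 0) < e" using \<open>e > 0\<close> by (intro exI[of _ M]) auto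
  qed
  ultimately show ?thesis using F by (auto simp: lim2_def)
qed

lemma lim2_Cauchy:
  assumes "lim2 F f" "e > 0"
  shows "\<exists>N. \<forall>m\<ge>N. \<forall>n\<ge>N. N2 (\<lambda>x. F m x - F n x) < e"
proof -
  have "\<forall>\<^sub>F n in sequentially. N2 (\<lambda>x. F n x - f x) < e / 4"
    using order_tendstoD(2)[OF lim2D(3)[OF assms(1)], of "e/4"] assms(2) by simp
  then obtain N where N: "\<And>n. n \<ge> N \<Longrightarrow> N2 (\<lambda>x. F n x - f x) < e / 4"
    unfolding eventually_sequentially by blast
  have "N2 (\<lambda>x. F m x - F n x) < e" if "m \<ge> N" "n \<ge> N" for m n
  proof -
    have "N2 (\<lambda>x. (F m x - f x) - (F n x - f x)) \<le> 2 * N2 (\<lambda>x. F m x - f x) + 2 * N2 (\<lambda>x. F n x - f x)"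
      by (intro N2_diff_le sqi_diff lim2D[OF assms(1)])
    then show ?thesis using N[OF that(1)] N[OF that(2)] by simp
  qed
  then show ?thesis by blast
qed

text \<open>Orthogonal projection onto the closure of S: a minimising sequence is Cauchy by the
  parallelogram law, and its limit differs from f by a vector orthogonal to S, which vanishes by
  assumption. Only real coefficients occur, in accordance with the real inner product.\<close>

theorem dense_if_orthogonal_trivial:
  fixes f :: "'a::euclidean_space \<Rightarrow> 'b::euclidean_space"
  assumes S: "\<And>s. s \<in> S \<Longrightarrow> sqi s" "(\<lambda>x. 0) \<in> S"
    and lin: "\<And>s t a b. s \<in> S \<Longrightarrow> t \<in> S \<Longrightarrow> (\<lambda>x. a *\<^sub>R s x + b *\<^sub>R t x) \<in> S"
    and orth: "\<And>g. sqi g \<Longrightarrow> (\<And>s. s \<in> S \<Longrightarrow> (\<integral>x. g x \<bullet> s x \<partial>lborel) = 0) \<Longrightarrow> AE x in lborel. g x = 0"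
    and f: "sqi f"
  shows "\<exists>s. (\<forall>n. s n \<in> S) \<and> lim2 s f"
proof -
  define D where "D = (\<lambda>s. N2 (\<lambda>x. f x - s x)) ` S"
  define d where "d = Inf D"
  have D: "D \<noteq> {}" "bdd_below D" using S(2) by (auto simp: D_def intro!: bdd_belowI[of _ 0])
  have dle: "d \<le> N2 (\<lambda>x. f x - s x)" if "s \<in> S" for s
    unfolding d_def using that D by (intro cInf_lower) (auto simp: D_def)
  have "\<exists>s\<in>S. N2 (\<lambda>x. f x - s x) < d + 1 / real (Suc n)" for n
  proof -
    have "Inf D < d + 1 / real (Suc n)" by (simp add: d_def)
    then show ?thesis using cInf_lessD[OF D(1)] by (auto simp: D_def)
  qed
  then obtain s where s: "\<And>n. s n \<in> S" "\<And>n. N2 (\<lambda>x. f x - s n x) < d + 1 / real (Suc n)" by metis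
  have sq: "sqi (\<lambda>x. f x - s n x)" for n by (intro sqi_diff f S s)
  \<comment> \<open>The midpoint of \<open>s m\<close> and \<open>s n\<close> lies in S, so its
    squared distance to f is at least d. The parallelogram law then leaves little room for the
    difference.\<close>
  have par: "N2 (\<lambda>x. s m x - s n x) \<le> 2 / real (Suc m) + 2 / real (Suc n)" for m n
  proof -
    have mid: "(\<lambda>x. (1/2) *\<^sub>R s m x + (1/2) *\<^sub>R s n x) \<in> S" by (intro lin s)
    define I where "I = (\<integral>x. (f x - s m x) \<bullet> (f x - s n x) \<partial>lborel)"
    have "N2 (\<lambda>x. (-1) *\<^sub>R (f x - s m x) + 1 *\<^sub>R (f x - s n x)) = N2 (\<lambda>x. f x - s m x) - 2 * I + N2 (\<lambda>x. f x - s n x)"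
      by (subst N2_lincomb[OF sq sq]) (simp add: I_def)
    moreover have "N2 (\<lambda>x. (1/2) *\<^sub>R (f x - s m x) + (1/2) *\<^sub>R (f x - s n x)) = N2 (\<lambda>x. f x - s m x) / 4 + I / 2 + N2 (\<lambda>x. f x - s n x) / 4"
      by (subst N2_lincomb[OF sq sq]) (simp add: I_def power2_eq_square)
    moreover have "(1/2) *\<^sub>R (f x - s m x) + (1/2) *\<^sub>R (f x - s n x) = f x - ((1/2) *\<^sub>R s m x + (1/2) *\<^sub>R s n x)" for x
      by (simp add: scaleR_diff_right scaleR_half_double[symmetric] del: scaleR_half_double)
         (metis (no_types, lifting) add_diff_add scaleR_half_double scaleR_right_distrib)
    ultimately have "N2 (\<lambda>x. s m x - s n x) = N2 (\<lambda>x. f x - s m x) - 2 * I + N2 (\<lambda>x. f x - s n x)"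
      "d \<le> N2 (\<lambda>x. f x - s m x) / 4 + I / 2 + N2 (\<lambda>x. f x - s n x) / 4"
      using dle[OF mid] by simp_all
    then show ?thesis using s(2)[of m] s(2)[of n] by simp
  qed
  have "\<exists>p. lim2 s p"
  proof (rule riesz_fischer)
    show "sqi (s n)" for n using S s by blast
    fix e :: real assume "e > 0"
    then obtain N where N: "1 / real (Suc N) < e / 4" using nat_approx_posE[of "e/4"] by auto
    have "N2 (\<lambda>x. s m x - s n x) < e" if "m \<ge> N" "n \<ge> N" for m n
    proof -
      have "1 / real (Suc m) \<le> 1 / real (Suc N)" "1 / real (Suc n) \<le> 1 / real (Suc N)"
        using that by (auto intro!: divide_left_mono)
      then show ?thesis using par[of m n] N by simp
    qed
    then show "\<exists>N. \<forall>m\<ge>N. \<forall>n\<ge>N. N2 (\<lambda>x. s m x - s n x) < e" by blast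
  qed
  then obtain p where p: "lim2 s p" ..
  define g where "g = (\<lambda>x. f x - p x)"
  have g: "sqi g" unfolding g_def by (intro sqi_diff f lim2D[OF p])
  have limg: "lim2 (\<lambda>n x. f x - s n x) g" unfolding g_def by (intro lim2_diff lim2_const f p)
  have "N2 g \<le> d"
  proof (rule LIMSEQ_le[OF lim2_N2[OF limg]])
    have "(\<lambda>n. d + 1 / real (Suc n)) \<longlonglongrightarrow> d + 0"
      using LIMSEQ_inverse_real_of_nat by (intro tendsto_intros) (simp add: inverse_eq_divide)
    then show "(\<lambda>n. d + 1 / real (Suc n)) \<longlonglongrightarrow> d" by simp
    show "\<exists>N. \<forall>n\<ge>N. N2 (\<lambda>x. f x - s n x) \<le> d + 1 / real (Suc n)" using s(2) less_imp_le by blast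
  qed
  have "AE x in lborel. g x = 0"
  proof (rule orth[OF g])
    fix t assume t: "t \<in> S"
    define I where "I = (\<integral>x. g x \<bullet> t x \<partial>lborel)"
    have *: "d \<le> N2 g - 2 * c * I + c\<^sup>2 * N2 t" for c
    proof -
      have "lim2 (\<lambda>n x. (f x - s n x) - c *\<^sub>R t x) (\<lambda>x. g x - c *\<^sub>R t x)"
        by (intro lim2_diff[OF limg] lim2_const sqi_scaleR S t)
      from lim2_N2[OF this] have "d \<le> N2 (\<lambda>x. g x - c *\<^sub>R t x)"
      proof (rule LIMSEQ_le_const, intro exI[of _ 0] allI impI)
        fix n
        have "d \<le> N2 (\<lambda>x. f x - (1 *\<^sub>R s n x + c *\<^sub>R t x))" by (intro dle lin s t)
        then show "d \<le> N2 (\<lambda>x. f x - s n x - c *\<^sub>R t x)" by (simp add: diff_diff_eq)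
      qed
      also have "\<dots> = N2 (\<lambda>x. 1 *\<^sub>R g x + (- c) *\<^sub>R t x)" by simp
      also have "\<dots> = N2 g - 2 * c * I + c\<^sup>2 * N2 t" by (subst N2_lincomb[OF g S(1)[OF t]]) (simp add: I_def)
      finally show ?thesis .
    qed
    \<comment> \<open>The exact minimiser would be I / N2 t. The added 1 avoids division by zero and
      still leads to c^2 (N2 t + 2) <= 0.\<close>
    define c where "c = I / (N2 t + 1)"
    have pos: "N2 t + 1 > 0" using N2_nonneg[of t] by linarith
    have I: "I = c * (N2 t + 1)" using pos by (simp add: c_def)
    have "0 \<le> - 2 * c * I + c\<^sup>2 * N2 t" using *[of c] \<open>N2 g \<le> d\<close> by linarith
    then have "c\<^sup>2 * (N2 t + 2) \<le> 0" unfolding I by (simp add: power2_eq_square algebra_simps)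
    then have "c = 0" using N2_nonneg[of t] by (simp add: mult_le_0_iff)
    then show "(\<integral>x. g x \<bullet> t x \<partial>lborel) = 0" using I by (simp add: I_def)
  qed
  then have "AE x in lborel. f x = p x" by eventually_elim (simp add: g_def)
  then have "lim2 s f" using lim2_AE_cong[OF p sqi_measurable[OF f]] by simp
  then show ?thesis using s by blast
qed

section \<open>The fundamental lemma and very weak solutions of the free equation\<close>

definition locint :: "('a::euclidean_space \<Rightarrow> real) \<Rightarrow> bool" where
  "locint f \<longleftrightarrow> f \<in> borel_measurable borel \<and> (\<forall>R. integrable lborel (\<lambda>x. indicator (cball 0 R) x * f x))"

lemma locint_cc_mult:
  assumes "locint f" "cc \<phi>"
  shows "integrable lborel (\<lambda>x. \<phi> x * f x)"
proof -
  obtain R where R: "\<And>x. norm x > R \<Longrightarrow> \<phi> x = 0" using assms(2) unfolding cc_def by blast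
  obtain M where M: "\<And>x. \<bar>\<phi> x\<bar> \<le> M" using cc_bounded[OF assms(2)] by blast
  have [measurable]: "f \<in> borel_measurable borel" "\<phi> \<in> borel_measurable borel"
    using assms cc_measurable by (auto simp: locint_def)
  have i: "integrable lborel (\<lambda>x. M * (indicator (cball 0 R) x * f x))"
    using assms(1) by (simp add: locint_def)
  show ?thesis
  proof (rule Bochner_Integration.integrable_bound[OF i], simp, rule AE_I2)
    fix x
    show "norm (\<phi> x * f x) \<le> norm (M * (indicator (cball 0 R) x * f x))"
    proof (cases "norm x > R")
      case False
      have "\<bar>\<phi> x\<bar> \<le> \<bar>M\<bar>" using M[of x] by linarith
      then show ?thesis using False by (simp add: abs_mult mult_right_mono)
    qed (simp add: R)
  qed
qed

lemma sqi_locint: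
  fixes f :: "'a::euclidean_space \<Rightarrow> real"
  assumes f: "sqi f"
  shows "locint f"
proof -
  have [measurable]: "f \<in> borel_measurable borel" by (rule sqi_measurable[OF f])
  have "integrable lborel (\<lambda>x. indicator (cball 0 R) x * f x)" for R
  proof (rule Bochner_Integration.integrable_bound)
    show "integrable lborel (\<lambda>x::'a. indicator (cball 0 R) x + (norm (f x))\<^sup>2)"
      using sqi_integrable[OF f] emeasure_lborel_cball_finite[of "0::'a" R]
      by (intro Bochner_Integration.integrable_add integrable_real_indicator) auto
    show "AE x in lborel. norm (indicator (cball 0 R) x * f x) \<le> norm (indicator (cball 0 R) x + (norm (f x))\<^sup>2)"
    proof (rule AE_I2)
      fix x :: 'a
      have "2 * \<bar>f x\<bar> * 1 \<le> \<bar>f x\<bar>\<^sup>2 + 1\<^sup>2" by (rule sum_squares_bound)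
      then show "norm (indicator (cball 0 R) x * f x) \<le> norm (indicator (cball 0 R) x + (norm (f x))\<^sup>2)"
        by (auto simp: indicator_def)
    qed
    have "(indicator (cball 0 R) :: 'a \<Rightarrow> real) \<in> borel_measurable borel"
      by (intro borel_measurable_indicator) auto
    then show "(\<lambda>x. indicator (cball 0 R) x * f x) \<in> borel_measurable lborel" by simp
  qed
  then show ?thesis by (simp add: locint_def)
qed

lemma bump_LIMSEQ: "t > 0 \<Longrightarrow> (\<lambda>j. bump (real j * t)) \<longlonglongrightarrow> 1"
proof -
  assume t: "t > 0"
  have "(\<lambda>j. exp (- (1 / t) * (1 / real j))) \<longlonglongrightarrow> exp (- (1 / t) * 0)"
    by (intro tendsto_intros lim_1_over_n)
  then have "(\<lambda>j. exp (- (1 / t) * (1 / real j))) \<longlonglongrightarrow> 1" by simp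
  then show ?thesis
    by (rule Lim_transform_eventually)
      (use t in \<open>auto simp: bump_def eventually_sequentially intro!: exI[of _ 1]\<close>)
qed

text \<open>Products of bumps in the scaled distances to the faces are test functions between 0 and
  1 that converge to the indicator of the open box.\<close>

lemma integral_box_eq_0:
  fixes f :: "'a::euclidean_space \<Rightarrow> real"
  assumes f: "locint f" and z: "\<And>\<phi>. cc \<phi> \<Longrightarrow> (\<integral>x. \<phi> x * f x \<partial>lborel) = 0"
  shows "integrable lborel (\<lambda>x. indicator (box c d) x * f x)" "(\<integral>x. indicator (box c d) x * f x \<partial>lborel) = 0"
proof -
  obtain R where R: "\<And>x. x \<in> box c d \<Longrightarrow> norm x \<le> R"
    using bounded_box[of c d] unfolding bounded_iff by blast
  have [measurable]: "f \<in> borel_measurable borel" using f by (simp add: locint_def)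
  have iR: "integrable lborel (\<lambda>x. indicator (cball 0 R) x * f x)" using f by (simp add: locint_def)
  show "integrable lborel (\<lambda>x. indicator (box c d) x * f x)"
    by (rule Bochner_Integration.integrable_bound[OF iR]) (use R in \<open>auto simp: indicator_def\<close>)
  define \<phi> where "\<phi> = (\<lambda>j x. \<Prod>b\<in>Basis. bump (real j * ((x - c) \<bullet> b)) * bump (real j * ((d - x) \<bullet> b)))"
  have out: "\<phi> j x = 0" if "x \<notin> box c d" for j x
  proof -
    obtain b where b: "b \<in> Basis" "x \<bullet> b \<le> c \<bullet> b \<or> d \<bullet> b \<le> x \<bullet> b" using \<open>x \<notin> box c d\<close> by (auto simp: mem_box)
    then have "real j * ((x - c) \<bullet> b) \<le> 0 \<or> real j * ((d - x) \<bullet> b) \<le> 0"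
      by (auto simp: inner_diff_left mult_nonneg_nonpos)
    then have "bump (real j * ((x - c) \<bullet> b)) * bump (real j * ((d - x) \<bullet> b)) = 0"
      using bump_bounds(4) by auto
    then show ?thesis unfolding \<phi>_def using b(1) by (intro prod_zero) auto
  qed
  have sm: "smooth_on UNIV (\<phi> j)" for j
    unfolding \<phi>_def inner_diff_left
    by (intro smooth_on_prod smooth_on_mult smooth_on_compose[OF smooth_on_bump]
        smooth_on_diff smooth_on_inner smooth_on_const) auto
  have cc: "cc (\<phi> j)" for j
    unfolding cc_def using sm out R by (intro conjI exI[of _ R]) (auto simp: not_le[symmetric])
  have [measurable]: "\<phi> j \<in> borel_measurable borel" for j by (rule cc_measurable[OF cc])
  have b01: "0 \<le> \<phi> j x" "\<phi> j x \<le> 1" for j x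
    unfolding \<phi>_def by (auto intro!: prod_nonneg prod_le_1 mult_le_one bump_bounds mult_nonneg_nonneg)
  have "(\<lambda>j. \<integral>x. \<phi> j x * f x \<partial>lborel) \<longlonglongrightarrow> (\<integral>x. indicator (box c d) x * f x \<partial>lborel)"
  proof (rule integral_dominated_convergence[where w = "\<lambda>x. norm (indicator (cball 0 R) x * f x)"])
    show "AE x in lborel. (\<lambda>j. \<phi> j x * f x) \<longlonglongrightarrow> indicator (box c d) x * f x"
    proof (rule AE_I2)
      fix x
      have "(\<lambda>j. \<phi> j x) \<longlonglongrightarrow> indicator (box c d) x"
      proof (cases "x \<in> box c d")
        case True
        have "(\<lambda>j. \<phi> j x) \<longlonglongrightarrow> (\<Prod>b\<in>(Basis::'a set). 1 * 1)"
          unfolding \<phi>_def using True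
          by (intro tendsto_prod tendsto_mult bump_LIMSEQ) (auto simp: mem_box inner_diff_left)
        then show ?thesis using True by simp
      qed (simp add: out)
      then show "(\<lambda>j. \<phi> j x * f x) \<longlonglongrightarrow> indicator (box c d) x * f x" by (intro tendsto_intros)
    qed
    show "AE x in lborel. norm (\<phi> j x * f x) \<le> norm (indicator (cball 0 R) x * f x)" for j
    proof (rule AE_I2)
      fix x show "norm (\<phi> j x * f x) \<le> norm (indicator (cball 0 R) x * f x)"
        using R[of x] out[of x j] b01[of j x] by (cases "x \<in> box c d") (auto simp: abs_mult mult_left_le_one_le)
    qed
  qed (use iR in auto)
  then show "(\<integral>x. indicator (box c d) x * f x \<partial>lborel) = 0"
    using z[OF cc] by (simp add: LIMSEQ_const_iff)
qed

text \<open>The positive and the negative part of f, taken as densities, define measures that agree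
  and are finite on boxes. Boxes generate the Borel sets and are stable under intersection, so the
  measures agree, and with them the densities almost everywhere.\<close>

theorem fundamental_lemma:
  fixes f :: "'a::euclidean_space \<Rightarrow> real"
  assumes f: "locint f" and z: "\<And>\<phi>. cc \<phi> \<Longrightarrow> (\<integral>x. \<phi> x * f x \<partial>lborel) = 0"
  shows "AE x in lborel. f x = 0"
proof -
  have [measurable]: "f \<in> borel_measurable borel" using f by (simp add: locint_def)
  define M N where "M = density lborel (\<lambda>x. ennreal (max 0 (f x)))" and "N = density lborel (\<lambda>x. ennreal (max 0 (- f x)))"
  have ipos: "integrable lborel (\<lambda>x. indicator (box c d) x * max 0 (f x))"
    and ineg: "integrable lborel (\<lambda>x. indicator (box c d) x * max 0 (- f x))" for c d
    by (rule Bochner_Integration.integrable_bound[OF integral_box_eq_0(1)[OF f z, of c d]]; auto simp: indicator_def)+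
  have eM: "emeasure M (box c d) = ennreal (\<integral>x. indicator (box c d) x * max 0 (f x) \<partial>lborel)" for c d
    unfolding M_def by (subst emeasure_density, simp, simp, subst nn_integral_eq_integral[OF ipos, symmetric])
      (auto intro!: nn_integral_cong simp: indicator_def)
  have eN: "emeasure N (box c d) = ennreal (\<integral>x. indicator (box c d) x * max 0 (- f x) \<partial>lborel)" for c d
    unfolding N_def by (subst emeasure_density, simp, simp, subst nn_integral_eq_integral[OF ineg, symmetric])
      (auto intro!: nn_integral_cong simp: indicator_def)
  have eq: "emeasure M (box c d) = emeasure N (box c d)" for c d
  proof -
    have "(\<integral>x. indicator (box c d) x * max 0 (f x) \<partial>lborel) - (\<integral>x. indicator (box c d) x * max 0 (- f x) \<partial>lborel)
      = (\<integral>x. indicator (box c d) x * max 0 (f x) - indicator (box c d) x * max 0 (- f x) \<partial>lborel)"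
      by (rule Bochner_Integration.integral_diff[OF ipos ineg, symmetric])
    also have "\<dots> = (\<integral>x. indicator (box c d) x * f x \<partial>lborel)"
      by (intro Bochner_Integration.integral_cong refl) (auto simp: max_def)
    finally show ?thesis using integral_box_eq_0(2)[OF f z, of c d] by (simp add: eM eN)
  qed
  have "M = N"
  proof (rule measure_eqI_generator_eq[where E = "range (\<lambda>(a, b). box a b :: 'a set)" and \<Omega> = UNIV
        and A = "\<lambda>n. box (- (real n *\<^sub>R One)) (real n *\<^sub>R One)"])
    show "Int_stable (range (\<lambda>(a, b). box a b :: 'a set))"
      by (auto simp: Int_stable_def box_Int_box)
    show "sets M = sigma_sets UNIV (range (\<lambda>(a, b). box a b))" "sets N = sigma_sets UNIV (range (\<lambda>(a, b). box a b))"
      by (simp_all add: M_def N_def borel_eq_box)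
    show "(\<Union>n. box (- (real n *\<^sub>R One)) (real n *\<^sub>R One)) = (UNIV::'a set)"
      using UN_box_eq_UNIV by simp
  qed (auto simp: eM simp flip: eq)
  then have "AE x in lborel. ennreal (max 0 (f x)) = ennreal (max 0 (- f x))"
    unfolding M_def N_def by (intro sigma_finite_measure.density_unique[OF sigma_finite_lborel]) auto
  then show ?thesis
  proof eventually_elim
    case (elim x)
    then have "max 0 (f x) = max 0 (- f x)" by simp
    then show ?case by (auto simp: max_def split: if_splits)
  qed
qed

lemma Ck_on_translate: "Ck_on UNIV k f \<Longrightarrow> Ck_on UNIV k (\<lambda>x. f (x - a))"
proof (induction k arbitrary: f)
  case 0
  then show ?case by (auto intro!: continuous_on_compose2[of UNIV f] continuous_intros)
next
  case (Suc k)
  show ?case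
  proof (rule Ck_on_SucI[where f' = "\<lambda>x h. pd h f (x - a)"])
    show "((\<lambda>x. f (x - a)) has_derivative (\<lambda>h. pd h f (x - a))) (at x)" for x
      by (rule has_derivative_compose[of "\<lambda>x. x - a" "\<lambda>h. h" x UNIV f, OF _ Ck_on_deriv[OF Suc.prems]])
        (auto intro!: derivative_eq_intros)
  qed (use Suc in auto)
qed

lemma cc_translate: "cc f \<Longrightarrow> cc (\<lambda>x. f (x - a))"
proof -
  assume f: "cc f"
  obtain R where R: "\<And>x. norm x > R \<Longrightarrow> f x = 0" using f unfolding cc_def by blast
  have "f (x - a) = 0" if "norm x > R + norm a" for x
    using R[of "x - a"] that norm_triangle_ineq2[of x a] by simp
  then show ?thesis using f Ck_on_translate unfolding cc_def smooth_on_def by blast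
qed

text \<open>Taylor's formula with Lagrange remainder at t and -t, added. In this form the quotient
  is both bounded by the second derivative and convergent to it as t tends to 0.\<close>

lemma second_difference:
  fixes \<phi> :: "'a::euclidean_space \<Rightarrow> real"
  assumes s: "smooth_on UNIV \<phi>" and b: "b \<in> Basis" and t: "t > 0"
  shows "\<exists>\<xi> \<xi>'. \<bar>\<xi>\<bar> \<le> t \<and> \<bar>\<xi>'\<bar> \<le> t \<and> (\<phi> (z + t *\<^sub>R b) + \<phi> (z - t *\<^sub>R b) - 2 * \<phi> z) / t\<^sup>2
     = (pd b (pd b \<phi>) (z + \<xi> *\<^sub>R b) + pd b (pd b \<phi>) (z + \<xi>' *\<^sub>R b)) / 2"
proof -
  define g where "g = (\<lambda>m s. ((pd b ^^ m) \<phi>) (z + s *\<^sub>R b))"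
  have sm: "smooth_on UNIV ((pd b ^^ m) \<phi>)" for m by (induction m) (auto intro: s smooth_on_pd b)
  have d: "\<forall>m x. (g m has_real_derivative g (Suc m) x) (at x)"
    using has_derivative_line[OF sm] by (auto simp: g_def)
  have T: "\<exists>\<xi>. \<bar>\<xi>\<bar> \<le> \<bar>x\<bar> \<and> g 0 x = g 0 0 + g 1 0 * x + g 2 \<xi> / 2 * x\<^sup>2" for x
    using Maclaurin_all_le[of g "g 0", OF refl d, of x 2] by (auto simp: numeral_2_eq_2)
  obtain \<xi> \<xi>' where "\<bar>\<xi>\<bar> \<le> \<bar>t\<bar>" "g 0 t = g 0 0 + g 1 0 * t + g 2 \<xi> / 2 * t\<^sup>2"
    "\<bar>\<xi>'\<bar> \<le> \<bar>-t\<bar>" "g 0 (-t) = g 0 0 + g 1 0 * (-t) + g 2 \<xi>' / 2 * (-t)\<^sup>2"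
    using T[of t] T[of "-t"] by blast
  then show ?thesis using t
    by (intro exI[of _ \<xi>] exI[of _ \<xi>']) (simp add: g_def numeral_2_eq_2 field_simps power2_eq_square)
qed

text \<open>
  For a test function \<open>\<phi>\<close>, the function \<open>G x = \<integral> u y \<phi> (y - x) dy\<close> satisfies \<open>G = c \<Delta>G\<close> and vanishes at
  infinity, so it has no positive maximum.
\<close>

theorem free_uniqueness:
  fixes u :: "'a::euclidean_space \<Rightarrow> real"
  assumes u: "sqi u" and c: "c > 0"
    and eq: "\<And>\<phi>. cc \<phi> \<Longrightarrow> (\<integral>x. u x * (\<phi> x - c * lap \<phi> x) \<partial>lborel) = 0"
  shows "AE x in lborel. u x = 0"
proof (rule fundamental_lemma[OF sqi_locint[OF u]])
  have [measurable]: "u \<in> borel_measurable borel" by (rule sqi_measurable[OF u])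
  have le0: "(\<integral>y. u y * \<phi> y \<partial>lborel) \<le> 0" if \<phi>: "cc \<phi>" for \<phi>
  proof (rule ccontr)
    define G where "G = (\<lambda>x. \<integral>y. u y * \<phi> (y - x) \<partial>lborel)"
    assume "\<not> ?thesis"
    then have G0: "G 0 > 0" by (simp add: G_def)
    note [measurable] = cc_measurable[OF \<phi>]
    obtain R where R: "R > 0" "\<And>x. norm x > R \<Longrightarrow> \<phi> x = 0" using ccE[OF \<phi>] by blast
    obtain M where M: "\<And>x. \<bar>\<phi> x\<bar> \<le> M" using cc_bounded[OF \<phi>] by blast
    have M0: "M \<ge> 0" using M[of 0] by linarith
    have int: "integrable lborel (\<lambda>y. u y * \<phi> (y - x))" for x
      using locint_cc_mult[OF sqi_locint[OF u] cc_translate[OF \<phi>]] by (simp add: mult.commute)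
    have cont: "continuous_on UNIV G"
      unfolding continuous_on_eq_continuous_at[OF open_UNIV]
    proof (rule ballI, rule continuous_at_sequentiallyI)
      fix x0 and X :: "nat \<Rightarrow> 'a" assume X: "X \<longlonglongrightarrow> x0"
      obtain S where S: "\<And>n. norm (X n) \<le> S"
        using convergent_imp_bounded[OF X] unfolding bounded_iff by blast
      show "(\<lambda>n. G (X n)) \<longlonglongrightarrow> G x0"
        unfolding G_def
      proof (rule integral_dominated_convergence[where w = "\<lambda>y. M * norm (indicator (cball 0 (R + S)) y * u y)"])
        show "integrable lborel (\<lambda>y. M * norm (indicator (cball 0 (R + S)) y * u y))"
          using sqi_locint[OF u] by (auto simp: locint_def)
        have "isCont \<phi> z" for z using cc_continuous[OF \<phi>] continuous_on_eq_continuous_at by blast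
        then show "AE y in lborel. (\<lambda>n. u y * \<phi> (y - X n)) \<longlonglongrightarrow> u y * \<phi> (y - x0)"
          by (intro AE_I2 tendsto_intros isCont_tendsto_compose[of _ \<phi>] X)
        show "AE y in lborel. norm (u y * \<phi> (y - X n)) \<le> M * norm (indicator (cball 0 (R + S)) y * u y)" for n
        proof (rule AE_I2)
          fix y show "norm (u y * \<phi> (y - X n)) \<le> M * norm (indicator (cball 0 (R + S)) y * u y)"
          proof (cases "norm y > R + S")
            case True
            then have "norm (y - X n) > R" using S[of n] norm_triangle_ineq2[of y "X n"] by linarith
            then show ?thesis using R M0 by simp
          next
            case False
            then show ?thesis using mult_right_mono[OF M[of "y - X n"], of "\<bar>u y\<bar>"] by (simp add: abs_mult mult.commute)
          qed
        qed
      qed auto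
    qed
    \<comment> \<open>Decay of G: far out, the translate of \<phi> meets only the tail of u, so
      Cauchy-Schwarz bounds G by the norm of that tail. With continuity, a positive value at 0
      forces a global maximum to be attained.\<close>
    have tail: "(\<lambda>n. N2 (\<lambda>y. indicator {y. norm y > real n} y * u y)) \<longlonglongrightarrow> 0"
    proof -
      have "(\<lambda>n. N2 (\<lambda>y. indicator {y. norm y > real n} y * u y)) \<longlonglongrightarrow> integral\<^sup>L lborel (\<lambda>y::'a. 0)"
        unfolding N2_def
      proof (rule integral_dominated_convergence[where w = "\<lambda>y. (norm (u y))\<^sup>2"])
        show "AE y in lborel. (\<lambda>n. (norm (indicator {y. norm y > real n} y * u y))\<^sup>2) \<longlonglongrightarrow> 0"
        proof (rule AE_I2, rule tendsto_eventually)
          fix y :: 'a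
          obtain N where "norm y \<le> real N" using real_arch_simple by blast
          then show "\<forall>\<^sub>F n in sequentially. (norm (indicator {y. norm y > real n} y * u y))\<^sup>2 = 0"
            unfolding eventually_sequentially by (intro exI[of _ N]) (auto simp: indicator_def)
        qed
      qed (use sqi_integrable[OF u] in \<open>auto simp: indicator_def\<close>)
      then show ?thesis by simp
    qed
    have sT: "sqi (\<lambda>y. indicator {y. norm y > r} y * u y)" for r
      by (rule sqi_bound(1)[OF u, of _ 1]) (auto simp: indicator_def)
    have "(\<lambda>n. sqrt (N2 (\<lambda>y. indicator {y. norm y > real n} y * u y)) * sqrt (N2 \<phi>)) \<longlonglongrightarrow> sqrt 0 * sqrt (N2 \<phi>)"
      by (intro tendsto_mult tendsto_const tendsto_real_sqrt tail)
    then have "\<forall>\<^sub>F n in sequentially. sqrt (N2 (\<lambda>y. indicator {y. norm y > real n} y * u y)) * sqrt (N2 \<phi>) < G 0"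
      using G0 by (intro order_tendstoD(2)) auto
    then obtain n where n: "sqrt (N2 (\<lambda>y. indicator {y. norm y > real n} y * u y)) * sqrt (N2 \<phi>) < G 0"
      unfolding eventually_sequentially by blast
    have decay: "G x < G 0" if x: "norm x > R + real n" for x
    proof -
      have N2t: "N2 (\<lambda>y. \<phi> (y - x)) = N2 \<phi>"
        unfolding N2_def using integral_lborel_translate[of "\<lambda>y. (norm (\<phi> y))\<^sup>2" "- x"] by simp
      have "G x = (\<integral>y. (indicator {y. norm y > real n} y * u y) \<bullet> \<phi> (y - x) \<partial>lborel)"
        unfolding G_def
      proof (rule Bochner_Integration.integral_cong[OF refl])
        fix y
        show "u y * \<phi> (y - x) = (indicator {y. norm y > real n} y * u y) \<bullet> \<phi> (y - x)"
        proof (cases "norm y > real n")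
          case False
          then have "norm (y - x) > R" using x norm_triangle_ineq2[of x y] by (simp add: norm_minus_commute)
          then show ?thesis using R by simp
        qed simp
      qed
      also have "\<dots> \<le> sqrt (N2 (\<lambda>y. indicator {y. norm y > real n} y * u y)) * sqrt (N2 \<phi>)"
        using cauchy_schwarz_sqi[OF sT[of "real n"] sqi_cc[OF cc_translate[OF \<phi>, of x]]] unfolding N2t by linarith
      finally show ?thesis using n by linarith
    qed
    have "\<exists>x0\<in>cball 0 (R + real n). \<forall>y\<in>cball 0 (R + real n). G y \<le> G x0"
      using R(1) by (intro continuous_attains_sup continuous_on_subset[OF cont]) auto
    then obtain x0 where "\<forall>y\<in>cball 0 (R + real n). G y \<le> G x0" by blast
    then have x0: "\<And>x. norm x \<le> R + real n \<Longrightarrow> G x \<le> G x0" by simp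
    have max: "G x \<le> G x0" for x
      using x0[of x] x0[of 0] decay[of x] R(1) by fastforce
    have G0': "G x0 > 0" using max[of 0] G0 by linarith
    define \<psi> where "\<psi> = (\<lambda>y. \<phi> (y - x0))"
    have \<psi>: "cc \<psi>" unfolding \<psi>_def by (rule cc_translate[OF \<phi>])
    note s\<psi> = cc_smooth[OF \<psi>]
    \<comment> \<open>The second derivative test at the maximum \<open>x0\<close>. The second
      difference of G is written as an integral of u against second differences of \<psi>, so that u
      is never differentiated.\<close>
    have sec: "(\<integral>y. u y * pd b (pd b \<psi>) y \<partial>lborel) \<le> 0" if b: "b \<in> Basis" for b
    proof -
      have cc2: "cc (pd b (pd b \<psi>))" using \<psi> b by (intro cc_pd)
      obtain S where S: "S > 0" "\<And>x. norm x > S \<Longrightarrow> \<psi> x = 0" using ccE[OF \<psi>] by blast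
      obtain K where K: "\<And>x. \<bar>pd b (pd b \<psi>) x\<bar> \<le> K" using cc_bounded[OF cc2] by blast
      have K0: "K \<ge> 0" using K[of 0] by linarith
      note [measurable] = cc_measurable[OF \<psi>] cc_measurable[OF cc2]
      define t where "t = (\<lambda>n. 1 / real (Suc n))"
      have t: "0 < t n" "t n \<le> 1" for n by (auto simp: t_def field_simps)
      have t0: "t \<longlonglongrightarrow> 0" unfolding t_def using LIMSEQ_inverse_real_of_nat by (simp add: inverse_eq_divide)
      define H where "H = (\<lambda>n y. (\<psi> (y + t n *\<^sub>R b) + \<psi> (y - t n *\<^sub>R b) - 2 * \<psi> y) / (t n)\<^sup>2)"
      have "\<forall>n y. \<exists>\<xi> \<xi>'. \<bar>\<xi>\<bar> \<le> t n \<and> \<bar>\<xi>'\<bar> \<le> t n \<and> H n y = (pd b (pd b \<psi>) (y + \<xi> *\<^sub>R b) + pd b (pd b \<psi>) (y + \<xi>' *\<^sub>R b)) / 2"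
        using second_difference[OF s\<psi> b t(1)] unfolding H_def by blast
      then obtain \<xi> \<xi>' where \<xi>: "\<And>n y. \<bar>\<xi> n y\<bar> \<le> t n" "\<And>n y. \<bar>\<xi>' n y\<bar> \<le> t n"
        "\<And>n y. H n y = (pd b (pd b \<psi>) (y + \<xi> n y *\<^sub>R b) + pd b (pd b \<psi>) (y + \<xi>' n y *\<^sub>R b)) / 2" by metis
      have "(\<lambda>n. \<integral>y. u y * H n y \<partial>lborel) \<longlonglongrightarrow> (\<integral>y. u y * pd b (pd b \<psi>) y \<partial>lborel)"
      proof (rule integral_dominated_convergence[where w = "\<lambda>y. K * norm (indicator (cball 0 (S + 1)) y * u y)"])
        show "integrable lborel (\<lambda>y. K * norm (indicator (cball 0 (S + 1)) y * u y))"
          using sqi_locint[OF u] by (auto simp: locint_def)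
        show "AE y in lborel. (\<lambda>n. u y * H n y) \<longlonglongrightarrow> u y * pd b (pd b \<psi>) y"
        proof (rule AE_I2)
          fix y
          have l: "(\<lambda>n. y + \<xi> n y *\<^sub>R b) \<longlonglongrightarrow> y + 0 *\<^sub>R b" "(\<lambda>n. y + \<xi>' n y *\<^sub>R b) \<longlonglongrightarrow> y + 0 *\<^sub>R b"
            by (intro tendsto_intros Lim_null_comparison[OF _ t0] always_eventually allI; simp add: \<xi>)+
          have ic: "isCont (pd b (pd b \<psi>)) z" for z using cc_continuous[OF cc2] continuous_on_eq_continuous_at by blast
          have "(\<lambda>n. H n y) \<longlonglongrightarrow> (pd b (pd b \<psi>) (y + 0 *\<^sub>R b) + pd b (pd b \<psi>) (y + 0 *\<^sub>R b)) / 2"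
            unfolding \<xi>(3) by (intro tendsto_intros isCont_tendsto_compose[OF ic] l) simp
          then show "(\<lambda>n. u y * H n y) \<longlonglongrightarrow> u y * pd b (pd b \<psi>) y" by (intro tendsto_intros) simp
        qed
        show "AE y in lborel. norm (u y * H n y) \<le> K * norm (indicator (cball 0 (S + 1)) y * u y)" for n
        proof (rule AE_I2)
          fix y show "norm (u y * H n y) \<le> K * norm (indicator (cball 0 (S + 1)) y * u y)"
          proof (cases "norm y > S + 1")
            case True
            have "norm (t n *\<^sub>R b) \<le> 1" using t[of n] b by simp
            then have "norm (y + t n *\<^sub>R b) > S" "norm (y - t n *\<^sub>R b) > S" "norm y > S"
              using True norm_triangle_ineq2[of y "t n *\<^sub>R b"] norm_diff_ineq[of y "t n *\<^sub>R b"] by linarith+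
            then show ?thesis using S(2) K0 by (simp add: H_def)
          next
            case False
            have "\<bar>H n y\<bar> \<le> K" using K[of "y + \<xi> n y *\<^sub>R b"] K[of "y + \<xi>' n y *\<^sub>R b"] unfolding \<xi>(3) by (auto simp: abs_le_iff)
            then show ?thesis using False mult_right_mono[of "\<bar>H n y\<bar>" K "\<bar>u y\<bar>"] by (simp add: abs_mult mult.commute)
          qed
        qed
      qed (auto simp: H_def)
      moreover have "(\<integral>y. u y * H n y \<partial>lborel) \<le> 0" for n
      proof -
        have "(\<integral>y. u y * H n y \<partial>lborel) = (\<integral>y. ((u y * \<phi> (y - (x0 - t n *\<^sub>R b)) + u y * \<phi> (y - (x0 + t n *\<^sub>R b))) - 2 * (u y * \<phi> (y - x0))) / (t n)\<^sup>2 \<partial>lborel)"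
          unfolding H_def \<psi>_def by (intro Bochner_Integration.integral_cong refl) (simp add: algebra_simps add_divide_distrib diff_divide_distrib)
        also have "\<dots> = (G (x0 - t n *\<^sub>R b) + G (x0 + t n *\<^sub>R b) - 2 * G x0) / (t n)\<^sup>2"
          unfolding G_def using int by simp
        also have "\<dots> \<le> 0" using max[of "x0 - t n *\<^sub>R b"] max[of "x0 + t n *\<^sub>R b"] by (intro divide_nonpos_nonneg) auto
        finally show ?thesis .
      qed
      ultimately show ?thesis by (intro LIMSEQ_le_const2) auto
    qed
    have iL: "integrable lborel (\<lambda>y. u y * lap \<psi> y)" and i\<psi>: "integrable lborel (\<lambda>y. u y * \<psi> y)"
      using locint_cc_mult[OF sqi_locint[OF u] cc_lap[OF \<psi>]] locint_cc_mult[OF sqi_locint[OF u] \<psi>]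
      by (simp_all add: mult.commute)
    have "(\<integral>y. u y * lap \<psi> y \<partial>lborel) = (\<Sum>b\<in>Basis. \<integral>y. u y * pd b (pd b \<psi>) y \<partial>lborel)"
      unfolding lap_def sum_distrib_left
      using locint_cc_mult[OF sqi_locint[OF u] cc_pd[OF cc_pd[OF \<psi>]]]
      by (intro Bochner_Integration.integral_sum) (simp add: mult.commute)
    also have "\<dots> \<le> 0" by (intro sum_nonpos sec)
    finally have "(\<integral>y. u y * lap \<psi> y \<partial>lborel) \<le> 0" .
    moreover have "(\<integral>y. u y * (\<psi> y - c * lap \<psi> y) \<partial>lborel) = (\<integral>y. u y * \<psi> y \<partial>lborel) - c * (\<integral>y. u y * lap \<psi> y \<partial>lborel)"
    proof -
      have "(\<integral>y. u y * (\<psi> y - c * lap \<psi> y) \<partial>lborel) = (\<integral>y. u y * \<psi> y - c * (u y * lap \<psi> y) \<partial>lborel)"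
        by (simp add: algebra_simps)
      then show ?thesis using iL i\<psi> by simp
    qed
    \<comment> \<open>The integrated form of G x0 = c lap G x0 <= 0, against G x0 > 0.\<close>
    ultimately have "(\<integral>y. u y * \<psi> y \<partial>lborel) \<le> 0"
      using eq[OF \<psi>] c by (simp add: mult_nonneg_nonpos)
    then show False using G0' by (simp add: G_def \<psi>_def)
  qed
  fix \<phi> :: "'a \<Rightarrow> real" assume "cc \<phi>"
  then have "(\<integral>y. u y * \<phi> y \<partial>lborel) \<le> 0" "(\<integral>y. u y * - \<phi> y \<partial>lborel) \<le> 0" using le0 cc_minus by blast+
  then show "(\<integral>y. \<phi> y * u y \<partial>lborel) = 0" by (simp add: mult.commute)
qed

section \<open>Solvability of the equation with complex spectral parameter\<close>

definition ccC :: "('a::euclidean_space \<Rightarrow> complex) \<Rightarrow> bool" where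
  "ccC u \<longleftrightarrow> cc (\<lambda>x. Re (u x)) \<and> cc (\<lambda>x. Im (u x))"

definition opr :: "real \<Rightarrow> ('a::euclidean_space \<Rightarrow> real) \<Rightarrow> ('a \<Rightarrow> real) \<Rightarrow> 'a \<Rightarrow> real" where
  "opr h p \<phi> x = - (h\<^sup>2) * lap \<phi> x + p x * \<phi> x"

text \<open>
  \<open>QQ h p \<tau> u\<close> is \<open>(- h\<^sup>2 \<Delta> + p + i\<tau>) u\<close>, and \<open>vw h p \<tau> u f\<close> says that it equals \<open>f\<close> in the sense of
  distributions; both are split into real and imaginary parts.
\<close>

definition QQ :: "real \<Rightarrow> ('a::euclidean_space \<Rightarrow> real) \<Rightarrow> real \<Rightarrow> ('a \<Rightarrow> complex) \<Rightarrow> 'a \<Rightarrow> complex" where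
  "QQ h p \<tau> u x = Complex (opr h p (\<lambda>x. Re (u x)) x - \<tau> * Im (u x)) (opr h p (\<lambda>x. Im (u x)) x + \<tau> * Re (u x))"

definition vw :: "real \<Rightarrow> ('a::euclidean_space \<Rightarrow> real) \<Rightarrow> real \<Rightarrow> ('a \<Rightarrow> complex) \<Rightarrow> ('a \<Rightarrow> complex) \<Rightarrow> bool" where
  "vw h p \<tau> u f \<longleftrightarrow> (\<forall>\<phi>. cc \<phi> \<longrightarrow>
     (\<integral>x. Re (u x) * opr h p \<phi> x \<partial>lborel) - \<tau> * (\<integral>x. Im (u x) * \<phi> x \<partial>lborel) = (\<integral>x. Re (f x) * \<phi> x \<partial>lborel) \<and>
     (\<integral>x. Im (u x) * opr h p \<phi> x \<partial>lborel) + \<tau> * (\<integral>x. Re (u x) * \<phi> x \<partial>lborel) = (\<integral>x. Im (f x) * \<phi> x \<partial>lborel))"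

definition bdd_meas :: "('a::euclidean_space \<Rightarrow> real) \<Rightarrow> bool" where
  "bdd_meas p \<longleftrightarrow> p \<in> borel_measurable borel \<and> (\<exists>M. AE x in lborel. \<bar>p x\<bar> \<le> M)"

lemma bdd_meas_sqi: "bdd_meas p \<Longrightarrow> sqi f \<Longrightarrow> sqi (\<lambda>x. p x *\<^sub>R f x)"
  unfolding bdd_meas_def using sqi_bdd_scaleR by blast
lemma bdd_meas_lim2: "bdd_meas p \<Longrightarrow> lim2 F f \<Longrightarrow> lim2 (\<lambda>n x. p x *\<^sub>R F n x) (\<lambda>x. p x *\<^sub>R f x)"
  unfolding bdd_meas_def using lim2_bdd_scaleR by blast
lemma bdd_meas_const: "bdd_meas (\<lambda>x. c)"
  unfolding bdd_meas_def by (auto intro!: exI[of _ "\<bar>c\<bar>"])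
lemma bdd_meas_diff: "bdd_meas p \<Longrightarrow> bdd_meas q \<Longrightarrow> bdd_meas (\<lambda>x. p x - q x)"
proof -
  assume a: "bdd_meas p" "bdd_meas q"
  then obtain M N where M: "AE x in lborel. \<bar>p x\<bar> \<le> M" "AE x in lborel. \<bar>q x\<bar> \<le> N" by (auto simp: bdd_meas_def)
  have "AE x in lborel. \<bar>p x - q x\<bar> \<le> M + N" using M by eventually_elim linarith
  then show ?thesis using a by (auto simp: bdd_meas_def)
qed

lemma sqi_Re: "sqi u \<Longrightarrow> sqi (\<lambda>x. Re (u x))" and sqi_Im: "sqi u \<Longrightarrow> sqi (\<lambda>x. Im (u x))"
proof -
  assume u: "sqi u"
  note [measurable] = sqi_measurable[OF u]
  show "sqi (\<lambda>x. Re (u x))" by (rule sqi_bound(1)[OF u, of _ 1]) (auto simp: abs_Re_le_cmod)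
  show "sqi (\<lambda>x. Im (u x))" by (rule sqi_bound(1)[OF u, of _ 1]) (auto simp: abs_Im_le_cmod)
qed

lemma Complex_measurable [measurable]:
  assumes [measurable]: "a \<in> borel_measurable M" "b \<in> borel_measurable M"
  shows "(\<lambda>x. Complex (a x) (b x)) \<in> borel_measurable M"
  unfolding Complex_eq by measurable

lemma sqi_Complex: "sqi a \<Longrightarrow> sqi b \<Longrightarrow> sqi (\<lambda>x. Complex (a x) (b x))"
proof -
  assume a: "sqi a" "sqi b"
  note [measurable] = a[THEN sqi_measurable]
  have "integrable lborel (\<lambda>x. (a x)\<^sup>2 + (b x)\<^sup>2)"
    using sqi_integrable[OF a(1)] sqi_integrable[OF a(2)] by simp
  then show ?thesis by (simp add: sqi_def cmod_power2)
qed

lemma N2_Re_Im: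
  assumes "sqi u"
  shows "N2 u = N2 (\<lambda>x. Re (u x)) + N2 (\<lambda>x. Im (u x))"
  unfolding N2_def cmod_power2
  using sqi_integrable[OF sqi_Re[OF assms]] sqi_integrable[OF sqi_Im[OF assms]] by simp

lemma lim2_Re: "lim2 F f \<Longrightarrow> lim2 (\<lambda>n x. Re (F n x)) (\<lambda>x. Re (f x))"
proof -
  assume F: "lim2 F f"
  note s = lim2D(1,2)[OF F]
  show ?thesis
    by (rule lim2_bound[OF F, of _ _ 1])
      (use s sqi_Re sqi_measurable abs_Re_le_cmod[of "F n x - f x" for n x] in \<open>auto\<close>)
qed

lemma lim2_Im: "lim2 F f \<Longrightarrow> lim2 (\<lambda>n x. Im (F n x)) (\<lambda>x. Im (f x))"
proof -
  assume F: "lim2 F f"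
  note s = lim2D(1,2)[OF F]
  show ?thesis
    by (rule lim2_bound[OF F, of _ _ 1])
      (use s sqi_Im sqi_measurable abs_Im_le_cmod[of "F n x - f x" for n x] in \<open>auto\<close>)
qed

lemma lim2_Complex:
  assumes "lim2 A a" "lim2 B b"
  shows "lim2 (\<lambda>n x. Complex (A n x) (B n x)) (\<lambda>x. Complex (a x) (b x))"
proof -
  note s = lim2D(1,2)[OF assms(1)] lim2D(1,2)[OF assms(2)]
  have "N2 (\<lambda>x. Complex (A n x) (B n x) - Complex (a x) (b x)) = N2 (\<lambda>x. A n x - a x) + N2 (\<lambda>x. B n x - b x)" for n
    using N2_Re_Im[OF sqi_diff[OF sqi_Complex[OF s(1) s(3)] sqi_Complex[OF s(2) s(4)]], of n n] by simp
  then show ?thesis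
    using tendsto_add[OF lim2D(3)[OF assms(1)] lim2D(3)[OF assms(2)]] s by (simp add: lim2_def sqi_Complex)
qed

lemma lap_lincomb:
  assumes "cc f" "cc g"
  shows "lap (\<lambda>x. a * f x + b * g x) x = a * lap f x + b * lap g x"
proof -
  note s = assms[THEN cc_smooth]
  note s' = smooth_on_mult[OF open_UNIV smooth_on_const[OF open_UNIV] s(1)] smooth_on_mult[OF open_UNIV smooth_on_const[OF open_UNIV] s(2)]
  have 1: "pd i (\<lambda>x. a * f x + b * g x) = (\<lambda>x. a * pd i f x + b * pd i g x)" for i
    by (rule ext) (simp add: pd_smooth_add[OF s'] pd_smooth_cmult[OF s(1,1)] pd_smooth_cmult[OF s(2,2)])
  have "pd i (\<lambda>x. a * pd i f x + b * pd i g x) x = a * pd i (pd i f) x + b * pd i (pd i g) x" if "i \<in> Basis" for i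
  proof -
    note t = s[THEN smooth_on_pd[OF _ that]]
    note t' = smooth_on_mult[OF open_UNIV smooth_on_const[OF open_UNIV] t(1)] smooth_on_mult[OF open_UNIV smooth_on_const[OF open_UNIV] t(2)]
    show ?thesis by (simp add: pd_smooth_add[OF t'] pd_smooth_cmult[OF t(1,1)] pd_smooth_cmult[OF t(2,2)])
  qed
  then show ?thesis by (simp add: lap_def 1 sum.distrib sum_distrib_left)
qed

lemma opr_lincomb: "cc f \<Longrightarrow> cc g \<Longrightarrow> opr h p (\<lambda>x. a * f x + b * g x) x = a * opr h p f x + b * opr h p g x"
  by (simp add: opr_def lap_lincomb algebra_simps)

lemma ccC_lincomb: "ccC u \<Longrightarrow> ccC v \<Longrightarrow> ccC (\<lambda>x. a *\<^sub>R u x + b *\<^sub>R v x)"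
  unfolding ccC_def by (auto intro: cc_add cc_cmult)

lemma QQ_lincomb: "ccC u \<Longrightarrow> ccC v \<Longrightarrow> QQ h p \<tau> (\<lambda>x. a *\<^sub>R u x + b *\<^sub>R v x) x = a *\<^sub>R QQ h p \<tau> u x + b *\<^sub>R QQ h p \<tau> v x"
  by (simp add: QQ_def complex_eq_iff opr_lincomb ccC_def algebra_simps)

lemma ccC_Complex: "cc a \<Longrightarrow> cc b \<Longrightarrow> ccC (\<lambda>x. Complex (a x) (b x))"
  by (simp add: ccC_def)

lemma sqi_opr: "bdd_meas p \<Longrightarrow> cc \<phi> \<Longrightarrow> sqi (opr h p \<phi>)"
proof -
  assume a: "bdd_meas p" "cc \<phi>"
  have "sqi (\<lambda>x. - (h\<^sup>2) * lap \<phi> x + p x * \<phi> x)"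
    using sqi_add[OF sqi_cmult[OF sqi_cc[OF cc_lap[OF a(2)]], of "- (h\<^sup>2)"] bdd_meas_sqi[OF a(1) sqi_cc[OF a(2)]]]
    unfolding real_scaleR_def .
  then show ?thesis by (simp add: opr_def[abs_def])
qed

lemma sqi_ccC: "ccC u \<Longrightarrow> sqi u"
  using sqi_Complex[OF sqi_cc sqi_cc, of "\<lambda>x. Re (u x)" "\<lambda>x. Im (u x)"] by (simp add: ccC_def)

lemma sqi_QQ: "bdd_meas p \<Longrightarrow> ccC u \<Longrightarrow> sqi (QQ h p \<tau> u)"
proof -
  assume a: "bdd_meas p" "ccC u"
  then have "sqi (\<lambda>x. Complex (opr h p (\<lambda>x. Re (u x)) x - \<tau> * Im (u x)) (opr h p (\<lambda>x. Im (u x)) x + \<tau> * Re (u x)))"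
    by (intro sqi_Complex sqi_add sqi_diff sqi_opr sqi_cmult sqi_cc) (auto simp: ccC_def)
  then show ?thesis by (simp add: QQ_def[abs_def])
qed

lemma sqi_mult_integrable: "sqi f \<Longrightarrow> sqi g \<Longrightarrow> integrable lborel (\<lambda>x. f x * g x)"
  for f g :: "'a::euclidean_space \<Rightarrow> real"
  using sqi_inner_integrable[of f g] by simp

lemma lim2_integral_mult:
  fixes F G :: "nat \<Rightarrow> 'a::euclidean_space \<Rightarrow> real"
  assumes "lim2 F f" "lim2 G g"
  shows "(\<lambda>n. \<integral>x. F n x * G n x \<partial>lborel) \<longlonglongrightarrow> (\<integral>x. f x * g x \<partial>lborel)"
  using lim2_integral_inner[OF assms] by simp

lemma lap_symmetric: "cc a \<Longrightarrow> cc b \<Longrightarrow> (\<integral>x. a x * lap b x \<partial>lborel) = (\<integral>x. lap a x * b x \<partial>lborel)"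
  using integral_lap_mult[OF cc_smooth, of a b] integral_lap_mult[OF cc_smooth, of b a]
  by (simp add: mult.commute)

lemma opr_symmetric:
  assumes p: "bdd_meas p" and ab: "cc a" "cc b"
  shows "(\<integral>x. a x * opr h p b x \<partial>lborel) = (\<integral>x. opr h p a x * b x \<partial>lborel)"
proof -
  have i: "integrable lborel (\<lambda>x. a x * lap b x)" "integrable lborel (\<lambda>x. lap a x * b x)"
    "integrable lborel (\<lambda>x. p x * a x * b x)"
    using ab bdd_meas_sqi[OF p sqi_cc[OF ab(1)]] by (auto intro!: sqi_mult_integrable sqi_cc cc_lap)
  have "(\<integral>x. a x * opr h p b x \<partial>lborel) = (\<integral>x. - (h\<^sup>2) * (a x * lap b x) + p x * a x * b x \<partial>lborel)"
    by (simp add: opr_def algebra_simps)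
  also have "\<dots> = - (h\<^sup>2) * (\<integral>x. lap a x * b x \<partial>lborel) + (\<integral>x. p x * a x * b x \<partial>lborel)"
    using i by (simp add: lap_symmetric[OF ab])
  also have "\<dots> = (\<integral>x. - (h\<^sup>2) * (lap a x * b x) + p x * a x * b x \<partial>lborel)" using i by simp
  also have "\<dots> = (\<integral>x. opr h p a x * b x \<partial>lborel)" by (simp add: opr_def algebra_simps)
  finally show ?thesis .
qed

lemma vw_ccC:
  assumes p: "bdd_meas p" and u: "ccC u"
  shows "vw h p \<tau> u (QQ h p \<tau> u)"
  unfolding vw_def
proof (intro allI impI)
  fix \<phi> :: "'a \<Rightarrow> real" assume \<phi>: "cc \<phi>"
  have c: "cc (\<lambda>x. Re (u x))" "cc (\<lambda>x. Im (u x))" using u by (auto simp: ccC_def)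
  have i: "integrable lborel (\<lambda>x. opr h p (\<lambda>x. Re (u x)) x * \<phi> x)" "integrable lborel (\<lambda>x. opr h p (\<lambda>x. Im (u x)) x * \<phi> x)"
    "integrable lborel (\<lambda>x. Re (u x) * \<phi> x)" "integrable lborel (\<lambda>x. Im (u x) * \<phi> x)"
    by (intro sqi_mult_integrable sqi_opr sqi_cc c p \<phi>)+
  have "(\<integral>x. Re (QQ h p \<tau> u x) * \<phi> x \<partial>lborel) = (\<integral>x. opr h p (\<lambda>x. Re (u x)) x * \<phi> x - \<tau> * (Im (u x) * \<phi> x) \<partial>lborel)"
    "(\<integral>x. Im (QQ h p \<tau> u x) * \<phi> x \<partial>lborel) = (\<integral>x. opr h p (\<lambda>x. Im (u x)) x * \<phi> x + \<tau> * (Re (u x) * \<phi> x) \<partial>lborel)"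
    by (simp_all add: QQ_def algebra_simps)
  then show "(\<integral>x. Re (u x) * opr h p \<phi> x \<partial>lborel) - \<tau> * (\<integral>x. Im (u x) * \<phi> x \<partial>lborel) = (\<integral>x. Re (QQ h p \<tau> u x) * \<phi> x \<partial>lborel) \<and>
     (\<integral>x. Im (u x) * opr h p \<phi> x \<partial>lborel) + \<tau> * (\<integral>x. Re (u x) * \<phi> x \<partial>lborel) = (\<integral>x. Im (QQ h p \<tau> u x) * \<phi> x \<partial>lborel)"
    using i by (simp add: opr_symmetric[OF p c(1) \<phi>] opr_symmetric[OF p c(2) \<phi>])
qed

lemma vw_lim:
  assumes p: "bdd_meas p" and u: "lim2 U u" and f: "lim2 F f" and v: "\<And>n. vw h p \<tau> (U n) (F n)"
  shows "vw h p \<tau> u f"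
  unfolding vw_def
proof (intro allI impI conjI)
  fix \<phi> :: "'a \<Rightarrow> real" assume \<phi>: "cc \<phi>"
  note c = lim2_const[OF sqi_cc[OF \<phi>]] lim2_const[OF sqi_opr[OF p \<phi>, of h]]
  have "(\<lambda>n. (\<integral>x. Re (U n x) * opr h p \<phi> x \<partial>lborel) - \<tau> * (\<integral>x. Im (U n x) * \<phi> x \<partial>lborel))
     \<longlonglongrightarrow> (\<integral>x. Re (u x) * opr h p \<phi> x \<partial>lborel) - \<tau> * (\<integral>x. Im (u x) * \<phi> x \<partial>lborel)"
    by (rule tendsto_diff[OF lim2_integral_mult[OF lim2_Re[OF u] c(2)]
        tendsto_mult[OF tendsto_const lim2_integral_mult[OF lim2_Im[OF u] c(1)]]])
  moreover have "(\<lambda>n. (\<integral>x. Re (F n x) * \<phi> x \<partial>lborel)) \<longlonglongrightarrow> (\<integral>x. Re (f x) * \<phi> x \<partial>lborel)"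
    by (rule lim2_integral_mult[OF lim2_Re[OF f] c(1)])
  ultimately show "(\<integral>x. Re (u x) * opr h p \<phi> x \<partial>lborel) - \<tau> * (\<integral>x. Im (u x) * \<phi> x \<partial>lborel) = (\<integral>x. Re (f x) * \<phi> x \<partial>lborel)"
    using v \<phi> LIMSEQ_unique unfolding vw_def by force
  have "(\<lambda>n. (\<integral>x. Im (U n x) * opr h p \<phi> x \<partial>lborel) + \<tau> * (\<integral>x. Re (U n x) * \<phi> x \<partial>lborel))
     \<longlonglongrightarrow> (\<integral>x. Im (u x) * opr h p \<phi> x \<partial>lborel) + \<tau> * (\<integral>x. Re (u x) * \<phi> x \<partial>lborel)"
    by (rule tendsto_add[OF lim2_integral_mult[OF lim2_Im[OF u] c(2)]
        tendsto_mult[OF tendsto_const lim2_integral_mult[OF lim2_Re[OF u] c(1)]]])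
  moreover have "(\<lambda>n. (\<integral>x. Im (F n x) * \<phi> x \<partial>lborel)) \<longlonglongrightarrow> (\<integral>x. Im (f x) * \<phi> x \<partial>lborel)"
    by (rule lim2_integral_mult[OF lim2_Im[OF f] c(1)])
  ultimately show "(\<integral>x. Im (u x) * opr h p \<phi> x \<partial>lborel) + \<tau> * (\<integral>x. Re (u x) * \<phi> x \<partial>lborel) = (\<integral>x. Im (f x) * \<phi> x \<partial>lborel)"
    using v \<phi> LIMSEQ_unique unfolding vw_def by force
qed

lemma vw_diff:
  assumes p: "bdd_meas p" and s: "sqi u" "sqi v" "sqi f" "sqi g" and v: "vw h p \<tau> u f" "vw h p \<tau> v g"
  shows "vw h p \<tau> (\<lambda>x. u x - v x) (\<lambda>x. f x - g x)"
  unfolding vw_def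
proof (intro allI impI)
  fix \<phi> :: "'a \<Rightarrow> real" assume \<phi>: "cc \<phi>"
  note i = sqi_mult_integrable[OF _ sqi_cc[OF \<phi>]] sqi_mult_integrable[OF _ sqi_opr[OF p \<phi>, of h]]
  note r = s[THEN sqi_Re] s[THEN sqi_Im]
  show "(\<integral>x. Re (u x - v x) * opr h p \<phi> x \<partial>lborel) - \<tau> * (\<integral>x. Im (u x - v x) * \<phi> x \<partial>lborel) = (\<integral>x. Re (f x - g x) * \<phi> x \<partial>lborel) \<and>
     (\<integral>x. Im (u x - v x) * opr h p \<phi> x \<partial>lborel) + \<tau> * (\<integral>x. Re (u x - v x) * \<phi> x \<partial>lborel) = (\<integral>x. Im (f x - g x) * \<phi> x \<partial>lborel)"
    using v[unfolded vw_def, rule_format, OF \<phi>] r[THEN i(1)] r[THEN i(2)]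
    by (simp add: left_diff_distrib right_diff_distrib Bochner_Integration.integral_diff)
qed

text \<open>A function orthogonal to the range solves the adjoint homogeneous equation in the sense
  of distributions, with - \<tau> in place of \<tau>. Purely real and purely imaginary test
  functions yield the two components of \<open>vw\<close>.\<close>

lemma QQ_dense:
  fixes f :: "'a::euclidean_space \<Rightarrow> complex"
  assumes p: "bdd_meas p" and uniq: "\<And>g. sqi g \<Longrightarrow> vw h p (- \<tau>) g (\<lambda>x. 0) \<Longrightarrow> AE x in lborel. g x = 0"
    and f: "sqi f"
  shows "\<exists>u. (\<forall>n. ccC (u n)) \<and> lim2 (\<lambda>n. QQ h p \<tau> (u n)) f"
proof -
  let ?S = "QQ h p \<tau> ` Collect ccC"
  have "\<exists>s. (\<forall>n. s n \<in> ?S) \<and> lim2 s f"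
  proof (rule dense_if_orthogonal_trivial[OF _ _ _ _ f])
    show "sqi s" if "s \<in> ?S" for s using that sqi_QQ[OF p] by blast
    have "ccC (\<lambda>x. 0)" by (simp add: ccC_def cc_zero)
    moreover have "QQ h p \<tau> (\<lambda>x. 0) = (\<lambda>x. 0)"
      using QQ_lincomb[OF \<open>ccC (\<lambda>x. 0)\<close> \<open>ccC (\<lambda>x. 0)\<close>, of h p \<tau> 0 0] by (simp add: fun_eq_iff)
    ultimately show "(\<lambda>x. 0) \<in> ?S" by (metis imageI mem_Collect_eq)
    show "(\<lambda>x. a *\<^sub>R s x + b *\<^sub>R t x) \<in> ?S" if st: "s \<in> ?S" "t \<in> ?S" for s t a b
    proof -
      obtain u v where uv: "ccC u" "ccC v" "s = QQ h p \<tau> u" "t = QQ h p \<tau> v" using st by blast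
      then have "(\<lambda>x. a *\<^sub>R s x + b *\<^sub>R t x) = QQ h p \<tau> (\<lambda>x. a *\<^sub>R u x + b *\<^sub>R v x)" by (simp add: QQ_lincomb fun_eq_iff)
      then show ?thesis using ccC_lincomb[OF uv(1,2)] by blast
    qed
    fix g :: "'a \<Rightarrow> complex" assume g: "sqi g" and o: "\<And>s. s \<in> ?S \<Longrightarrow> (\<integral>x. g x \<bullet> s x \<partial>lborel) = 0"
    have "vw h p (- \<tau>) g (\<lambda>x. 0)"
      unfolding vw_def
    proof (intro allI impI conjI)
      fix \<phi> :: "'a \<Rightarrow> real" assume \<phi>: "cc \<phi>"
      note i = sqi_mult_integrable[OF _ sqi_cc[OF \<phi>]] sqi_mult_integrable[OF _ sqi_opr[OF p \<phi>, of h]]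
      note r = sqi_Re[OF g] sqi_Im[OF g]
      have z: "opr h p (\<lambda>x. 0) x = 0" for x using opr_lincomb[OF cc_zero cc_zero, of h p 0 0] by simp
      have "(\<integral>x. g x \<bullet> QQ h p \<tau> (\<lambda>x. Complex (\<phi> x) 0) x \<partial>lborel) = 0"
        using o ccC_Complex[OF \<phi> cc_zero] by blast
      moreover have "(\<integral>x. g x \<bullet> QQ h p \<tau> (\<lambda>x. Complex (\<phi> x) 0) x \<partial>lborel) = (\<integral>x. Re (g x) * opr h p \<phi> x + \<tau> * (Im (g x) * \<phi> x) \<partial>lborel)"
        by (intro Bochner_Integration.integral_cong refl) (simp add: QQ_def inner_complex_def z algebra_simps)
      ultimately show "(\<integral>x. Re (g x) * opr h p \<phi> x \<partial>lborel) - - \<tau> * (\<integral>x. Im (g x) * \<phi> x \<partial>lborel) = (\<integral>x. Re 0 * \<phi> x \<partial>lborel)"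
        using i(2)[OF r(1)] i(1)[OF r(2)] by simp
      have "(\<integral>x. g x \<bullet> QQ h p \<tau> (\<lambda>x. Complex 0 (\<phi> x)) x \<partial>lborel) = 0"
        using o ccC_Complex[OF cc_zero \<phi>] by blast
      moreover have "(\<integral>x. g x \<bullet> QQ h p \<tau> (\<lambda>x. Complex 0 (\<phi> x)) x \<partial>lborel) = (\<integral>x. Im (g x) * opr h p \<phi> x - \<tau> * (Re (g x) * \<phi> x) \<partial>lborel)"
        by (intro Bochner_Integration.integral_cong refl) (simp add: QQ_def inner_complex_def z algebra_simps)
      ultimately show "(\<integral>x. Im (g x) * opr h p \<phi> x \<partial>lborel) + - \<tau> * (\<integral>x. Re (g x) * \<phi> x \<partial>lborel) = (\<integral>x. Im 0 * \<phi> x \<partial>lborel)"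
        using i(2)[OF r(2)] i(1)[OF r(1)] by simp
    qed
    then show "AE x in lborel. g x = 0" by (rule uniq[OF g])
  qed
  then obtain s where s: "\<And>n. s n \<in> ?S" "lim2 s f" by blast
  from s(1) have "\<forall>n. \<exists>u. ccC u \<and> s n = QQ h p \<tau> u" by blast
  then obtain u where u: "\<And>n. ccC (u n)" "\<And>n. s n = QQ h p \<tau> (u n)" by metis
  have "s = (\<lambda>n. QQ h p \<tau> (u n))" using u(2) by blast
  then show ?thesis using s(2) u(1) by blast
qed

text \<open>The integrand is the imaginary part of QQ u times the conjugate of u; the symmetric part
  of the operator cancels in it.\<close>

lemma energy_Im:
  assumes p: "bdd_meas p" and u: "ccC u"
  shows "(\<integral>x. Im (QQ h p \<tau> u x) * Re (u x) - Re (QQ h p \<tau> u x) * Im (u x) \<partial>lborel) = \<tau> * N2 u"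
proof -
  have c: "cc (\<lambda>x. Re (u x))" "cc (\<lambda>x. Im (u x))" using u by (auto simp: ccC_def)
  have i: "integrable lborel (\<lambda>x. Re (u x) * opr h p (\<lambda>x. Im (u x)) x)" "integrable lborel (\<lambda>x. Im (u x) * opr h p (\<lambda>x. Re (u x)) x)"
    by (intro sqi_mult_integrable sqi_opr sqi_cc c p)+
  have "(\<integral>x. Im (QQ h p \<tau> u x) * Re (u x) - Re (QQ h p \<tau> u x) * Im (u x) \<partial>lborel)
    = (\<integral>x. (Re (u x) * opr h p (\<lambda>x. Im (u x)) x - Im (u x) * opr h p (\<lambda>x. Re (u x)) x) + \<tau> * (norm (u x))\<^sup>2 \<partial>lborel)"
    by (intro Bochner_Integration.integral_cong refl) (simp only: cmod_power2, simp add: QQ_def algebra_simps power2_eq_square)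
  also have "\<dots> = (\<integral>x. Re (u x) * opr h p (\<lambda>x. Im (u x)) x \<partial>lborel) - (\<integral>x. Im (u x) * opr h p (\<lambda>x. Re (u x)) x \<partial>lborel) + \<tau> * N2 u"
    using i sqi_integrable[OF sqi_ccC[OF u]] by (simp add: N2_def)
  also have "(\<integral>x. Re (u x) * opr h p (\<lambda>x. Im (u x)) x \<partial>lborel) = (\<integral>x. Im (u x) * opr h p (\<lambda>x. Re (u x)) x \<partial>lborel)"
    using opr_symmetric[OF p c] by (simp add: mult.commute)
  finally show ?thesis by simp
qed

lemma energy_Re:
  assumes p: "bdd_meas p" and u: "ccC u"
  shows "(\<integral>x. QQ h p \<tau> u x \<bullet> u x \<partial>lborel) =
    h\<^sup>2 * (\<Sum>b\<in>Basis. N2 (pd b (\<lambda>x. Re (u x))) + N2 (pd b (\<lambda>x. Im (u x)))) + (\<integral>x. p x * (norm (u x))\<^sup>2 \<partial>lborel)"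
proof -
  have c: "cc (\<lambda>x. Re (u x))" "cc (\<lambda>x. Im (u x))" using u by (auto simp: ccC_def)
  have i: "integrable lborel (\<lambda>x. Re (u x) * lap (\<lambda>x. Re (u x)) x)" "integrable lborel (\<lambda>x. Im (u x) * lap (\<lambda>x. Im (u x)) x)"
    by (intro sqi_mult_integrable sqi_cc cc_lap c)+
  have ip: "integrable lborel (\<lambda>x. p x * (norm (u x))\<^sup>2)"
    using sqi_inner_integrable[OF bdd_meas_sqi[OF p sqi_ccC[OF u]] sqi_ccC[OF u]] by (simp add: power2_norm_eq_inner)
  have "(\<integral>x. QQ h p \<tau> u x \<bullet> u x \<partial>lborel) = (\<integral>x. - (h\<^sup>2) * (Re (u x) * lap (\<lambda>x. Re (u x)) x + Im (u x) * lap (\<lambda>x. Im (u x)) x) + p x * (norm (u x))\<^sup>2 \<partial>lborel)"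
    by (intro Bochner_Integration.integral_cong refl) (simp only: cmod_power2, simp add: QQ_def opr_def inner_complex_def algebra_simps power2_eq_square)
  also have "\<dots> = - (h\<^sup>2) * ((\<integral>x. Re (u x) * lap (\<lambda>x. Re (u x)) x \<partial>lborel) + (\<integral>x. Im (u x) * lap (\<lambda>x. Im (u x)) x \<partial>lborel)) + (\<integral>x. p x * (norm (u x))\<^sup>2 \<partial>lborel)"
    using i ip by simp
  finally show ?thesis
    unfolding integral_lap_mult[OF cc_smooth[OF c(1)] c(1)] integral_lap_mult[OF cc_smooth[OF c(2)] c(2)]
    by (simp add: N2_inner sum.distrib sum_negf algebra_simps)
qed

lemma coercive_free:
  assumes u: "ccC u"
  shows "N2 u \<le> N2 (QQ h (\<lambda>x. 1) 0 u)"
proof -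
  note s = sqi_QQ[OF bdd_meas_const[of 1] u, of h 0] sqi_ccC[OF u]
  have "N2 u \<le> (\<integral>x. QQ h (\<lambda>x. 1) 0 u x \<bullet> u x \<partial>lborel)"
    unfolding energy_Re[OF bdd_meas_const u] by (simp add: N2_def[of u] sum_nonneg)
  also have "\<dots> \<le> sqrt (N2 (QQ h (\<lambda>x. 1) 0 u)) * sqrt (N2 u)"
    using cauchy_schwarz_sqi[OF s] by linarith
  finally have le: "sqrt (N2 u) * sqrt (N2 u) \<le> sqrt (N2 (QQ h (\<lambda>x. 1) 0 u)) * sqrt (N2 u)" by simp
  show ?thesis
  proof (cases "N2 u = 0")
    case False
    then have "0 < sqrt (N2 u)" using N2_nonneg[of u] by (simp add: less_le)
    from mult_right_le_imp_le[OF le this] show ?thesis by simp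
  qed simp
qed

lemma coercive_dissipative:
  assumes p: "bdd_meas p" and u: "ccC u"
  shows "\<tau>\<^sup>2 * N2 u \<le> N2 (QQ h p \<tau> u)"
proof -
  let ?Q = "QQ h p \<tau> u"
  have Q: "sqi ?Q" by (rule sqi_QQ[OF p u])
  \<comment> \<open>Multiplication by -i turns the imaginary part of the pairing into the real inner
    product, to which Cauchy-Schwarz applies.\<close>
  have J: "sqi (\<lambda>x. Complex (Im (?Q x)) (- Re (?Q x)))"
    by (intro sqi_Complex sqi_uminus sqi_Re sqi_Im Q)
  have N: "N2 (\<lambda>x. Complex (Im (?Q x)) (- Re (?Q x))) = N2 ?Q"
    by (simp add: N2_def cmod_power2 add.commute)
  have "\<bar>\<tau> * N2 u\<bar> = \<bar>\<integral>x. Complex (Im (?Q x)) (- Re (?Q x)) \<bullet> u x \<partial>lborel\<bar>"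
    using energy_Im[OF p u, of h \<tau>] by (simp add: inner_complex_def)
  also have "\<dots> \<le> sqrt (N2 ?Q) * sqrt (N2 u)"
    using cauchy_schwarz_sqi[OF J sqi_ccC[OF u]] by (simp add: N)
  finally have le: "(\<bar>\<tau>\<bar> * sqrt (N2 u)) * sqrt (N2 u) \<le> sqrt (N2 ?Q) * sqrt (N2 u)"
    by (simp add: abs_mult mult.assoc)
  have "\<bar>\<tau>\<bar> * sqrt (N2 u) \<le> sqrt (N2 ?Q)"
  proof (cases "N2 u = 0")
    case False
    then have "0 < sqrt (N2 u)" using N2_nonneg[of u] by (simp add: less_le)
    from mult_right_le_imp_le[OF le this] show ?thesis .
  qed simp
  then have "(\<bar>\<tau>\<bar> * sqrt (N2 u))\<^sup>2 \<le> (sqrt (N2 ?Q))\<^sup>2" by (intro power_mono) auto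
  then show ?thesis by (simp add: power_mult_distrib)
qed

text \<open>By linearity, coercivity bounds differences of preimages by differences of images, so
  preimages of a convergent sequence are Cauchy.\<close>

lemma lim2_of_coercive:
  assumes p: "bdd_meas p" and u: "\<And>n. ccC (U n)" and f: "lim2 (\<lambda>n. QQ h p \<tau> (U n)) f"
    and k: "\<kappa> > 0" and co: "\<And>u. ccC u \<Longrightarrow> \<kappa> * N2 u \<le> N2 (QQ h p \<tau> u)"
  shows "\<exists>u. lim2 U u"
proof (rule riesz_fischer)
  show "sqi (U n)" for n by (rule sqi_ccC[OF u])
  fix e :: real assume "e > 0"
  then obtain N where N: "\<forall>m\<ge>N. \<forall>n\<ge>N. N2 (\<lambda>x. QQ h p \<tau> (U m) x - QQ h p \<tau> (U n) x) < \<kappa> * e"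
    using lim2_Cauchy[OF f, of "\<kappa> * e"] k by auto
  have "N2 (\<lambda>x. U m x - U n x) < e" if "m \<ge> N" "n \<ge> N" for m n
  proof -
    have "\<kappa> * N2 (\<lambda>x. 1 *\<^sub>R U m x + (-1) *\<^sub>R U n x) \<le> N2 (QQ h p \<tau> (\<lambda>x. 1 *\<^sub>R U m x + (-1) *\<^sub>R U n x))"
      by (rule co[OF ccC_lincomb[OF u u]])
    also have "QQ h p \<tau> (\<lambda>x. 1 *\<^sub>R U m x + (-1) *\<^sub>R U n x) = (\<lambda>x. QQ h p \<tau> (U m) x - QQ h p \<tau> (U n) x)"
      by (rule ext) (simp only: QQ_lincomb[OF u u], simp)
    also have "N2 \<dots> < \<kappa> * e" using N that by blast
    finally show ?thesis using k by simp
  qed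
  then show "\<exists>N. \<forall>m\<ge>N. \<forall>n\<ge>N. N2 (\<lambda>x. U m x - U n x) < e" by blast
qed

lemma vw_free_unique:
  assumes h: "h > 0" and g: "sqi g" and v: "vw h (\<lambda>x. 1) 0 g (\<lambda>x. 0)"
  shows "AE x in lborel. g x = 0"
proof -
  have "AE x in lborel. Re (g x) = 0"
    by (rule free_uniqueness[OF sqi_Re[OF g], of "h\<^sup>2"]) (use v h in \<open>auto simp: vw_def opr_def algebra_simps\<close>)
  moreover have "AE x in lborel. Im (g x) = 0"
    by (rule free_uniqueness[OF sqi_Im[OF g], of "h\<^sup>2"]) (use v h in \<open>auto simp: vw_def opr_def algebra_simps\<close>)
  ultimately show ?thesis by eventually_elim (simp add: complex_eq_iff)
qed

text \<open>
  \<open>u\<close> solves the free equation \<open>(- h\<^sup>2 \<Delta> + 1) u = f - (p - 1 + i\<tau>) u\<close>, and the approximation is the one of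
  this equation, whose very weak solution is unique.
\<close>

lemma vw_approx:
  assumes h: "h > 0" and p: "bdd_meas p" and u: "sqi u" and f: "sqi f" and v: "vw h p \<tau> u f"
  shows "\<exists>U. (\<forall>n. ccC (U n)) \<and> lim2 U u \<and> lim2 (\<lambda>n. QQ h p \<tau> (U n)) f"
proof -
  \<comment> \<open>The zeroth-order difference between the given operator and - h^2 \<Delta> + 1.
    It is bounded on square-integrable functions and therefore commutes with limits.\<close>
  define Z where "Z = (\<lambda>u x. (p x - 1) *\<^sub>R u x + \<tau> *\<^sub>R Complex (- Im (u x)) (Re (u x)))"
  have pm: "bdd_meas (\<lambda>x. p x - 1)" by (intro bdd_meas_diff p bdd_meas_const)
  have Zlim: "lim2 (\<lambda>n. Z (U n)) (Z w)" if "lim2 U w" for U w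
    unfolding Z_def using lim2_scaleR[OF lim2_Im[OF that], of "-1"]
    by (intro lim2_add bdd_meas_lim2[OF pm] lim2_scaleR lim2_Complex lim2_Re that) auto
  have Zsqi: "sqi (Z u)" using lim2D(2)[OF Zlim[OF lim2_const[OF u]]] .
  define F where "F = (\<lambda>x. f x - Z u x)"
  have F: "sqi F" unfolding F_def by (intro sqi_diff f Zsqi)
  obtain U where U: "\<And>n. ccC (U n)" "lim2 (\<lambda>n. QQ h (\<lambda>x. 1) 0 (U n)) F"
    using QQ_dense[OF bdd_meas_const _ F, of h 1 0] vw_free_unique[OF h] by (auto simp del: minus_zero simp: minus_zero)
  obtain u' where u': "lim2 U u'"
    using lim2_of_coercive[OF bdd_meas_const U zero_less_one] coercive_free by auto
  have v1: "vw h (\<lambda>x. 1) 0 u' F" by (rule vw_lim[OF bdd_meas_const u' U(2) vw_ccC[OF bdd_meas_const U(1)]])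
  have v2: "vw h (\<lambda>x. 1) 0 u F"
    unfolding vw_def
  proof (intro allI impI conjI)
    fix \<phi> :: "'a \<Rightarrow> real" assume \<phi>: "cc \<phi>"
    note s = sqi_cc[OF \<phi>]
    have s1: "sqi (\<lambda>x. (p x - 1) * \<phi> x)" using bdd_meas_sqi[OF pm s] by simp
    note i = sqi_mult_integrable[OF sqi_Re[OF u] sqi_opr[OF p \<phi>, of h]] sqi_mult_integrable[OF sqi_Im[OF u] sqi_opr[OF p \<phi>, of h]]
      sqi_mult_integrable[OF sqi_Re[OF u] s1] sqi_mult_integrable[OF sqi_Im[OF u] s1]
      sqi_mult_integrable[OF sqi_Re[OF u] s] sqi_mult_integrable[OF sqi_Im[OF u] s]
      sqi_mult_integrable[OF sqi_Re[OF f] s] sqi_mult_integrable[OF sqi_Im[OF f] s]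
    have o: "opr h (\<lambda>x. 1) \<phi> x = opr h p \<phi> x - (p x - 1) * \<phi> x" for x by (simp add: opr_def algebra_simps)
    have "(\<integral>x. Re (u x) * opr h (\<lambda>x. 1) \<phi> x \<partial>lborel) = (\<integral>x. Re (u x) * opr h p \<phi> x \<partial>lborel) - (\<integral>x. Re (u x) * ((p x - 1) * \<phi> x) \<partial>lborel)"
      unfolding o right_diff_distrib[of "Re _"] using i by simp
    moreover have "(\<integral>x. Re (F x) * \<phi> x \<partial>lborel) = (\<integral>x. (Re (f x) * \<phi> x - Re (u x) * ((p x - 1) * \<phi> x)) + \<tau> * (Im (u x) * \<phi> x) \<partial>lborel)"
      by (intro Bochner_Integration.integral_cong refl) (simp add: F_def Z_def algebra_simps)
    moreover have "\<dots> = (\<integral>x. Re (f x) * \<phi> x \<partial>lborel) - (\<integral>x. Re (u x) * ((p x - 1) * \<phi> x) \<partial>lborel) + \<tau> * (\<integral>x. Im (u x) * \<phi> x \<partial>lborel)"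
      using i by simp
    ultimately show "(\<integral>x. Re (u x) * opr h (\<lambda>x. 1) \<phi> x \<partial>lborel) - 0 * (\<integral>x. Im (u x) * \<phi> x \<partial>lborel) = (\<integral>x. Re (F x) * \<phi> x \<partial>lborel)"
      using v[unfolded vw_def, rule_format, OF \<phi>] by simp
    have "(\<integral>x. Im (u x) * opr h (\<lambda>x. 1) \<phi> x \<partial>lborel) = (\<integral>x. Im (u x) * opr h p \<phi> x \<partial>lborel) - (\<integral>x. Im (u x) * ((p x - 1) * \<phi> x) \<partial>lborel)"
      unfolding o right_diff_distrib[of "Im _"] using i by simp
    moreover have "(\<integral>x. Im (F x) * \<phi> x \<partial>lborel) = (\<integral>x. (Im (f x) * \<phi> x - Im (u x) * ((p x - 1) * \<phi> x)) - \<tau> * (Re (u x) * \<phi> x) \<partial>lborel)"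
      by (intro Bochner_Integration.integral_cong refl) (simp add: F_def Z_def algebra_simps)
    moreover have "\<dots> = (\<integral>x. Im (f x) * \<phi> x \<partial>lborel) - (\<integral>x. Im (u x) * ((p x - 1) * \<phi> x) \<partial>lborel) - \<tau> * (\<integral>x. Re (u x) * \<phi> x \<partial>lborel)"
      using i by simp
    ultimately show "(\<integral>x. Im (u x) * opr h (\<lambda>x. 1) \<phi> x \<partial>lborel) + 0 * (\<integral>x. Re (u x) * \<phi> x \<partial>lborel) = (\<integral>x. Im (F x) * \<phi> x \<partial>lborel)"
      using v[unfolded vw_def, rule_format, OF \<phi>] by simp
  qed
  have s: "sqi (\<lambda>x. u x - u' x)" by (intro sqi_diff u lim2D[OF u'])
  have "vw h (\<lambda>x. 1) 0 (\<lambda>x. u x - u' x) (\<lambda>x. F x - F x)"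
    by (rule vw_diff[OF bdd_meas_const u lim2D(2)[OF u'] F F v2 v1])
  then have "AE x in lborel. u x - u' x = 0" by (intro vw_free_unique[OF h s]) simp
  then have uu': "AE x in lborel. u x = u' x" by eventually_elim simp
  have limu: "lim2 U u" by (rule lim2_AE_cong[OF u' sqi_measurable[OF u] uu'])
  have "lim2 (\<lambda>n x. QQ h (\<lambda>x. 1) 0 (U n) x + Z (U n) x) (\<lambda>x. F x + Z u x)"
    by (intro lim2_add U(2) Zlim limu)
  moreover have "QQ h (\<lambda>x. 1) 0 w x + Z w x = QQ h p \<tau> w x" for w x
    by (simp add: QQ_def Z_def opr_def complex_eq_iff algebra_simps)
  ultimately show ?thesis using U(1) limu by (auto simp: F_def)
qed

text \<open>Coercivity is known for test functions; \<open>vw_approx\<close> carries it over to all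
  square-integrable distributional solutions. In the language of unbounded operators, the deficiency
  spaces are trivial.\<close>

lemma vw_dissipative_unique:
  fixes g :: "'a::euclidean_space \<Rightarrow> complex"
  assumes h: "h > 0" and p: "bdd_meas p" and t: "\<tau> \<noteq> 0" and g: "sqi g" and v: "vw h p \<tau> g (\<lambda>x. 0)"
  shows "AE x in lborel. g x = 0"
proof -
  obtain U where U: "\<And>n. ccC (U n)" "lim2 U g" "lim2 (\<lambda>n. QQ h p \<tau> (U n)) (\<lambda>x. 0)"
    using vw_approx[OF h p g sqi_zero v] by blast
  have "\<tau>\<^sup>2 * N2 g \<le> N2 (\<lambda>x::'a. 0::complex)"
    by (rule LIMSEQ_le[OF tendsto_mult[OF tendsto_const lim2_N2[OF U(2)]] lim2_N2[OF U(3)]])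
      (use coercive_dissipative[OF p U(1)] in blast)
  also have "\<dots> = 0" by (simp add: N2_def)
  finally have "N2 g = 0" using t N2_nonneg[of g] by (simp add: mult_le_0_iff)
  then show ?thesis by (rule N2_zero_AE[OF g])
qed

text \<open>Uniqueness for - \<tau>, the adjoint problem, makes the range dense; coercivity for
  \<tau> makes the preimages of an approximating sequence converge.\<close>

theorem dissipative_solvable:
  assumes h: "h > 0" and p: "bdd_meas p" and t: "\<tau> \<noteq> 0" and f: "sqi f"
  shows "\<exists>U u. (\<forall>n. ccC (U n)) \<and> lim2 U u \<and> lim2 (\<lambda>n. QQ h p \<tau> (U n)) f"
proof -
  obtain U where U: "\<And>n. ccC (U n)" "lim2 (\<lambda>n. QQ h p \<tau> (U n)) f"
    using QQ_dense[OF p vw_dissipative_unique[OF h p, of "- \<tau>"] f, where \<tau> = \<tau>] t by auto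
  moreover have "\<exists>u. lim2 U u"
    by (rule lim2_of_coercive[OF p U(1,2), of "\<tau>\<^sup>2"]) (use t coercive_dissipative[OF p] in auto)
  ultimately show ?thesis by blast
qed

section \<open>Approximation of the resolvent by test functions\<close>

lemma pd_lincomb:
  assumes "cc f" "cc g"
  shows "pd b (\<lambda>x. f x - g x) = (\<lambda>x. pd b f x - pd b g x)"
  by (rule ext) (rule pd_smooth_diff[OF assms[THEN cc_smooth] UNIV_I])

text \<open>The squared gradient integrates to the pairing of f with minus its Laplacian, which
  Cauchy-Schwarz splits into the two norms.\<close>

lemma N2_pd_le:
  assumes f: "cc f" and b: "b \<in> Basis"
  shows "N2 (pd b f) \<le> N2 f + N2 (lap f)"
proof -
  have "N2 (pd b f) \<le> (\<Sum>i\<in>Basis. N2 (pd i f))" using b by (intro member_le_sum) auto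
  also have "\<dots> = - (\<integral>x. f x \<bullet> lap f x \<partial>lborel)"
    using integral_lap_mult[OF cc_smooth[OF f] f] by (simp add: N2_inner)
  also have "\<dots> \<le> sqrt (N2 f) * sqrt (N2 (lap f))"
    using cauchy_schwarz_sqi[OF sqi_cc[OF f] sqi_cc[OF cc_lap[OF f]]] by linarith
  also have "\<dots> \<le> (sqrt (N2 f))\<^sup>2 + (sqrt (N2 (lap f)))\<^sup>2"
  proof -
    have "0 \<le> sqrt (N2 f) * sqrt (N2 (lap f))" by simp
    then show ?thesis using sum_squares_bound[of "sqrt (N2 f)" "sqrt (N2 (lap f))"] by linarith
  qed
  finally show ?thesis by simp
qed

text \<open>Abstract in \<open>D\<close> so as to serve first and second derivatives alike:
  linearity and the bound by the graph norm of the Laplacian make the derivatives Cauchy.\<close>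

lemma lim2_of_graph_bound:
  fixes A :: "nat \<Rightarrow> 'a::euclidean_space \<Rightarrow> real"
  assumes a: "\<And>n. cc (A n)" and lim: "lim2 A a" "lim2 (\<lambda>n. lap (A n)) L"
    and D: "\<And>f. cc f \<Longrightarrow> sqi (D f)" "\<And>f g. cc f \<Longrightarrow> cc g \<Longrightarrow> D (\<lambda>x. f x - g x) = (\<lambda>x. D f x - D g x)"
    and le: "\<And>f. cc f \<Longrightarrow> N2 (D f) \<le> N2 f + N2 (lap f)"
  shows "\<exists>g. lim2 (\<lambda>n. D (A n)) g"
proof (rule riesz_fischer)
  show "sqi (D (A n))" for n by (rule D(1)[OF a])
  fix e :: real assume "e > 0"
  then obtain N1 N2' where N: "\<forall>m\<ge>N1. \<forall>n\<ge>N1. N2 (\<lambda>x. A m x - A n x) < e / 2"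
    "\<forall>m\<ge>N2'. \<forall>n\<ge>N2'. N2 (\<lambda>x. lap (A m) x - lap (A n) x) < e / 2"
    using lim2_Cauchy[OF lim(1), of "e/2"] lim2_Cauchy[OF lim(2), of "e/2"] by auto
  have "N2 (\<lambda>x. D (A m) x - D (A n) x) < e" if "m \<ge> max N1 N2'" "n \<ge> max N1 N2'" for m n
  proof -
    have "lap (\<lambda>x. A m x - A n x) = (\<lambda>x. lap (A m) x - lap (A n) x)"
      using lap_lincomb[OF a a, of 1 m "-1" n] by (simp add: fun_eq_iff)
    then show ?thesis
      using le[OF cc_diff[OF a a], of m n] N(1)[rule_format, of m n] N(2)[rule_format, of m n] that
      by (simp add: D(2)[OF a a])
  qed
  then show "\<exists>N. \<forall>m\<ge>N. \<forall>n\<ge>N. N2 (\<lambda>x. D (A m) x - D (A n) x) < e" by blast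
qed

lemma lim2_pd:
  assumes "\<And>n. cc (A n)" "lim2 A a" "lim2 (\<lambda>n. lap (A n)) L" "b \<in> Basis"
  shows "\<exists>g. lim2 (\<lambda>n. pd b (A n)) g"
  by (rule lim2_of_graph_bound[OF assms(1-3)])
    (use assms(4) in \<open>auto intro!: sqi_cc cc_pd pd_lincomb N2_pd_le\<close>)

lemma lim2_pd_pd:
  assumes "\<And>n. cc (A n)" "lim2 A a" "lim2 (\<lambda>n. lap (A n)) L" "b \<in> Basis" "c \<in> Basis"
  shows "\<exists>g. lim2 (\<lambda>n. pd c (pd b (A n))) g"
proof (rule lim2_of_graph_bound[OF assms(1-3)])
  show "sqi (pd c (pd b f))" if "cc f" for f using that assms(4,5) by (intro sqi_cc cc_pd)
  show "pd c (pd b (\<lambda>x. f x - g x)) = (\<lambda>x. pd c (pd b f) x - pd c (pd b g) x)" if "cc f" "cc g" for f g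
    using pd_lincomb[OF that] pd_lincomb[OF that[THEN cc_pd[OF _ assms(4)]]] by metis
  show "N2 (pd c (pd b f)) \<le> N2 f + N2 (lap f)" if "cc f" for f
  proof -
    have "N2 (pd c (pd b f)) \<le> N2 (lap f)"
      using integral_hessian_sq_le[OF that assms(4,5)] by (simp add: N2_def)
    then show ?thesis using N2_nonneg[of f] by linarith
  qed
qed

definition wp :: "'a::euclidean_space \<Rightarrow> ('a \<Rightarrow> real) \<Rightarrow> ('a \<Rightarrow> real) \<Rightarrow> bool" where
  "wp b u w \<longleftrightarrow> (\<forall>\<phi>. cc \<phi> \<longrightarrow> (\<integral>x. pd b \<phi> x * u x \<partial>lborel) = - (\<integral>x. \<phi> x * w x \<partial>lborel))"

lemma wp_lim:
  assumes a: "\<And>n. cc (A n)" and lim: "lim2 A a" "lim2 (\<lambda>n. pd b (A n)) g" and b: "b \<in> Basis"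
  shows "wp b a g"
  unfolding wp_def
proof (intro allI impI)
  fix \<phi> :: "'a \<Rightarrow> real" assume \<phi>: "cc \<phi>"
  have "(\<lambda>n. \<integral>x. pd b \<phi> x * A n x \<partial>lborel) \<longlonglongrightarrow> (\<integral>x. pd b \<phi> x * a x \<partial>lborel)"
    by (rule lim2_integral_mult[OF lim2_const[OF sqi_cc[OF cc_pd[OF \<phi> b]]] lim(1)])
  moreover have "(\<lambda>n. - (\<integral>x. \<phi> x * pd b (A n) x \<partial>lborel)) \<longlonglongrightarrow> - (\<integral>x. \<phi> x * g x \<partial>lborel)"
    by (rule tendsto_minus[OF lim2_integral_mult[OF lim2_const[OF sqi_cc[OF \<phi>]] lim(2)]])
  moreover have "(\<integral>x. pd b \<phi> x * A n x \<partial>lborel) = - (\<integral>x. \<phi> x * pd b (A n) x \<partial>lborel)" for n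
    using integral_by_parts[OF cc_smooth[OF \<phi>] a b, of n] by simp
  ultimately show "(\<integral>x. pd b \<phi> x * a x \<partial>lborel) = - (\<integral>x. \<phi> x * g x \<partial>lborel)"
    using LIMSEQ_unique by simp
qed

lemma wp_unique:
  assumes "wp b u v" "wp b u w" "locint v" "locint w"
  shows "AE x in lborel. v x = w x"
proof -
  have "locint (\<lambda>x. v x - w x)" using assms(3,4)
    unfolding locint_def right_diff_distrib by (auto intro!: borel_measurable_diff Bochner_Integration.integrable_diff)
  then have "AE x in lborel. v x - w x = 0"
  proof (rule fundamental_lemma)
    fix \<phi> :: "'a \<Rightarrow> real" assume \<phi>: "cc \<phi>"
    have "(\<integral>x. \<phi> x * (v x - w x) \<partial>lborel) = (\<integral>x. \<phi> x * v x \<partial>lborel) - (\<integral>x. \<phi> x * w x \<partial>lborel)"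
      using locint_cc_mult[OF assms(3) \<phi>] locint_cc_mult[OF assms(4) \<phi>] by (simp add: right_diff_distrib)
    also have "\<dots> = 0" using assms(1,2) \<phi> unfolding wp_def by fastforce
    finally show "(\<integral>x. \<phi> x * (v x - w x) \<partial>lborel) = 0" .
  qed
  then show ?thesis by eventually_elim simp
qed

section \<open>Weak derivatives of complex functions and membership in H2\<close>

lemma locally_integrable_Re_Im:
  assumes "locally_integrable u"
  shows "locint (\<lambda>x. Re (u x))" "locint (\<lambda>x. Im (u x))"
proof -
  have [measurable]: "u \<in> borel_measurable borel" using assms by (simp add: locally_integrable_def)
  have i: "integrable lborel (\<lambda>x. indicator (cball 0 R) x *\<^sub>R u x)" for R
    using assms by (auto simp: locally_integrable_def set_integrable_def)
  show "locint (\<lambda>x. Re (u x))" "locint (\<lambda>x. Im (u x))"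
    unfolding locint_def using integrable_Re[OF i] integrable_Im[OF i] by auto
qed

lemma sqi_locally_integrable:
  fixes u :: "'a::euclidean_space \<Rightarrow> complex"
  assumes u: "sqi u"
  shows "locally_integrable u"
  unfolding locally_integrable_def set_integrable_def
proof (intro conjI allI impI)
  show [measurable]: "u \<in> borel_measurable borel" by (rule sqi_measurable[OF u])
  fix K :: "'a set" assume K: "compact K"
  have [measurable]: "K \<in> sets borel" using K by (simp add: borel_compact)
  show "integrable lborel (\<lambda>x. indicator K x *\<^sub>R u x)"
  proof (rule Bochner_Integration.integrable_bound)
    show "integrable lborel (\<lambda>x. indicator K x + (norm (u x))\<^sup>2 :: real)"
      using sqi_integrable[OF u] emeasure_compact_finite[OF K]
      by (intro Bochner_Integration.integrable_add integrable_real_indicator) auto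
    show "AE x in lborel. norm (indicator K x *\<^sub>R u x) \<le> norm (indicator K x + (norm (u x))\<^sup>2 :: real)"
    proof (rule AE_I2)
      fix x
      have "2 * norm (u x) * 1 \<le> (norm (u x))\<^sup>2 + 1\<^sup>2" by (rule sum_squares_bound)
      then show "norm (indicator K x *\<^sub>R u x) \<le> norm (indicator K x + (norm (u x))\<^sup>2 :: real)"
        using norm_ge_zero[of "u x"] by (auto simp: indicator_def simp del: norm_ge_zero)
    qed
  qed (use sqi_measurable[OF u] in measurable)
qed

lemma locally_integrable_cc:
  assumes "locally_integrable u" "cc \<phi>"
  shows "integrable lborel (\<lambda>x. \<phi> x *\<^sub>R u x)"
proof -
  note i = locally_integrable_Re_Im[OF assms(1), THEN locint_cc_mult[OF _ assms(2)]]
  have "integrable lborel (\<lambda>x. of_real (\<phi> x * Re (u x)) + \<i> * of_real (\<phi> x * Im (u x)))"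
    using integrable_of_real[OF i(1), where 'a = complex] integrable_of_real[OF i(2), where 'a = complex]
    by (intro Bochner_Integration.integrable_add integrable_mult_right) auto
  moreover have "of_real (\<phi> x * Re (u x)) + \<i> * of_real (\<phi> x * Im (u x)) = \<phi> x *\<^sub>R u x" for x
    by (simp add: complex_eq_iff)
  ultimately show ?thesis by simp
qed

lemma has_weak_partial_iff:
  assumes b: "b \<in> Basis"
  shows "has_weak_partial b u v \<longleftrightarrow> locally_integrable u \<and> locally_integrable v \<and>
    wp b (\<lambda>x. Re (u x)) (\<lambda>x. Re (v x)) \<and> wp b (\<lambda>x. Im (u x)) (\<lambda>x. Im (v x))"
proof (cases "locally_integrable u \<and> locally_integrable v")
  case True
  have "(\<integral>x. frechet_derivative \<phi> (at x) b *\<^sub>R u x \<partial>lborel) = - (\<integral>x. \<phi> x *\<^sub>R v x \<partial>lborel) \<longleftrightarrow>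
     (\<integral>x. pd b \<phi> x * Re (u x) \<partial>lborel) = - (\<integral>x. \<phi> x * Re (v x) \<partial>lborel) \<and>
     (\<integral>x. pd b \<phi> x * Im (u x) \<partial>lborel) = - (\<integral>x. \<phi> x * Im (v x) \<partial>lborel)" if \<phi>: "cc \<phi>" for \<phi>
  proof -
    have i: "integrable lborel (\<lambda>x. pd b \<phi> x *\<^sub>R u x)" "integrable lborel (\<lambda>x. \<phi> x *\<^sub>R v x)"
      using True \<phi> cc_pd[OF \<phi> b] locally_integrable_cc by auto
    have fd: "(\<integral>x. frechet_derivative \<phi> (at x) b *\<^sub>R u x \<partial>lborel) = (\<integral>x. pd b \<phi> x *\<^sub>R u x \<partial>lborel)" by (simp add: pd_def)
    show ?thesis unfolding fd
      by (simp add: complex_eq_iff integral_Re[OF i(1), symmetric] integral_Re[OF i(2), symmetric]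
          integral_Im[OF i(1), symmetric] integral_Im[OF i(2), symmetric])
  qed
  then show ?thesis using True unfolding has_weak_partial_def wp_def test_function_iff_cc by blast
qed (auto simp: has_weak_partial_def)

lemma has_weak_partial_unique:
  assumes b: "b \<in> Basis" and "has_weak_partial b u v" "has_weak_partial b u w"
  shows "AE x in lborel. v x = w x"
proof -
  have "AE x in lborel. Re (v x) = Re (w x)" "AE x in lborel. Im (v x) = Im (w x)"
    using assms(2,3) wp_unique locally_integrable_Re_Im unfolding has_weak_partial_iff[OF b] by metis+
  then show ?thesis by eventually_elim (simp add: complex_eq_iff)
qed

lemma has_weak_partial_AE_cong:
  assumes b: "b \<in> Basis" and v: "has_weak_partial b u v" and u': "locally_integrable u'" "AE x in lborel. u' x = u x"
  shows "has_weak_partial b u' v"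
  unfolding has_weak_partial_def
proof (intro conjI allI impI)
  show "locally_integrable v" "locally_integrable u'" using v u' by (auto simp: has_weak_partial_def)
  fix \<phi> :: "'a \<Rightarrow> real" assume t: "test_function UNIV \<phi>"
  then have \<phi>: "cc \<phi>" by (simp add: test_function_iff_cc)
  have [measurable]: "u \<in> borel_measurable borel" "u' \<in> borel_measurable borel" "pd b \<phi> \<in> borel_measurable borel"
    using v u' cc_measurable[OF cc_pd[OF \<phi> b]] by (auto simp: has_weak_partial_def locally_integrable_def)
  have "(\<integral>x. pd b \<phi> x *\<^sub>R u' x \<partial>lborel) = (\<integral>x. pd b \<phi> x *\<^sub>R u x \<partial>lborel)"
  proof (rule integral_cong_AE)
    show "AE x in lborel. pd b \<phi> x *\<^sub>R u' x = pd b \<phi> x *\<^sub>R u x" using u'(2) by eventually_elim simp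
  qed measurable
  then show "(\<integral>x. frechet_derivative \<phi> (at x) b *\<^sub>R u' x \<partial>lborel) = - (\<integral>x. \<phi> x *\<^sub>R v x \<partial>lborel)"
    using v t by (simp add: has_weak_partial_def pd_def)
qed

lemma H2_iff: "u \<in> H2 \<longleftrightarrow> sqi u \<and> (\<forall>b\<in>Basis. \<exists>v. sqi v \<and> has_weak_partial b u v \<and>
    (\<forall>c\<in>Basis. \<exists>w. sqi w \<and> has_weak_partial c v w))"
  by (simp add: H2_def Bex_def L2_iff_sqi)

text \<open>\<open>laplacian\<close> involves two nested choices of weak derivatives, which need not
  be the functions provided by \<open>H2\<close>. Uniqueness up to null sets identifies them almost
  everywhere with square-integrable ones.\<close>

lemma H2_laplacian:
  assumes u: "u \<in> H2"
  shows "\<exists>W. (\<forall>b\<in>Basis. sqi (W b)) \<and> (AE x in lborel. laplacian u x = (\<Sum>b\<in>Basis. W b x)) \<and>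
    (\<forall>b\<in>Basis. \<exists>v. has_weak_partial b u v \<and> has_weak_partial b v (W b))"
proof -
  have "\<forall>b\<in>Basis. \<exists>w. sqi w \<and> (AE x in lborel. weak_partial b (weak_partial b u) x = w x) \<and>
     (\<exists>v. has_weak_partial b u v \<and> has_weak_partial b v w)"
  proof
    fix b :: 'a assume b: "b \<in> Basis"
    then obtain v w where vw: "sqi w" "has_weak_partial b u v" "has_weak_partial b v w"
      using u unfolding H2_iff by blast
    have p1: "has_weak_partial b u (weak_partial b u)"
      unfolding weak_partial_def by (rule someI[of "has_weak_partial b u", OF vw(2)])
    \<comment> \<open>\<open>w\<close> is a derivative of \<open>v\<close>; it serves the chosen
      first derivative as well, because that one agrees with \<open>v\<close> almost
      everywhere.\<close>
    have p2: "has_weak_partial b (weak_partial b u) w"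
      by (rule has_weak_partial_AE_cong[OF b vw(3)])
        (use p1 has_weak_partial_unique[OF b p1 vw(2)] in \<open>auto simp: has_weak_partial_def\<close>)
    have p3: "has_weak_partial b (weak_partial b u) (weak_partial b (weak_partial b u))"
      unfolding weak_partial_def[of b "weak_partial b u"] by (rule someI[of "has_weak_partial b (weak_partial b u)", OF p2])
    show "\<exists>w. sqi w \<and> (AE x in lborel. weak_partial b (weak_partial b u) x = w x) \<and>
     (\<exists>v. has_weak_partial b u v \<and> has_weak_partial b v w)"
      using vw has_weak_partial_unique[OF b p3 p2] by blast
  qed
  then obtain W where W: "\<forall>b\<in>Basis. sqi (W b) \<and> (AE x in lborel. weak_partial b (weak_partial b u) x = W b x) \<and>
     (\<exists>v. has_weak_partial b u v \<and> has_weak_partial b v (W b))" by metis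
  have "AE x in lborel. \<forall>b\<in>Basis. weak_partial b (weak_partial b u) x = W b x"
    using W by (intro AE_finite_allI) auto
  then have "AE x in lborel. laplacian u x = (\<Sum>b\<in>Basis. W b x)"
    by eventually_elim (simp add: laplacian_def)
  then show ?thesis using W by blast
qed

text \<open>The residual \<rho> of the equation is square-integrable, and its pairings with test
  functions are the defect in \<open>vw\<close>. The fundamental lemma therefore links the pointwise
  equation, by which \<open>resolvent\<close> is defined, to the distributional theory.\<close>

lemma H2_vw_iff:
  assumes u: "u \<in> H2" and p: "bdd_meas p" and f: "sqi f"
  shows "vw h p \<tau> u f \<longleftrightarrow>
    (AE x in lborel. - complex_of_real (h\<^sup>2) * laplacian u x + complex_of_real (p x) * u x + \<i> * complex_of_real \<tau> * u x = f x)"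
proof -
  have su: "sqi u" using u by (simp add: H2_def L2_iff_sqi)
  obtain W where W: "\<And>b. b \<in> Basis \<Longrightarrow> sqi (W b)" "AE x in lborel. laplacian u x = (\<Sum>b\<in>Basis. W b x)"
    "\<And>b. b \<in> Basis \<Longrightarrow> \<exists>v. has_weak_partial b u v \<and> has_weak_partial b v (W b)"
    using H2_laplacian[OF u] by blast
  define S where "S = (\<lambda>x. \<Sum>b\<in>Basis. W b x)"
  have S: "sqi S" unfolding S_def by (rule sqi_sum[OF W(1)])
  define \<rho> where "\<rho> = (\<lambda>x. (- (h\<^sup>2)) *\<^sub>R S x + p x *\<^sub>R u x + \<tau> *\<^sub>R Complex (- Im (u x)) (Re (u x)) - f x)"
  have \<rho>: "sqi \<rho>"
    unfolding \<rho>_def using sqi_uminus[OF sqi_Im[OF su]]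
    by (intro sqi_diff sqi_add sqi_scaleR sqi_Complex bdd_meas_sqi[OF p] S su f sqi_Re)
  have lapS: "(\<integral>x. Re (u x) * lap \<phi> x \<partial>lborel) = (\<integral>x. Re (S x) * \<phi> x \<partial>lborel)"
    "(\<integral>x. Im (u x) * lap \<phi> x \<partial>lborel) = (\<integral>x. Im (S x) * \<phi> x \<partial>lborel)" if \<phi>: "cc \<phi>" for \<phi>
  proof -
    note i1 = sqi_mult_integrable[OF sqi_Re[OF su] sqi_cc[OF cc_pd[OF cc_pd[OF \<phi>]]]]
      sqi_mult_integrable[OF sqi_Im[OF su] sqi_cc[OF cc_pd[OF cc_pd[OF \<phi>]]]]
    note i2 = sqi_mult_integrable[OF sqi_Re[OF W(1)] sqi_cc[OF \<phi>]]
      sqi_mult_integrable[OF sqi_Im[OF W(1)] sqi_cc[OF \<phi>]]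
    have "(\<integral>x. Re (u x) * pd b (pd b \<phi>) x \<partial>lborel) = (\<integral>x. Re (W b x) * \<phi> x \<partial>lborel) \<and>
      (\<integral>x. Im (u x) * pd b (pd b \<phi>) x \<partial>lborel) = (\<integral>x. Im (W b x) * \<phi> x \<partial>lborel)" if b: "b \<in> Basis" for b
    proof -
      obtain v where v: "has_weak_partial b u v" "has_weak_partial b v (W b)" using W(3)[OF b] by blast
      show ?thesis
        using v cc_pd[OF \<phi> b] \<phi> unfolding has_weak_partial_iff[OF b] wp_def
        by (simp add: mult.commute[of "Re (u _)"] mult.commute[of "Im (u _)"] mult.commute[of "Re (W b _)"] mult.commute[of "Im (W b _)"])
    qed
    then show "(\<integral>x. Re (u x) * lap \<phi> x \<partial>lborel) = (\<integral>x. Re (S x) * \<phi> x \<partial>lborel)"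
      "(\<integral>x. Im (u x) * lap \<phi> x \<partial>lborel) = (\<integral>x. Im (S x) * \<phi> x \<partial>lborel)"
      unfolding lap_def S_def Re_sum Im_sum sum_distrib_left sum_distrib_right
      using i1 i2 by (simp_all add: Bochner_Integration.integral_sum)
  qed
  have res: "(\<integral>x. \<phi> x * Re (\<rho> x) \<partial>lborel) = (\<integral>x. Re (u x) * opr h p \<phi> x \<partial>lborel) - \<tau> * (\<integral>x. Im (u x) * \<phi> x \<partial>lborel) - (\<integral>x. Re (f x) * \<phi> x \<partial>lborel)"
    "(\<integral>x. \<phi> x * Im (\<rho> x) \<partial>lborel) = (\<integral>x. Im (u x) * opr h p \<phi> x \<partial>lborel) + \<tau> * (\<integral>x. Re (u x) * \<phi> x \<partial>lborel) - (\<integral>x. Im (f x) * \<phi> x \<partial>lborel)"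
    if \<phi>: "cc \<phi>" for \<phi>
  proof -
    note s = sqi_cc[OF \<phi>]
    have sp: "sqi (\<lambda>x. p x * \<phi> x)" using bdd_meas_sqi[OF p s] by simp
    note i = sqi_mult_integrable[OF sqi_Re[OF S] s] sqi_mult_integrable[OF sqi_Im[OF S] s]
      sqi_mult_integrable[OF sqi_Re[OF f] s] sqi_mult_integrable[OF sqi_Im[OF f] s]
      sqi_mult_integrable[OF sqi_Re[OF su] s] sqi_mult_integrable[OF sqi_Im[OF su] s]
      sqi_mult_integrable[OF sqi_Re[OF su] sp] sqi_mult_integrable[OF sqi_Im[OF su] sp]
      sqi_mult_integrable[OF sqi_Re[OF su] sqi_cc[OF cc_lap[OF \<phi>]]] sqi_mult_integrable[OF sqi_Im[OF su] sqi_cc[OF cc_lap[OF \<phi>]]]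
    have "(\<integral>x. \<phi> x * Re (\<rho> x) \<partial>lborel) = (\<integral>x. - (h\<^sup>2) * (Re (S x) * \<phi> x) + Re (u x) * (p x * \<phi> x) - \<tau> * (Im (u x) * \<phi> x) - Re (f x) * \<phi> x \<partial>lborel)"
      "(\<integral>x. \<phi> x * Im (\<rho> x) \<partial>lborel) = (\<integral>x. - (h\<^sup>2) * (Im (S x) * \<phi> x) + Im (u x) * (p x * \<phi> x) + \<tau> * (Re (u x) * \<phi> x) - Im (f x) * \<phi> x \<partial>lborel)"
      by (auto simp: \<rho>_def algebra_simps)
    moreover have "(\<integral>x. Re (u x) * opr h p \<phi> x \<partial>lborel) = - (h\<^sup>2) * (\<integral>x. Re (u x) * lap \<phi> x \<partial>lborel) + (\<integral>x. Re (u x) * (p x * \<phi> x) \<partial>lborel)"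
      "(\<integral>x. Im (u x) * opr h p \<phi> x \<partial>lborel) = - (h\<^sup>2) * (\<integral>x. Im (u x) * lap \<phi> x \<partial>lborel) + (\<integral>x. Im (u x) * (p x * \<phi> x) \<partial>lborel)"
      using i by (simp_all add: opr_def distrib_left right_diff_distrib mult.left_commute[of _ "h\<^sup>2"])
    ultimately show "(\<integral>x. \<phi> x * Re (\<rho> x) \<partial>lborel) = (\<integral>x. Re (u x) * opr h p \<phi> x \<partial>lborel) - \<tau> * (\<integral>x. Im (u x) * \<phi> x \<partial>lborel) - (\<integral>x. Re (f x) * \<phi> x \<partial>lborel)"
      "(\<integral>x. \<phi> x * Im (\<rho> x) \<partial>lborel) = (\<integral>x. Im (u x) * opr h p \<phi> x \<partial>lborel) + \<tau> * (\<integral>x. Re (u x) * \<phi> x \<partial>lborel) - (\<integral>x. Im (f x) * \<phi> x \<partial>lborel)"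
      using i lapS[OF \<phi>] by simp_all
  qed
  have eqv: "(AE x in lborel. - complex_of_real (h\<^sup>2) * laplacian u x + complex_of_real (p x) * u x + \<i> * complex_of_real \<tau> * u x = f x)
    \<longleftrightarrow> (AE x in lborel. \<rho> x = 0)"
  proof -
    have "AE x in lborel. (- complex_of_real (h\<^sup>2) * laplacian u x + complex_of_real (p x) * u x + \<i> * complex_of_real \<tau> * u x = f x) \<longleftrightarrow> \<rho> x = 0"
      using W(2)
    proof eventually_elim
      case (elim x)
      have "\<rho> x = - complex_of_real (h\<^sup>2) * laplacian u x + complex_of_real (p x) * u x + \<i> * complex_of_real \<tau> * u x - f x"
        unfolding \<rho>_def elim S_def by (simp add: complex_eq_iff)
      then show ?case by simp
    qed
    then show ?thesis by (auto elim: AE_mp)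
  qed
  show ?thesis unfolding eqv
  proof
    assume v: "vw h p \<tau> u f"
    have "AE x in lborel. Re (\<rho> x) = 0" "AE x in lborel. Im (\<rho> x) = 0"
      by (rule fundamental_lemma[OF sqi_locint]; use sqi_Re[OF \<rho>] sqi_Im[OF \<rho>] v res in \<open>simp add: vw_def\<close>)+
    then show "AE x in lborel. \<rho> x = 0" by eventually_elim (simp add: complex_eq_iff)
  next
    assume z: "AE x in lborel. \<rho> x = 0"
    have "(\<integral>x. \<phi> x * Re (\<rho> x) \<partial>lborel) = 0" "(\<integral>x. \<phi> x * Im (\<rho> x) \<partial>lborel) = 0" for \<phi>
      by (rule integral_eq_zero_AE; use z in eventually_elim; simp)+
    then show "vw h p \<tau> u f" using res unfolding vw_def by auto
  qed
qed

text \<open>The equation can be solved for the Laplacian, and the remaining terms are bounded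
  operations on convergent sequences.\<close>

lemma lim2_lap_of_QQ:
  assumes h: "h > 0" and p: "bdd_meas p" and lim: "lim2 U u" "lim2 (\<lambda>n. QQ h p \<tau> (U n)) f"
  shows "\<exists>L. lim2 (\<lambda>n. lap (\<lambda>x. Re (U n x))) L" "\<exists>L. lim2 (\<lambda>n. lap (\<lambda>x. Im (U n x))) L"
proof -
  note R = lim2_Re[OF lim(1)] lim2_Im[OF lim(1)] lim2_Re[OF lim(2)] lim2_Im[OF lim(2)]
  have "lim2 (\<lambda>n x. (1 / h\<^sup>2) *\<^sub>R (p x *\<^sub>R Re (U n x) - \<tau> *\<^sub>R Im (U n x) - Re (QQ h p \<tau> (U n) x)))
     (\<lambda>x. (1 / h\<^sup>2) *\<^sub>R (p x *\<^sub>R Re (u x) - \<tau> *\<^sub>R Im (u x) - Re (f x)))"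
    by (intro lim2_scaleR lim2_diff bdd_meas_lim2[OF p] R)
  moreover have "(1 / h\<^sup>2) *\<^sub>R (p x *\<^sub>R Re (w x) - \<tau> *\<^sub>R Im (w x) - Re (QQ h p \<tau> w x)) = lap (\<lambda>x. Re (w x)) x" for w x
    using h by (simp add: QQ_def opr_def)
  ultimately show "\<exists>L. lim2 (\<lambda>n. lap (\<lambda>x. Re (U n x))) L" by auto
  have "lim2 (\<lambda>n x. (1 / h\<^sup>2) *\<^sub>R (p x *\<^sub>R Im (U n x) + \<tau> *\<^sub>R Re (U n x) - Im (QQ h p \<tau> (U n) x)))
     (\<lambda>x. (1 / h\<^sup>2) *\<^sub>R (p x *\<^sub>R Im (u x) + \<tau> *\<^sub>R Re (u x) - Im (f x)))"
    by (intro lim2_scaleR lim2_diff lim2_add bdd_meas_lim2[OF p] R)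
  moreover have "(1 / h\<^sup>2) *\<^sub>R (p x *\<^sub>R Im (w x) + \<tau> *\<^sub>R Re (w x) - Im (QQ h p \<tau> w x)) = lap (\<lambda>x. Im (w x)) x" for w x
    using h by (simp add: QQ_def opr_def)
  ultimately show "\<exists>L. lim2 (\<lambda>n. lap (\<lambda>x. Im (U n x))) L" by auto
qed

text \<open>Elliptic regularity in the limit: convergence of the Laplacians forces that of all first
  and second derivatives, and weak derivatives pass to limits.\<close>

lemma H2_of_lim:
  assumes h: "h > 0" and p: "bdd_meas p" and U: "\<And>n. ccC (U n)" and lim: "lim2 U u" "lim2 (\<lambda>n. QQ h p \<tau> (U n)) f"
  shows "u \<in> H2"
proof -
  obtain L1 L2 where L: "lim2 (\<lambda>n. lap (\<lambda>x. Re (U n x))) L1" "lim2 (\<lambda>n. lap (\<lambda>x. Im (U n x))) L2"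
    using lim2_lap_of_QQ[OF h p lim] by blast
  have c: "cc (\<lambda>x. Re (U n x))" "cc (\<lambda>x. Im (U n x))" for n using U by (auto simp: ccC_def)
  note R = lim2_Re[OF lim(1)] lim2_Im[OF lim(1)]
  have "\<exists>v. sqi v \<and> has_weak_partial b u v \<and> (\<forall>c\<in>Basis. \<exists>w. sqi w \<and> has_weak_partial c v w)" if b: "b \<in> Basis" for b
  proof -
    obtain g1 g2 where g: "lim2 (\<lambda>n. pd b (\<lambda>x. Re (U n x))) g1" "lim2 (\<lambda>n. pd b (\<lambda>x. Im (U n x))) g2"
      using lim2_pd[OF c(1) R(1) L(1) b] lim2_pd[OF c(2) R(2) L(2) b] by blast
    note gs = lim2D(2)[OF g(1)] lim2D(2)[OF g(2)]
    have v: "sqi (\<lambda>x. Complex (g1 x) (g2 x))" by (intro sqi_Complex gs)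
    have "has_weak_partial b u (\<lambda>x. Complex (g1 x) (g2 x))"
      unfolding has_weak_partial_iff[OF b]
      using wp_lim[OF c(1) R(1) g(1) b] wp_lim[OF c(2) R(2) g(2) b] sqi_locally_integrable[OF v]
        sqi_locally_integrable[OF lim2D(2)[OF lim(1)]] by simp
    moreover have "\<exists>w. sqi w \<and> has_weak_partial e (\<lambda>x. Complex (g1 x) (g2 x)) w" if e: "e \<in> Basis" for e
    proof -
      obtain w1 w2 where w: "lim2 (\<lambda>n. pd e (pd b (\<lambda>x. Re (U n x)))) w1" "lim2 (\<lambda>n. pd e (pd b (\<lambda>x. Im (U n x)))) w2"
        using lim2_pd_pd[OF c(1) R(1) L(1) b e] lim2_pd_pd[OF c(2) R(2) L(2) b e] by blast
      have ws: "sqi (\<lambda>x. Complex (w1 x) (w2 x))"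
        by (intro sqi_Complex lim2D(2)[OF w(1)] lim2D(2)[OF w(2)])
      have "has_weak_partial e (\<lambda>x. Complex (g1 x) (g2 x)) (\<lambda>x. Complex (w1 x) (w2 x))"
        unfolding has_weak_partial_iff[OF e]
        using wp_lim[OF cc_pd[OF c(1) b] g(1) w(1) e] wp_lim[OF cc_pd[OF c(2) b] g(2) w(2) e]
          sqi_locally_integrable[OF v] sqi_locally_integrable[OF ws] by simp
      then show ?thesis using ws by blast
    qed
    ultimately show ?thesis using v by blast
  qed
  then show ?thesis using lim2D(2)[OF lim(1)] unfolding H2_iff by blast
qed

text \<open>All later estimates are proved for test functions and reach the resolvent through this
  statement. The convergence of the gradients is included because the multiplier contains a radial
  derivative.\<close>

theorem resolvent_approximation:
  fixes f :: "'a::euclidean_space \<Rightarrow> complex" and E :: real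
  assumes h: "h > 0" and V: "bdd_meas V" and e: "\<epsilon> \<noteq> 0" and f: "sqi f"
  defines "u \<equiv> resolvent (schroedinger h V E) (\<i> * complex_of_real \<epsilon>) f"
  shows "\<exists>U G1 G2. (\<forall>n. ccC (U n)) \<and> lim2 U u \<and> lim2 (\<lambda>n. QQ h (\<lambda>x. V x - E) (- \<epsilon>) (U n)) f \<and>
    (\<forall>b\<in>Basis. lim2 (\<lambda>n. pd b (\<lambda>x. Re (U n x))) (G1 b) \<and> lim2 (\<lambda>n. pd b (\<lambda>x. Im (U n x))) (G2 b))"
proof -
  let ?p = "\<lambda>x. V x - E"
  have p: "bdd_meas ?p" by (intro bdd_meas_diff V bdd_meas_const)
  have eq: "schroedinger h V E w x - \<i> * complex_of_real \<epsilon> * w x =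
    - complex_of_real (h\<^sup>2) * laplacian w x + complex_of_real (?p x) * w x + \<i> * complex_of_real (- \<epsilon>) * w x" for w x
    by (simp add: schroedinger_def algebra_simps)
  obtain U0 u0 where U0: "\<And>n. ccC (U0 n)" "lim2 U0 u0" "lim2 (\<lambda>n. QQ h ?p (- \<epsilon>) (U0 n)) f"
    using dissipative_solvable[OF h p _ f, of "- \<epsilon>"] e by auto
  have "u0 \<in> H2" by (rule H2_of_lim[OF h p U0])
  moreover have "vw h ?p (- \<epsilon>) u0 f" by (rule vw_lim[OF p U0(2,3) vw_ccC[OF p U0(1)]])
  ultimately have "u0 \<in> H2 \<and> (AE x in lborel. schroedinger h V E u0 x - \<i> * complex_of_real \<epsilon> * u0 x = f x)"
    unfolding eq using H2_vw_iff[OF _ p f] by blast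
  \<comment> \<open>The solution \<open>u0\<close> justifies the choice hidden in
    \<open>resolvent\<close>; what follows concerns the chosen function \<open>u\<close>.\<close>
  from someI[of "\<lambda>u. u \<in> H2 \<and> (AE x in lborel. schroedinger h V E u x - \<i> * complex_of_real \<epsilon> * u x = f x)", OF this]
  have u: "u \<in> H2 \<and> (AE x in lborel. schroedinger h V E u x - \<i> * complex_of_real \<epsilon> * u x = f x)"
    unfolding u_def resolvent_def .
  then have v: "vw h ?p (- \<epsilon>) u f" unfolding eq using H2_vw_iff[OF _ p f] by blast
  have su: "sqi u" using u by (simp add: H2_def L2_iff_sqi)
  obtain U where U: "\<And>n. ccC (U n)" "lim2 U u" "lim2 (\<lambda>n. QQ h ?p (- \<epsilon>) (U n)) f"
    using vw_approx[OF h p su f v] by blast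
  obtain L1 L2 where L: "lim2 (\<lambda>n. lap (\<lambda>x. Re (U n x))) L1" "lim2 (\<lambda>n. lap (\<lambda>x. Im (U n x))) L2"
    using lim2_lap_of_QQ[OF h p U(2,3)] by blast
  have c: "cc (\<lambda>x. Re (U n x))" "cc (\<lambda>x. Im (U n x))" for n using U by (auto simp: ccC_def)
  have "\<forall>b. \<exists>g. b \<in> Basis \<longrightarrow> lim2 (\<lambda>n. pd b (\<lambda>x. Re (U n x))) g"
    "\<forall>b. \<exists>g. b \<in> Basis \<longrightarrow> lim2 (\<lambda>n. pd b (\<lambda>x. Im (U n x))) g"
    using lim2_pd[OF c(1) lim2_Re[OF U(2)] L(1)] lim2_pd[OF c(2) lim2_Im[OF U(2)] L(2)] by blast+
  then obtain G1 G2 where "\<forall>b\<in>Basis. lim2 (\<lambda>n. pd b (\<lambda>x. Re (U n x))) (G1 b) \<and> lim2 (\<lambda>n. pd b (\<lambda>x. Im (U n x))) (G2 b)"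
    by metis
  then show ?thesis using U by blast
qed

section \<open>Radial calculus away from the origin\<close>

text \<open>\<open>ed b\<close> is a component of x / |x|, the gradient of the norm, and
  \<open>rd\<close> below is the radial derivative. Division by zero makes both vanish at the
  origin.\<close>

definition ed :: "'a::euclidean_space \<Rightarrow> 'a \<Rightarrow> real" where
  "ed b x = (x \<bullet> b) / norm x"

definition rd :: "('a::euclidean_space \<Rightarrow> real) \<Rightarrow> 'a \<Rightarrow> real" where
  "rd f x = (\<Sum>b\<in>Basis. ed b x * pd b f x)"

abbreviation "pct \<equiv> - {0::'a::euclidean_space}"

lemma open_pct: "open pct" by auto

lemma smooth_radial: "smooth_on {0<..} f \<Longrightarrow> smooth_on pct (\<lambda>x::'a::euclidean_space. f (norm x))"
  by (rule smooth_on_compose[OF _ smooth_on_norm]) auto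

lemma smooth_ed: "smooth_on pct (ed b)"
proof -
  have "smooth_on pct (\<lambda>x. (x \<bullet> b) / norm x)"
    by (rule smooth_on_divide[OF smooth_on_inner smooth_on_norm]) auto
  then show ?thesis by (simp add: ed_def[abs_def])
qed

lemma smooth_rd: "smooth_on pct f \<Longrightarrow> smooth_on pct (rd f)"
proof -
  assume "smooth_on pct f"
  then have "smooth_on pct (\<lambda>x. \<Sum>b\<in>Basis. ed b x * pd b f x)"
    by (intro smooth_on_sum smooth_on_mult smooth_ed smooth_on_pd open_pct)
  then show ?thesis by (simp add: rd_def[abs_def])
qed

lemma pd_radial:
  assumes "(f has_real_derivative d) (at (norm x))" "x \<noteq> 0"
  shows "pd b (\<lambda>x. f (norm x)) x = d * ed b x"
proof -
  have n: "(norm has_derivative (\<lambda>h. h \<bullet> sgn x)) (at x)" using has_derivative_norm[OF assms(2)] by (simp add: inner_commute)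
  have "((\<lambda>x. f (norm x)) has_derivative (\<lambda>h. d * (h \<bullet> sgn x))) (at x)"
    by (rule has_derivative_compose[OF n, of f "\<lambda>h. d * h"]) (use assms(1) in \<open>simp add: has_field_derivative_def\<close>)
  from pd_eqI[OF this] show ?thesis by (simp add: ed_def sgn_div_norm inner_commute divide_inverse mult.commute)
qed

text \<open>The Hessian of the norm: the projection onto the tangent space of the sphere, divided by
  r. It is the source of every factor 1/r in what follows.\<close>

lemma pd_ed:
  assumes "x \<noteq> 0" "b \<in> Basis" "c \<in> Basis"
  shows "pd b (ed c) x = ((if b = c then 1 else 0) - ed b x * ed c x) / norm x"
proof -
  have 1: "pd b (\<lambda>x. inverse (norm x)) x = - inverse ((norm x)\<^sup>2) * ed b x"
    by (rule pd_radial[OF _ assms(1)]) (use assms(1) in \<open>auto intro!: derivative_eq_intros simp: power2_eq_square\<close>)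
  have 2: "pd b (\<lambda>x. x \<bullet> c) x = b \<bullet> c"
    by (rule pd_eqI[of _ "\<lambda>h. h \<bullet> c"]) (auto intro!: derivative_eq_intros)
  have "pd b (\<lambda>x. (x \<bullet> c) * inverse (norm x)) x = (x \<bullet> c) * pd b (\<lambda>x. inverse (norm x)) x + pd b (\<lambda>x. x \<bullet> c) x * inverse (norm x)"
    by (rule pd_smooth_mult[OF _ smooth_on_inverse[OF smooth_on_norm]]) (use assms in auto)
  then have "pd b (\<lambda>x. (x \<bullet> c) * inverse (norm x)) x = ((b \<bullet> c) - ed b x * ed c x) / norm x"
    unfolding 1 2 using assms(1) by (simp add: ed_def field_simps power2_eq_square)
  then show ?thesis using assms by (simp add: ed_def[abs_def] divide_inverse inner_Basis)
qed

lemma sum_ed_sq: "x \<noteq> 0 \<Longrightarrow> (\<Sum>b\<in>Basis. (ed b x)\<^sup>2) = 1"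
proof -
  assume "x \<noteq> 0"
  have "(\<Sum>b\<in>Basis. (ed b x)\<^sup>2) = (\<Sum>b\<in>Basis. (x \<bullet> b) * (x \<bullet> b)) / (norm x)\<^sup>2"
    by (simp add: ed_def power_divide sum_divide_distrib power2_eq_square)
  also have "(\<Sum>b\<in>Basis. (x \<bullet> b) * (x \<bullet> b)) = (norm x)\<^sup>2"
    using euclidean_inner[of x x] by (simp add: power2_norm_eq_inner)
  finally show ?thesis using \<open>x \<noteq> 0\<close> by simp
qed

lemma abs_ed_le: "b \<in> Basis \<Longrightarrow> \<bar>ed b x\<bar> \<le> 1"
  using Basis_le_norm[of b x] by (cases "x = 0") (auto simp: ed_def)

lemma div_ed: "x \<noteq> 0 \<Longrightarrow> (\<Sum>b\<in>Basis. pd b (ed b) x) = (real DIM('a) - 1) / norm x" for x :: "'a::euclidean_space"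
proof -
  assume x: "x \<noteq> 0"
  have "(\<Sum>b\<in>Basis. pd b (ed b) x) = (\<Sum>b\<in>Basis. (1 - (ed b x)\<^sup>2) / norm x)"
    by (intro sum.cong refl) (simp add: pd_ed[OF x] power2_eq_square)
  also have "\<dots> = (real DIM('a) - (\<Sum>b\<in>Basis. (ed b x)\<^sup>2)) / norm x"
    by (simp add: sum_divide_distrib[symmetric] sum_subtractf)
  finally show ?thesis using sum_ed_sq[OF x] by simp
qed

lemma rd_radial: "(f has_real_derivative d) (at (norm x)) \<Longrightarrow> x \<noteq> 0 \<Longrightarrow> rd (\<lambda>x. f (norm x)) x = d"
  using sum_ed_sq[of x] by (simp add: rd_def pd_radial mult.left_commute power2_eq_square sum_distrib_left[symmetric])

lemma rd_mult:
  assumes "smooth_on pct f" "smooth_on pct g" "x \<noteq> 0"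
  shows "rd (\<lambda>x. f x * g x) x = f x * rd g x + rd f x * g x"
proof -
  have "pd b (\<lambda>x. f x * g x) x = f x * pd b g x + pd b f x * g x" for b
    by (rule pd_smooth_mult[OF assms(1,2)]) (use assms in auto)
  then show ?thesis by (simp add: rd_def sum.distrib sum_distrib_left sum_distrib_right algebra_simps)
qed

text \<open>Identifies \<open>rd\<close> with the directional derivative used in
  \<open>has_distributional_radial_derivative\<close>.\<close>

lemma rd_linear_direction:
  assumes "f differentiable at x"
  shows "frechet_derivative f (at x) (x /\<^sub>R norm x) = rd f x"
proof -
  have l: "linear (frechet_derivative f (at x))"
    using assms by (rule linear_frechet_derivative)
  have "x /\<^sub>R norm x = (\<Sum>b\<in>Basis. ed b x *\<^sub>R b)"
    unfolding ed_def by (subst euclidean_representation[of x, symmetric])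
      (simp add: scaleR_sum_right divide_inverse mult.commute)
  then show ?thesis by (simp add: linear_sum[OF l] linear_scale[OF l] rd_def pd_def)
qed

lemma cauchy_schwarz_rd:
  assumes "x \<noteq> 0"
  shows "(rd v x)\<^sup>2 \<le> (\<Sum>b\<in>Basis. (pd b v x)\<^sup>2)"
proof -
  have "(rd v x)\<^sup>2 \<le> (\<Sum>b\<in>Basis. (ed b x)\<^sup>2) * (\<Sum>b\<in>Basis. (pd b v x)\<^sup>2)"
    unfolding rd_def by (rule Cauchy_Schwarz_ineq_sum)
  then show ?thesis by (simp add: sum_ed_sq[OF assms])
qed

lemma divergence_theorem_pct:
  assumes F: "\<And>b. b \<in> Basis \<Longrightarrow> smooth_on pct (F b)" and \<eta>: "\<eta> > 0"
    and z: "\<And>b x. b \<in> Basis \<Longrightarrow> norm x < \<eta> \<Longrightarrow> F b x = 0" "\<And>b x. b \<in> Basis \<Longrightarrow> norm x > R \<Longrightarrow> F b x = 0"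
  shows "(\<integral>x. (\<Sum>b\<in>Basis. pd b (F b) x) \<partial>lborel) = 0"
proof -
  have "smooth_on UNIV (F b)" if "b \<in> Basis" for b
    by (rule smooth_on_glue_0[OF F[OF that] z(1)[OF that] \<eta>])
  note i = integral_pd_eq_0[OF this z(2)]
  have "(\<integral>x. (\<Sum>b\<in>Basis. pd b (F b) x) \<partial>lborel) = (\<Sum>b\<in>Basis. \<integral>x. pd b (F b) x \<partial>lborel)"
    by (rule Bochner_Integration.integral_sum) (rule i(1))
  also have "\<dots> = 0" by (intro sum.neutral ballI i(2))
  finally show ?thesis .
qed

lemma measurable_pct: "continuous_on pct f \<Longrightarrow> f \<in> borel_measurable borel" for f :: "'a::euclidean_space \<Rightarrow> real"
  by (rule borel_measurable_continuous_countable_exceptions[of "{0}"]) auto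

lemma AE_nonzero: "AE x in lborel. x \<noteq> (0::'a::euclidean_space)"
  by (rule AE_lborel_singleton)

lemma integrable_bounded_support:
  fixes f :: "'a::euclidean_space \<Rightarrow> real"
  assumes [measurable]: "f \<in> borel_measurable borel" and "AE x in lborel. \<bar>f x\<bar> \<le> C" "\<And>x. norm x > R \<Longrightarrow> f x = 0"
  shows "integrable lborel f"
proof (rule Bochner_Integration.integrable_bound)
  show "integrable lborel (\<lambda>x::'a. \<bar>C\<bar> * indicator (cball 0 R) x)"
    using emeasure_lborel_cball_finite[of "0::'a" R] by (intro integrable_mult_right integrable_real_indicator) auto
  show "AE x in lborel. norm (f x) \<le> norm (\<bar>C\<bar> * indicator (cball 0 R) x :: real)"
    using assms(2)
  proof eventually_elim
    case (elim x)
    then show ?case using assms(3)[of x] by (cases "norm x > R") (auto simp: indicator_def)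
  qed
qed auto

text \<open>The divergence theorem for the field f(r) g(x) x/r; the summand with (n - 1)/r is the
  divergence of the radial unit field. The indicator discards the origin, where the formulas have no
  meaning.\<close>

lemma radial_parts:
  fixes g :: "'a::euclidean_space \<Rightarrow> real"
  assumes f: "smooth_on {0<..} f" "\<And>r. r > 0 \<Longrightarrow> (f has_real_derivative f1 r) (at r)" "\<And>r. 0 < r \<Longrightarrow> r < \<eta> \<Longrightarrow> f r = 0" "\<eta> > 0"
    and g: "smooth_on pct g" "\<And>x. norm x > R \<Longrightarrow> g x = 0"
  shows "(\<integral>x. indicator pct x * (f1 (norm x) * g x + f (norm x) * rd g x + (real DIM('a) - 1) / norm x * f (norm x) * g x) \<partial>lborel) = 0"
proof -
  define F where "F = (\<lambda>b x. indicator pct x * (ed b x * (f (norm x) * g x)))"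
  define G where "G = (\<lambda>x. f (norm x) * g x)"
  have G: "smooth_on pct G" unfolding G_def by (intro smooth_on_mult smooth_radial f g open_pct)
  have s: "smooth_on pct (F b)" for b
    by (rule smooth_on_cong[OF open_pct _ smooth_on_mult[OF open_pct smooth_ed[of b] G]]) (simp add: F_def G_def)
  have "(\<integral>x. (\<Sum>b\<in>Basis. pd b (F b) x) \<partial>lborel) = 0"
    by (rule divergence_theorem_pct[OF s f(4), where R = R]) (auto simp: F_def f(3) g(2) indicator_def)
  moreover have pw: "(\<Sum>b\<in>Basis. pd b (F b) x) = f1 (norm x) * g x + f (norm x) * rd g x + (real DIM('a) - 1) / norm x * f (norm x) * g x"
    if x: "x \<noteq> 0" for x
  proof -
    have "pd b (F b) x = ed b x * pd b G x + pd b (ed b) x * G x" for b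
      using pd_cong[OF open_pct, of x "F b" "\<lambda>x. ed b x * G x" b] x pd_smooth_mult[OF smooth_ed[of b] G, of x b]
      by (simp add: F_def G_def)
    then have "(\<Sum>b\<in>Basis. pd b (F b) x) = rd G x + (real DIM('a) - 1) / norm x * G x"
      using div_ed[OF x] by (simp add: rd_def sum.distrib sum_distrib_right[symmetric])
    also have "rd G x = f (norm x) * rd g x + f1 (norm x) * g x"
      unfolding G_def using x by (simp add: rd_mult[OF smooth_radial[OF f(1)] g(1) x] rd_radial[OF f(2)])
    finally show ?thesis by (simp add: G_def)
  qed
  moreover have "(\<integral>x. (\<Sum>b\<in>Basis. pd b (F b) x) \<partial>lborel) = (\<integral>x. indicator pct x * (\<Sum>b\<in>Basis. pd b (F b) x) \<partial>lborel)"
  proof (rule integral_cong_AE)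
    show "AE x in lborel. (\<Sum>b\<in>Basis. pd b (F b) x) = indicator pct x * (\<Sum>b\<in>Basis. pd b (F b) x)"
      using AE_nonzero by eventually_elim simp
    have [measurable]: "pd b (F b) \<in> borel_measurable borel" if "b \<in> Basis" for b
      by (intro measurable_pct smooth_on_continuous smooth_on_pd s that)
    show "(\<lambda>x. \<Sum>b\<in>Basis. pd b (F b) x) \<in> borel_measurable lborel"
      "(\<lambda>x. indicator pct x * (\<Sum>b\<in>Basis. pd b (F b) x)) \<in> borel_measurable lborel" by measurable
  qed
  moreover have "(\<integral>x. indicator pct x * (\<Sum>b\<in>Basis. pd b (F b) x) \<partial>lborel)
    = (\<integral>x. indicator pct x * (f1 (norm x) * g x + f (norm x) * rd g x + (real DIM('a) - 1) / norm x * f (norm x) * g x) \<partial>lborel)"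
  proof (intro Bochner_Integration.integral_cong refl)
    fix x :: 'a
    show "indicator pct x * (\<Sum>b\<in>Basis. pd b (F b) x)
      = indicator pct x * (f1 (norm x) * g x + f (norm x) * rd g x + (real DIM('a) - 1) / norm x * f (norm x) * g x)"
    proof (cases "x = 0")
      case False
      show ?thesis by (simp only: pw[OF False])
    qed simp
  qed
  ultimately show ?thesis by simp
qed

text \<open>The commutator of a partial derivative with the radial one is the tangential part of the
  gradient divided by r, by the Hessian of the norm.\<close>

lemma pd_rd:
  fixes v :: "'a::euclidean_space \<Rightarrow> real"
  assumes v: "smooth_on pct v" and x: "x \<noteq> 0" and b: "b \<in> Basis"
  shows "pd b (rd v) x = (\<Sum>c\<in>Basis. ed c x * pd b (pd c v) x) + (pd b v x - ed b x * rd v x) / norm x"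
proof -
  have "pd b (rd v) x = (\<Sum>c\<in>Basis. pd b (\<lambda>x. ed c x * pd c v x) x)"
    unfolding rd_def[abs_def]
    by (rule pd_smooth_sum[OF open_pct]) (use x in \<open>auto intro!: smooth_on_mult[OF open_pct] smooth_ed smooth_on_pd v\<close>)
  also have "\<dots> = (\<Sum>c\<in>Basis. ed c x * pd b (pd c v) x + pd b (ed c) x * pd c v x)"
    by (rule sum.cong[OF refl], rule pd_smooth_mult[OF smooth_ed smooth_on_pd[OF v]]) (use x in auto)
  also have "\<dots> = (\<Sum>c\<in>Basis. ed c x * pd b (pd c v) x) + (\<Sum>c\<in>Basis. ((if b = c then 1 else 0) - ed b x * ed c x) / norm x * pd c v x)"
    by (simp add: sum.distrib pd_ed[OF x b])
  also have "(\<Sum>c\<in>Basis. ((if b = c then 1 else 0) - ed b x * ed c x) / norm x * pd c v x)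
    = (\<Sum>c\<in>Basis. (if b = c then pd c v x / norm x else 0)) - (\<Sum>c\<in>Basis. ed b x * (ed c x * pd c v x) / norm x)"
    unfolding sum_subtractf[symmetric] by (intro sum.cong refl) (simp add: field_simps diff_divide_distrib)
  also have "\<dots> = (pd b v x - ed b x * rd v x) / norm x"
    using b by (simp add: rd_def sum_distrib_left[symmetric] sum_divide_distrib[symmetric] diff_divide_distrib)
  finally show ?thesis .
qed

section \<open>The squared gradient and the Morawetz identity\<close>

definition grad2 :: "('a::euclidean_space \<Rightarrow> real) \<Rightarrow> 'a \<Rightarrow> real" where
  "grad2 v x = (\<Sum>b\<in>Basis. (pd b v x)\<^sup>2)"

lemma smooth_grad2: "smooth_on pct v \<Longrightarrow> smooth_on pct (grad2 v)"
proof -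
  assume "smooth_on pct v"
  then have "smooth_on pct (\<lambda>x. \<Sum>b\<in>Basis. (pd b v x)\<^sup>2)" by (intro smooth_on_sum smooth_on_power smooth_on_pd open_pct)
  then show ?thesis by (simp add: grad2_def[abs_def])
qed

lemma rd_grad2:
  assumes v: "smooth_on pct v" and x: "x \<noteq> 0"
  shows "rd (grad2 v) x = 2 * (\<Sum>b\<in>Basis. \<Sum>c\<in>Basis. ed c x * pd b v x * pd b (pd c v) x)"
proof -
  have "pd c (grad2 v) x = (\<Sum>b\<in>Basis. 2 * (pd b v x * pd b (pd c v) x))" if c: "c \<in> Basis" for c
  proof -
    have "pd c (grad2 v) x = (\<Sum>b\<in>Basis. pd c (\<lambda>x. (pd b v x)\<^sup>2) x)"
      unfolding grad2_def[abs_def]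
      by (rule pd_smooth_sum[OF open_pct]) (use x in \<open>auto intro!: smooth_on_power[OF open_pct] smooth_on_pd v\<close>)
    also have "\<dots> = (\<Sum>b\<in>Basis. 2 * (pd b v x * pd b (pd c v) x))"
    proof (intro sum.cong refl)
      fix b :: 'a assume b: "b \<in> Basis"
      have "pd c (\<lambda>x. pd b v x * pd b v x) x = pd b v x * pd c (pd b v) x + pd c (pd b v) x * pd b v x"
        using x by (intro pd_smooth_mult[OF smooth_on_pd[OF v b] smooth_on_pd[OF v b]]) auto
      moreover have "pd c (pd b v) x = pd b (pd c v) x" by (rule pd_commute[OF open_pct _ v c b]) (use x in auto)
      ultimately show "pd c (\<lambda>x. (pd b v x)\<^sup>2) x = 2 * (pd b v x * pd b (pd c v) x)" by (simp add: power2_eq_square)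
    qed
    finally show ?thesis .
  qed
  then have "rd (grad2 v) x = (\<Sum>c\<in>Basis. \<Sum>b\<in>Basis. 2 * (ed c x * pd b v x * pd b (pd c v) x))"
    unfolding rd_def by (intro sum.cong refl) (simp add: sum_distrib_left algebra_simps)
  also have "\<dots> = 2 * (\<Sum>b\<in>Basis. \<Sum>c\<in>Basis. ed c x * pd b v x * pd b (pd c v) x)"
    by (subst sum.swap) (simp add: sum_distrib_left)
  finally show ?thesis .
qed

text \<open>The Morawetz identity for the multiplier k d/dr + \<mu>. The value of \<mu> is the one
  for which \<mu> |grad v|^2 cancels the contribution (n - 1) k / (2 r) |grad v|^2 from the
  divergence of the radial field. There remain the radial part with coefficient k'/2, the angular
  part with k/r - k'/2, and a mixed term with \<mu>'.\<close>

lemma morawetz_pointwise: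
  fixes v :: "'a::euclidean_space \<Rightarrow> real"
  assumes v: "smooth_on pct v" and x: "x \<noteq> 0"
    and k: "smooth_on {0<..} k" "\<And>r. r > 0 \<Longrightarrow> (k has_real_derivative k1 r) (at r)"
    and \<mu>: "smooth_on {0<..} \<mu>" "\<And>r. r > 0 \<Longrightarrow> (\<mu> has_real_derivative \<mu>1 r) (at r)"
      "\<mu> (norm x) = (real DIM('a) - 1) / 2 * (k (norm x) / norm x)"
  shows "(\<Sum>b\<in>Basis. pd b (\<lambda>x. - pd b v x * (k (norm x) * rd v x + \<mu> (norm x) * v x) + ed b x * (k (norm x) * grad2 v x) / 2) x)
    = - lap v x * (k (norm x) * rd v x + \<mu> (norm x) * v x)
      - (k1 (norm x) / 2 * (rd v x)\<^sup>2 + (k (norm x) / norm x - k1 (norm x) / 2) * (grad2 v x - (rd v x)\<^sup>2) + \<mu>1 (norm x) * v x * rd v x)"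
proof -
  define K M where "K = (\<lambda>x::'a. k (norm x))" and "M = (\<lambda>x::'a. \<mu> (norm x))"
  have xp: "x \<in> pct" "norm x > 0" using x by auto
  have sK: "smooth_on pct K" "smooth_on pct M" unfolding K_def M_def by (intro smooth_radial k \<mu>)+
  note sr = smooth_rd[OF v] and sg = smooth_grad2[OF v] and sp = smooth_on_pd[OF v]
  note mult = smooth_on_mult[OF open_pct] and add = smooth_on_add[OF open_pct]
  define X where "X = (\<lambda>x. K x * rd v x + M x * v x)"
  have sX: "smooth_on pct X" unfolding X_def by (intro add mult sK sr v)
  have dK: "pd b K x = k1 (norm x) * ed b x" and dM: "pd b M x = \<mu>1 (norm x) * ed b x" for b
    unfolding K_def M_def using xp by (auto intro!: pd_radial k \<mu> x)
  have pX: "pd b X x = K x * pd b (rd v) x + k1 (norm x) * ed b x * rd v x + (M x * pd b v x + \<mu>1 (norm x) * ed b x * v x)" for b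
    unfolding X_def pd_smooth_add[OF mult[OF sK(1) sr] mult[OF sK(2) v] xp(1)]
      pd_smooth_mult[OF sK(1) sr xp(1)] pd_smooth_mult[OF sK(2) v xp(1)] dK dM by simp
  have trm: "pd b (\<lambda>x. - pd b v x * X x + ed b x * (K x * grad2 v x) / 2) x
     = - pd b (pd b v) x * X x - pd b v x * pd b X x + (ed b x * pd b (\<lambda>x. K x * grad2 v x) x + pd b (ed b) x * (K x * grad2 v x)) / 2"
    if b: "b \<in> Basis" for b
  proof -
    have s1: "smooth_on pct (\<lambda>x. pd b v x * X x)" "smooth_on pct (\<lambda>x. ed b x * (K x * grad2 v x))"
      by (intro mult sp b sX smooth_ed sK sg)+
    have "pd b (\<lambda>x. (-1) * (pd b v x * X x) + (1/2) * (ed b x * (K x * grad2 v x))) x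
      = (-1) * pd b (\<lambda>x. pd b v x * X x) x + (1/2) * pd b (\<lambda>x. ed b x * (K x * grad2 v x)) x"
      by (rule trans[OF pd_smooth_add[OF mult[OF smooth_on_const[OF open_pct] s1(1)] mult[OF smooth_on_const[OF open_pct] s1(2)] xp(1)]])
        (simp only: pd_smooth_cmult[OF s1(1,1) xp(1)] pd_smooth_cmult[OF s1(2,2) xp(1)])
    also have "\<dots> = - (pd b v x * pd b X x + pd b (pd b v) x * X x) + (ed b x * pd b (\<lambda>x. K x * grad2 v x) x + pd b (ed b) x * (K x * grad2 v x)) / 2"
      unfolding pd_smooth_mult[OF sp[OF b] sX xp(1)] pd_smooth_mult[OF smooth_ed mult[OF sK(1) sg] xp(1)] by simp
    finally show ?thesis by (simp add: algebra_simps)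
  qed
  have "(\<Sum>b\<in>Basis. pd b (\<lambda>x. - pd b v x * X x + ed b x * (K x * grad2 v x) / 2) x)
    = (\<Sum>b\<in>Basis. - pd b (pd b v) x * X x - pd b v x * pd b X x + (ed b x * pd b (\<lambda>x. K x * grad2 v x) x + pd b (ed b) x * (K x * grad2 v x)) / 2)"
    by (intro sum.cong refl trm)
  also have "\<dots> = - lap v x * X x - (\<Sum>b\<in>Basis. pd b v x * pd b X x)
     + (rd (\<lambda>x. K x * grad2 v x) x + (\<Sum>b\<in>Basis. pd b (ed b) x) * (K x * grad2 v x)) / 2"
    by (simp add: sum.distrib sum_subtractf sum_distrib_right[symmetric] sum_divide_distrib[symmetric] lap_def rd_def sum_negf)
  also have "rd (\<lambda>x. K x * grad2 v x) x = K x * rd (grad2 v) x + k1 (norm x) * grad2 v x"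
    unfolding rd_mult[OF sK(1) sg x] unfolding K_def using rd_radial[OF k(2)[OF xp(2)] x] by simp
  also have "(\<Sum>b\<in>Basis. pd b v x * pd b X x)
    = K x * (\<Sum>b\<in>Basis. pd b v x * pd b (rd v) x) + k1 (norm x) * (rd v x)\<^sup>2 + M x * grad2 v x + \<mu>1 (norm x) * v x * rd v x"
  proof -
    have "pd b v x * pd b X x = K x * (pd b v x * pd b (rd v) x) + k1 (norm x) * rd v x * (ed b x * pd b v x)
       + (M x * (pd b v x)\<^sup>2 + \<mu>1 (norm x) * v x * (ed b x * pd b v x))" for b
      unfolding pX by (simp add: algebra_simps power2_eq_square)
    then have "(\<Sum>b\<in>Basis. pd b v x * pd b X x) = K x * (\<Sum>b\<in>Basis. pd b v x * pd b (rd v) x)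
      + k1 (norm x) * rd v x * rd v x + (M x * grad2 v x + \<mu>1 (norm x) * v x * rd v x)"
      by (simp add: sum.distrib sum_distrib_left[symmetric] rd_def grad2_def)
    then show ?thesis by (simp add: power2_eq_square)
  qed
  also have "(\<Sum>b\<in>Basis. pd b v x * pd b (rd v) x) = rd (grad2 v) x / 2 + (grad2 v x - (rd v x)\<^sup>2) / norm x"
  proof -
    have "pd b v x * pd b (rd v) x = (\<Sum>c\<in>Basis. ed c x * pd b v x * pd b (pd c v) x) + ((pd b v x)\<^sup>2 - rd v x * (ed b x * pd b v x)) / norm x"
      if "b \<in> Basis" for b
      unfolding pd_rd[OF v x that] by (simp add: distrib_left sum_distrib_left power2_eq_square algebra_simps)
    then have "(\<Sum>b\<in>Basis. pd b v x * pd b (rd v) x) = (\<Sum>b\<in>Basis. \<Sum>c\<in>Basis. ed c x * pd b v x * pd b (pd c v) x)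
       + (grad2 v x - rd v x * rd v x) / norm x"
      by (simp add: sum.distrib sum_subtractf sum_divide_distrib[symmetric] sum_distrib_left[symmetric] grad2_def)
        (simp add: rd_def)
    then show ?thesis unfolding rd_grad2[OF v x] by (simp add: power2_eq_square)
  qed
  also have "(\<Sum>b\<in>Basis. pd b (ed b) x) = (real DIM('a) - 1) / norm x" by (rule div_ed[OF x])
  finally have "(\<Sum>b\<in>Basis. pd b (\<lambda>x. - pd b v x * X x + ed b x * (K x * grad2 v x) / 2) x) =
    - lap v x * X x - (K x * (rd (grad2 v) x / 2 + (grad2 v x - (rd v x)\<^sup>2) / norm x) + k1 (norm x) * (rd v x)\<^sup>2 + M x * grad2 v x + \<mu>1 (norm x) * v x * rd v x)
    + (K x * rd (grad2 v) x + k1 (norm x) * grad2 v x + (real DIM('a) - 1) / norm x * (K x * grad2 v x)) / 2" .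
  also have "\<dots> = - lap v x * X x
      - (k1 (norm x) / 2 * (rd v x)\<^sup>2 + (K x / norm x - k1 (norm x) / 2) * (grad2 v x - (rd v x)\<^sup>2) + \<mu>1 (norm x) * v x * rd v x)"
    unfolding K_def M_def \<mu>(3) using xp(2) by (simp add: field_simps)
  finally show ?thesis unfolding X_def K_def M_def .
qed

section \<open>The multiplier inequality\<close>

text \<open>The first-order term of the conjugated operator is 2 h \<psi> times d/dr + (n - 1)/(2r),
  the operator that is also used as multiplier. Paired with w times it, this term is a nonnegative
  square as soon as \<psi> and w are nonnegative.\<close>

lemma conjugated_laplacian:
  fixes u :: "'a::euclidean_space \<Rightarrow> real"
  assumes u: "smooth_on pct u" and x: "x \<noteq> 0" and h: "h \<noteq> 0"
    and \<phi>: "smooth_on {0<..} \<phi>" "\<And>r. r > 0 \<Longrightarrow> (\<phi> has_real_derivative \<psi> r) (at r)"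
      "\<And>r. r > 0 \<Longrightarrow> (\<psi> has_real_derivative \<psi>1 r) (at r)" and \<psi>: "smooth_on {0<..} \<psi>"
  defines "v \<equiv> \<lambda>x. exp (\<phi> (norm x) / h) * u x"
  shows rd_conj: "rd v x = exp (\<phi> (norm x) / h) * (rd u x + \<psi> (norm x) / h * u x)"
    and pd_conj: "pd b v x = exp (\<phi> (norm x) / h) * (pd b u x + \<psi> (norm x) / h * ed b x * u x)"
    and lap_conj: "exp (\<phi> (norm x) / h) * (- (h\<^sup>2) * lap u x) = - (h\<^sup>2) * lap v x
      + 2 * h * \<psi> (norm x) * (rd v x + (real DIM('a) - 1) / 2 / norm x * v x) + (h * \<psi>1 (norm x) - (\<psi> (norm x))\<^sup>2) * v x"
    and smooth_conj: "smooth_on pct v"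
proof -
  define X where "X = (\<lambda>x::'a. exp (\<phi> (norm x) / h))"
  define P where "P = (\<lambda>x::'a. \<psi> (norm x) / h)"
  have xp: "x \<in> pct" "norm x > 0" using x by auto
  note mult = smooth_on_mult[OF open_pct] and add = smooth_on_add[OF open_pct]
  have sX: "smooth_on pct X"
  proof -
    have "smooth_on {0<..} (\<lambda>r. exp (\<phi> r * (1 / h)))"
      by (rule smooth_on_compose[OF smooth_on_exp smooth_on_mult[OF _ \<phi>(1) smooth_on_const]]) auto
    from smooth_radial[OF this] show ?thesis by (simp add: X_def)
  qed
  have sP: "smooth_on pct P"
  proof -
    have "smooth_on {0<..} (\<lambda>r. \<psi> r * (1 / h))" by (rule smooth_on_mult[OF _ \<psi> smooth_on_const]) auto
    from smooth_radial[OF this] show ?thesis by (simp add: P_def)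
  qed
  have v: "v = (\<lambda>x. X x * u x)" by (simp add: v_def X_def)
  show "smooth_on pct v" unfolding v by (rule mult[OF sX u])
  have pX: "pd b X y = X y * P y * ed b y" if y: "y \<noteq> 0" for b y
  proof -
    have "((\<lambda>r. exp (\<phi> r / h)) has_real_derivative exp (\<phi> (norm y) / h) * (\<psi> (norm y) / h)) (at (norm y))"
      using \<phi>(2)[of "norm y"] y h by (auto intro!: derivative_eq_intros)
    from pd_radial[OF this y] show ?thesis by (simp add: X_def P_def)
  qed
  have pP: "pd b P x = \<psi>1 (norm x) / h * ed b x" for b
    unfolding P_def by (rule pd_radial[OF _ x]) (use \<phi>(3)[OF xp(2)] h in \<open>auto intro!: derivative_eq_intros\<close>)
  have pv: "pd b v y = X y * pd b u y + (X y * P y) * ed b y * u y" if y: "y \<noteq> 0" for b y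
    using pd_smooth_mult[OF sX u, of y b] y unfolding v by (simp add: pX[OF y])
  then show "pd b v x = exp (\<phi> (norm x) / h) * (pd b u x + \<psi> (norm x) / h * ed b x * u x)"
    using x by (simp add: X_def P_def algebra_simps)
  have rdv: "rd v x = X x * (rd u x + P x * u x)"
  proof -
    have "rd v x = (\<Sum>b\<in>Basis. X x * (ed b x * pd b u x) + (X x * P x * u x) * (ed b x)\<^sup>2)"
      unfolding rd_def by (intro sum.cong refl) (simp add: pv[OF x] algebra_simps power2_eq_square)
    also have "\<dots> = X x * rd u x + X x * P x * u x"
      by (simp add: sum.distrib sum_distrib_left[symmetric] sum_ed_sq[OF x] rd_def)
    finally show ?thesis by (simp add: algebra_simps)
  qed
  then show "rd v x = exp (\<phi> (norm x) / h) * (rd u x + \<psi> (norm x) / h * u x)" by (simp add: X_def P_def)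
  have sXP: "smooth_on pct (\<lambda>y. X y * P y)" by (rule mult[OF sX sP])
  have ppv: "pd b (pd b v) x = X x * pd b (pd b u) x + X x * P x * ed b x * pd b u x
      + ((X x * P x) * ed b x * pd b u x + ((X x * P x) * pd b (ed b) x + (X x * (\<psi>1 (norm x) / h * ed b x) + X x * P x * ed b x * P x) * ed b x) * u x)"
    if b: "b \<in> Basis" for b
  proof -
    have su: "smooth_on pct (pd b u)" by (rule smooth_on_pd[OF u b])
    have sXe: "smooth_on pct (\<lambda>y. (X y * P y) * ed b y)" by (rule mult[OF sXP smooth_ed])
    have "pd b (pd b v) x = pd b (\<lambda>y. X y * pd b u y + (X y * P y) * ed b y * u y) x"
      by (rule pd_cong[OF open_pct xp(1)]) (simp add: pv)
    also have "\<dots> = X x * pd b (pd b u) x + pd b X x * pd b u x + ((X x * P x) * ed b x * pd b u x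
        + ((X x * P x) * pd b (ed b) x + (X x * pd b P x + pd b X x * P x) * ed b x) * u x)"
      unfolding pd_smooth_add[OF mult[OF sX su] mult[OF sXe u] xp(1)] pd_smooth_mult[OF sX su xp(1)]
        pd_smooth_mult[OF sXe u xp(1)] pd_smooth_mult[OF sXP smooth_ed xp(1)] pd_smooth_mult[OF sX sP xp(1)] by simp
    finally show ?thesis by (simp add: pX[OF x] pP)
  qed
  have "lap v x = (\<Sum>b\<in>Basis. X x * pd b (pd b u) x + (2 * X x * P x) * (ed b x * pd b u x)
     + (X x * P x * u x) * pd b (ed b) x + (X x * u x * (\<psi>1 (norm x) / h + P x * P x)) * (ed b x)\<^sup>2)"
    unfolding lap_def by (intro sum.cong refl) (simp add: ppv algebra_simps power2_eq_square)
  also have "\<dots> = X x * lap u x + (2 * X x * P x) * rd u x + (X x * P x * u x) * ((real DIM('a) - 1) / norm x)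
     + X x * u x * (\<psi>1 (norm x) / h + P x * P x)"
    by (simp add: sum.distrib sum_distrib_left[symmetric] sum_ed_sq[OF x] div_ed[OF x] rd_def lap_def)
  finally have L: "lap v x = X x * lap u x + (2 * X x * P x) * rd u x + (X x * P x * u x) * ((real DIM('a) - 1) / norm x)
     + X x * u x * (\<psi>1 (norm x) / h + P x * P x)" .
  have "X x * (- (h\<^sup>2) * lap u x) = - (h\<^sup>2) * lap v x
      + 2 * h * (h * P x) * (rd v x + (real DIM('a) - 1) / 2 / norm x * v x) + (h * \<psi>1 (norm x) - (h * P x)\<^sup>2) * v x"
    unfolding L rdv using h xp(2) by (simp add: v field_simps power2_eq_square)
  then show "exp (\<phi> (norm x) / h) * (- (h\<^sup>2) * lap u x) = - (h\<^sup>2) * lap v x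
      + 2 * h * \<psi> (norm x) * (rd v x + (real DIM('a) - 1) / 2 / norm x * v x) + (h * \<psi>1 (norm x) - (\<psi> (norm x))\<^sup>2) * v x"
    using h by (simp add: X_def P_def)
qed

lemma smooth_on_DERIV_smooth:
  assumes "smooth_on {0<..} f" "\<And>r. r > 0 \<Longrightarrow> (f has_real_derivative f1 r) (at r)"
  shows "smooth_on {0<..} f1"
proof (rule smooth_on_cong[OF _ _ smooth_on_pd[OF assms(1), of 1]])
  fix r :: real assume "r \<in> {0<..}"
  then show "pd 1 f r = f1 r" using smooth_on_DERIV[OF assms(1), of r] assms(2)[of r] DERIV_unique by auto
qed auto

text \<open>
  The integrand of the multiplier inequality at a point: \<open>i\<close>, \<open>R\<close>, \<open>G\<close>, \<open>L\<close> stand for \<open>1/r\<close>, \<open>\<partial>\<^sub>r v\<close>,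
  \<open>|\<nabla>v|\<^sup>2\<close>, \<open>\<Delta>v\<close>, and \<open>\<kappa>\<close> is a cutoff near the origin. The last four summands on the right integrate
  to something nonnegative. This is where \<open>n \<noteq> 2\<close> is needed.
\<close>

lemma carleman_algebra:
  fixes w w1 w2 \<kappa> \<kappa>1 i R v G L V T T1 h E q qq n \<psi> c :: real
  assumes k: "k = w * \<kappa>" and k1: "k1 = w1 * \<kappa> + w * \<kappa>1"
    and m1: "m1 = w1 * i - w * i\<^sup>2" and m2: "m2 = w2 * i - 2 * w1 * i\<^sup>2 + 2 * w * i^3"
    and n: "n = 1 \<or> n \<ge> 3" and pos: "h > 0" "\<kappa> \<ge> 0" "\<kappa>1 \<ge> 0" "w \<ge> 0" "w1 \<ge> 0" "i > 0" "\<psi> \<ge> 0" "G \<ge> R\<^sup>2"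
    and conc: "w2 \<le> 0" "w1 \<le> w * i" and key: "w1 * T + w * T1 \<ge> E / 2 * w1 + w1 * qq + w * q" and V: "V \<le> qq"
  shows "k * (R + (n - 1) / 2 * i * v) * (- (h\<^sup>2) * L + 2 * h * \<psi> * (R + (n - 1) / 2 * i * v) + (V - T) * v)
    \<ge> \<kappa> * (w1 * (h\<^sup>2 / 2 * R\<^sup>2 + E / 4 * v\<^sup>2))
     + w * \<kappa>1 * (h\<^sup>2 / 2 * R\<^sup>2 - h\<^sup>2 / 2 * (G - R\<^sup>2) + (T - V) / 2 * v\<^sup>2 + h\<^sup>2 * ((n - 1) / 2) * i * v * R)
     + h\<^sup>2 * (- L * (k * R + (n - 1) / 2 * (k * i) * v) - (k1 / 2 * R\<^sup>2 + (k * i - k1 / 2) * (G - R\<^sup>2) + (n - 1) / 2 * (m1 * \<kappa> + w * i * \<kappa>1) * v * R))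
     - ((k1 * T + k * T1) * (v\<^sup>2 / 2) + k * T * (v * R) + (n - 1) * i * (k * T) * (v\<^sup>2 / 2))
     + h\<^sup>2 * ((n - 1) / 2) * ((\<kappa>1 * m1 + \<kappa> * m2) * (v\<^sup>2 / 2) + \<kappa> * m1 * (v * R) + (n - 1) * i * (\<kappa> * m1) * (v\<^sup>2 / 2))
     + (V * (k1 * v\<^sup>2 + 2 * k * v * (R + (n - 1) / 2 * i * v)) + q * k * v\<^sup>2) / 2"
    (is "?l \<ge> ?r")
proof -
  \<comment> \<open>The summands are the angular part, the square from the first-order term, the
    surplus of \<open>key\<close> together with V <= qq, a term with the derivative of the cutoff,
    and the zeroth-order term that depends on the dimension.\<close>
  have "?l - ?r = h\<^sup>2 * (\<kappa> * (w * i - w1 / 2) * (G - R\<^sup>2)) + 2 * h * \<psi> * (w * \<kappa>) * (R + (n - 1) / 2 * i * v)\<^sup>2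
    + \<kappa> * (v\<^sup>2 / 2) * ((w1 * T + w * T1 - E / 2 * w1 - w1 * qq - w * q) + w1 * (qq - V))
    + h\<^sup>2 * ((n - 1) / 2) * (v\<^sup>2 / 2) * (\<kappa>1 * (i * (w * i - w1))) + h\<^sup>2 * (v\<^sup>2 / 2) * \<kappa> * ((n - 1) / 2 * (- w2 * i) + (n - 1) / 2 * (n - 3) * (i\<^sup>2 * (w * i - w1)))"
    unfolding k k1 m1 m2 by (simp add: field_simps power2_eq_square power3_eq_cube)
  also have "\<dots> \<ge> 0"
  proof -
    have 1: "0 \<le> \<kappa> * (w * i - w1 / 2) * (G - R\<^sup>2)"
      using pos conc by (intro mult_nonneg_nonneg) auto
    have 2: "0 \<le> 2 * h * \<psi> * (w * \<kappa>) * (R + (n - 1) / 2 * i * v)\<^sup>2"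
      using pos by (intro mult_nonneg_nonneg) auto
    have 3: "0 \<le> \<kappa> * (v\<^sup>2 / 2) * ((w1 * T + w * T1 - E / 2 * w1 - w1 * qq - w * q) + w1 * (qq - V))"
      using pos key V by (intro mult_nonneg_nonneg add_nonneg_nonneg) auto
    have 4: "0 \<le> h\<^sup>2 * ((n - 1) / 2) * (v\<^sup>2 / 2) * (\<kappa>1 * (i * (w * i - w1)))"
      using pos conc n by (intro mult_nonneg_nonneg) auto
    \<comment> \<open>For n = 1 the first factor is zero; for n >= 3 every factor is nonnegative,
      the last one by w1 <= w i.\<close>
    have 5: "0 \<le> (n - 1) / 2 * (n - 3) * (i\<^sup>2 * (w * i - w1))"
      using n pos conc by (elim disjE) (auto intro!: mult_nonneg_nonneg)
    have 6: "0 \<le> (n - 1) / 2 * (- w2 * i)"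
      using n pos conc by (intro mult_nonneg_nonneg) auto
    have 7: "0 \<le> h\<^sup>2 * (v\<^sup>2 / 2) * \<kappa> * ((n - 1) / 2 * (- w2 * i) + (n - 1) / 2 * (n - 3) * (i\<^sup>2 * (w * i - w1)))"
      by (rule mult_nonneg_nonneg[OF _ add_nonneg_nonneg[OF 6 5]]) (use pos in simp)
    show ?thesis using 1 2 3 4 7 by (intro add_nonneg_nonneg mult_nonneg_nonneg[of "h\<^sup>2"]) auto
  qed
  finally show ?thesis by simp
qed

lemma smooth_integrable_pct:
  fixes f :: "'a::euclidean_space \<Rightarrow> real"
  assumes "smooth_on pct f" "\<And>x. norm x < \<eta> \<Longrightarrow> f x = 0" "\<eta> > 0" "\<And>x. norm x > R \<Longrightarrow> f x = 0"
  shows "integrable lborel f"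
  by (rule integrable_compact_support[OF smooth_on_continuous[OF smooth_on_glue_0[OF assms(1-3)]] assms(4)])

lemma bdd_meas_integrable:
  fixes f :: "'a::euclidean_space \<Rightarrow> real"
  assumes V: "bdd_meas V" and f: "integrable lborel f"
  shows "integrable lborel (\<lambda>x. V x * f x)"
proof -
  have [measurable]: "V \<in> borel_measurable borel" "f \<in> borel_measurable borel"
    using V f by (auto simp: bdd_meas_def)
  obtain M where M: "AE x in lborel. \<bar>V x\<bar> \<le> M" using V by (auto simp: bdd_meas_def)
  show ?thesis
  proof (rule Bochner_Integration.integrable_bound[OF integrable_mult_right[OF f, of M]])
    show "AE x in lborel. norm (V x * f x) \<le> norm (M * f x)"
      using M by eventually_elim (auto simp: abs_mult intro!: mult_right_mono)
  qed auto
qed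

text \<open>
  \<open>w\<close> is the multiplier and \<open>exp (\<phi> / h)\<close> the Carleman weight; \<open>w1, w2\<close> and \<open>\<psi>, \<psi>1, \<psi>2\<close> are the successive
  derivatives of \<open>w\<close> and \<open>\<phi>\<close>. The assumption \<open>V_dist\<close> is \<open>\<partial>\<^sub>r V \<le> (1 + r)\<^sup>-\<^sup>1\<^sup>-\<^sup>\<delta>\<close>, tested against
  nonnegative functions supported away from the origin.
\<close>

locale carleman =
  fixes w w1 w2 \<phi> \<psi> \<psi>1 \<psi>2 :: "real \<Rightarrow> real" and h E \<delta> B :: real and V :: "'a::euclidean_space \<Rightarrow> real"
  assumes h: "h > 0" and dim: "DIM('a) \<noteq> 2"
    and sw: "smooth_on {0<..} w" and s\<phi>: "smooth_on {0<..} \<phi>"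
    and dw: "\<And>r. r > 0 \<Longrightarrow> (w has_real_derivative w1 r) (at r)"
    and dw1: "\<And>r. r > 0 \<Longrightarrow> (w1 has_real_derivative w2 r) (at r)"
    and d\<phi>: "\<And>r. r > 0 \<Longrightarrow> (\<phi> has_real_derivative \<psi> r) (at r)"
    and d\<psi>: "\<And>r. r > 0 \<Longrightarrow> (\<psi> has_real_derivative \<psi>1 r) (at r)"
    and d\<psi>1: "\<And>r. r > 0 \<Longrightarrow> (\<psi>1 has_real_derivative \<psi>2 r) (at r)"
    and w_bounds: "\<And>r. r > 0 \<Longrightarrow> 0 \<le> w r" "\<And>r. r > 0 \<Longrightarrow> w r \<le> r" "\<And>r. r > 0 \<Longrightarrow> w r \<le> 1"
      "\<And>r. r > 0 \<Longrightarrow> 0 \<le> w1 r" "\<And>r. r > 0 \<Longrightarrow> w1 r \<le> 1" "\<And>r. r > 0 \<Longrightarrow> w1 r \<le> w r / r" "\<And>r. r > 0 \<Longrightarrow> w2 r \<le> 0"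
    and \<psi>_bounds: "\<And>r. r > 0 \<Longrightarrow> 0 \<le> \<psi> r" "\<And>r. r > 0 \<Longrightarrow> \<psi> r \<le> B" "\<And>r. r > 0 \<Longrightarrow> \<bar>\<psi>1 r\<bar> \<le> B" "\<And>r. r > 0 \<Longrightarrow> \<bar>\<phi> r\<bar> \<le> B"
    and key: "\<And>r. r > 0 \<Longrightarrow> w1 r * (E + (\<psi> r)\<^sup>2 - h * \<psi>1 r) + w r * (2 * \<psi> r * \<psi>1 r - h * \<psi>2 r)
      \<ge> E / 2 * w1 r + w1 r * (1 + r) powr (- \<delta>) + w r * (1 + r) powr (- 1 - \<delta>)"
    and V: "bdd_meas V" and V_le: "AE x in lborel. V x \<le> (1 + norm x) powr (- \<delta>)"
    and V_dist: "\<And>\<zeta> \<eta> R. smooth_on UNIV \<zeta> \<Longrightarrow> (\<And>x. norm x < \<eta> \<Longrightarrow> \<zeta> x = 0) \<Longrightarrow> \<eta> > 0 \<Longrightarrow>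
      (\<And>x. norm x > R \<Longrightarrow> \<zeta> x = 0) \<Longrightarrow> (\<And>x. 0 \<le> \<zeta> x) \<Longrightarrow>
      (\<integral>x. V x * rd \<zeta> x * norm x powr (1 - real DIM('a)) \<partial>lborel) \<ge> - (\<integral>x. (1 + norm x) powr (- 1 - \<delta>) * \<zeta> x * norm x powr (1 - real DIM('a)) \<partial>lborel)"
begin

lemma smooths: "smooth_on {0<..} w1" "smooth_on {0<..} w2" "smooth_on {0<..} \<psi>" "smooth_on {0<..} \<psi>1" "smooth_on {0<..} \<psi>2"
  using smooth_on_DERIV_smooth[OF sw dw] smooth_on_DERIV_smooth[OF _ dw1] smooth_on_DERIV_smooth[OF s\<phi> d\<phi>]
    smooth_on_DERIV_smooth[OF _ d\<psi>] smooth_on_DERIV_smooth[OF _ d\<psi>1] by blast+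

text \<open>
  \<open>Z v\<close> is \<open>exp (\<phi> / h) (- h\<^sup>2 \<Delta> + V - E) (exp (- \<phi> / h) v)\<close>, and \<open>Mm\<close> is \<open>\<partial>\<^sub>r\<close> conjugated by
  \<open>r\<^sup>(\<^sup>n\<^sup>-\<^sup>1\<^sup>)\<^sup>/\<^sup>2\<close>. The terms \<open>BB v\<close> carry the derivative of the cutoff.
\<close>

definition "T r = E + (\<psi> r)\<^sup>2 - h * \<psi>1 r"
definition "T1 r = 2 * \<psi> r * \<psi>1 r - h * \<psi>2 r"
definition "N = real DIM('a)"
definition "Mm v x = rd v x + (N - 1) / 2 * (1 / norm x) * v x" for x :: 'a
definition "Z v x = - (h\<^sup>2) * lap v x + 2 * h * \<psi> (norm x) * Mm v x + (V x - T (norm x)) * v x" for x :: 'a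
text \<open>The density to be controlled. E/4 is half of the constant E/2 in \<open>key\<close>,
  since the zeroth-order terms enter through the derivative of v^2 / 2. \<open>T\<close> is the
  zeroth-order coefficient of the conjugated operator without V and with reversed sign, so
  \<open>key\<close> is a lower bound for the derivative of w T.\<close>

definition "LL v x = w1 (norm x) * (h\<^sup>2 / 2 * (rd v x)\<^sup>2 + E / 4 * (v x)\<^sup>2)" for x :: 'a
definition "BB v x = h\<^sup>2 / 2 * (rd v x)\<^sup>2 - h\<^sup>2 / 2 * (grad2 v x - (rd v x)\<^sup>2) + (T (norm x) - V x) / 2 * (v x)\<^sup>2
   + h\<^sup>2 * ((N - 1) / 2) * (1 / norm x) * v x * rd v x" for x :: 'a

lemma dT: "r > 0 \<Longrightarrow> (T has_real_derivative T1 r) (at r)"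
  unfolding T_def[abs_def] T1_def by (auto intro!: derivative_eq_intros d\<psi> d\<psi>1)

lemma sT: "smooth_on {0<..} T" and sT1: "smooth_on {0<..} T1"
  unfolding T_def[abs_def] T1_def[abs_def]
  by (intro smooth_on_add smooth_on_diff smooth_on_mult smooth_on_power smooth_on_const smooths; simp)+

text \<open>The inequality of \<open>carleman_algebra\<close>, integrated. With \<kappa> in the
  multiplier all vector fields vanish near the origin, so that \<open>D1\<close>, \<open>D2\<close>,
  \<open>D3\<close> integrate to zero exactly, while the terms with V integrate to something
  nonnegative by \<open>V_dist\<close>.\<close>

lemma carleman_cutoff:
  assumes v: "smooth_on pct v" "\<And>x. norm x > R \<Longrightarrow> v x = 0"
    and \<kappa>: "smooth_on {0<..} \<kappa>" "\<And>r. r > 0 \<Longrightarrow> (\<kappa> has_real_derivative \<kappa>1 r) (at r)" "\<And>r. 0 \<le> \<kappa> r" "\<And>r. 0 \<le> \<kappa>1 r"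
      "\<And>r. r < \<eta> \<Longrightarrow> \<kappa> r = 0" "\<And>r. r < \<eta> \<Longrightarrow> \<kappa>1 r = 0" "\<eta> > 0"
  shows "(\<integral>x. \<kappa> (norm x) * LL v x \<partial>lborel) + (\<integral>x. w (norm x) * \<kappa>1 (norm x) * BB v x \<partial>lborel)
    \<le> (\<integral>x. w (norm x) * \<kappa> (norm x) * Mm v x * Z v x \<partial>lborel)"
proof -
  define i where "i = (\<lambda>r::real. 1 / r)"
  define k k1 where "k = (\<lambda>r. w r * \<kappa> r)" and "k1 = (\<lambda>r. w1 r * \<kappa> r + w r * \<kappa>1 r)"
  define m1 m2 where "m1 = (\<lambda>r. w1 r * i r - w r * (i r)\<^sup>2)" and "m2 = (\<lambda>r. w2 r * i r - 2 * w1 r * (i r)\<^sup>2 + 2 * w r * (i r)^3)"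
  define \<mu> \<mu>1 where "\<mu> = (\<lambda>r. (N - 1) / 2 * (k r * i r))" and "\<mu>1 = (\<lambda>r. (N - 1) / 2 * (m1 r * \<kappa> r + w r * i r * \<kappa>1 r))"
  have si: "smooth_on {0<..} i" unfolding i_def by (rule smooth_on_divide) auto
  have di: "r > 0 \<Longrightarrow> (i has_real_derivative - (i r)\<^sup>2) (at r)" for r
    unfolding i_def by (auto intro!: derivative_eq_intros simp: power2_eq_square)
  have s\<kappa>1: "smooth_on {0<..} \<kappa>1" by (rule smooth_on_DERIV_smooth[OF \<kappa>(1,2)])
  note cl = smooth_on_add smooth_on_diff smooth_on_mult smooth_on_power smooth_on_const
  note sall = smooths sw \<kappa>(1) s\<kappa>1 si sT sT1
  have sk: "smooth_on {0<..} k" "smooth_on {0<..} k1" "smooth_on {0<..} m1" "smooth_on {0<..} m2"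
    unfolding k_def k1_def m1_def m2_def by (intro cl sall; simp)+
  have s\<mu>: "smooth_on {0<..} \<mu>" "smooth_on {0<..} \<mu>1"
    unfolding \<mu>_def \<mu>1_def by (intro cl sall sk; simp)+
  have dk: "r > 0 \<Longrightarrow> (k has_real_derivative k1 r) (at r)" for r
    unfolding k_def k1_def by (auto intro!: derivative_eq_intros dw \<kappa>(2))
  have dm1: "r > 0 \<Longrightarrow> (m1 has_real_derivative m2 r) (at r)" for r
    unfolding m1_def m2_def by (auto intro!: derivative_eq_intros dw dw1 di simp: power2_eq_square power3_eq_cube algebra_simps)
  have d\<mu>: "r > 0 \<Longrightarrow> (\<mu> has_real_derivative \<mu>1 r) (at r)" for r
    unfolding \<mu>_def \<mu>1_def
    by (rule DERIV_cong[OF DERIV_cmult[OF DERIV_mult[OF dk di]]])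
      (auto simp: m1_def k_def k1_def algebra_simps)
  have z: "k r = 0" "k1 r = 0" "\<mu> r = 0" "\<mu>1 r = 0" if "r < \<eta>" for r
    using that by (auto simp: k_def k1_def \<mu>_def \<mu>1_def \<kappa>)
  have pdv0: "pd b v x = 0" if "norm x > R" for b x by (rule pd_zero_outside[OF v(2) that])
  have rdv0: "rd v x = 0" and g0: "grad2 v x = 0" if "norm x > R" for x
    using pdv0[OF that] by (auto simp: rd_def grad2_def)
  have lap0: "lap v x = 0" if "norm x > R" for x
    unfolding lap_def by (intro sum.neutral ballI pd_zero_outside[OF pdv0 that])
  have slap: "smooth_on pct (lap v)"
  proof -
    have "smooth_on pct (\<lambda>x. \<Sum>b\<in>Basis. pd b (pd b v) x)" by (intro smooth_on_sum smooth_on_pd v open_pct)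
    then show ?thesis by (simp add: lap_def[abs_def])
  qed
  note clp = smooth_on_add[OF open_pct] smooth_on_diff[OF open_pct] smooth_on_mult[OF open_pct] smooth_on_power[OF open_pct]
     smooth_on_const[OF open_pct] smooth_on_uminus[OF open_pct]
  note sp = smooth_rd[OF v(1)] smooth_grad2[OF v(1)] slap v(1) smooth_radial[OF sk(1)] smooth_radial[OF sk(2)]
    smooth_radial[OF sk(3)] smooth_radial[OF sk(4)] smooth_radial[OF s\<mu>(1)] smooth_radial[OF s\<mu>(2)]
    sall[THEN smooth_radial]
  have sq: "smooth_on {0<..} (\<lambda>r. (1 + r) powr (- 1 - \<delta>))"
    by (rule smooth_on_compose[OF smooth_on_powr]) (auto intro!: smooth_on_add smooth_on_const smooth_on_id)
  note sq' = smooth_radial[OF sq]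

  \<comment> \<open>\<open>D1\<close> is the divergence of the Morawetz field; \<open>D2\<close> and
    \<open>D3\<close> are the divergences of the radial fields with profiles k T v^2 / 2 and
    \<kappa> m1 v^2 / 2. They integrate by parts the pairing with T v and the part of the mixed term
    in which \<kappa> is not differentiated.\<close>
  define D1 where "D1 = (\<lambda>x. - lap v x * (k (norm x) * rd v x + \<mu> (norm x) * v x)
      - (k1 (norm x) / 2 * (rd v x)\<^sup>2 + (k (norm x) * i (norm x) - k1 (norm x) / 2) * (grad2 v x - (rd v x)\<^sup>2) + \<mu>1 (norm x) * v x * rd v x))"
  define D2 where "D2 = (\<lambda>x. (k1 (norm x) * T (norm x) + k (norm x) * T1 (norm x)) * ((v x)\<^sup>2 / 2)
      + k (norm x) * T (norm x) * (v x * rd v x) + (N - 1) * i (norm x) * (k (norm x) * T (norm x)) * ((v x)\<^sup>2 / 2))"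
  define D3 where "D3 = (\<lambda>x. (\<kappa>1 (norm x) * m1 (norm x) + \<kappa> (norm x) * m2 (norm x)) * ((v x)\<^sup>2 / 2)
      + \<kappa> (norm x) * m1 (norm x) * (v x * rd v x) + (N - 1) * i (norm x) * (\<kappa> (norm x) * m1 (norm x)) * ((v x)\<^sup>2 / 2))"
  define A4 where "A4 = (\<lambda>x. k1 (norm x) * (v x)\<^sup>2 + 2 * k (norm x) * v x * (rd v x + (N - 1) / 2 * i (norm x) * v x))"
  define Q4 where "Q4 = (\<lambda>x. (1 + norm x) powr (- 1 - \<delta>) * (k (norm x) * (v x)\<^sup>2))"
  have sv2: "smooth_on pct (\<lambda>x. (v x)\<^sup>2 * (1/2))" by (intro clp v)
  have rdv2: "rd (\<lambda>x. (v x)\<^sup>2 * (1/2)) x = v x * rd v x" if x: "x \<noteq> 0" for x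
  proof -
    have p: "pd b (\<lambda>x. (v x)\<^sup>2 * (1/2)) x = v x * pd b v x" for b
    proof -
      have "pd b (\<lambda>x. (1/2) * (v x * v x)) x = (1/2) * pd b (\<lambda>x. v x * v x) x"
        by (rule pd_smooth_cmult[of pct _ "\<lambda>_. 0"]) (use x v clp in auto)
      also have "pd b (\<lambda>x. v x * v x) x = v x * pd b v x + pd b v x * v x"
        by (rule pd_smooth_mult[OF v(1) v(1)]) (use x in auto)
      finally show ?thesis by (simp add: power2_eq_square mult.commute)
    qed
    show ?thesis unfolding rd_def p by (simp add: sum_distrib_left algebra_simps)
  qed
  have int0: "(\<integral>x. indicator pct x * F x \<partial>lborel) = (\<integral>x. F x \<partial>lborel)" if "F 0 = 0" for F :: "'a \<Rightarrow> real"
    by (intro Bochner_Integration.integral_cong refl) (use that in \<open>auto simp: indicator_def\<close>)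
  have int_D1: "(\<integral>x. D1 x \<partial>lborel) = 0"
  proof -
    define F where "F = (\<lambda>b x. - pd b v x * (k (norm x) * rd v x + \<mu> (norm x) * v x) + ed b x * (k (norm x) * grad2 v x) / 2)"
    have sF: "smooth_on pct (F b)" if "b \<in> Basis" for b
    proof -
      have "smooth_on pct (\<lambda>x. - pd b v x * (k (norm x) * rd v x + \<mu> (norm x) * v x) + ed b x * (k (norm x) * grad2 v x) * (1/2))"
        by (intro clp sp smooth_on_pd v that smooth_ed)
      then show ?thesis by (simp add: F_def)
    qed
    have "(\<integral>x. (\<Sum>b\<in>Basis. pd b (F b) x) \<partial>lborel) = 0"
      by (rule divergence_theorem_pct[OF sF \<kappa>(7), where R = R]) (auto simp: F_def z pdv0 g0 rdv0 v(2))
    moreover have "(\<Sum>b\<in>Basis. pd b (F b) x) = D1 x" if x: "x \<noteq> 0" for x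
      unfolding F_def D1_def
      by (subst morawetz_pointwise[OF v(1) x sk(1) dk s\<mu>(1) d\<mu>]) (auto simp: \<mu>_def i_def N_def)
    moreover have "(\<integral>x. (\<Sum>b\<in>Basis. pd b (F b) x) \<partial>lborel) = (\<integral>x. D1 x \<partial>lborel)"
    proof (rule integral_cong_AE)
      show "AE x in lborel. (\<Sum>b\<in>Basis. pd b (F b) x) = D1 x"
        using AE_nonzero by eventually_elim (rule calculation(2))
      have [measurable]: "pd b (F b) \<in> borel_measurable borel" if "b \<in> Basis" for b
        by (intro measurable_pct smooth_on_continuous smooth_on_pd sF that)
      show "(\<lambda>x. \<Sum>b\<in>Basis. pd b (F b) x) \<in> borel_measurable lborel" by measurable
      have "smooth_on pct (\<lambda>x. - lap v x * (k (norm x) * rd v x + \<mu> (norm x) * v x)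
      - (k1 (norm x) * (1/2) * (rd v x)\<^sup>2 + (k (norm x) * i (norm x) - k1 (norm x) * (1/2)) * (grad2 v x - (rd v x)\<^sup>2) + \<mu>1 (norm x) * v x * rd v x))"
        by (intro clp sp)
      then show "D1 \<in> borel_measurable lborel" using measurable_pct[OF smooth_on_continuous] by (simp add: D1_def)
    qed
    ultimately show ?thesis by simp
  qed
  have int_D2: "(\<integral>x. D2 x \<partial>lborel) = 0"
  proof -
    have s: "smooth_on {0<..} (\<lambda>r. k r * T r)" by (intro cl sk sT) simp
    have d: "((\<lambda>r. k r * T r) has_real_derivative k1 r * T r + k r * T1 r) (at r)" if "r > 0" for r
      using dk[OF that] dT[OF that] by (auto intro!: derivative_eq_intros)
    have "(\<integral>x. indicator pct x * D2 x \<partial>lborel) = (\<integral>x. indicator pct x * ((k1 (norm x) * T (norm x) + k (norm x) * T1 (norm x)) * ((v x)\<^sup>2 * (1/2)) + k (norm x) * T (norm x) * rd (\<lambda>x. (v x)\<^sup>2 * (1/2)) x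
        + (real DIM('a) - 1) / norm x * (k (norm x) * T (norm x)) * ((v x)\<^sup>2 * (1/2))) \<partial>lborel)"
      by (intro Bochner_Integration.integral_cong refl) (auto simp: indicator_def D2_def rdv2[simplified] i_def N_def)
    also have "\<dots> = 0"
      by (rule radial_parts[OF s d _ \<kappa>(7) sv2, of R]) (use z v(2) in auto)
    finally show ?thesis by (subst (asm) int0) (use \<kappa>(7) z[of 0] in \<open>simp_all add: D2_def\<close>)
  qed
  have int_D3: "(\<integral>x. D3 x \<partial>lborel) = 0"
  proof -
    have s: "smooth_on {0<..} (\<lambda>r. \<kappa> r * m1 r)" by (intro cl sk \<kappa>) simp
    have d: "((\<lambda>r. \<kappa> r * m1 r) has_real_derivative \<kappa>1 r * m1 r + \<kappa> r * m2 r) (at r)" if "r > 0" for r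
      using \<kappa>(2)[OF that] dm1[OF that] by (auto intro!: derivative_eq_intros)
    have "(\<integral>x. indicator pct x * D3 x \<partial>lborel) = (\<integral>x. indicator pct x * ((\<kappa>1 (norm x) * m1 (norm x) + \<kappa> (norm x) * m2 (norm x)) * ((v x)\<^sup>2 * (1/2)) + \<kappa> (norm x) * m1 (norm x) * rd (\<lambda>x. (v x)\<^sup>2 * (1/2)) x
        + (real DIM('a) - 1) / norm x * (\<kappa> (norm x) * m1 (norm x)) * ((v x)\<^sup>2 * (1/2))) \<partial>lborel)"
      by (intro Bochner_Integration.integral_cong refl) (auto simp: indicator_def D3_def rdv2[simplified] i_def N_def)
    also have "\<dots> = 0"
      by (rule radial_parts[OF s d _ \<kappa>(7) sv2, of R]) (use \<kappa>(5) v(2) in auto)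
    finally show ?thesis by (subst (asm) int0) (use \<kappa>(5,6)[of 0] \<kappa>(7) in \<open>simp_all add: D3_def\<close>)
  qed
  have sA4: "smooth_on pct A4" and sQ4: "smooth_on pct Q4"
    unfolding A4_def Q4_def by (intro clp sp sq')+
  have iA4: "integrable lborel A4" and iQ4: "integrable lborel Q4"
    by (rule smooth_integrable_pct[OF sA4 _ \<kappa>(7), where R = R], auto simp: A4_def z v(2))
      (rule smooth_integrable_pct[OF sQ4 _ \<kappa>(7), where R = R], auto simp: Q4_def z v(2))
  have int_D4: "(\<integral>x. V x * A4 x + Q4 x \<partial>lborel) \<ge> 0"
  proof -
    \<comment> \<open>The test function is \<zeta> = r^(n-1) k v^2: the power cancels the weight
      r^(1-n) in the distributional derivative, and \<zeta> >= 0 because w and \<kappa> are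
      nonnegative. \<open>A4\<close> is r^(1-n) times the radial derivative of \<zeta>.\<close>
    define f f1 where "f = (\<lambda>r. k r * r powr (N - 1))" and "f1 = (\<lambda>r. k1 r * r powr (N - 1) + k r * ((N - 1) * r powr (N - 1 - 1)))"
    have sf: "smooth_on {0<..} f" unfolding f_def by (intro cl sk smooth_on_powr) simp
    have df: "(f has_real_derivative f1 r) (at r)" if "r > 0" for r
      unfolding f_def f1_def using that dk[OF that] by (auto intro!: derivative_eq_intros)
    define \<zeta> where "\<zeta> = (\<lambda>x. f (norm x) * (v x * v x))"
    have svv: "smooth_on pct (\<lambda>x. v x * v x)" by (intro clp v)
    have s1: "smooth_on pct \<zeta>" unfolding \<zeta>_def by (intro clp smooth_radial[OF sf] svv)
    have z1: "\<zeta> x = 0" if "norm x < \<eta>" for x using z[OF that] by (simp add: \<zeta>_def f_def)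
    have z2: "\<zeta> x = 0" if "norm x > R" for x using v(2)[OF that] by (simp add: \<zeta>_def)
    have pos: "0 \<le> \<zeta> x" for x
    proof (cases "norm x < \<eta>")
      case False
      then have "norm x > 0" using \<kappa>(7) by linarith
      then show ?thesis using w_bounds(1)[of "norm x"] \<kappa>(3)[of "norm x"] by (simp add: \<zeta>_def f_def k_def)
    qed (simp add: z1)
    have e1: "rd \<zeta> x * norm x powr (1 - N) = A4 x" and e2: "\<zeta> x * norm x powr (1 - N) = k (norm x) * (v x)\<^sup>2" if x: "x \<noteq> 0" for x
    proof -
      have xp: "norm x > 0" using x by simp
      have c: "norm x powr (N - 1) * norm x powr (1 - N) = 1" using xp by (simp add: powr_add[symmetric])
      have c2: "norm x powr (N - 1 - 1) * norm x powr (1 - N) = i (norm x)"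
        using xp by (simp add: powr_add[symmetric] powr_minus i_def divide_inverse)
      have "rd \<zeta> x = f (norm x) * rd (\<lambda>x. v x * v x) x + f1 (norm x) * (v x * v x)"
        unfolding \<zeta>_def rd_mult[OF smooth_radial[OF sf] svv x] rd_radial[OF df[OF xp] x] ..
      also have "rd (\<lambda>x. v x * v x) x = 2 * (v x * rd v x)" using rd_mult[OF v(1) v(1) x] by simp
      finally have rz: "rd \<zeta> x = f (norm x) * (2 * (v x * rd v x)) + f1 (norm x) * (v x * v x)" .
      have "rd \<zeta> x * norm x powr (1 - N) = k (norm x) * (2 * (v x * rd v x)) * (norm x powr (N - 1) * norm x powr (1 - N))
        + (k1 (norm x) * (norm x powr (N - 1) * norm x powr (1 - N)) + k (norm x) * (N - 1) * (norm x powr (N - 1 - 1) * norm x powr (1 - N))) * (v x * v x)"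
        unfolding rz by (simp add: f_def f1_def algebra_simps)
      then show "rd \<zeta> x * norm x powr (1 - N) = A4 x" unfolding c c2 A4_def by (simp add: field_simps power2_eq_square)
      have "\<zeta> x * norm x powr (1 - N) = k (norm x) * (v x)\<^sup>2 * (norm x powr (N - 1) * norm x powr (1 - N))"
        by (simp add: \<zeta>_def f_def power2_eq_square)
      then show "\<zeta> x * norm x powr (1 - N) = k (norm x) * (v x)\<^sup>2" unfolding c by simp
    qed
    have o: "A4 0 = 0" "Q4 0 = 0" using z[of 0] \<kappa>(7) by (simp_all add: A4_def Q4_def)
    have "(\<integral>x. V x * rd \<zeta> x * norm x powr (1 - N) \<partial>lborel) = (\<integral>x. V x * A4 x \<partial>lborel)"
    proof (intro Bochner_Integration.integral_cong refl)
      fix x :: 'a show "V x * rd \<zeta> x * norm x powr (1 - N) = V x * A4 x"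
        using e1[of x] o by (cases "x = 0") (auto simp: mult.assoc)
    qed
    moreover have "(\<integral>x. (1 + norm x) powr (- 1 - \<delta>) * \<zeta> x * norm x powr (1 - N) \<partial>lborel) = (\<integral>x. Q4 x \<partial>lborel)"
    proof (intro Bochner_Integration.integral_cong refl)
      fix x :: 'a show "(1 + norm x) powr (- 1 - \<delta>) * \<zeta> x * norm x powr (1 - N) = Q4 x"
        using e2[of x] o by (cases "x = 0") (auto simp: mult.assoc Q4_def)
    qed
    ultimately have "(\<integral>x. V x * A4 x \<partial>lborel) \<ge> - (\<integral>x. Q4 x \<partial>lborel)"
      using V_dist[OF smooth_on_glue_0[OF s1 z1 \<kappa>(7)] z1 \<kappa>(7) z2 pos] by (simp add: N_def)
    then show ?thesis using bdd_meas_integrable[OF V iA4] iQ4 by simp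
  qed

  \<comment> \<open>V is only measurable and bounded, so each integrand is split into a smooth part
    and V times a smooth part; integrability is then checked for the smooth parts.\<close>
  define S where "S = (\<lambda>x. w (norm x) * \<kappa>1 (norm x) * (h\<^sup>2 / 2 * (rd v x)\<^sup>2 - h\<^sup>2 / 2 * (grad2 v x - (rd v x)\<^sup>2) + T (norm x) / 2 * (v x)\<^sup>2
   + h\<^sup>2 * ((N - 1) / 2) * i (norm x) * v x * rd v x))"
  define SV where "SV = (\<lambda>x. w (norm x) * \<kappa>1 (norm x) * ((v x)\<^sup>2 * (1/2)))"
  define Y where "Y = (\<lambda>x. k (norm x) * (rd v x + (N - 1) / 2 * i (norm x) * v x) * (- (h\<^sup>2) * lap v x + 2 * h * \<psi> (norm x) * (rd v x + (N - 1) / 2 * i (norm x) * v x) - T (norm x) * v x))"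
  define YV where "YV = (\<lambda>x. k (norm x) * (rd v x + (N - 1) / 2 * i (norm x) * v x) * v x)"
  have iS: "integrable lborel S" "integrable lborel SV" "integrable lborel Y" "integrable lborel YV" "integrable lborel D1" "integrable lborel D2" "integrable lborel D3"
    "integrable lborel (\<lambda>x. \<kappa> (norm x) * LL v x)"
  proof -
    have "smooth_on pct (\<lambda>x. w (norm x) * \<kappa>1 (norm x) * (h\<^sup>2 / 2 * (rd v x)\<^sup>2 - h\<^sup>2 / 2 * (grad2 v x - (rd v x)\<^sup>2) + T (norm x) * (1 / 2) * (v x)\<^sup>2
   + h\<^sup>2 * ((N - 1) / 2) * i (norm x) * v x * rd v x))" by (intro clp sp)
    then have "smooth_on pct S" by (simp add: S_def)
    then show "integrable lborel S"
      by (rule smooth_integrable_pct[OF _ _ \<kappa>(7), where R = R]) (auto simp: S_def z \<kappa> rdv0 g0 v(2))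
    have "smooth_on pct SV" unfolding SV_def by (intro clp sp)
    then show "integrable lborel SV"
      by (rule smooth_integrable_pct[OF _ _ \<kappa>(7), where R = R]) (auto simp: SV_def z \<kappa> rdv0 g0 v(2))
    have "smooth_on pct Y" unfolding Y_def by (intro clp sp)
    then show "integrable lborel Y"
      by (rule smooth_integrable_pct[OF _ _ \<kappa>(7), where R = R]) (auto simp: Y_def z \<kappa> rdv0 g0 v(2))
    have "smooth_on pct YV" unfolding YV_def by (intro clp sp)
    then show "integrable lborel YV"
      by (rule smooth_integrable_pct[OF _ _ \<kappa>(7), where R = R]) (auto simp: YV_def z \<kappa> rdv0 g0 v(2))
    have "smooth_on pct (\<lambda>x. - lap v x * (k (norm x) * rd v x + \<mu> (norm x) * v x)
      - (k1 (norm x) * (1 / 2) * (rd v x)\<^sup>2 + (k (norm x) * i (norm x) - k1 (norm x) * (1 / 2)) * (grad2 v x - (rd v x)\<^sup>2) + \<mu>1 (norm x) * v x * rd v x))"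
      by (intro clp sp)
    then have "smooth_on pct D1" by (simp add: D1_def)
    then show "integrable lborel D1"
      by (rule smooth_integrable_pct[OF _ _ \<kappa>(7), where R = R]) (auto simp: D1_def z \<kappa> rdv0 g0 v(2))
    have "smooth_on pct (\<lambda>x. (k1 (norm x) * T (norm x) + k (norm x) * T1 (norm x)) * ((v x)\<^sup>2 * (1 / 2))
      + k (norm x) * T (norm x) * (v x * rd v x) + (N - 1) * i (norm x) * (k (norm x) * T (norm x)) * ((v x)\<^sup>2 * (1 / 2)))" by (intro clp sp)
    then have "smooth_on pct D2" by (simp add: D2_def)
    then show "integrable lborel D2"
      by (rule smooth_integrable_pct[OF _ _ \<kappa>(7), where R = R]) (auto simp: D2_def z \<kappa> rdv0 g0 v(2))
    have "smooth_on pct (\<lambda>x. (\<kappa>1 (norm x) * m1 (norm x) + \<kappa> (norm x) * m2 (norm x)) * ((v x)\<^sup>2 * (1 / 2))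
      + \<kappa> (norm x) * m1 (norm x) * (v x * rd v x) + (N - 1) * i (norm x) * (\<kappa> (norm x) * m1 (norm x)) * ((v x)\<^sup>2 * (1 / 2)))" by (intro clp sp)
    then have "smooth_on pct D3" by (simp add: D3_def)
    then show "integrable lborel D3"
      by (rule smooth_integrable_pct[OF _ _ \<kappa>(7), where R = R]) (auto simp: D3_def z \<kappa> rdv0 g0 v(2))
    have "smooth_on pct (\<lambda>x. \<kappa> (norm x) * LL v x)" unfolding LL_def by (intro clp sp)
    then show "integrable lborel (\<lambda>x. \<kappa> (norm x) * LL v x)"
      by (rule smooth_integrable_pct[OF _ _ \<kappa>(7), where R = R]) (auto simp: LL_def z \<kappa> rdv0 g0 v(2))
  qed
  have eqB: "w (norm x) * \<kappa>1 (norm x) * BB v x = S x - V x * SV x" for x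
    by (simp add: BB_def S_def SV_def i_def field_simps)
  have eqZ: "w (norm x) * \<kappa> (norm x) * Mm v x * Z v x = Y x + V x * YV x" for x
    by (simp add: Mm_def Z_def Y_def YV_def k_def i_def field_simps)
  note iV = bdd_meas_integrable[OF V iS(2)] bdd_meas_integrable[OF V iS(4)] bdd_meas_integrable[OF V iA4]
  have "(\<integral>x. \<kappa> (norm x) * LL v x + (S x - V x * SV x) + h\<^sup>2 * D1 x - D2 x + h\<^sup>2 * ((N - 1) / 2) * D3 x + (V x * A4 x + Q4 x) / 2 \<partial>lborel)
    \<le> (\<integral>x. Y x + V x * YV x \<partial>lborel)"
  proof (rule integral_mono_AE)
    show "integrable lborel (\<lambda>x. \<kappa> (norm x) * LL v x + (S x - V x * SV x) + h\<^sup>2 * D1 x - D2 x + h\<^sup>2 * ((N - 1) / 2) * D3 x + (V x * A4 x + Q4 x) / 2)"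
      using iS iV iA4 iQ4 by (intro Bochner_Integration.integrable_add Bochner_Integration.integrable_diff integrable_mult_right integrable_divide) auto
    show "integrable lborel (\<lambda>x. Y x + V x * YV x)" using iS iV by simp
    show "AE x in lborel. \<kappa> (norm x) * LL v x + (S x - V x * SV x) + h\<^sup>2 * D1 x - D2 x + h\<^sup>2 * ((N - 1) / 2) * D3 x + (V x * A4 x + Q4 x) / 2
      \<le> Y x + V x * YV x"
      using V_le AE_nonzero
    proof eventually_elim
      case (elim x)
      have xp: "norm x > 0" using elim by simp
      have n: "N = 1 \<or> N \<ge> 3"
      proof -
        have "DIM('a) = 1 \<or> DIM('a) \<ge> 3" using dim DIM_positive[where 'a = 'a] by linarith
        then show ?thesis unfolding N_def by auto
      qed
      have ke: "w1 (norm x) * T (norm x) + w (norm x) * T1 (norm x) \<ge> E / 2 * w1 (norm x) + w1 (norm x) * (1 + norm x) powr (- \<delta>) + w (norm x) * (1 + norm x) powr (- 1 - \<delta>)"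
        using key[OF xp] by (simp add: T_def T1_def)
      have cw: "w1 (norm x) \<le> w (norm x) * i (norm x)" using w_bounds(6)[OF xp] by (simp add: i_def)
      have ip: "i (norm x) > 0" using xp by (simp add: i_def)
      have cs: "grad2 v x \<ge> (rd v x)\<^sup>2" unfolding grad2_def using cauchy_schwarz_rd elim by auto
      show ?case
        using carleman_algebra[of "k (norm x)" "w (norm x)" "\<kappa> (norm x)" "k1 (norm x)" "w1 (norm x)" "\<kappa>1 (norm x)" "m1 (norm x)" "i (norm x)"
            "m2 (norm x)" "w2 (norm x)" N h "\<psi> (norm x)" "rd v x" "grad2 v x" E "(1 + norm x) powr (- \<delta>)" "(1 + norm x) powr (- 1 - \<delta>)" "T (norm x)" "T1 (norm x)" "V x" "v x" "lap v x",
            OF _ _ _ _ n h \<kappa>(3) \<kappa>(4) w_bounds(1)[OF xp] w_bounds(4)[OF xp] ip \<psi>_bounds(1)[OF xp] cs w_bounds(7)[OF xp] cw ke elim(1)]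
        unfolding eqB[symmetric] eqZ[symmetric]
        unfolding k_def k1_def m1_def m2_def LL_def BB_def Mm_def Z_def D1_def D2_def D3_def A4_def Q4_def \<mu>_def \<mu>1_def
        by (simp add: i_def mult.assoc)
    qed
  qed
  moreover have "(\<integral>x. \<kappa> (norm x) * LL v x + (S x - V x * SV x) + h\<^sup>2 * D1 x - D2 x + h\<^sup>2 * ((N - 1) / 2) * D3 x + (V x * A4 x + Q4 x) / 2 \<partial>lborel)
    = (\<integral>x. \<kappa> (norm x) * LL v x \<partial>lborel) + (\<integral>x. S x - V x * SV x \<partial>lborel) + h\<^sup>2 * (\<integral>x. D1 x \<partial>lborel) - (\<integral>x. D2 x \<partial>lborel)
      + h\<^sup>2 * ((N - 1) / 2) * (\<integral>x. D3 x \<partial>lborel) + (\<integral>x. V x * A4 x + Q4 x \<partial>lborel) / 2"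
  proof -
    have j: "integrable lborel (\<lambda>x. S x - V x * SV x)" "integrable lborel (\<lambda>x. V x * A4 x + Q4 x)"
      "integrable lborel (\<lambda>x. h\<^sup>2 * D1 x)" "integrable lborel (\<lambda>x. h\<^sup>2 * ((N - 1) / 2) * D3 x)"
      using iS iV iA4 iQ4 by simp_all
    show ?thesis
      by (simp only: Bochner_Integration.integral_add Bochner_Integration.integral_diff Bochner_Integration.integrable_add Bochner_Integration.integrable_diff
          iS j integrable_divide integral_divide_zero integral_mult_right_zero)
  qed
  ultimately show ?thesis unfolding eqB eqZ int_D1 int_D2 int_D3 using int_D4 by simp
qed

end

section \<open>Removing the cutoff at the origin\<close>

text \<open>The usual smooth step on [0, 1]. The denominator is positive because t and 1 - t are
  never both nonpositive.\<close>

definition cutoff :: "real \<Rightarrow> real" where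
  "cutoff t = bump t / (bump t + bump (1 - t))"

lemma bump_mono: "s \<le> t \<Longrightarrow> bump s \<le> bump t"
  by (auto simp: bump_def intro!: divide_left_mono)

lemma cutoff_denominator: "bump t + bump (1 - t) > 0"
  using bump_bounds(1)[of t] bump_bounds(1)[of "1 - t"] bump_bounds(3)[of t] bump_bounds(3)[of "1 - t"]
  by (cases "t > 0") (auto intro: add_pos_nonneg add_nonneg_pos)

lemma smooth_cutoff: "smooth_on UNIV cutoff"
proof -
  have "smooth_on UNIV (\<lambda>t::real. bump (1 - t))"
    by (rule smooth_on_compose[OF smooth_on_bump]) (auto intro!: smooth_on_diff smooth_on_const smooth_on_id)
  then have "smooth_on UNIV (\<lambda>t. bump t / (bump t + bump (1 - t)))"
    by (intro smooth_on_divide smooth_on_bump smooth_on_add cutoff_denominator open_UNIV)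
  then show ?thesis by (simp add: cutoff_def[abs_def])
qed

lemma cutoff_bounds: "0 \<le> cutoff t" "cutoff t \<le> 1" "t \<le> 0 \<Longrightarrow> cutoff t = 0" "t \<ge> 1 \<Longrightarrow> cutoff t = 1"
  using cutoff_denominator[of t] bump_bounds(1)[of t] bump_bounds(1)[of "1 - t"] bump_bounds(4)[of t] bump_bounds(4)[of "1 - t"]
  by (auto simp: cutoff_def divide_le_eq)

text \<open>Monotonicity makes the derivative of the cutoff nonnegative, as
  \<open>carleman_algebra\<close> requires of \<kappa>1.\<close>

lemma cutoff_mono: "mono cutoff"
proof (rule monoI)
  fix s t :: real assume "s \<le> t"
  then have "bump s * bump (1 - t) \<le> bump t * bump (1 - s)"
    by (intro mult_mono bump_mono bump_bounds) auto
  then show "cutoff s \<le> cutoff t"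
    unfolding cutoff_def using cutoff_denominator[of s] cutoff_denominator[of t]
    by (simp add: divide_le_eq le_divide_eq mult.commute algebra_simps)
qed

definition "cutoff1 = pd 1 cutoff"

lemma cutoff1: "(cutoff has_real_derivative cutoff1 t) (at t)" "0 \<le> cutoff1 t" "t < 0 \<or> t > 1 \<Longrightarrow> cutoff1 t = 0"
    "\<exists>K\<ge>0. \<forall>t. cutoff1 t \<le> K"
proof -
  show d: "(cutoff has_real_derivative cutoff1 t) (at t)" for t
    unfolding cutoff1_def by (rule smooth_on_DERIV[OF smooth_cutoff]) auto
  show "0 \<le> cutoff1 t" using mono_on_imp_deriv_nonneg[of UNIV cutoff, OF _ d] cutoff_mono by auto
  have z: "cutoff1 t = 0" if "t < 0 \<or> t > 1" for t
    using that
  proof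
    assume t: "t < 0"
    have "pd 1 cutoff t = pd 1 (\<lambda>t. 0) t" by (rule pd_cong[of "{..<0}"]) (use t cutoff_bounds(3) in auto)
    then show ?thesis by (simp add: cutoff1_def)
  next
    assume t: "t > 1"
    have "pd 1 cutoff t = pd 1 (\<lambda>t. 1) t" by (rule pd_cong[of "{1<..}"]) (use t cutoff_bounds(4) in auto)
    then show ?thesis by (simp add: cutoff1_def)
  qed
  then show "t < 0 \<or> t > 1 \<Longrightarrow> cutoff1 t = 0" .
  have "continuous_on UNIV cutoff1"
    unfolding cutoff1_def by (intro smooth_on_continuous smooth_on_pd smooth_cutoff) auto
  then obtain M where "M \<ge> 0" "\<And>t. \<bar>cutoff1 t\<bar> \<le> M"
    using bounded_compact_support[of cutoff1 1] z by (metis abs_ge_self real_norm_def abs_le_D1 linorder_not_less abs_if)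
  then show "\<exists>K\<ge>0. \<forall>t. cutoff1 t \<le> K" by (metis abs_le_D1)
qed

lemma content_cball_0: "measure lborel (cball (0::'a::euclidean_space) r) = unit_ball_vol (real DIM('a)) * r ^ DIM('a)" if "r \<ge> 0"
  using content_cball[OF that, of "0::'a"] by simp

context carleman
begin

lemma T_bound: "r > 0 \<Longrightarrow> \<bar>T r\<bar> \<le> \<bar>E\<bar> + B\<^sup>2 + h * B"
proof -
  assume r: "r > 0"
  have "(\<psi> r)\<^sup>2 \<le> B\<^sup>2" using \<psi>_bounds(1,2)[OF r] by (intro power_mono) auto
  moreover have "h * \<bar>\<psi>1 r\<bar> \<le> h * B" using h \<psi>_bounds(3)[OF r] by (intro mult_left_mono) auto
  then have "\<bar>h * \<psi>1 r\<bar> \<le> h * B" using h by (simp add: abs_mult)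
  ultimately show ?thesis unfolding T_def using zero_le_power2[of "\<psi> r"] by linarith
qed

definition "wconj u x = exp (\<phi> (norm x) / h) * u x" for x :: 'a

lemma wconj_facts:
  assumes u: "smooth_on UNIV u"
  shows "smooth_on pct (wconj u)"
    and "x \<noteq> 0 \<Longrightarrow> rd (wconj u) x = exp (\<phi> (norm x) / h) * (rd u x + \<psi> (norm x) / h * u x)"
    and "x \<noteq> 0 \<Longrightarrow> pd b (wconj u) x = exp (\<phi> (norm x) / h) * (pd b u x + \<psi> (norm x) / h * ed b x * u x)"
    and "x \<noteq> 0 \<Longrightarrow> Z (wconj u) x = exp (\<phi> (norm x) / h) * opr h (\<lambda>x. V x - E) u x"
proof -
  have up: "smooth_on pct u" by (rule smooth_on_subset[OF u]) auto
  have wc: "(\<lambda>x. exp (\<phi> (norm x) / h) * u x) = wconj u" by (simp add: wconj_def fun_eq_iff)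
  note c = conjugated_laplacian[OF up _ _ s\<phi> d\<phi> d\<psi> smooths(3), where h = h, unfolded wc]
  obtain b where "b \<in> (Basis::'a set)" using nonempty_Basis by blast
  then have "b \<noteq> 0" by auto
  from c(4)[OF this] show "smooth_on pct (wconj u)" using h by simp
  show "x \<noteq> 0 \<Longrightarrow> rd (wconj u) x = exp (\<phi> (norm x) / h) * (rd u x + \<psi> (norm x) / h * u x)"
    "x \<noteq> 0 \<Longrightarrow> pd b (wconj u) x = exp (\<phi> (norm x) / h) * (pd b u x + \<psi> (norm x) / h * ed b x * u x)" for b
    using c(1,2)[of x] h by auto
  assume x: "x \<noteq> 0"
  have "exp (\<phi> (norm x) / h) * opr h (\<lambda>x. V x - E) u x = exp (\<phi> (norm x) / h) * (- (h\<^sup>2) * lap u x) + (V x - E) * wconj u x"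
    by (simp add: opr_def wconj_def algebra_simps)
  also have "\<dots> = Z (wconj u) x"
  proof -
    have "Z (wconj u) x = (- (h\<^sup>2) * lap (wconj u) x
      + 2 * h * \<psi> (norm x) * (rd (wconj u) x + (real DIM('a) - 1) / 2 / norm x * wconj u x) + (h * \<psi>1 (norm x) - (\<psi> (norm x))\<^sup>2) * wconj u x)
      + (V x - E) * wconj u x"
    proof -
      have e: "(real DIM('a) - 1) / 2 / norm x = (N - 1) / 2 * (1 / norm x)" by (simp add: N_def)
      show ?thesis unfolding Z_def Mm_def T_def e by (simp add: algebra_simps)
    qed
    moreover have "h \<noteq> 0" using h by simp
    note c(3)[OF x this]
    ultimately show ?thesis by (simp add: wconj_def)
  qed
  finally show "Z (wconj u) x = exp (\<phi> (norm x) / h) * opr h (\<lambda>x. V x - E) u x" ..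
qed

text \<open>The conjugated function has at most a conical singularity at the origin: its first
  derivatives stay bounded there, whereas second derivatives may grow like 1/r. Bounds of first
  order are what the removal of the cutoff uses.\<close>

lemma wconj_bounded:
  assumes u: "cc u"
  shows "\<exists>C\<ge>0. \<forall>x. x \<noteq> 0 \<longrightarrow> \<bar>wconj u x\<bar> \<le> C \<and> \<bar>rd (wconj u) x\<bar> \<le> C \<and> grad2 (wconj u) x \<le> C"
proof -
  define X where "X = exp (B / h)"
  have X: "0 < exp (\<phi> (norm x) / h)" "exp (\<phi> (norm x) / h) \<le> X" if "x \<noteq> 0" for x :: 'a
    using \<psi>_bounds(4)[of "norm x"] that h by (auto simp: X_def intro!: divide_right_mono)
  have "\<forall>b\<in>Basis. \<exists>M. \<forall>x. \<bar>pd b u x\<bar> \<le> M" using cc_bounded[OF cc_pd[OF u]] by blast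
  then obtain Mb where Mb: "\<And>b x. b \<in> Basis \<Longrightarrow> \<bar>pd b u x\<bar> \<le> Mb b" by metis
  obtain M where M: "\<And>x. \<bar>u x\<bar> \<le> M" using cc_bounded[OF u] by blast
  have M0: "M \<ge> 0" "X > 0" using M[of 0] by (auto simp: X_def)
  define Cb where "Cb = (\<lambda>b. X * (Mb b + B / h * M))"
  have p: "\<bar>pd b (wconj u) x\<bar> \<le> Cb b" if x: "x \<noteq> 0" and b: "b \<in> Basis" for b x
  proof -
    have "\<bar>\<psi> (norm x) / h * ed b x * u x\<bar> \<le> B / h * 1 * M"
      unfolding abs_mult using \<psi>_bounds(1,2)[of "norm x"] x h abs_ed_le[OF b, of x] M[of x]
      by (intro mult_mono) (auto intro!: divide_right_mono)
    then have "\<bar>pd b u x + \<psi> (norm x) / h * ed b x * u x\<bar> \<le> Mb b + B / h * M" using Mb[OF b, of x] by linarith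
    then show ?thesis unfolding wconj_facts(3)[OF cc_smooth[OF u] x] Cb_def abs_mult
      using X[OF x] M0 by (intro mult_mono) auto
  qed
  define C where "C = X * M + (\<Sum>b\<in>Basis. Cb b) + (\<Sum>b\<in>Basis. (Cb b)\<^sup>2)"
  obtain y :: 'a where y: "y \<noteq> 0" using nonempty_Basis nonzero_Basis by blast
  have Cb0: "Cb b \<ge> 0" if "b \<in> Basis" for b using p[OF y that] by linarith
  have nn: "0 \<le> X * M" "0 \<le> (\<Sum>b\<in>Basis. Cb b)" "0 \<le> (\<Sum>b\<in>(Basis::'a set). (Cb b)\<^sup>2)"
    using M0 Cb0 by (auto intro!: sum_nonneg)
  have "\<bar>wconj u x\<bar> \<le> C \<and> \<bar>rd (wconj u) x\<bar> \<le> C \<and> grad2 (wconj u) x \<le> C" if x: "x \<noteq> 0" for x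
  proof -
    have "\<bar>wconj u x\<bar> \<le> X * M" unfolding wconj_def abs_mult using X[OF x] M[of x] M0 by (intro mult_mono) auto
    moreover have "\<bar>rd (wconj u) x\<bar> \<le> (\<Sum>b\<in>Basis. Cb b)"
    proof -
      have "\<bar>rd (wconj u) x\<bar> \<le> (\<Sum>b\<in>Basis. \<bar>ed b x * pd b (wconj u) x\<bar>)" unfolding rd_def by (rule sum_abs)
      also have "\<dots> \<le> (\<Sum>b\<in>Basis. 1 * Cb b)"
        unfolding abs_mult using p[OF x] abs_ed_le by (intro sum_mono mult_mono) auto
      finally show ?thesis by simp
    qed
    moreover have "grad2 (wconj u) x \<le> (\<Sum>b\<in>Basis. (Cb b)\<^sup>2)"
      unfolding grad2_def
    proof (rule sum_mono)
      fix b :: 'a assume b: "b \<in> Basis"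
      have "\<bar>pd b (wconj u) x\<bar>\<^sup>2 \<le> (Cb b)\<^sup>2" using p[OF x b] by (intro power_mono) auto
      then show "(pd b (wconj u) x)\<^sup>2 \<le> (Cb b)\<^sup>2" by simp
    qed
    ultimately show ?thesis unfolding C_def using nn by linarith
  qed
  moreover have "C \<ge> 0" unfolding C_def using nn by linarith
  ultimately show ?thesis by blast
qed

text \<open>The cutoff shrinks to the origin. On the shell from \<eta> to 2 \<eta> its derivative is
  O(1/\<eta>) while w <= r, so the error density is O(1), except for the summand with (n - 1)/r,
  which is O(1/\<eta>). The volume O(\<eta>^n) beats both, since the latter summand is absent for n
  = 1.\<close>

lemma carleman_real:
  assumes u: "cc u"
  shows "(\<integral>x. LL (wconj u) x \<partial>lborel) \<le> (\<integral>x. w (norm x) * Mm (wconj u) x * Z (wconj u) x \<partial>lborel)"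
proof -
  define v where "v = wconj u"
  obtain R where R: "\<And>x. norm x > R \<Longrightarrow> u x = 0" using u unfolding cc_def by blast
  have v: "smooth_on pct v" "\<And>x. norm x > R \<Longrightarrow> v x = 0"
    using wconj_facts(1)[OF cc_smooth[OF u]] R by (auto simp: v_def wconj_def)
  obtain C where C0: "C \<ge> 0" and C: "\<And>x. x \<noteq> 0 \<Longrightarrow> \<bar>v x\<bar> \<le> C" "\<And>x. x \<noteq> 0 \<Longrightarrow> \<bar>rd v x\<bar> \<le> C" "\<And>x. x \<noteq> 0 \<Longrightarrow> grad2 v x \<le> C"
    using wconj_bounded[OF u] unfolding v_def by blast
  have sq: "(v x)\<^sup>2 \<le> C\<^sup>2" "(rd v x)\<^sup>2 \<le> C\<^sup>2" if "x \<noteq> 0" for x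
    using power_mono[OF C(1)[OF that], of 2] power_mono[OF C(2)[OF that], of 2] by auto
  obtain M' where M': "AE x in lborel. \<bar>V x\<bar> \<le> M'" and [measurable]: "V \<in> borel_measurable borel" using V by (auto simp: bdd_meas_def)
  define M where "M = \<bar>M'\<bar>"
  have M0: "M \<ge> 0" and M: "AE x in lborel. \<bar>V x\<bar> \<le> M"
    unfolding M_def using M' by (auto elim!: eventually_mono)
  obtain L where L: "\<And>x. \<bar>lap u x\<bar> \<le> L" using cc_bounded[OF cc_lap[OF u]] by blast
  obtain K0 where K0: "\<And>x. \<bar>u x\<bar> \<le> K0" using cc_bounded[OF u] by blast
  note clp = smooth_on_add[OF open_pct] smooth_on_diff[OF open_pct] smooth_on_mult[OF open_pct] smooth_on_power[OF open_pct]
     smooth_on_const[OF open_pct] smooth_on_uminus[OF open_pct]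
  have si: "smooth_on {0<..} (\<lambda>r::real. 1 / r)" by (rule smooth_on_divide) auto
  have slap: "smooth_on pct (lap v)"
  proof -
    have "smooth_on pct (\<lambda>x. \<Sum>b\<in>Basis. pd b (pd b v) x)" by (intro smooth_on_sum smooth_on_pd v open_pct)
    then show ?thesis by (simp add: lap_def[abs_def])
  qed
  note sall = sw smooths sT sT1 si
  note sp = smooth_rd[OF v(1)] smooth_grad2[OF v(1)] slap v(1) sall[THEN smooth_radial]
  have sM: "smooth_on pct (Mm v)" unfolding Mm_def by (intro clp sp)
  note meas = measurable_pct[OF smooth_on_continuous]
  have [measurable]: "(\<lambda>x::'a. w (norm x)) \<in> borel_measurable borel" "Mm v \<in> borel_measurable borel" "lap v \<in> borel_measurable borel"
    "(\<lambda>x::'a. \<psi> (norm x)) \<in> borel_measurable borel" "(\<lambda>x::'a. T (norm x)) \<in> borel_measurable borel" "v \<in> borel_measurable borel"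
    "LL v \<in> borel_measurable borel" "rd v \<in> borel_measurable borel" "grad2 v \<in> borel_measurable borel"
    using sM sp by (auto intro!: meas) (unfold LL_def, intro meas clp sp)
  have [measurable]: "Z v \<in> borel_measurable borel" "BB v \<in> borel_measurable borel"
    unfolding Z_def[abs_def] BB_def[abs_def] by measurable
  have rd0: "rd v x = 0" if "norm x > R" for x
    unfolding rd_def by (intro sum.neutral ballI) (simp add: pd_zero_outside[OF v(2) that])
  have iL: "integrable lborel (LL v)"
  proof (rule integrable_bounded_support[where C = "h\<^sup>2 / 2 * C\<^sup>2 + \<bar>E\<bar> / 4 * C\<^sup>2" and R = R])
    show "AE x in lborel. \<bar>LL v x\<bar> \<le> h\<^sup>2 / 2 * C\<^sup>2 + \<bar>E\<bar> / 4 * C\<^sup>2"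
      using AE_nonzero
    proof eventually_elim
      case (elim x)
      have xp: "norm x > 0" using elim by simp
      have "\<bar>h\<^sup>2 / 2 * (rd v x)\<^sup>2 + E / 4 * (v x)\<^sup>2\<bar> \<le> h\<^sup>2 / 2 * (rd v x)\<^sup>2 + \<bar>E\<bar> / 4 * (v x)\<^sup>2"
        by (rule order.trans[OF abs_triangle_ineq]) (simp add: abs_mult)
      also have "\<dots> \<le> h\<^sup>2 / 2 * C\<^sup>2 + \<bar>E\<bar> / 4 * C\<^sup>2" using sq[OF elim] by (intro add_mono mult_left_mono) auto
      finally have "\<bar>w1 (norm x)\<bar> * \<bar>h\<^sup>2 / 2 * (rd v x)\<^sup>2 + E / 4 * (v x)\<^sup>2\<bar> \<le> 1 * (h\<^sup>2 / 2 * C\<^sup>2 + \<bar>E\<bar> / 4 * C\<^sup>2)"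
        using w_bounds(4,5)[OF xp] by (intro mult_mono) auto
      then show ?case by (simp add: LL_def abs_mult)
    qed
  qed (auto simp: LL_def v(2) rd0)
  define WZ where "WZ = (\<lambda>x. w (norm x) * Mm v x * Z v x)"
  have [measurable]: "WZ \<in> borel_measurable borel" unfolding WZ_def by measurable
  have iWZ: "integrable lborel WZ"
  proof (rule integrable_bounded_support[where C = "(C + \<bar>(N - 1) / 2\<bar> * C) * (exp (B / h) * (h\<^sup>2 * L + (M + \<bar>E\<bar>) * K0))" and R = R])
    show "AE x in lborel. \<bar>WZ x\<bar> \<le> (C + \<bar>(N - 1) / 2\<bar> * C) * (exp (B / h) * (h\<^sup>2 * L + (M + \<bar>E\<bar>) * K0))"
      using M AE_nonzero
    proof eventually_elim
      case (elim x)
      have xp: "norm x > 0" using elim by simp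
      note wb = w_bounds(1-3)[OF xp]
      have "\<bar>w (norm x) * Mm v x\<bar> \<le> C + \<bar>(N - 1) / 2\<bar> * C"
      proof -
        have "w (norm x) * Mm v x = w (norm x) * rd v x + (w (norm x) / norm x) * ((N - 1) / 2) * v x" by (simp add: Mm_def algebra_simps)
        also have "\<bar>\<dots>\<bar> \<le> \<bar>w (norm x)\<bar> * \<bar>rd v x\<bar> + \<bar>w (norm x) / norm x\<bar> * \<bar>(N - 1) / 2\<bar> * \<bar>v x\<bar>"
          by (rule order.trans[OF abs_triangle_ineq]) (simp add: abs_mult)
        also have "\<dots> \<le> 1 * C + 1 * \<bar>(N - 1) / 2\<bar> * C"
          using wb xp C elim by (intro add_mono mult_mono) (auto simp: divide_le_eq)
        finally show ?thesis by simp
      qed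
      \<comment> \<open>\<open>Z\<close> is estimated through the operator before conjugation, since
        its summands with the Laplacian of v and with 1/r need not be bounded near the origin
        separately.\<close>
      moreover have "\<bar>Z v x\<bar> \<le> exp (B / h) * (h\<^sup>2 * L + (M + \<bar>E\<bar>) * K0)"
      proof -
        have "\<bar>opr h (\<lambda>x. V x - E) u x\<bar> \<le> h\<^sup>2 * \<bar>lap u x\<bar> + \<bar>V x - E\<bar> * \<bar>u x\<bar>"
          unfolding opr_def by (rule order.trans[OF abs_triangle_ineq]) (simp add: abs_mult)
        also have "\<dots> \<le> h\<^sup>2 * L + (M + \<bar>E\<bar>) * K0"
          using L[of x] K0[of x] elim(1) by (intro add_mono mult_mono) auto
        finally have "exp (\<phi> (norm x) / h) * \<bar>opr h (\<lambda>x. V x - E) u x\<bar> \<le> exp (B / h) * (h\<^sup>2 * L + (M + \<bar>E\<bar>) * K0)"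
          using \<psi>_bounds(4)[OF xp] h by (intro mult_mono) (auto intro!: divide_right_mono)
        then show ?thesis unfolding v_def wconj_facts(4)[OF cc_smooth[OF u] elim(2)] by (simp add: abs_mult)
      qed
      ultimately have "\<bar>w (norm x) * Mm v x\<bar> * \<bar>Z v x\<bar> \<le> (C + \<bar>(N - 1) / 2\<bar> * C) * (exp (B / h) * (h\<^sup>2 * L + (M + \<bar>E\<bar>) * K0))"
        by (intro mult_mono) auto
      then show ?case by (simp add: WZ_def abs_mult)
    qed
    show "WZ x = 0" if "norm x > R" for x using rd0[OF that] v(2)[OF that] by (simp add: WZ_def Mm_def)
  qed simp
  define \<eta> where "\<eta> = (\<lambda>j. 1 / real (Suc j))"
  have \<eta>: "\<eta> j > 0" for j by (simp add: \<eta>_def)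
  have \<eta>0: "\<eta> \<longlonglongrightarrow> 0" unfolding \<eta>_def using LIMSEQ_inverse_real_of_nat by (simp add: inverse_eq_divide)
  \<comment> \<open>The cutoff is zero for r < \<eta> and one for r >= 2 \<eta>.\<close>
  define \<kappa> \<kappa>1 where "\<kappa> = (\<lambda>j r. cutoff (r / \<eta> j - 1))" and "\<kappa>1 = (\<lambda>j r. cutoff1 (r / \<eta> j - 1) / \<eta> j)"
  have s\<kappa>: "smooth_on UNIV (\<kappa> j)" for j
  proof -
    have "smooth_on UNIV (\<lambda>r::real. r * (1 / \<eta> j) - 1)" by (intro smooth_on_diff smooth_on_mult smooth_on_id smooth_on_const) auto
    then have "smooth_on UNIV (\<lambda>r. cutoff (r * (1 / \<eta> j) - 1))" by (rule smooth_on_compose[OF smooth_cutoff]) auto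
    then show ?thesis by (simp add: \<kappa>_def)
  qed
  have d\<kappa>: "(\<kappa> j has_real_derivative \<kappa>1 j r) (at r)" for j r
  proof -
    have "((\<lambda>r. r / \<eta> j - 1) has_real_derivative 1 / \<eta> j) (at r)" using \<eta>[of j] by (auto intro!: derivative_eq_intros)
    from DERIV_chain2[OF cutoff1(1) this] show ?thesis by (simp add: \<kappa>_def \<kappa>1_def)
  qed
  have \<kappa>01: "0 \<le> \<kappa> j r" "\<kappa> j r \<le> 1" "0 \<le> \<kappa>1 j r" for j r
    using cutoff_bounds cutoff1(2) \<eta>[of j] by (auto simp: \<kappa>_def \<kappa>1_def)
  have \<kappa>z: "\<kappa> j r = 0" "\<kappa>1 j r = 0" if "r < \<eta> j" for j r
  proof -
    have "r / \<eta> j - 1 < 0" using that \<eta>[of j] by (simp add: divide_less_eq)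
    then show "\<kappa> j r = 0" "\<kappa>1 j r = 0" using cutoff_bounds(3) cutoff1(3) by (auto simp: \<kappa>_def \<kappa>1_def)
  qed
  have \<kappa>lim: "(\<lambda>j. \<kappa> j r) \<longlonglongrightarrow> 1" if r: "r > 0" for r
  proof (rule tendsto_eventually)
    have "\<forall>\<^sub>F j in sequentially. \<eta> j < r / 2" using order_tendstoD(2)[OF \<eta>0, of "r / 2"] r by simp
    then show "\<forall>\<^sub>F j in sequentially. \<kappa> j r = 1"
    proof eventually_elim
      case (elim j)
      then have "r / \<eta> j - 1 \<ge> 1" using \<eta>[of j] by (simp add: le_divide_eq)
      then show ?case by (simp add: \<kappa>_def cutoff_bounds(4))
    qed
  qed
  obtain K where K: "K \<ge> 0" "\<And>t. cutoff1 t \<le> K" using cutoff1(4) by blast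
  have [measurable]: "(\<lambda>x::'a. \<kappa> j (norm x)) \<in> borel_measurable borel" "(\<lambda>x::'a. \<kappa>1 j (norm x)) \<in> borel_measurable borel" for j
  proof -
    have "smooth_on {0<..} (\<kappa> j)" "smooth_on {0<..} (\<kappa>1 j)"
      using smooth_on_DERIV_smooth[of "\<kappa> j" "\<kappa>1 j"] smooth_on_subset[OF s\<kappa>] d\<kappa> by auto
    then show "(\<lambda>x::'a. \<kappa> j (norm x)) \<in> borel_measurable borel" "(\<lambda>x::'a. \<kappa>1 j (norm x)) \<in> borel_measurable borel"
      by (auto intro!: meas smooth_radial)
  qed
  have main: "(\<integral>x. \<kappa> j (norm x) * LL v x \<partial>lborel) + (\<integral>x. w (norm x) * \<kappa>1 j (norm x) * BB v x \<partial>lborel)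
    \<le> (\<integral>x. w (norm x) * \<kappa> j (norm x) * Mm v x * Z v x \<partial>lborel)" for j
    by (rule carleman_cutoff[OF v smooth_on_subset[OF s\<kappa>] d\<kappa> \<kappa>01(1,3) \<kappa>z \<eta>]) auto
  have l1: "(\<lambda>j. \<integral>x. \<kappa> j (norm x) * LL v x \<partial>lborel) \<longlonglongrightarrow> (\<integral>x. LL v x \<partial>lborel)"
  proof (rule integral_dominated_convergence[where w = "\<lambda>x. norm (LL v x)"])
    show "AE x in lborel. (\<lambda>j. \<kappa> j (norm x) * LL v x) \<longlonglongrightarrow> LL v x"
      using AE_nonzero by eventually_elim (use tendsto_mult[OF \<kappa>lim tendsto_const] in fastforce)
  qed (use iL \<kappa>01 in \<open>auto simp: abs_mult mult_left_le_one_le\<close>)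
  have l2: "(\<lambda>j. \<integral>x. w (norm x) * \<kappa> j (norm x) * Mm v x * Z v x \<partial>lborel) \<longlonglongrightarrow> (\<integral>x. WZ x \<partial>lborel)"
  proof (rule integral_dominated_convergence[where w = "\<lambda>x. norm (WZ x)"])
    have e: "w (norm x) * \<kappa> j (norm x) * Mm v x * Z v x = \<kappa> j (norm x) * WZ x" for j x by (simp add: WZ_def)
    show "AE x in lborel. (\<lambda>j. w (norm x) * \<kappa> j (norm x) * Mm v x * Z v x) \<longlonglongrightarrow> WZ x"
      unfolding e using AE_nonzero by eventually_elim (use tendsto_mult[OF \<kappa>lim tendsto_const] in fastforce)
    show "AE x in lborel. norm (w (norm x) * \<kappa> j (norm x) * Mm v x * Z v x) \<le> norm (WZ x)" for j
      unfolding e using \<kappa>01 by (auto simp: abs_mult mult_left_le_one_le)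
  qed (use iWZ in auto)
  define CT where "CT = \<bar>E\<bar> + B\<^sup>2 + h * B"
  define C3 where "C3 = h\<^sup>2 / 2 * C\<^sup>2 + h\<^sup>2 / 2 * (C + C\<^sup>2) + (CT + M) / 2 * C\<^sup>2"
  define C4 where "C4 = h\<^sup>2 * ((N - 1) / 2) * C\<^sup>2"
  have N1: "N \<ge> 1" unfolding N_def using DIM_positive[where 'a = 'a] by linarith
  have C4: "C4 \<ge> 0" unfolding C4_def using N1 by simp
  have C3: "C3 \<ge> 0"
  proof -
    have "B \<ge> 0" using \<psi>_bounds(3)[of 1] by linarith
    then have "CT \<ge> 0" unfolding CT_def using h by simp
    then show ?thesis unfolding C3_def using M0 C0 by (intro add_nonneg_nonneg mult_nonneg_nonneg) auto
  qed
  \<comment> \<open>On the shell w <= r <= 2 \<eta> and \<kappa>1 <= K / \<eta>, which gives 2 K C3.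
    In the summand with 1/r the factor w is spent on w / r <= 1, so K C4 / \<eta> remains.\<close>
  define er where "er = (\<lambda>j. (2 * K * C3 + K * C4 / \<eta> j) * measure lborel (cball (0::'a) (2 * \<eta> j)))"
  have err: "\<bar>\<integral>x. w (norm x) * \<kappa>1 j (norm x) * BB v x \<partial>lborel\<bar> \<le> er j" for j
  proof -
    let ?c = "2 * K * C3 + K * C4 / \<eta> j"
    have c0: "?c \<ge> 0" using K C3 C4 \<eta>[of j] by simp
    have iI: "integrable lborel (\<lambda>x::'a. ?c * indicator (cball 0 (2 * \<eta> j)) x)"
      using emeasure_lborel_cball_finite[of "0::'a" "2 * \<eta> j"] by (intro integrable_mult_right integrable_real_indicator) auto
    have ae: "AE x in lborel. norm (w (norm x) * \<kappa>1 j (norm x) * BB v x) \<le> ?c * indicator (cball 0 (2 * \<eta> j)) x"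
      using M AE_nonzero
    proof eventually_elim
      case (elim x)
      have xp: "norm x > 0" using elim by simp
      note wb = w_bounds(1-3)[OF xp]
      show ?case
      proof (cases "norm x > 2 * \<eta> j")
        case True
        then have "norm x / \<eta> j - 1 > 1" using \<eta>[of j] by (simp add: less_divide_eq)
        then have "\<kappa>1 j (norm x) = 0" using cutoff1(3) by (simp add: \<kappa>1_def)
        then show ?thesis using c0 by simp
      next
        case False
        have k1: "\<kappa>1 j (norm x) \<le> K / \<eta> j" unfolding \<kappa>1_def using K \<eta>[of j] by (intro divide_right_mono) auto
        define b1 where "b1 = h\<^sup>2 / 2 * (rd v x)\<^sup>2 - h\<^sup>2 / 2 * (grad2 v x - (rd v x)\<^sup>2) + (T (norm x) - V x) / 2 * (v x)\<^sup>2"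
        define b2 where "b2 = h\<^sup>2 * ((N - 1) / 2) * v x * rd v x"
        have "\<bar>b1\<bar> \<le> C3"
        proof -
          have g0: "grad2 v x \<ge> 0" unfolding grad2_def by (intro sum_nonneg) auto
          have "\<bar>grad2 v x - (rd v x)\<^sup>2\<bar> \<le> C + C\<^sup>2" using C(3)[OF elim(2)] sq[OF elim(2)] g0 zero_le_power2[of "rd v x"] zero_le_power2[of C] C0 by linarith
          then have 1: "\<bar>h\<^sup>2 / 2 * (grad2 v x - (rd v x)\<^sup>2)\<bar> \<le> h\<^sup>2 / 2 * (C + C\<^sup>2)" unfolding abs_mult by (intro mult_mono) auto
          have 2: "\<bar>h\<^sup>2 / 2 * (rd v x)\<^sup>2\<bar> \<le> h\<^sup>2 / 2 * C\<^sup>2" unfolding abs_mult using sq[OF elim(2)] by (intro mult_mono) auto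
          have "\<bar>(T (norm x) - V x) / 2\<bar> \<le> (CT + M) / 2" using T_bound[OF xp] elim(1) unfolding CT_def by auto
          then have 3: "\<bar>(T (norm x) - V x) / 2 * (v x)\<^sup>2\<bar> \<le> (CT + M) / 2 * C\<^sup>2"
            unfolding abs_mult[of _ "(v x)\<^sup>2"] using sq[OF elim(2)] by (intro mult_mono) auto
          show ?thesis unfolding b1_def C3_def using 1 2 3 by linarith
        qed
        have "\<bar>b2\<bar> \<le> C4"
        proof -
          have "\<bar>v x\<bar> * \<bar>rd v x\<bar> \<le> C * C" using C C0 elim by (intro mult_mono) auto
          then have "h\<^sup>2 * ((N - 1) / 2) * (\<bar>v x\<bar> * \<bar>rd v x\<bar>) \<le> h\<^sup>2 * ((N - 1) / 2) * (C * C)"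
            using N1 by (intro mult_left_mono) auto
          then show ?thesis using N1 by (simp add: b2_def C4_def abs_mult power2_eq_square mult.assoc)
        qed
        have "w (norm x) * BB v x = w (norm x) * b1 + (w (norm x) / norm x) * b2"
          by (simp add: BB_def b1_def b2_def algebra_simps)
        also have "\<bar>\<dots>\<bar> \<le> \<bar>w (norm x)\<bar> * \<bar>b1\<bar> + \<bar>w (norm x) / norm x\<bar> * \<bar>b2\<bar>"
          by (rule order.trans[OF abs_triangle_ineq]) (simp add: abs_mult)
        also have "\<dots> \<le> (2 * \<eta> j) * C3 + 1 * C4"
          using wb xp False \<open>\<bar>b1\<bar> \<le> C3\<close> \<open>\<bar>b2\<bar> \<le> C4\<close> by (intro add_mono mult_mono) (auto simp: divide_le_eq)
        finally have "\<bar>\<kappa>1 j (norm x)\<bar> * \<bar>w (norm x) * BB v x\<bar> \<le> K / \<eta> j * ((2 * \<eta> j) * C3 + 1 * C4)"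
          using k1 \<kappa>01(3)[of j "norm x"] K \<eta>[of j] by (intro mult_mono) auto
        also have "\<dots> = ?c" using \<eta>[of j] by (simp add: field_simps)
        finally show ?thesis using False by (simp add: abs_mult mult.left_commute mult.assoc)
      qed
    qed
    have "\<bar>\<integral>x. w (norm x) * \<kappa>1 j (norm x) * BB v x \<partial>lborel\<bar> \<le> (\<integral>x. norm (w (norm x) * \<kappa>1 j (norm x) * BB v x) \<partial>lborel)"
      using integral_norm_bound[of lborel "\<lambda>x. w (norm x) * \<kappa>1 j (norm x) * BB v x"] by simp
    also have "\<dots> \<le> (\<integral>x. ?c * indicator (cball (0::'a) (2 * \<eta> j)) x \<partial>lborel)"
      by (rule integral_mono_AE'[OF iI ae]) (use c0 in auto)
    also have "\<dots> = er j" by (simp add: er_def)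
    finally show ?thesis .
  qed
  have er0: "er \<longlonglongrightarrow> 0"
  proof -
    let ?n = "DIM('a)"
    define \<omega> where "\<omega> = unit_ball_vol (real ?n)"
    have e: "er j = (2 * K * C3 * \<omega> * 2 ^ ?n) * \<eta> j ^ ?n + (K * C4 * \<omega> * 2 ^ ?n) * \<eta> j ^ (?n - 1)" for j
    proof -
      have "\<eta> j ^ ?n = \<eta> j * \<eta> j ^ (?n - 1)" using DIM_positive[where 'a = 'a] by (cases ?n) auto
      then show ?thesis unfolding er_def using \<eta>[of j]
        by (subst content_cball_0) (auto simp: \<omega>_def power_mult_distrib field_simps)
    qed
    have z2: "(\<lambda>j. (K * C4 * \<omega> * 2 ^ ?n) * \<eta> j ^ (?n - 1)) \<longlonglongrightarrow> 0"
    proof (cases "?n = 1")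
      case True
      then show ?thesis by (simp add: C4_def N_def)
    next
      case False
      then have "?n - 1 > 0" using DIM_positive[where 'a = 'a] by linarith
      then show ?thesis using tendsto_mult_right_zero[OF tendsto_null_power[OF \<eta>0, of "?n - 1"]] by auto
    qed
    have "(\<lambda>j. (2 * K * C3 * \<omega> * 2 ^ ?n) * \<eta> j ^ ?n + (K * C4 * \<omega> * 2 ^ ?n) * \<eta> j ^ (?n - 1)) \<longlonglongrightarrow> 0 + 0"
      by (rule tendsto_add[OF tendsto_mult_right_zero[OF tendsto_null_power[OF \<eta>0]] z2]) simp
    then show ?thesis unfolding e[abs_def] by simp
  qed
  have "(\<lambda>j. \<integral>x. w (norm x) * \<kappa>1 j (norm x) * BB v x \<partial>lborel) \<longlonglongrightarrow> 0"
    by (rule Lim_null_comparison[OF _ er0]) (use err in auto)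
  from LIMSEQ_le[OF tendsto_add[OF l1 this] l2] main have "(\<integral>x. LL v x \<partial>lborel) + 0 \<le> (\<integral>x. WZ x \<partial>lborel)" by blast
  then show ?thesis by (simp add: v_def WZ_def)
qed

end

section \<open>The Carleman estimate for the resolvent\<close>

lemma lim2_sum:
  assumes "\<And>i. i \<in> I \<Longrightarrow> lim2 (F i) (f i)"
  shows "lim2 (\<lambda>n x. \<Sum>i\<in>I. F i n x) (\<lambda>x. \<Sum>i\<in>I. f i x)"
  using assms by (induction I rule: infinite_finite_induct) (auto intro!: lim2_add lim2_const sqi_zero)

lemma ed_bdd_meas: "b \<in> Basis \<Longrightarrow> bdd_meas (ed b)"
  unfolding bdd_meas_def using measurable_pct[OF smooth_on_continuous[OF smooth_ed]] abs_ed_le by (auto intro!: exI[of _ 1])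

text \<open>The right-hand side is kept as an integral of |f| |u| instead of a product of norms, so
  that weights and cutoffs can later be moved between the two factors.\<close>

lemma energy_Im_lim:
  assumes p: "bdd_meas p" and U: "\<And>n. ccC (U n)" and lim: "lim2 U u" "lim2 (\<lambda>n. QQ h p (- \<epsilon>) (U n)) f"
  shows "\<epsilon> * N2 u \<le> (\<integral>x. norm (f x) * norm (u x) \<partial>lborel)"
proof -
  have J: "lim2 (\<lambda>n x. Complex (Im (QQ h p (- \<epsilon>) (U n) x)) (- Re (QQ h p (- \<epsilon>) (U n) x))) (\<lambda>x. Complex (Im (f x)) (- Re (f x)))"
    using lim2_scaleR[OF lim2_Re[OF lim(2)], of "-1"] by (intro lim2_Complex lim2_Im lim) simp
  have "(\<lambda>n. - \<epsilon> * N2 (U n)) \<longlonglongrightarrow> (\<integral>x. Complex (Im (f x)) (- Re (f x)) \<bullet> u x \<partial>lborel)"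
    using lim2_integral_inner[OF J lim(1)] energy_Im[OF p U, of h "- \<epsilon>"] by (simp add: inner_complex_def)
  moreover have "(\<lambda>n. - \<epsilon> * N2 (U n)) \<longlonglongrightarrow> - \<epsilon> * N2 u" by (intro tendsto_mult tendsto_const lim2_N2 lim)
  ultimately have "- \<epsilon> * N2 u = (\<integral>x. Complex (Im (f x)) (- Re (f x)) \<bullet> u x \<partial>lborel)" by (rule LIMSEQ_unique[rotated])
  then have "\<epsilon> * N2 u \<le> \<bar>\<integral>x. Complex (Im (f x)) (- Re (f x)) \<bullet> u x \<partial>lborel\<bar>" by linarith
  also have "\<dots> \<le> (\<integral>x. norm (Complex (Im (f x)) (- Re (f x)) \<bullet> u x) \<partial>lborel)"
    using integral_norm_bound[of lborel "\<lambda>x. Complex (Im (f x)) (- Re (f x)) \<bullet> u x"] by simp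
  also have "\<dots> \<le> (\<integral>x. norm (f x) * norm (u x) \<partial>lborel)"
  proof (rule integral_mono)
    show "integrable lborel (\<lambda>x. norm (Complex (Im (f x)) (- Re (f x)) \<bullet> u x))"
      by (intro integrable_norm sqi_inner_integrable lim2D(2)[OF J] lim2D(2)[OF lim(1)])
    show "integrable lborel (\<lambda>x. norm (f x) * norm (u x))"
      by (rule sqi_mult_norm_integrable[OF lim2D(2)[OF lim(2)] lim2D(2)[OF lim(1)]])
    fix x
    have "norm (Complex (Im (f x)) (- Re (f x))) = norm (f x)" by (simp add: cmod_def add.commute)
    then show "norm (Complex (Im (f x)) (- Re (f x)) \<bullet> u x) \<le> norm (f x) * norm (u x)"
      using Cauchy_Schwarz_ineq2[of "Complex (Im (f x)) (- Re (f x))" "u x"] by simp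
  qed
  finally show ?thesis .
qed

text \<open>A gradient bound is needed because the \<epsilon> term of the Carleman estimate pairs u
  with its own radial derivative.\<close>

lemma energy_Re_lim:
  assumes p: "bdd_meas p" and U: "\<And>n. ccC (U n)" and lim: "lim2 U u" "lim2 (\<lambda>n. QQ h p \<tau> (U n)) f"
    and G: "\<And>b. b \<in> Basis \<Longrightarrow> lim2 (\<lambda>n. pd b (\<lambda>x. Re (U n x))) (G1 b)" "\<And>b. b \<in> Basis \<Longrightarrow> lim2 (\<lambda>n. pd b (\<lambda>x. Im (U n x))) (G2 b)"
    and M: "AE x in lborel. - M \<le> p x"
  shows "h\<^sup>2 * (\<Sum>b\<in>Basis. N2 (G1 b) + N2 (G2 b)) \<le> (\<integral>x. norm (f x) * norm (u x) \<partial>lborel) + M * N2 u"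
proof -
  have l1: "(\<lambda>n. \<integral>x. QQ h p \<tau> (U n) x \<bullet> U n x \<partial>lborel) \<longlonglongrightarrow> (\<integral>x. f x \<bullet> u x \<partial>lborel)"
    by (rule lim2_integral_inner[OF lim(2,1)])
  have l2: "(\<lambda>n. \<integral>x. p x * (norm (U n x))\<^sup>2 \<partial>lborel) \<longlonglongrightarrow> (\<integral>x. p x * (norm (u x))\<^sup>2 \<partial>lborel)"
    using lim2_integral_inner[OF bdd_meas_lim2[OF p lim(1)] lim(1)] by (simp add: power2_norm_eq_inner)
  have "(\<lambda>n. h\<^sup>2 * (\<Sum>b\<in>Basis. N2 (pd b (\<lambda>x. Re (U n x))) + N2 (pd b (\<lambda>x. Im (U n x)))) + (\<integral>x. p x * (norm (U n x))\<^sup>2 \<partial>lborel))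
    \<longlonglongrightarrow> h\<^sup>2 * (\<Sum>b\<in>Basis. N2 (G1 b) + N2 (G2 b)) + (\<integral>x. p x * (norm (u x))\<^sup>2 \<partial>lborel)"
    by (intro tendsto_add tendsto_mult tendsto_const tendsto_sum lim2_N2 G l2)
  then have eq: "h\<^sup>2 * (\<Sum>b\<in>Basis. N2 (G1 b) + N2 (G2 b)) + (\<integral>x. p x * (norm (u x))\<^sup>2 \<partial>lborel) = (\<integral>x. f x \<bullet> u x \<partial>lborel)"
    using l1 unfolding energy_Re[OF p U] by (rule LIMSEQ_unique)
  note s = lim2D(2)[OF lim(2)] lim2D(2)[OF lim(1)]
  have "(\<integral>x. f x \<bullet> u x \<partial>lborel) \<le> (\<integral>x. norm (f x) * norm (u x) \<partial>lborel)"
    by (intro integral_mono sqi_inner_integrable sqi_mult_norm_integrable s norm_cauchy_schwarz)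
  moreover have "(\<integral>x. - M * (norm (u x))\<^sup>2 \<partial>lborel) \<le> (\<integral>x. p x * (norm (u x))\<^sup>2 \<partial>lborel)"
  proof (rule integral_mono_AE)
    show "integrable lborel (\<lambda>x. p x * (norm (u x))\<^sup>2)"
      by (rule bdd_meas_integrable[OF p sqi_integrable[OF s(2)]])
    show "AE x in lborel. - M * (norm (u x))\<^sup>2 \<le> p x * (norm (u x))\<^sup>2"
      using M by eventually_elim (intro mult_right_mono, auto)
  qed (use sqi_integrable[OF s(2)] in simp)
  ultimately show ?thesis using eq by (simp add: N2_def)
qed

text \<open>Absorption of the source term: the part with P uses up the whole derivative term of
  \<open>LL\<close>, the part with a uses E/8 of its E/4, and the other E/8 is left for the final
  estimate. The hypothesis on \<open>t\<close> replaces 1/w1 by the weight (1 + r)^(2s), and h <= 1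
  gives both remainders the common factor 1/h^2.\<close>

lemma young_pointwise:
  fixes w w1 h E i n X a P f Cw t :: real
  assumes pos: "0 < w1" "0 < h" "h \<le> 1" "0 < E" and w: "0 \<le> w" "w \<le> 1" "0 \<le> w * i" "w * i \<le> 1" and t: "1 \<le> w1 * Cw * t"
  shows "(w * X * P + w * X\<^sup>2 * ((n - 1) / 2) * i * a) * f
    \<le> w1 * (h\<^sup>2 / 2 * P\<^sup>2) + E / 8 * w1 * X\<^sup>2 * a\<^sup>2 + Cw * (1 / 2 + (n - 1)\<^sup>2 / (2 * E)) / h\<^sup>2 * (X\<^sup>2 * t * f\<^sup>2)"
proof -
  have inv: "1 / w1 \<le> Cw * t" using t pos by (simp add: divide_le_eq mult.commute mult.left_commute)
  have Y1: "(w * X * P) * f \<le> w1 * (h\<^sup>2 / 2 * P\<^sup>2) + (w * X * f)\<^sup>2 / (2 * h\<^sup>2) * (1 / w1)"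
  proof -
    have "0 \<le> (w1 * h\<^sup>2 * P - w * X * f)\<^sup>2 / (2 * h\<^sup>2 * w1)" using pos by simp
    also have "\<dots> = w1 * (h\<^sup>2 / 2 * P\<^sup>2) + (w * X * f)\<^sup>2 / (2 * h\<^sup>2) * (1 / w1) - (w * X * P) * f"
      using pos by (simp add: field_simps power2_eq_square)
    finally show ?thesis by simp
  qed
  have Y2: "(w * X\<^sup>2 * ((n - 1) / 2) * i * a) * f \<le> E / 8 * w1 * X\<^sup>2 * a\<^sup>2 + X\<^sup>2 * (n - 1)\<^sup>2 / (2 * E) * (w * i * f)\<^sup>2 * (1 / w1)"
  proof -
    have "0 \<le> X\<^sup>2 * (E * w1 * a - 2 * (n - 1) * (w * i) * f)\<^sup>2 / (8 * E * w1)" using pos by simp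
    also have "\<dots> = E / 8 * w1 * X\<^sup>2 * a\<^sup>2 + X\<^sup>2 * (n - 1)\<^sup>2 / (2 * E) * (w * i * f)\<^sup>2 * (1 / w1) - (w * X\<^sup>2 * ((n - 1) / 2) * i * a) * f"
      using pos by (simp add: field_simps power2_eq_square)
    finally show ?thesis by simp
  qed
  have w2: "w\<^sup>2 \<le> 1" "(w * i)\<^sup>2 \<le> 1" using power_mono[OF w(2,1), of 2] power_mono[OF w(4,3), of 2] by auto
  have "(w * X * f)\<^sup>2 / (2 * h\<^sup>2) * (1 / w1) \<le> (X * f)\<^sup>2 / (2 * h\<^sup>2) * (Cw * t)"
  proof (rule mult_mono[OF divide_right_mono inv])
    show "(w * X * f)\<^sup>2 \<le> (X * f)\<^sup>2" using w2(1) mult_right_mono[OF w2(1), of "(X * f)\<^sup>2"] by (simp add: power_mult_distrib mult.assoc)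
  qed (use pos in auto)
  moreover have "X\<^sup>2 * (n - 1)\<^sup>2 / (2 * E) * (w * i * f)\<^sup>2 * (1 / w1) \<le> X\<^sup>2 * (n - 1)\<^sup>2 / (2 * E) / h\<^sup>2 * f\<^sup>2 * (Cw * t)"
  proof (rule mult_mono[OF _ inv])
    have a: "(w * i * f)\<^sup>2 \<le> f\<^sup>2" using mult_right_mono[OF w2(2), of "f\<^sup>2"] by (simp add: power_mult_distrib)
    have "X\<^sup>2 * (n - 1)\<^sup>2 / (2 * E) \<le> X\<^sup>2 * (n - 1)\<^sup>2 / (2 * E) / h\<^sup>2"
    proof -
      have "h\<^sup>2 \<le> 1" using pos power_mono[of h 1 2] by simp
      then have "X\<^sup>2 * (n - 1)\<^sup>2 / (2 * E) * h\<^sup>2 \<le> X\<^sup>2 * (n - 1)\<^sup>2 / (2 * E) * 1" using pos by (intro mult_left_mono) auto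
      then show ?thesis using pos by (simp add: le_divide_eq)
    qed
    then show "X\<^sup>2 * (n - 1)\<^sup>2 / (2 * E) * (w * i * f)\<^sup>2 \<le> X\<^sup>2 * (n - 1)\<^sup>2 / (2 * E) / h\<^sup>2 * f\<^sup>2"
      using a pos by (intro mult_mono) auto
  qed (use pos in auto)
  moreover have "(X * f)\<^sup>2 / (2 * h\<^sup>2) * (Cw * t) + X\<^sup>2 * (n - 1)\<^sup>2 / (2 * E) / h\<^sup>2 * f\<^sup>2 * (Cw * t)
     = Cw * (1 / 2 + (n - 1)\<^sup>2 / (2 * E)) / h\<^sup>2 * (X\<^sup>2 * t * f\<^sup>2)"
    using pos by (simp add: field_simps power2_eq_square)
  ultimately show ?thesis using Y1 Y2 by (simp add: distrib_right)
qed

text \<open>Young's inequality with the parameter h, so that the semiclassical energy h^2 |du|^2 +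
  |u|^2 appears on the right.\<close>

lemma cross_term_le:
  fixes h a b da db :: real
  assumes h: "h > 0"
  shows "\<bar>- da * b + db * a\<bar> \<le> 1 / (2 * h) * (h\<^sup>2 * (da\<^sup>2 + db\<^sup>2) + (a\<^sup>2 + b\<^sup>2))"
proof -
  have "0 \<le> (h * da - b)\<^sup>2 + (h * db + a)\<^sup>2" "0 \<le> (h * da + b)\<^sup>2 + (h * db - a)\<^sup>2" by simp_all
  then have "2 * h * (da * b - db * a) \<le> h\<^sup>2 * (da\<^sup>2 + db\<^sup>2) + (a\<^sup>2 + b\<^sup>2)"
    "2 * h * (- da * b + db * a) \<le> h\<^sup>2 * (da\<^sup>2 + db\<^sup>2) + (a\<^sup>2 + b\<^sup>2)"
    by (simp_all add: power2_eq_square algebra_simps)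
  then have "2 * h * \<bar>- da * b + db * a\<bar> \<le> h\<^sup>2 * (da\<^sup>2 + db\<^sup>2) + (a\<^sup>2 + b\<^sup>2)"
    using h by (auto simp: abs_if)
  then show ?thesis using h by (simp add: field_simps)
qed

text \<open>The equations for real and imaginary part have the sources f1 - e b and f2 + e a, so the
  spectral parameter enters only through the antisymmetric combination - Sa b + Sb a.\<close>

lemma absorb_pointwise:
  fixes Sa Sb f1 f2 a b e D Pa Pb w1 X E K t h2 :: real
  assumes "Sa * f1 \<le> w1 * (h2 / 2 * Pa\<^sup>2) + E / 8 * w1 * X\<^sup>2 * a\<^sup>2 + K * (X\<^sup>2 * t * f1\<^sup>2)"
    and "Sb * f2 \<le> w1 * (h2 / 2 * Pb\<^sup>2) + E / 8 * w1 * X\<^sup>2 * b\<^sup>2 + K * (X\<^sup>2 * t * f2\<^sup>2)"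
    and "e * (- Sa * b + Sb * a) \<le> e * D"
  shows "E / 8 * (w1 * X\<^sup>2 * (a\<^sup>2 + b\<^sup>2)) - K * (X\<^sup>2 * t * (f1\<^sup>2 + f2\<^sup>2)) - e * D
    \<le> ((h2 / 2 * ((w1 * Pa) * Pa) + E / 4 * ((w1 * (X * a)) * (X * a))) + (h2 / 2 * ((w1 * Pb) * Pb) + E / 4 * ((w1 * (X * b)) * (X * b))))
      - (Sa * (f1 - e * b) + Sb * (f2 + e * a))"
  using assms by (simp add: power2_eq_square algebra_simps)

context carleman
begin

text \<open>\<open>PP\<close> is the radial derivative of the conjugated function, and
  \<open>SS\<close> is exp (\<phi> / h) w M v, both expressed by the original function. The radial
  derivative \<open>da\<close> is a separate argument because for the resolvent it exists only as a
  limit in square mean.\<close>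

definition "Xw x = exp (\<phi> (norm x) / h)" for x :: 'a
definition "PP a da x = Xw x * (da x + \<psi> (norm x) / h * a x)" for x :: 'a
definition "SS a da x = w (norm x) * Xw x * PP a da x + w (norm x) * (Xw x)\<^sup>2 * ((N - 1) / 2) * (1 / norm x) * a x" for x :: 'a

lemma bdd_meas_radial:
  assumes "smooth_on {0<..} g" "\<And>r. r > 0 \<Longrightarrow> \<bar>g r\<bar> \<le> C"
  shows "bdd_meas (\<lambda>x::'a. g (norm x))"
  unfolding bdd_meas_def
proof
  show "(\<lambda>x::'a. g (norm x)) \<in> borel_measurable borel"
    by (rule measurable_pct[OF smooth_on_continuous[OF smooth_radial[OF assms(1)]]])
  have "AE x::'a in lborel. \<bar>g (norm x)\<bar> \<le> C" using AE_nonzero by eventually_elim (use assms(2) in auto)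
  then show "\<exists>M. AE x::'a in lborel. \<bar>g (norm x)\<bar> \<le> M" by blast
qed

lemma smooth_exp\<phi>: "smooth_on {0<..} (\<lambda>r. exp (\<phi> r / h))"
proof -
  have "smooth_on {0<..} (\<lambda>r. exp (\<phi> r * (1 / h)))"
    by (rule smooth_on_compose[OF smooth_on_exp smooth_on_mult[OF _ s\<phi> smooth_on_const]]) auto
  then show ?thesis by simp
qed

lemma exp\<phi>_le: "r > 0 \<Longrightarrow> exp (\<phi> r / h) \<le> exp (B / h)"
  using \<psi>_bounds(4)[of r] h by (auto intro!: divide_right_mono)

lemma weights_bdd: "bdd_meas Xw" "bdd_meas (\<lambda>x::'a. \<psi> (norm x) / h)" "bdd_meas (\<lambda>x::'a. w1 (norm x))" "bdd_meas (\<lambda>x::'a. w (norm x))"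
    "bdd_meas (\<lambda>x::'a. w (norm x) * (1 / norm x))"
proof -
  show "bdd_meas Xw" unfolding Xw_def[abs_def]
    by (rule bdd_meas_radial[OF smooth_exp\<phi>, of "exp (B / h)"]) (use exp\<phi>_le in auto)
  have "smooth_on {0<..} (\<lambda>r. \<psi> r * (1 / h))" by (rule smooth_on_mult[OF _ smooths(3) smooth_on_const]) auto
  then have "bdd_meas (\<lambda>x::'a. \<psi> (norm x) * (1 / h))"
    by (rule bdd_meas_radial[of _ "B / h"]) (use \<psi>_bounds(1,2) h in \<open>auto intro!: divide_right_mono simp: abs_mult\<close>)
  then show "bdd_meas (\<lambda>x::'a. \<psi> (norm x) / h)" by simp
  show "bdd_meas (\<lambda>x::'a. w1 (norm x))" by (rule bdd_meas_radial[OF smooths(1), of 1]) (use w_bounds in auto)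
  show "bdd_meas (\<lambda>x::'a. w (norm x))" by (rule bdd_meas_radial[OF sw, of 1]) (use w_bounds in auto)
  have "smooth_on {0<..} (\<lambda>r. w r * (1 / r))" by (intro smooth_on_mult sw smooth_on_divide smooth_on_const smooth_on_id) auto
  then show "bdd_meas (\<lambda>x::'a. w (norm x) * (1 / norm x))"
    by (rule bdd_meas_radial[of _ 1]) (use w_bounds(1,2) in \<open>auto simp: divide_le_eq\<close>)
qed

lemma lim2_PP_SS:
  assumes a: "lim2 A a" and da: "lim2 DA da"
  shows "lim2 (\<lambda>n. PP (A n) (DA n)) (PP a da)" "lim2 (\<lambda>n. SS (A n) (DA n)) (SS a da)"
proof -
  note m = weights_bdd[THEN bdd_meas_lim2]
  have "lim2 (\<lambda>n x. Xw x *\<^sub>R (DA n x + (\<psi> (norm x) / h) *\<^sub>R A n x)) (\<lambda>x. Xw x *\<^sub>R (da x + (\<psi> (norm x) / h) *\<^sub>R a x))"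
    by (intro m lim2_add a da)
  then show P: "lim2 (\<lambda>n. PP (A n) (DA n)) (PP a da)" by (simp add: PP_def[abs_def])
  have "lim2 (\<lambda>n x. w (norm x) *\<^sub>R (Xw x *\<^sub>R PP (A n) (DA n) x) + Xw x *\<^sub>R (Xw x *\<^sub>R ((w (norm x) * (1 / norm x)) *\<^sub>R (((N - 1) / 2) *\<^sub>R A n x))))
    (\<lambda>x. w (norm x) *\<^sub>R (Xw x *\<^sub>R PP a da x) + Xw x *\<^sub>R (Xw x *\<^sub>R ((w (norm x) * (1 / norm x)) *\<^sub>R (((N - 1) / 2) *\<^sub>R a x))))"
    by (intro m lim2_add lim2_scaleR P a)
  then show "lim2 (\<lambda>n. SS (A n) (DA n)) (SS a da)" by (simp add: SS_def[abs_def] power2_eq_square mult_ac)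
qed

text \<open>Every integral is now an inner product of images of \<open>a\<close> and its derivatives
  under bounded operations, hence continuous under convergence in square mean.\<close>

lemma carleman_real':
  assumes a: "cc a"
  shows "h\<^sup>2 / 2 * (\<integral>x. (w1 (norm x) * PP a (rd a) x) * PP a (rd a) x \<partial>lborel) + E / 4 * (\<integral>x. (w1 (norm x) * (Xw x * a x)) * (Xw x * a x) \<partial>lborel)
    \<le> (\<integral>x. SS a (rd a) x * opr h (\<lambda>x. V x - E) a x \<partial>lborel)"
proof -
  have sa: "sqi a" by (rule sqi_cc[OF a])
  have "sqi (\<lambda>x. \<Sum>b\<in>Basis. ed b x *\<^sub>R pd b a x)" by (intro sqi_sum bdd_meas_sqi ed_bdd_meas sqi_cc cc_pd a)
  then have srd: "sqi (rd a)" by (simp add: rd_def[abs_def])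
  have sP: "sqi (PP a (rd a))" using lim2D(2)[OF lim2_PP_SS(1)[OF lim2_const[OF sa] lim2_const[OF srd]]] .
  have i: "integrable lborel (\<lambda>x. (w1 (norm x) * PP a (rd a) x) * PP a (rd a) x)" "integrable lborel (\<lambda>x. (w1 (norm x) * (Xw x * a x)) * (Xw x * a x))"
    using sqi_mult_integrable[OF bdd_meas_sqi[OF weights_bdd(3) sP] sP]
      sqi_mult_integrable[OF bdd_meas_sqi[OF weights_bdd(3) bdd_meas_sqi[OF weights_bdd(1) sa]] bdd_meas_sqi[OF weights_bdd(1) sa]] by simp_all
  note cf = wconj_facts[OF cc_smooth[OF a]]
  have "(\<integral>x. LL (wconj a) x \<partial>lborel) = (\<integral>x. h\<^sup>2 / 2 * ((w1 (norm x) * PP a (rd a) x) * PP a (rd a) x) + E / 4 * ((w1 (norm x) * (Xw x * a x)) * (Xw x * a x)) \<partial>lborel)"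
  proof (rule integral_cong_AE)
    have [measurable]: "LL (wconj a) \<in> borel_measurable borel"
    proof -
      have "smooth_on pct (LL (wconj a))"
        unfolding LL_def[abs_def]
        by (intro smooth_on_mult[OF open_pct] smooth_on_add[OF open_pct] smooth_on_power[OF open_pct] smooth_on_const[OF open_pct]
           smooth_radial smooths smooth_rd cf(1))
      then show ?thesis by (rule measurable_pct[OF smooth_on_continuous])
    qed
    show "LL (wconj a) \<in> borel_measurable lborel" by simp
    show "(\<lambda>x. h\<^sup>2 / 2 * ((w1 (norm x) * PP a (rd a) x) * PP a (rd a) x) + E / 4 * ((w1 (norm x) * (Xw x * a x)) * (Xw x * a x))) \<in> borel_measurable lborel"
      using i[THEN borel_measurable_integrable] by measurable
    show "AE x in lborel. LL (wconj a) x = h\<^sup>2 / 2 * ((w1 (norm x) * PP a (rd a) x) * PP a (rd a) x) + E / 4 * ((w1 (norm x) * (Xw x * a x)) * (Xw x * a x))"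
      using AE_nonzero
    proof eventually_elim
      case (elim x)
      have "rd (wconj a) x = PP a (rd a) x" unfolding cf(2)[OF elim] PP_def Xw_def by simp
      moreover have "wconj a x = Xw x * a x" by (simp add: wconj_def Xw_def)
      ultimately show ?case by (simp add: LL_def power2_eq_square algebra_simps)
    qed
  qed
  also have "\<dots> = h\<^sup>2 / 2 * (\<integral>x. (w1 (norm x) * PP a (rd a) x) * PP a (rd a) x \<partial>lborel) + E / 4 * (\<integral>x. (w1 (norm x) * (Xw x * a x)) * (Xw x * a x) \<partial>lborel)"
    by (subst Bochner_Integration.integral_add[OF integrable_mult_right[OF i(1)] integrable_mult_right[OF i(2)]]) simp
  moreover have "(\<integral>x. w (norm x) * Mm (wconj a) x * Z (wconj a) x \<partial>lborel) = (\<integral>x. SS a (rd a) x * opr h (\<lambda>x. V x - E) a x \<partial>lborel)"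
  proof (rule integral_cong_AE)
    have p: "bdd_meas (\<lambda>x. V x - E)" by (intro bdd_meas_diff V bdd_meas_const)
    have [measurable]: "SS a (rd a) \<in> borel_measurable borel" "opr h (\<lambda>x. V x - E) a \<in> borel_measurable borel"
      using lim2D(2)[OF lim2_PP_SS(2)[OF lim2_const[OF sa] lim2_const[OF srd]]] sqi_opr[OF p a, of h] sqi_measurable by auto
    show "(\<lambda>x. SS a (rd a) x * opr h (\<lambda>x. V x - E) a x) \<in> borel_measurable lborel" by measurable
    have [measurable]: "V \<in> borel_measurable borel" using V by (auto simp: bdd_meas_def)
    have slap: "smooth_on pct (lap (wconj a))"
    proof -
      have "smooth_on pct (\<lambda>x. \<Sum>b\<in>Basis. pd b (pd b (wconj a)) x)" by (intro smooth_on_sum smooth_on_pd cf(1) open_pct)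
      then show ?thesis by (simp add: lap_def[abs_def])
    qed
    have si: "smooth_on {0<..} (\<lambda>r::real. 1 / r)" by (rule smooth_on_divide) auto
    note meas = measurable_pct[OF smooth_on_continuous]
    have "smooth_on pct (Mm (wconj a))" unfolding Mm_def[abs_def]
      by (intro smooth_on_mult[OF open_pct] smooth_on_add[OF open_pct] smooth_on_const[OF open_pct] smooth_radial[OF si] smooth_rd cf(1))
    from meas[OF this] have [measurable]: "Mm (wconj a) \<in> borel_measurable borel" .
    have [measurable]: "(\<lambda>x::'a. w (norm x)) \<in> borel_measurable borel" "(\<lambda>x::'a. \<psi> (norm x)) \<in> borel_measurable borel"
       "(\<lambda>x::'a. T (norm x)) \<in> borel_measurable borel" "lap (wconj a) \<in> borel_measurable borel" "wconj a \<in> borel_measurable borel"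
      by (intro meas smooth_radial sw smooths sT slap cf(1))+
    show "(\<lambda>x. w (norm x) * Mm (wconj a) x * Z (wconj a) x) \<in> borel_measurable lborel"
      unfolding Z_def[abs_def] by measurable
    show "AE x in lborel. w (norm x) * Mm (wconj a) x * Z (wconj a) x = SS a (rd a) x * opr h (\<lambda>x. V x - E) a x"
      using AE_nonzero
    proof eventually_elim
      case (elim x)
      have "rd (wconj a) x = PP a (rd a) x" unfolding cf(2)[OF elim] PP_def Xw_def by simp
      moreover have "wconj a x = Xw x * a x" by (simp add: wconj_def Xw_def)
      moreover have "w (norm x) * (P + c1 * c2 * (Xw x * a x)) * (Xw x * y) = (w (norm x) * Xw x * P + w (norm x) * (Xw x)\<^sup>2 * c1 * c2 * a x) * y"
        for P c1 c2 y by (simp add: power2_eq_square algebra_simps)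
      ultimately show ?case unfolding cf(4)[OF elim] Mm_def SS_def Xw_def[symmetric] by metis
    qed
  qed
  ultimately show ?thesis using carleman_real[OF a] by simp
qed

text \<open>Since V is real, real and imaginary part satisfy real equations coupled only through
  \<epsilon>. The two real estimates are added and taken to the limit.\<close>

lemma carleman_complex:
  assumes U: "\<And>n. ccC (U n)" and lim: "lim2 U u" "lim2 (\<lambda>n. QQ h (\<lambda>x. V x - E) (- \<epsilon>) (U n)) f"
    and G: "\<And>b. b \<in> Basis \<Longrightarrow> lim2 (\<lambda>n. pd b (\<lambda>x. Re (U n x))) (G1 b)" "\<And>b. b \<in> Basis \<Longrightarrow> lim2 (\<lambda>n. pd b (\<lambda>x. Im (U n x))) (G2 b)"
  defines "a \<equiv> \<lambda>x. Re (u x)" and "b \<equiv> \<lambda>x. Im (u x)"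
    and "da \<equiv> \<lambda>x. \<Sum>c\<in>Basis. ed c x *\<^sub>R G1 c x" and "db \<equiv> \<lambda>x. \<Sum>c\<in>Basis. ed c x *\<^sub>R G2 c x"
  shows "h\<^sup>2 / 2 * (\<integral>x. (w1 (norm x) * PP a da x) * PP a da x \<partial>lborel) + E / 4 * (\<integral>x. (w1 (norm x) * (Xw x * a x)) * (Xw x * a x) \<partial>lborel)
    + (h\<^sup>2 / 2 * (\<integral>x. (w1 (norm x) * PP b db x) * PP b db x \<partial>lborel) + E / 4 * (\<integral>x. (w1 (norm x) * (Xw x * b x)) * (Xw x * b x) \<partial>lborel))
    \<le> (\<integral>x. SS a da x * (Re (f x) - \<epsilon> * b x) \<partial>lborel) + (\<integral>x. SS b db x * (Im (f x) + \<epsilon> * a x) \<partial>lborel)"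
    and "sqi da" "sqi db" "sqi (PP a da)" "sqi (PP b db)" "sqi (SS a da)" "sqi (SS b db)"
proof -
  define A where "A = (\<lambda>n x. Re (U n x))"
  define Bb where "Bb = (\<lambda>n x. Im (U n x))"
  have c: "cc (A n)" "cc (Bb n)" for n using U by (auto simp: ccC_def A_def Bb_def)
  have la: "lim2 A a" "lim2 Bb b" unfolding A_def Bb_def a_def b_def by (intro lim2_Re lim2_Im lim)+
  have "lim2 (\<lambda>n x. \<Sum>c\<in>Basis. ed c x *\<^sub>R pd c (A n) x) da" "lim2 (\<lambda>n x. \<Sum>c\<in>Basis. ed c x *\<^sub>R pd c (Bb n) x) db"
    unfolding da_def db_def A_def Bb_def by (intro lim2_sum bdd_meas_lim2 ed_bdd_meas G; assumption)+
  then have ld: "lim2 (\<lambda>n. rd (A n)) da" "lim2 (\<lambda>n. rd (Bb n)) db" by (simp_all add: rd_def[abs_def])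
  note PS = lim2_PP_SS[OF la(1) ld(1)] lim2_PP_SS[OF la(2) ld(2)]
  show "sqi da" "sqi db" "sqi (PP a da)" "sqi (PP b db)" "sqi (SS a da)" "sqi (SS b db)" using PS ld lim2D(2) by blast+
  have m: "lim2 (\<lambda>n x. w1 (norm x) * F n x) (\<lambda>x. w1 (norm x) * g x)" if "lim2 F g" for F and g :: "'a \<Rightarrow> real"
    using bdd_meas_lim2[OF weights_bdd(3) that] by simp
  have mX: "lim2 (\<lambda>n x. Xw x * F n x) (\<lambda>x. Xw x * g x)" if "lim2 F g" for F and g :: "'a \<Rightarrow> real"
    using bdd_meas_lim2[OF weights_bdd(1) that] by simp
  have oA: "opr h (\<lambda>x. V x - E) (A n) = (\<lambda>x. Re (QQ h (\<lambda>x. V x - E) (- \<epsilon>) (U n) x) - \<epsilon> * Bb n x)"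
    and oB: "opr h (\<lambda>x. V x - E) (Bb n) = (\<lambda>x. Im (QQ h (\<lambda>x. V x - E) (- \<epsilon>) (U n) x) + \<epsilon> * A n x)" for n
    by (simp_all add: QQ_def A_def Bb_def fun_eq_iff)
  have lo: "lim2 (\<lambda>n. opr h (\<lambda>x. V x - E) (A n)) (\<lambda>x. Re (f x) - \<epsilon> * b x)" "lim2 (\<lambda>n. opr h (\<lambda>x. V x - E) (Bb n)) (\<lambda>x. Im (f x) + \<epsilon> * a x)"
    unfolding oA oB using lim2_scaleR[OF la(1), of \<epsilon>] lim2_scaleR[OF la(2), of \<epsilon>]
    by (intro lim2_diff lim2_add lim2_Re lim2_Im lim; simp)+
  note I = lim2_integral_mult
  have 1: "(\<lambda>n. h\<^sup>2 / 2 * (\<integral>x. (w1 (norm x) * PP (A n) (rd (A n)) x) * PP (A n) (rd (A n)) x \<partial>lborel) + E / 4 * (\<integral>x. (w1 (norm x) * (Xw x * A n x)) * (Xw x * A n x) \<partial>lborel)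
    + (h\<^sup>2 / 2 * (\<integral>x. (w1 (norm x) * PP (Bb n) (rd (Bb n)) x) * PP (Bb n) (rd (Bb n)) x \<partial>lborel) + E / 4 * (\<integral>x. (w1 (norm x) * (Xw x * Bb n x)) * (Xw x * Bb n x) \<partial>lborel)))
    \<longlonglongrightarrow> h\<^sup>2 / 2 * (\<integral>x. (w1 (norm x) * PP a da x) * PP a da x \<partial>lborel) + E / 4 * (\<integral>x. (w1 (norm x) * (Xw x * a x)) * (Xw x * a x) \<partial>lborel)
    + (h\<^sup>2 / 2 * (\<integral>x. (w1 (norm x) * PP b db x) * PP b db x \<partial>lborel) + E / 4 * (\<integral>x. (w1 (norm x) * (Xw x * b x)) * (Xw x * b x) \<partial>lborel))"
    by (intro tendsto_add tendsto_mult[OF tendsto_const] I m mX PS la)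
  have 2: "(\<lambda>n. (\<integral>x. SS (A n) (rd (A n)) x * opr h (\<lambda>x. V x - E) (A n) x \<partial>lborel) + (\<integral>x. SS (Bb n) (rd (Bb n)) x * opr h (\<lambda>x. V x - E) (Bb n) x \<partial>lborel))
    \<longlonglongrightarrow> (\<integral>x. SS a da x * (Re (f x) - \<epsilon> * b x) \<partial>lborel) + (\<integral>x. SS b db x * (Im (f x) + \<epsilon> * a x) \<partial>lborel)"
    by (intro tendsto_add I PS lo)
  show "h\<^sup>2 / 2 * (\<integral>x. (w1 (norm x) * PP a da x) * PP a da x \<partial>lborel) + E / 4 * (\<integral>x. (w1 (norm x) * (Xw x * a x)) * (Xw x * a x) \<partial>lborel)
    + (h\<^sup>2 / 2 * (\<integral>x. (w1 (norm x) * PP b db x) * PP b db x \<partial>lborel) + E / 4 * (\<integral>x. (w1 (norm x) * (Xw x * b x)) * (Xw x * b x) \<partial>lborel))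
    \<le> (\<integral>x. SS a da x * (Re (f x) - \<epsilon> * b x) \<partial>lborel) + (\<integral>x. SS b db x * (Im (f x) + \<epsilon> * a x) \<partial>lborel)"
    by (rule LIMSEQ_le[OF 1 2]) (intro exI[of _ 0] allI impI add_mono carleman_real' c)
qed

text \<open>The difference of the two sides of \<open>carleman_complex\<close> is bounded below
  pointwise by \<open>W\<close>, in which \<epsilon> multiplies only the energy h^2 |du|^2 + |u|^2.
  The two energy identities bound \<epsilon> times this energy by (2 + M + E) times the integral of
  |f| |u|.\<close>

theorem carleman_estimate:
  assumes U: "\<And>n. ccC (U n)" and lim: "lim2 U u" "lim2 (\<lambda>n. QQ h (\<lambda>x. V x - E) (- \<epsilon>) (U n)) f"
    and G: "\<And>b. b \<in> Basis \<Longrightarrow> lim2 (\<lambda>n. pd b (\<lambda>x. Re (U n x))) (G1 b)" "\<And>b. b \<in> Basis \<Longrightarrow> lim2 (\<lambda>n. pd b (\<lambda>x. Im (U n x))) (G2 b)"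
    and e: "0 < \<epsilon>" "\<epsilon> \<le> 1" and h1: "h \<le> 1" and E: "E > 0" and M: "AE x in lborel. \<bar>V x\<bar> \<le> M" and M0: "0 \<le> M"
    and Cw: "\<And>r. r > 0 \<Longrightarrow> 0 < w1 r" "\<And>r. r > 0 \<Longrightarrow> 1 \<le> w1 r * Cw * (1 + r) powr (2 * s)"
    and Xh: "\<And>r. r > 0 \<Longrightarrow> exp (\<phi> r / h) \<le> Xh"
    and intf: "integrable lborel (\<lambda>x. (1 + norm x) powr (2 * s) * (norm (f x))\<^sup>2)"
  shows "E / 8 * (\<integral>x. w1 (norm x) * (Xw x)\<^sup>2 * (norm (u x))\<^sup>2 \<partial>lborel)
    \<le> Cw * (1 / 2 + (N - 1)\<^sup>2 / (2 * E)) / h\<^sup>2 * (\<integral>x. (Xw x)\<^sup>2 * (1 + norm x) powr (2 * s) * (norm (f x))\<^sup>2 \<partial>lborel)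
      + Xh\<^sup>2 / (2 * h) * (2 + M + E) * (\<integral>x. norm (f x) * norm (u x) \<partial>lborel)"
proof -
  define a b where "a = (\<lambda>x. Re (u x))" and "b = (\<lambda>x. Im (u x))"
  define da db where "da = (\<lambda>x. \<Sum>c\<in>Basis. ed c x *\<^sub>R G1 c x)" and "db = (\<lambda>x. \<Sum>c\<in>Basis. ed c x *\<^sub>R G2 c x)"
  note cx = carleman_complex[OF U lim G, folded a_def b_def da_def db_def]
  have su: "sqi u" "sqi f" using lim lim2D(2) by blast+
  have sab: "sqi a" "sqi b" unfolding a_def b_def by (intro sqi_Re sqi_Im su)+
  have sf: "sqi (\<lambda>x. Re (f x))" "sqi (\<lambda>x. Im (f x))" by (intro sqi_Re sqi_Im su)+
  have p: "bdd_meas (\<lambda>x. V x - E)" by (intro bdd_meas_diff V bdd_meas_const)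
  define K where "K = Cw * (1 / 2 + (N - 1)\<^sup>2 / (2 * E)) / h\<^sup>2"
  define t where "t = (\<lambda>x::'a. (1 + norm x) powr (2 * s))"
  note i1 = sqi_mult_integrable
  have w1s: "sqi (\<lambda>x. w1 (norm x) * g x)" "sqi (\<lambda>x. Xw x * g x)" if "sqi g" for g
    using bdd_meas_sqi[OF weights_bdd(3) that] bdd_meas_sqi[OF weights_bdd(1) that] by simp_all
  have iX: "integrable lborel (\<lambda>x. Xw x * g x)" if "integrable lborel g" for g
    using bdd_meas_integrable[OF weights_bdd(1) that] .
  have iw: "integrable lborel (\<lambda>x. w (norm x) * g x)" "integrable lborel (\<lambda>x. w1 (norm x) * g x)" if "integrable lborel g" for g :: "'a \<Rightarrow> real"
    using bdd_meas_integrable[OF weights_bdd(4) that] bdd_meas_integrable[OF weights_bdd(3) that] by auto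
  have iK: "integrable lborel (\<lambda>x. (Xw x)\<^sup>2 * t x * (norm (f x))\<^sup>2)"
    using iX[OF iX[OF intf]] by (simp add: t_def power2_eq_square mult.assoc)
  have iu: "integrable lborel (\<lambda>x. (norm (u x))\<^sup>2)" by (rule sqi_integrable[OF su(1)])
  have iL: "integrable lborel (\<lambda>x. w1 (norm x) * (Xw x)\<^sup>2 * (norm (u x))\<^sup>2)"
    using iw(2)[OF iX[OF iX[OF iu]]] by (simp add: power2_eq_square mult.assoc)
  have ida: "integrable lborel (\<lambda>x. (da x)\<^sup>2)" "integrable lborel (\<lambda>x. (db x)\<^sup>2)"
    using sqi_integrable[OF cx(2)] sqi_integrable[OF cx(3)] by simp_all
  have j: "integrable lborel (\<lambda>x. (w1 (norm x) * PP a da x) * PP a da x)" "integrable lborel (\<lambda>x. (w1 (norm x) * (Xw x * a x)) * (Xw x * a x))"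
       "integrable lborel (\<lambda>x. (w1 (norm x) * PP b db x) * PP b db x)" "integrable lborel (\<lambda>x. (w1 (norm x) * (Xw x * b x)) * (Xw x * b x))"
  proof -
    have X: "sqi (\<lambda>x. Xw x * a x)" "sqi (\<lambda>x. Xw x * b x)" using w1s(2) sab by blast+
    note Y = w1s(1)[OF X(1)] w1s(1)[OF X(2)] w1s(1)[OF cx(4)] w1s(1)[OF cx(5)]
    show "integrable lborel (\<lambda>x. (w1 (norm x) * PP a da x) * PP a da x)" by (rule i1[OF Y(3) cx(4)])
    show "integrable lborel (\<lambda>x. (w1 (norm x) * (Xw x * a x)) * (Xw x * a x))" by (rule i1[OF Y(1) X(1)])
    show "integrable lborel (\<lambda>x. (w1 (norm x) * PP b db x) * PP b db x)" by (rule i1[OF Y(4) cx(5)])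
    show "integrable lborel (\<lambda>x. (w1 (norm x) * (Xw x * b x)) * (Xw x * b x))" by (rule i1[OF Y(2) X(2)])
  qed
  have ip: "integrable lborel (\<lambda>x. h\<^sup>2 / 2 * ((w1 (norm x) * PP a da x) * PP a da x) + E / 4 * ((w1 (norm x) * (Xw x * a x)) * (Xw x * a x)))"
    "integrable lborel (\<lambda>x. h\<^sup>2 / 2 * ((w1 (norm x) * PP b db x) * PP b db x) + E / 4 * ((w1 (norm x) * (Xw x * b x)) * (Xw x * b x)))"
    by (intro Bochner_Integration.integrable_add[OF integrable_mult_right[OF j(1)] integrable_mult_right[OF j(2)]]
        Bochner_Integration.integrable_add[OF integrable_mult_right[OF j(3)] integrable_mult_right[OF j(4)]])+
  have iS: "integrable lborel (\<lambda>x. SS a da x * (Re (f x) - \<epsilon> * b x))" "integrable lborel (\<lambda>x. SS b db x * (Im (f x) + \<epsilon> * a x))"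
  proof -
    have R: "sqi (\<lambda>x. Re (f x) - \<epsilon> * b x)" "sqi (\<lambda>x. Im (f x) + \<epsilon> * a x)"
      using sqi_diff[OF sf(1) sqi_cmult[OF sab(2), of \<epsilon>]] sqi_add[OF sf(2) sqi_cmult[OF sab(1), of \<epsilon>]] by blast+
    have S: "sqi (SS a da)" "sqi (SS b db)" using cx(6,7) by blast+
    show "integrable lborel (\<lambda>x. SS a da x * (Re (f x) - \<epsilon> * b x))" by (rule sqi_mult_integrable[OF S(1) R(1)])
    show "integrable lborel (\<lambda>x. SS b db x * (Im (f x) + \<epsilon> * a x))" by (rule sqi_mult_integrable[OF S(2) R(2)])
  qed
  have A: "(\<integral>x. (h\<^sup>2 / 2 * ((w1 (norm x) * PP a da x) * PP a da x) + E / 4 * ((w1 (norm x) * (Xw x * a x)) * (Xw x * a x)))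
      + (h\<^sup>2 / 2 * ((w1 (norm x) * PP b db x) * PP b db x) + E / 4 * ((w1 (norm x) * (Xw x * b x)) * (Xw x * b x))) \<partial>lborel)
    \<le> (\<integral>x. SS a da x * (Re (f x) - \<epsilon> * b x) + SS b db x * (Im (f x) + \<epsilon> * a x) \<partial>lborel)"
  proof -
    show ?thesis
      unfolding Bochner_Integration.integral_add[OF iS] Bochner_Integration.integral_add[OF ip]
        Bochner_Integration.integral_add[OF integrable_mult_right[OF j(1)] integrable_mult_right[OF j(2)]]
        Bochner_Integration.integral_add[OF integrable_mult_right[OF j(3)] integrable_mult_right[OF j(4)]]
      using cx(1) by (simp add: a_def b_def)
  qed
  define W where "W = (\<lambda>x. E / 8 * (w1 (norm x) * (Xw x)\<^sup>2 * (norm (u x))\<^sup>2) - K * ((Xw x)\<^sup>2 * t x * (norm (f x))\<^sup>2)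
      - \<epsilon> * Xh\<^sup>2 / (2 * h) * (h\<^sup>2 * ((da x)\<^sup>2 + (db x)\<^sup>2) + (norm (u x))\<^sup>2))"
  have iW: "integrable lborel W"
    unfolding W_def by (intro Bochner_Integration.integrable_diff integrable_mult_right Bochner_Integration.integrable_add iL iK ida iu)
  have "(\<integral>x. W x \<partial>lborel) \<le> (\<integral>x. ((h\<^sup>2 / 2 * ((w1 (norm x) * PP a da x) * PP a da x) + E / 4 * ((w1 (norm x) * (Xw x * a x)) * (Xw x * a x)))
      + (h\<^sup>2 / 2 * ((w1 (norm x) * PP b db x) * PP b db x) + E / 4 * ((w1 (norm x) * (Xw x * b x)) * (Xw x * b x))))
      - (SS a da x * (Re (f x) - \<epsilon> * b x) + SS b db x * (Im (f x) + \<epsilon> * a x)) \<partial>lborel)"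
  proof (rule integral_mono_AE[OF iW])
    show "integrable lborel (\<lambda>x. ((h\<^sup>2 / 2 * ((w1 (norm x) * PP a da x) * PP a da x) + E / 4 * ((w1 (norm x) * (Xw x * a x)) * (Xw x * a x)))
      + (h\<^sup>2 / 2 * ((w1 (norm x) * PP b db x) * PP b db x) + E / 4 * ((w1 (norm x) * (Xw x * b x)) * (Xw x * b x))))
      - (SS a da x * (Re (f x) - \<epsilon> * b x) + SS b db x * (Im (f x) + \<epsilon> * a x)))"
      by (intro Bochner_Integration.integrable_diff Bochner_Integration.integrable_add[OF ip] Bochner_Integration.integrable_add[OF iS])
    show "AE x in lborel. W x \<le> ((h\<^sup>2 / 2 * ((w1 (norm x) * PP a da x) * PP a da x) + E / 4 * ((w1 (norm x) * (Xw x * a x)) * (Xw x * a x)))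
      + (h\<^sup>2 / 2 * ((w1 (norm x) * PP b db x) * PP b db x) + E / 4 * ((w1 (norm x) * (Xw x * b x)) * (Xw x * b x))))
      - (SS a da x * (Re (f x) - \<epsilon> * b x) + SS b db x * (Im (f x) + \<epsilon> * a x))"
      using AE_nonzero
    proof eventually_elim
      case (elim x)
      have xp: "norm x > 0" using elim by simp
      note wb = w_bounds(1-3)[OF xp]
      have wi: "0 \<le> w (norm x) * (1 / norm x)" "w (norm x) * (1 / norm x) \<le> 1" using wb xp by (auto simp: divide_le_eq)
      have Ya: "SS a da x * Re (f x) \<le> w1 (norm x) * (h\<^sup>2 / 2 * (PP a da x)\<^sup>2) + E / 8 * w1 (norm x) * (Xw x)\<^sup>2 * (a x)\<^sup>2 + K * ((Xw x)\<^sup>2 * t x * (Re (f x))\<^sup>2)"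
        unfolding SS_def K_def t_def by (rule young_pointwise[OF Cw(1)[OF xp] h h1 E wb(1,3) wi Cw(2)[OF xp]])
      have Yb: "SS b db x * Im (f x) \<le> w1 (norm x) * (h\<^sup>2 / 2 * (PP b db x)\<^sup>2) + E / 8 * w1 (norm x) * (Xw x)\<^sup>2 * (b x)\<^sup>2 + K * ((Xw x)\<^sup>2 * t x * (Im (f x))\<^sup>2)"
        unfolding SS_def K_def t_def by (rule young_pointwise[OF Cw(1)[OF xp] h h1 E wb(1,3) wi Cw(2)[OF xp]])
      \<comment> \<open>All terms of \<open>SS\<close> that are common real multiples of a and b
        cancel in the antisymmetric combination. Neither \<psi> nor 1/r survives, only the radial
        derivatives.\<close>
      have cr: "- SS a da x * b x + SS b db x * a x = w (norm x) * (Xw x)\<^sup>2 * (- da x * b x + db x * a x)"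
        unfolding SS_def PP_def by (simp add: power2_eq_square algebra_simps)
      have "w (norm x) * (Xw x)\<^sup>2 * (- da x * b x + db x * a x) \<le> 1 * Xh\<^sup>2 * (1 / (2 * h) * (h\<^sup>2 * ((da x)\<^sup>2 + (db x)\<^sup>2) + ((a x)\<^sup>2 + (b x)\<^sup>2)))"
      proof -
        have "w (norm x) * (Xw x)\<^sup>2 * (- da x * b x + db x * a x) \<le> w (norm x) * (Xw x)\<^sup>2 * \<bar>- da x * b x + db x * a x\<bar>"
          using wb by (intro mult_left_mono) auto
        also have "\<dots> \<le> 1 * Xh\<^sup>2 * (1 / (2 * h) * (h\<^sup>2 * ((da x)\<^sup>2 + (db x)\<^sup>2) + ((a x)\<^sup>2 + (b x)\<^sup>2)))"
          using wb Xh[OF xp] by (intro mult_mono cross_term_le h power_mono) (auto simp: Xw_def)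
        finally show ?thesis .
      qed
      then have cr2: "\<epsilon> * (- SS a da x * b x + SS b db x * a x) \<le> \<epsilon> * (Xh\<^sup>2 * (1 / (2 * h) * (h\<^sup>2 * ((da x)\<^sup>2 + (db x)\<^sup>2) + ((a x)\<^sup>2 + (b x)\<^sup>2))))"
        unfolding cr using e by (intro mult_left_mono) auto
      have nu: "(norm (u x))\<^sup>2 = (a x)\<^sup>2 + (b x)\<^sup>2" "(norm (f x))\<^sup>2 = (Re (f x))\<^sup>2 + (Im (f x))\<^sup>2"
        by (simp_all add: cmod_power2 a_def b_def)
      show ?case using absorb_pointwise[OF Ya Yb cr2] unfolding W_def nu by (simp add: mult.assoc)
    qed
  qed
  also have "\<dots> \<le> 0"
    using A by (subst Bochner_Integration.integral_diff[OF Bochner_Integration.integrable_add[OF ip] Bochner_Integration.integrable_add[OF iS]]) simp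
  also have "(\<integral>x. W x \<partial>lborel) = E / 8 * (\<integral>x. w1 (norm x) * (Xw x)\<^sup>2 * (norm (u x))\<^sup>2 \<partial>lborel) - K * (\<integral>x. (Xw x)\<^sup>2 * t x * (norm (f x))\<^sup>2 \<partial>lborel)
      - \<epsilon> * Xh\<^sup>2 / (2 * h) * (h\<^sup>2 * (N2 da + N2 db) + N2 u)"
    unfolding W_def using iL iK ida iu by (simp add: N2_def)
  finally have m0: "E / 8 * (\<integral>x. w1 (norm x) * (Xw x)\<^sup>2 * (norm (u x))\<^sup>2 \<partial>lborel) - K * (\<integral>x. (Xw x)\<^sup>2 * t x * (norm (f x))\<^sup>2 \<partial>lborel)
      - \<epsilon> * Xh\<^sup>2 / (2 * h) * (h\<^sup>2 * (N2 da + N2 db) + N2 u) \<le> 0" .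
  have "\<epsilon> * Xh\<^sup>2 / (2 * h) * (h\<^sup>2 * (N2 da + N2 db) + N2 u) = Xh\<^sup>2 / (2 * h) * (\<epsilon> * (h\<^sup>2 * (N2 da + N2 db) + N2 u))"
    by simp
  then have main: "E / 8 * (\<integral>x. w1 (norm x) * (Xw x)\<^sup>2 * (norm (u x))\<^sup>2 \<partial>lborel) \<le> K * (\<integral>x. (Xw x)\<^sup>2 * t x * (norm (f x))\<^sup>2 \<partial>lborel)
      + Xh\<^sup>2 / (2 * h) * (\<epsilon> * (h\<^sup>2 * (N2 da + N2 db) + N2 u))"
    using m0 by linarith
  have dG: "N2 (\<lambda>x. \<Sum>c\<in>Basis. ed c x *\<^sub>R H c x) \<le> (\<Sum>c\<in>Basis. N2 (H c))" if H: "\<And>c. c \<in> Basis \<Longrightarrow> sqi (H c)" for H :: "'a \<Rightarrow> 'a \<Rightarrow> real"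
  proof -
    have s: "sqi (\<lambda>x. \<Sum>c\<in>Basis. ed c x *\<^sub>R H c x)" by (intro sqi_sum bdd_meas_sqi ed_bdd_meas H)
    have iH: "integrable lborel (\<lambda>x. (H c x)\<^sup>2)" if "c \<in> Basis" for c using sqi_integrable[OF H[OF that]] by simp
    have "N2 (\<lambda>x. \<Sum>c\<in>Basis. ed c x *\<^sub>R H c x) \<le> (\<integral>x. (\<Sum>c\<in>Basis. (H c x)\<^sup>2) \<partial>lborel)"
      unfolding N2_def
    proof (rule integral_mono_AE)
      show "AE x in lborel. (norm (\<Sum>c\<in>Basis. ed c x *\<^sub>R H c x))\<^sup>2 \<le> (\<Sum>c\<in>Basis. (H c x)\<^sup>2)"
        using AE_nonzero
      proof eventually_elim
        case (elim x)
        show ?case using Cauchy_Schwarz_ineq_sum[of "\<lambda>c. ed c x" "\<lambda>c. H c x" Basis] sum_ed_sq[OF elim] by simp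
      qed
      show "integrable lborel (\<lambda>x. (norm (\<Sum>c\<in>Basis. ed c x *\<^sub>R H c x))\<^sup>2)" by (rule sqi_integrable[OF s])
      show "integrable lborel (\<lambda>x. \<Sum>c\<in>Basis. (H c x)\<^sup>2)" by (intro Bochner_Integration.integrable_sum iH)
    qed
    also have "\<dots> = (\<Sum>c\<in>Basis. N2 (H c))" unfolding N2_def by (subst Bochner_Integration.integral_sum) (auto intro: iH)
    finally show ?thesis .
  qed
  have "AE x in lborel. - (M + E) \<le> V x - E" using M by eventually_elim auto
  from energy_Re_lim[OF p U lim G this]
  have e2: "h\<^sup>2 * (\<Sum>b\<in>Basis. N2 (G1 b) + N2 (G2 b)) \<le> (\<integral>x. norm (f x) * norm (u x) \<partial>lborel) + (M + E) * N2 u" .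
  have e1: "\<epsilon> * N2 u \<le> (\<integral>x. norm (f x) * norm (u x) \<partial>lborel)" by (rule energy_Im_lim[OF p U lim])
  have sG: "sqi (G1 c)" "sqi (G2 c)" if "c \<in> Basis" for c using G[OF that] lim2D(2) by blast+
  have "N2 da + N2 db \<le> (\<Sum>b\<in>Basis. N2 (G1 b) + N2 (G2 b))"
    unfolding da_def db_def sum.distrib by (intro add_mono dG sG)
  then have "h\<^sup>2 * (N2 da + N2 db) \<le> (\<integral>x. norm (f x) * norm (u x) \<partial>lborel) + (M + E) * N2 u"
    using e2 mult_left_mono[of "N2 da + N2 db" "\<Sum>b\<in>Basis. N2 (G1 b) + N2 (G2 b)" "h\<^sup>2"] by simp
  \<comment> \<open>After expansion, \<epsilon> <= 1 is used for the integral of |f| |u|, while each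
    N2 u is kept together with its factor \<epsilon>, as the energy identity demands.\<close>
  then have "\<epsilon> * (h\<^sup>2 * (N2 da + N2 db) + N2 u) \<le> \<epsilon> * (((\<integral>x. norm (f x) * norm (u x) \<partial>lborel) + (M + E) * N2 u) + N2 u)"
    using e by (intro mult_left_mono) auto
  also have "\<dots> = \<epsilon> * (\<integral>x. norm (f x) * norm (u x) \<partial>lborel) + (M + E + 1) * (\<epsilon> * N2 u)" by (simp add: algebra_simps)
  also have "\<dots> \<le> 1 * (\<integral>x. norm (f x) * norm (u x) \<partial>lborel) + (M + E + 1) * (\<integral>x. norm (f x) * norm (u x) \<partial>lborel)"
    using e e1 M0 E by (intro add_mono mult_mono e1 mult_right_mono) auto
  finally have "\<epsilon> * (h\<^sup>2 * (N2 da + N2 db) + N2 u) \<le> (2 + M + E) * (\<integral>x. norm (f x) * norm (u x) \<partial>lborel)" by (simp add: algebra_simps)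
  then have "Xh\<^sup>2 / (2 * h) * (\<epsilon> * (h\<^sup>2 * (N2 da + N2 db) + N2 u)) \<le> Xh\<^sup>2 / (2 * h) * ((2 + M + E) * (\<integral>x. norm (f x) * norm (u x) \<partial>lborel))"
    using h by (intro mult_left_mono) auto
  then have "E / 8 * (\<integral>x. w1 (norm x) * (Xw x)\<^sup>2 * (norm (u x))\<^sup>2 \<partial>lborel) \<le> K * (\<integral>x. (Xw x)\<^sup>2 * t x * (norm (f x))\<^sup>2 \<partial>lborel)
      + Xh\<^sup>2 / (2 * h) * ((2 + M + E) * (\<integral>x. norm (f x) * norm (u x) \<partial>lborel))"
    using main by linarith
  then show ?thesis unfolding K_def t_def by (simp only: mult.assoc)
qed

end

section \<open>The weights\<close>

text \<open>The family of \<open>bump_family_deriv\<close> under a name of its own, so that the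
  derivatives of the ramp have explicit formulas and bounds.\<close>

definition bumpF :: "nat \<Rightarrow> real \<Rightarrow> real" where
  "bumpF j t = (if t > 0 then (1 / t) ^ j * exp (- (1 / t)) else 0)"

lemma bumpF_deriv: "(bumpF j has_real_derivative bumpF (j + 2) t - real j * bumpF (j + 1) t) (at t)"
  unfolding bumpF_def[abs_def] by (rule bump_family_deriv)

lemma bumpF_nonneg: "0 \<le> bumpF j t" by (simp add: bumpF_def)

text \<open>27 = 3^3 arises from x/3 <= exp (x/3), cubed, with x = 1/t.\<close>

lemma bumpF_3_le: "bumpF 3 t \<le> 27"
proof (cases "t > 0")
  case True
  define x where "x = 1 / t"
  have x: "x > 0" using True by (simp add: x_def)
  have "x / 3 \<le> exp (x / 3)" using exp_ge_add_one_self[of "x / 3"] by linarith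
  then have "(x / 3) ^ 3 \<le> exp (x / 3) ^ 3" using x by (intro power_mono) auto
  also have "\<dots> = exp x" by (simp add: exp_of_nat_mult[symmetric])
  finally have "x ^ 3 \<le> 27 * exp x" by (simp add: power_divide)
  then have "x ^ 3 * exp (- x) \<le> 27 * exp x * exp (- x)" by (intro mult_right_mono) auto
  also have "\<dots> = 27" by (simp add: exp_minus)
  finally show ?thesis using True by (simp add: bumpF_def x_def)
qed (simp add: bumpF_def)

text \<open>A smooth substitute for the positive part of t: it stays within distance 1 of it, has
  slope at most 1, and its second derivative \<open>bumpF 3\<close> is bounded.\<close>

definition ramp :: "real \<Rightarrow> real" where "ramp t = t * bump t"
definition ramp1 :: "real \<Rightarrow> real" where "ramp1 t = bumpF 0 t + bumpF 1 t"

lemma bump_eq_bumpF: "bump = bumpF 0"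
  by (auto simp: bump_def bumpF_def fun_eq_iff)

lemma ramp_deriv: "(ramp has_real_derivative ramp1 t) (at t)" "(ramp1 has_real_derivative bumpF 3 t) (at t)"
proof -
  have "((\<lambda>t. t * bumpF 0 t) has_real_derivative ramp1 t) (at t)"
    by (rule DERIV_cong[OF DERIV_mult[OF DERIV_ident bumpF_deriv[of 0 t]]])
       (simp add: ramp1_def bumpF_def power2_eq_square)
  then show "(ramp has_real_derivative ramp1 t) (at t)" by (simp add: ramp_def[abs_def] bump_eq_bumpF)
  show "(ramp1 has_real_derivative bumpF 3 t) (at t)"
    unfolding ramp1_def[abs_def] using bumpF_deriv[of 0 t] bumpF_deriv[of 1 t]
    by (auto intro!: derivative_eq_intros simp: numeral_eq_Suc)
qed

lemma smooth_ramp: "smooth_on UNIV ramp"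
  unfolding ramp_def[abs_def] by (intro smooth_on_mult smooth_on_id smooth_on_bump) auto

lemma ramp_bounds: "0 \<le> ramp t" "t \<le> 0 \<Longrightarrow> ramp t = 0" "t \<ge> 0 \<Longrightarrow> ramp t \<le> t" "t > 0 \<Longrightarrow> t - 1 \<le> ramp t"
   "0 \<le> ramp1 t" "ramp1 t \<le> 1"
proof -
  show "0 \<le> ramp t" "t \<le> 0 \<Longrightarrow> ramp t = 0" by (auto simp: ramp_def bump_def)
  show "t \<ge> 0 \<Longrightarrow> ramp t \<le> t" using bump_bounds(2)[of t] by (simp add: ramp_def mult_left_le)
  show "t > 0 \<Longrightarrow> t - 1 \<le> ramp t"
  proof -
    assume t: "t > 0"
    have "1 - 1 / t \<le> exp (- (1 / t))" using exp_ge_add_one_self[of "- (1 / t)"] by linarith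
    then have "t * (1 - 1 / t) \<le> t * exp (- (1 / t))" using t by (intro mult_left_mono) auto
    then show ?thesis using t by (simp add: ramp_def bump_def algebra_simps)
  qed
  show "0 \<le> ramp1 t" by (simp add: ramp1_def bumpF_nonneg)
  show "ramp1 t \<le> 1"
  proof (cases "t > 0")
    case True
    have "1 + 1 / t \<le> exp (1 / t)" by (rule exp_ge_add_one_self)
    then have "(1 + 1 / t) * exp (- (1 / t)) \<le> exp (1 / t) * exp (- (1 / t))" by (intro mult_right_mono) auto
    also have "\<dots> = 1" by (simp add: exp_minus)
    finally show ?thesis using True by (simp add: ramp1_def bumpF_def algebra_simps)
  qed (simp add: ramp1_def bumpF_def)
qed

text \<open>The derivative \<delta> (1 + r)^(-1-\<delta>) dominates \<delta> (1 + r)^(-2s) once 1 +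
  \<delta> <= 2 s. This is how the weight (1 + r)^(-s) with any s > 1/2 is reached.\<close>

definition wt :: "real \<Rightarrow> real \<Rightarrow> real" where "wt \<delta> r = 1 - (1 + r) powr (- \<delta>)"
definition wt1 :: "real \<Rightarrow> real \<Rightarrow> real" where "wt1 \<delta> r = \<delta> * (1 + r) powr (- \<delta> - 1)"
definition wt2 :: "real \<Rightarrow> real \<Rightarrow> real" where "wt2 \<delta> r = - (\<delta> * (1 + \<delta>) * (1 + r) powr (- \<delta> - 2))"

lemma wt_deriv:
  assumes "r > -1"
  shows "(wt \<delta> has_real_derivative wt1 \<delta> r) (at r)" "(wt1 \<delta> has_real_derivative wt2 \<delta> r) (at r)"
  unfolding wt_def[abs_def] wt1_def[abs_def] wt2_def using assms
  by (auto intro!: derivative_eq_intros simp: algebra_simps)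

lemma smooth_wt: "smooth_on {0<..} (wt \<delta>)"
proof -
  have "smooth_on {0<..} (\<lambda>r. (1 + r) powr (- \<delta>))"
    by (rule smooth_on_compose[OF smooth_on_powr smooth_on_add[OF _ smooth_on_const smooth_on_id]]) auto
  then show ?thesis unfolding wt_def[abs_def] by (intro smooth_on_diff smooth_on_const) auto
qed

lemma wt_bounds:
  assumes \<delta>: "0 < \<delta>" "\<delta> \<le> 1" and r: "r > 0"
  shows "0 \<le> wt \<delta> r" "wt \<delta> r \<le> \<delta> * ln (1 + r)" "wt \<delta> r \<le> r" "wt \<delta> r \<le> 1" "0 < wt1 \<delta> r" "wt1 \<delta> r \<le> 1" "wt1 \<delta> r \<le> wt \<delta> r / r"
    "wt2 \<delta> r \<le> 0" "\<bar>wt2 \<delta> r\<bar> \<le> 2 * wt1 \<delta> r"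
proof -
  have e: "(1 + r) powr (- \<delta>) = exp (- (\<delta> * ln (1 + r)))" using r by (simp add: powr_def)
  show "0 \<le> wt \<delta> r" unfolding wt_def e using \<delta> r by (simp add: ln_ge_zero)
  have "1 - \<delta> * ln (1 + r) \<le> exp (- (\<delta> * ln (1 + r)))" using exp_ge_add_one_self[of "- (\<delta> * ln (1 + r))"] by linarith
  then show 1: "wt \<delta> r \<le> \<delta> * ln (1 + r)" unfolding wt_def e by linarith
  have "ln (1 + r) \<le> r" using r by (intro ln_add_one_self_le_self) auto
  then have "\<delta> * ln (1 + r) \<le> 1 * r" using \<delta> r by (intro mult_mono) (auto simp: ln_ge_zero)
  then show "wt \<delta> r \<le> r" using 1 by linarith
  show "wt \<delta> r \<le> 1" by (simp add: wt_def)
  show "0 < wt1 \<delta> r" using \<delta> r by (simp add: wt1_def)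
  have "(1 + r) powr (- \<delta> - 1) \<le> 1" using powr_mono[of "- \<delta> - 1" 0 "1 + r"] \<delta> r by simp
  then show "wt1 \<delta> r \<le> 1" unfolding wt1_def using \<delta> mult_mono[of \<delta> 1 "(1 + r) powr (- \<delta> - 1)" 1] by simp
  show "wt2 \<delta> r \<le> 0" using \<delta> by (simp add: wt2_def)
  \<comment> \<open>By concavity: w vanishes at 0, so w r / r is a value of w' at an earlier point,
    where w' is larger.\<close>
  have "\<exists>\<xi>. 0 < \<xi> \<and> \<xi> < r \<and> wt \<delta> r - wt \<delta> 0 = (r - 0) * wt1 \<delta> \<xi>"
    using r by (intro MVT2 wt_deriv) auto
  then obtain \<xi> where \<xi>: "0 < \<xi>" "\<xi> < r" "wt \<delta> r = r * wt1 \<delta> \<xi>" by (auto simp: wt_def)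
  have "wt1 \<delta> r \<le> wt1 \<delta> \<xi>" unfolding wt1_def using \<xi> \<delta> by (intro mult_left_mono powr_mono2') auto
  then show "wt1 \<delta> r \<le> wt \<delta> r / r" using \<xi>(3) r by simp
  have "(1 + r) powr (- \<delta> - 2) \<le> (1 + r) powr (- \<delta> - 1)" using r by (intro powr_mono) auto
  then have "\<delta> * (1 + \<delta>) * (1 + r) powr (- \<delta> - 2) \<le> \<delta> * 2 * (1 + r) powr (- \<delta> - 1)"
    using \<delta> by (intro mult_mono) auto
  then show "\<bar>wt2 \<delta> r\<bar> \<le> 2 * wt1 \<delta> r" using \<delta> by (simp add: wt2_def wt1_def)
qed

text \<open>
  The perturbation in the last inequality is \<open>w' g\<close> with \<open>g = (1 + r)\<^sup>-\<^sup>\<delta>\<^sup>0 + (w / \<delta>) (1 + r)\<^sup>\<delta>\<^sup>-\<^sup>\<delta>\<^sup>0\<close>, which is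
  bounded uniformly in \<open>\<delta>\<close> and at most \<open>E / 4\<close> where \<open>w > \<omega>\<close>, if \<open>\<delta>\<close> is small compared to \<open>\<omega>\<close>. So \<open>\<psi>\<close> has
  to be large only for \<open>w \<le> \<omega>\<close>; as a slowly decreasing function of \<open>ln (w + \<omega>)\<close> it satisfies
  \<open>w |(\<psi>\<^sup>2)'| \<le> E w' / 8\<close>, and it vanishes once \<open>w \<ge> 1 / 2\<close>.
\<close>

lemma carleman_weights:
  fixes E \<delta>0 s :: real
  assumes E: "E > 0" and \<delta>0: "\<delta>0 > 0" and s: "s > 1 / 2"
  obtains \<delta> \<phi> \<psi> \<psi>1 \<psi>2 B R0 h0 where
    "0 < \<delta>" "\<delta> \<le> 1" "1 + \<delta> \<le> 2 * s" "R0 > 0" "0 < h0" "h0 \<le> 1"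
    "smooth_on {0<..} \<phi>"
    "\<And>r. r > 0 \<Longrightarrow> (\<phi> has_real_derivative \<psi> r) (at r)"
    "\<And>r. r > 0 \<Longrightarrow> (\<psi> has_real_derivative \<psi>1 r) (at r)"
    "\<And>r. r > 0 \<Longrightarrow> (\<psi>1 has_real_derivative \<psi>2 r) (at r)"
    "\<And>r. r > 0 \<Longrightarrow> 0 \<le> \<psi> r" "\<And>r. r > 0 \<Longrightarrow> \<psi> r \<le> B" "\<And>r. r > 0 \<Longrightarrow> \<bar>\<psi>1 r\<bar> \<le> B"
    "\<And>r. r > 0 \<Longrightarrow> 0 \<le> \<phi> r" "\<And>r. r > 0 \<Longrightarrow> \<phi> r \<le> \<phi> R0" "\<And>r. r \<ge> R0 \<Longrightarrow> \<phi> r = \<phi> R0" "\<phi> R0 \<le> B"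
    "\<And>h r. 0 < h \<Longrightarrow> h \<le> h0 \<Longrightarrow> r > 0 \<Longrightarrow>
       wt1 \<delta> r * (E + (\<psi> r)\<^sup>2 - h * \<psi>1 r) + wt \<delta> r * (2 * \<psi> r * \<psi>1 r - h * \<psi>2 r)
      \<ge> E / 2 * wt1 \<delta> r + wt1 \<delta> r * (1 + r) powr (- \<delta>0) + wt \<delta> r * (1 + r) powr (- 1 - \<delta>0)"
proof -
  \<comment> \<open>\<open>A\<close> is the height of \<psi> at the origin. Where w <= \<omega> one
    gets \<psi> >= A - 2 >= 1, hence \<psi>^2 >= A - 2 = 1 + 2/\<delta>0 + E, which exceeds the
    bound 1 + 2/\<delta>0 for g by E.\<close>
  define A where "A = 3 + 2 / \<delta>0 + E"
  have A: "A > 3" "A \<ge> E" using E \<delta>0 by (auto simp: A_def intro!: add_pos_pos)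
  define \<beta> where "\<beta> = E / (16 * A)"
  have \<beta>: "\<beta> > 0" "\<beta> \<le> 1" "\<beta> * A = E / 16" using E A by (auto simp: \<beta>_def divide_le_eq)
  \<comment> \<open>Chosen so that A - \<beta> ln ((w + \<omega>) / \<omega>) has become nonpositive
    when w reaches 1/2.\<close>
  define \<omega> where "\<omega> = exp (- (A / \<beta>)) / 2"
  have \<omega>: "\<omega> > 0" "\<omega> * exp (A / \<beta>) = 1 / 2" by (simp_all add: \<omega>_def exp_minus)
  \<comment> \<open>\<open>A\<close>, \<beta> and \<omega> depend only on E and \<delta>0, so
    choosing \<delta> after them is not circular. The entries serve, in order,
    \<open>wt_bounds\<close>, the comparison with the weight exponent s, the decay (1 +
    r)^(\<delta>-\<delta>0) <= (1 + r)^(-\<delta>0/2), the bound a >= 1 in \<open>g_le2\<close>, and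
    the contradiction there.\<close>
  define \<delta> where "\<delta> = Min {1, 2 * s - 1, \<delta>0 / 2, 8 / E, (\<omega> * \<delta>0 / 4)\<^sup>2 * E / 8}"
  have \<delta>: "0 < \<delta>" "\<delta> \<le> 1" "\<delta> \<le> 2 * s - 1" "\<delta> \<le> \<delta>0 / 2" "\<delta> \<le> 8 / E" "\<delta> \<le> (\<omega> * \<delta>0 / 4)\<^sup>2 * E / 8"
  proof -
    have "(\<omega> * \<delta>0 / 4)\<^sup>2 * E / 8 > 0" using E \<delta>0 \<omega>(1) by simp
    then show "0 < \<delta>" using E \<delta>0 s unfolding \<delta>_def by (subst Min_gr_iff) auto
  qed (unfold \<delta>_def, rule Min_le; auto)+
  define w w1 w2 where "w = wt \<delta>" and "w1 = wt1 \<delta>" and "w2 = wt2 \<delta>"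
  note wb = wt_bounds[OF \<delta>(1,2), folded w_def w1_def w2_def]
  define g where "g = (\<lambda>r. (1 + r) powr (- \<delta>0) + w r / \<delta> * (1 + r) powr (\<delta> - \<delta>0))"
  have g: "w1 r * (1 + r) powr (- \<delta>0) + w r * (1 + r) powr (- 1 - \<delta>0) = w1 r * g r" if r: "r > 0" for r
  proof -
    have "(1 + r) powr (- 1 - \<delta>0) = (1 + r) powr (- \<delta> - 1) * (1 + r) powr (\<delta> - \<delta>0)"
      using r by (simp add: powr_add[symmetric])
    then show ?thesis using \<delta>(1) by (simp add: g_def w1_def wt1_def field_simps)
  qed
  have powle: "(1 + r) powr (\<delta> - \<delta>0) \<le> (1 + r) powr (- (\<delta>0 / 2))" "(1 + r) powr (- \<delta>0) \<le> (1 + r) powr (- (\<delta>0 / 2))" if r: "r > 0" for r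
    using r \<delta> \<delta>0 by (auto intro!: powr_mono)
  have g_le1: "g r \<le> 1 + 2 / \<delta>0" if r: "r > 0" for r
  proof -
    have p1: "(1 + r) powr (- \<delta>0) \<le> 1" using powr_mono[of "- \<delta>0" 0 "1 + r"] \<delta>0 r by simp
    have "w r / \<delta> \<le> (1 + r) powr (\<delta>0 / 2) * (2 / \<delta>0)"
    proof -
      have "w r / \<delta> \<le> ln (1 + r)" using wb(2)[OF r] \<delta>(1) by (simp add: divide_le_eq mult.commute)
      also have "\<dots> \<le> (1 + r) powr (\<delta>0 / 2) / (\<delta>0 / 2)" by (rule ln_powr_bound) (use r \<delta>0 in auto)
      finally show ?thesis by simp
    qed
    then have "w r / \<delta> * (1 + r) powr (\<delta> - \<delta>0) \<le> ((1 + r) powr (\<delta>0 / 2) * (2 / \<delta>0)) * (1 + r) powr (- (\<delta>0 / 2))"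
      using powle(1)[OF r] wb(1)[OF r] \<delta> \<delta>0 by (intro mult_mono) auto
    also have "\<dots> = 2 / \<delta>0 * ((1 + r) powr (\<delta>0 / 2) * (1 + r) powr (- (\<delta>0 / 2)))" by simp
    also have "(1 + r) powr (\<delta>0 / 2) * (1 + r) powr (- (\<delta>0 / 2)) = 1" using r by (simp add: powr_minus)
    finally show ?thesis using p1 by (simp add: g_def)
  qed
  have g_le2: "g r \<le> E / 4" if r: "r > 0" and wr: "w r > \<omega>" for r
  proof -
    \<comment> \<open>If w > \<omega>, then (1 + r)^(\<delta>0/2) must be at least a: otherwise ln
      (1 + r) would be so small that w <= \<delta> ln (1 + r) <= \<omega>. This size of r makes g as
      small as E/4 in spite of the factor 1/\<delta>.\<close>
    define a where "a = 8 / (E * \<delta>)"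
    have a: "a \<ge> 1" using \<delta>(1,5) E by (simp add: a_def le_divide_eq mult.commute)
    have "(1 + r) powr (\<delta>0 / 2) \<ge> a"
    proof (rule ccontr)
      assume n: "\<not> (1 + r) powr (\<delta>0 / 2) \<ge> a"
      then have "ln ((1 + r) powr (\<delta>0 / 2)) \<le> ln a" using r by (intro ln_mono) auto
      then have "ln (1 + r) \<le> 2 / \<delta>0 * ln a" using r \<delta>0 by (simp add: ln_powr field_simps)
      also have "ln a \<le> a powr (1/2) / (1/2)" by (rule ln_powr_bound[OF a]) simp
      then have "2 / \<delta>0 * ln a \<le> 2 / \<delta>0 * (2 * sqrt a)" using \<delta>0 a by (intro mult_left_mono) (auto simp: powr_half_sqrt)
      finally have "\<delta> * ln (1 + r) \<le> \<delta> * (2 / \<delta>0 * (2 * sqrt a))" using \<delta>(1) by (intro mult_left_mono) auto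
      then have "w r \<le> 4 / \<delta>0 * (\<delta> * sqrt a)" using wb(2)[OF r] by (simp add: mult_ac)
      also have "\<delta> * sqrt a = sqrt (8 * \<delta> / E)"
      proof -
        have "\<delta> * sqrt a = sqrt (\<delta>\<^sup>2) * sqrt a" using \<delta>(1) by simp
        also have "\<dots> = sqrt (\<delta>\<^sup>2 * a)" by (rule real_sqrt_mult[symmetric])
        also have "\<delta>\<^sup>2 * a = 8 * \<delta> / E" using \<delta>(1) E by (simp add: a_def power2_eq_square)
        finally show ?thesis .
      qed
      also have "\<dots> \<le> sqrt ((\<omega> * \<delta>0 / 4)\<^sup>2)"
      proof (rule real_sqrt_le_mono)
        have "\<delta> * 8 \<le> (\<omega> * \<delta>0 / 4)\<^sup>2 * E" using \<delta>(6) by simp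
        then show "8 * \<delta> / E \<le> (\<omega> * \<delta>0 / 4)\<^sup>2" using E by (simp add: divide_le_eq mult.commute)
      qed
      also have "\<dots> = \<omega> * \<delta>0 / 4" using \<omega> \<delta>0 by simp
      finally have "w r \<le> 4 / \<delta>0 * (\<omega> * \<delta>0 / 4)" using \<delta>0 by (simp add: divide_right_mono mult_left_mono)
      also have "\<dots> = \<omega>" using \<delta>0 by simp
      finally show False using wr by simp
    qed
    then have p: "(1 + r) powr (- (\<delta>0 / 2)) \<le> E * \<delta> / 8"
      using a r E \<delta>(1) unfolding powr_minus a_def
      by (subst inverse_le_iff_le[symmetric]) (auto simp: inverse_eq_divide)
    have "g r \<le> (1 + r) powr (- (\<delta>0 / 2)) + 1 / \<delta> * (1 + r) powr (- (\<delta>0 / 2))"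
      unfolding g_def using powle[OF r] wb(1,4)[OF r] \<delta>(1) by (intro add_mono mult_mono divide_right_mono) auto
    also have "\<dots> = (1 + 1 / \<delta>) * (1 + r) powr (- (\<delta>0 / 2))" by (simp add: algebra_simps)
    also have "\<dots> \<le> (2 / \<delta>) * (E * \<delta> / 8)"
    proof (rule mult_mono[OF _ p])
      have "1 \<le> 1 / \<delta>" using \<delta>(1,2) by simp
      then show "1 + 1 / \<delta> \<le> 2 / \<delta>" by (simp add: add_divide_distrib[symmetric])
    qed (use \<delta>(1) in auto)
    also have "\<dots> = E / 4" using \<delta>(1) by simp
    finally show ?thesis .
  qed

  \<comment> \<open>\<open>q\<close> decreases from A at r = 0, and w |q'| <= \<beta> w' because w /
    (w + \<omega>) <= 1. The shift by \<omega> keeps the logarithm finite at the origin, where w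
    vanishes.\<close>
  define q where "q = (\<lambda>r. A - \<beta> * ln ((w r + \<omega>) / \<omega>))"
  define q1 where "q1 = (\<lambda>r. - \<beta> * (w1 r / (w r + \<omega>)))"
  define q2 where "q2 = (\<lambda>r. - \<beta> * (w2 r / (w r + \<omega>) - (w1 r / (w r + \<omega>))\<^sup>2))"
  have w0: "0 \<le> w r" if "r \<ge> 0" for r using wb(1)[of r] that by (cases "r = 0") (auto simp: w_def wt_def)
  have wp: "w r + \<omega> > 0" if "r \<ge> 0" for r using w0[OF that] \<omega>(1) by linarith
  have dw: "(w has_real_derivative w1 r) (at r)" "(w1 has_real_derivative w2 r) (at r)" if "r \<ge> 0" for r
    unfolding w_def w1_def w2_def using that by (auto intro!: wt_deriv)
  have dq: "(q has_real_derivative q1 r) (at r)" "(q1 has_real_derivative q2 r) (at r)" if r: "r \<ge> 0" for r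
  proof -
    note [derivative_intros] = dw[OF r]
    show "(q has_real_derivative q1 r) (at r)" unfolding q_def q1_def using wp[OF r] \<omega>(1)
      by (auto intro!: derivative_eq_intros dw[OF r] simp: field_simps)
    have "((\<lambda>r. w r + \<omega>) has_real_derivative w1 r) (at r)" using DERIV_add[OF dw(1)[OF r] DERIV_const] by simp
    from DERIV_cmult[OF DERIV_divide[OF dw(2)[OF r] this], of "- \<beta>"] wp[OF r]
    show "(q1 has_real_derivative q2 r) (at r)" unfolding q1_def q2_def
      by (simp add: diff_divide_distrib power2_eq_square)
  qed
  define \<psi> \<psi>1 \<psi>2 where "\<psi> = (\<lambda>r. ramp (q r))" and "\<psi>1 = (\<lambda>r. ramp1 (q r) * q1 r)"
    and "\<psi>2 = (\<lambda>r. bumpF 3 (q r) * q1 r * q1 r + ramp1 (q r) * q2 r)"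
  have d\<psi>: "(\<psi> has_real_derivative \<psi>1 r) (at r)" "(\<psi>1 has_real_derivative \<psi>2 r) (at r)" if r: "r \<ge> 0" for r
  proof -
    show "(\<psi> has_real_derivative \<psi>1 r) (at r)" unfolding \<psi>_def \<psi>1_def by (rule DERIV_chain2[OF ramp_deriv(1) dq(1)[OF r]])
    have "((\<lambda>r. ramp1 (q r)) has_real_derivative bumpF 3 (q r) * q1 r) (at r)" by (rule DERIV_chain2[OF ramp_deriv(2) dq(1)[OF r]])
    from DERIV_mult[OF this dq(2)[OF r]] show "(\<psi>1 has_real_derivative \<psi>2 r) (at r)"
      unfolding \<psi>1_def \<psi>2_def by (simp add: mult.commute mult.assoc add.commute)
  qed
  have lnn: "0 \<le> ln ((w r + \<omega>) / \<omega>)" if "r \<ge> 0" for r using w0[OF that] \<omega>(1) by (simp add: ln_ge_zero)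
  have q_le: "q r \<le> A" if "r \<ge> 0" for r using mult_nonneg_nonneg[OF less_imp_le[OF \<beta>(1)] lnn[OF that]] unfolding q_def by linarith
  have \<psi>0: "0 \<le> \<psi> r" "\<psi> r \<le> A" if "r \<ge> 0" for r
  proof -
    show "0 \<le> \<psi> r" by (simp add: \<psi>_def ramp_bounds)
    show "\<psi> r \<le> A" using q_le[OF that] ramp_bounds(2)[of "q r"] ramp_bounds(3)[of "q r"] A unfolding \<psi>_def by (cases "q r \<ge> 0") auto
  qed
  have q1b: "q1 r \<le> 0" "\<bar>q1 r\<bar> \<le> \<beta> / \<omega> * w1 r" if r: "r > 0" for r
  proof -
    note wp' = wp[OF less_imp_le[OF r]]
    show "q1 r \<le> 0" unfolding q1_def using \<beta>(1) wb(5)[OF r] wp' by simp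
    have "w1 r / (w r + \<omega>) \<le> w1 r / \<omega>" using wb(1,5)[OF r] \<omega>(1) wp' by (intro divide_left_mono) auto
    then have "\<beta> * (w1 r / (w r + \<omega>)) \<le> \<beta> * (w1 r / \<omega>)" using \<beta>(1) by (intro mult_left_mono) auto
    then show "\<bar>q1 r\<bar> \<le> \<beta> / \<omega> * w1 r" using \<beta>(1) wb(5)[OF r] wp' by (simp add: q1_def abs_mult)
  qed
  have q2b: "\<bar>q2 r\<bar> \<le> \<beta> * (2 / \<omega> + 1 / \<omega>\<^sup>2) * w1 r" if r: "r > 0" for r
  proof -
    note wp' = wp[OF less_imp_le[OF r]]
    have 1: "\<bar>w2 r / (w r + \<omega>)\<bar> \<le> 2 * w1 r / \<omega>"
      unfolding abs_divide using wb(1,5,9)[OF r] \<omega>(1) wp' by (intro frac_le) auto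
    have "w1 r / (w r + \<omega>) \<le> w1 r / \<omega>" using wb(1,5)[OF r] \<omega>(1) wp' by (intro divide_left_mono) auto
    then have "(w1 r / (w r + \<omega>))\<^sup>2 \<le> (w1 r / \<omega>)\<^sup>2" using wb(5)[OF r] wp' by (intro power_mono) auto
    also have "\<dots> \<le> w1 r / \<omega>\<^sup>2" using wb(5,6)[OF r] by (simp add: power_divide power2_eq_square divide_right_mono mult_left_le)
    finally have "\<bar>w2 r / (w r + \<omega>) - (w1 r / (w r + \<omega>))\<^sup>2\<bar> \<le> 2 * w1 r / \<omega> + w1 r / \<omega>\<^sup>2" using 1 zero_le_power2[of "w1 r / (w r + \<omega>)"] by linarith
    then have "\<beta> * \<bar>w2 r / (w r + \<omega>) - (w1 r / (w r + \<omega>))\<^sup>2\<bar> \<le> \<beta> * (2 * w1 r / \<omega> + w1 r / \<omega>\<^sup>2)" using \<beta>(1) by (intro mult_left_mono) auto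
    also have "\<dots> = \<beta> * (2 / \<omega> + 1 / \<omega>\<^sup>2) * w1 r" by (simp add: algebra_simps)
    finally show ?thesis using \<beta>(1) by (simp add: q2_def abs_mult)
  qed
  \<comment> \<open>Bounds |\<psi>2| by a multiple of w1, with 27 from \<open>bumpF_3_le\<close>.
    The proportionality to w1 matters, since the right-hand side of \<open>key\<close> decays as
    well.\<close>
  define C2 where "C2 = 27 * (\<beta> / \<omega>)\<^sup>2 + \<beta> * (2 / \<omega> + 1 / \<omega>\<^sup>2)"
  have C2: "C2 \<ge> 0" unfolding C2_def using \<beta>(1) \<omega>(1) by (intro add_nonneg_nonneg mult_nonneg_nonneg) auto
  have \<psi>1b: "\<bar>\<psi>1 r\<bar> \<le> \<beta> / \<omega> * w1 r" if r: "r > 0" for r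
  proof -
    have "\<bar>ramp1 (q r)\<bar> * \<bar>q1 r\<bar> \<le> 1 * (\<beta> / \<omega> * w1 r)" using q1b[OF r] ramp_bounds(5,6)[of "q r"] by (intro mult_mono) auto
    then show ?thesis by (simp add: \<psi>1_def abs_mult)
  qed
  have \<psi>2b: "\<bar>\<psi>2 r\<bar> \<le> C2 * w1 r" if r: "r > 0" for r
  proof -
    have "\<beta> / \<omega> * w1 r \<le> \<beta> / \<omega> * 1" using wb(6)[OF r] \<beta>(1) \<omega>(1) by (intro mult_left_mono) auto
    from mult_mono[OF q1b(2)[OF r] order_trans[OF q1b(2)[OF r] this]] wb(5)[OF r] \<beta>(1) \<omega>(1)
    have "\<bar>q1 r\<bar> * \<bar>q1 r\<bar> \<le> (\<beta> / \<omega> * w1 r) * (\<beta> / \<omega> * 1)" by simp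
    then have "bumpF 3 (q r) * (\<bar>q1 r\<bar> * \<bar>q1 r\<bar>) \<le> 27 * ((\<beta> / \<omega> * w1 r) * (\<beta> / \<omega> * 1))"
      by (rule mult_mono[OF bumpF_3_le]) auto
    then have 1: "\<bar>bumpF 3 (q r) * q1 r * q1 r\<bar> \<le> 27 * (\<beta> / \<omega>)\<^sup>2 * w1 r"
      using bumpF_nonneg[of 3 "q r"] by (simp add: abs_mult power2_eq_square mult_ac)
    have "\<bar>ramp1 (q r)\<bar> * \<bar>q2 r\<bar> \<le> 1 * (\<beta> * (2 / \<omega> + 1 / \<omega>\<^sup>2) * w1 r)"
      using q2b[OF r] ramp_bounds(5,6)[of "q r"] by (intro mult_mono) auto
    then have 2: "\<bar>ramp1 (q r) * q2 r\<bar> \<le> \<beta> * (2 / \<omega> + 1 / \<omega>\<^sup>2) * w1 r" by (simp add: abs_mult)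
    show ?thesis using 1 2 unfolding \<psi>2_def C2_def by (simp add: distrib_right)
  qed
  \<comment> \<open>For h <= h0 all terms with an explicit factor h cost at most E/16 of w1.\<close>
  define h0 where "h0 = min 1 (E / 16 / (\<beta> / \<omega> + C2))"
  have Dp: "\<beta> / \<omega> + C2 > 0" using \<beta>(1) \<omega>(1) C2 by (intro add_pos_nonneg) auto
  have h0: "0 < h0" "h0 \<le> 1" "h0 * (\<beta> / \<omega> + C2) \<le> E / 16"
  proof -
    show "0 < h0" "h0 \<le> 1" using E Dp by (auto simp: h0_def)
    have "h0 \<le> E / 16 / (\<beta> / \<omega> + C2)" by (simp add: h0_def)
    then show "h0 * (\<beta> / \<omega> + C2) \<le> E / 16" by (simp only: pos_le_divide_eq[OF Dp])
  qed
  have key: "w1 r * (E + (\<psi> r)\<^sup>2 - h * \<psi>1 r) + w r * (2 * \<psi> r * \<psi>1 r - h * \<psi>2 r) \<ge> E / 2 * w1 r + w1 r * (1 + r) powr (- \<delta>0) + w r * (1 + r) powr (- 1 - \<delta>0)"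
    if h: "0 < h" "h \<le> h0" and r: "r > 0" for h r
  proof -
    have r0: "r \<ge> 0" using r by simp
    have t1: "h * (w1 r * \<psi>1 r + w r * \<psi>2 r) \<le> E / 16 * w1 r"
    proof -
      have "w1 r * \<psi>1 r + w r * \<psi>2 r \<le> \<bar>w1 r\<bar> * \<bar>\<psi>1 r\<bar> + \<bar>w r\<bar> * \<bar>\<psi>2 r\<bar>"
        unfolding abs_mult[symmetric] by linarith
      also have "\<dots> \<le> 1 * (\<beta> / \<omega> * w1 r) + 1 * (C2 * w1 r)"
        using wb[OF r] \<psi>1b[OF r] \<psi>2b[OF r] by (intro add_mono mult_mono) auto
      also have "\<dots> = (\<beta> / \<omega> + C2) * w1 r" by (simp add: algebra_simps)
      finally have "h * (w1 r * \<psi>1 r + w r * \<psi>2 r) \<le> h * ((\<beta> / \<omega> + C2) * w1 r)" using h by (intro mult_left_mono) auto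
      also have "\<dots> \<le> h0 * ((\<beta> / \<omega> + C2) * w1 r)" using h Dp wb(5)[OF r] by (intro mult_right_mono) auto
      also have "\<dots> \<le> E / 16 * w1 r" using mult_right_mono[OF h0(3), of "w1 r"] wb(5)[OF r] by (simp add: mult.assoc)
      finally show ?thesis .
    qed
    \<comment> \<open>With \<psi> <= A, slope of the ramp at most 1 and w / (w + \<omega>) <= 1, the
      loss is 2 A \<beta> w1.\<close>
    have t2: "w r * (2 * \<psi> r * \<psi>1 r) \<ge> - (E / 8) * w1 r"
    proof -
      have "w r * (2 * \<psi> r * (ramp1 (q r) * (\<beta> * (w1 r / (w r + \<omega>))))) = 2 * \<psi> r * ramp1 (q r) * \<beta> * w1 r * (w r / (w r + \<omega>))" by simp
      also have "\<dots> \<le> 2 * A * 1 * \<beta> * w1 r * 1"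
        using \<psi>0[OF r0] ramp_bounds(5,6)[of "q r"] \<beta>(1) wb[OF r] wp[OF r0] A \<omega>(1) by (intro mult_mono) (auto simp: divide_le_eq)
      also have "\<dots> = 2 * (\<beta> * A) * w1 r" by simp
      also have "\<dots> = E / 8 * w1 r" unfolding \<beta>(3) by simp
      finally show ?thesis by (simp add: \<psi>1_def q1_def)
    qed
    \<comment> \<open>The budget: from E one subtracts E/8 for the derivative of \<psi>^2 and E/16
      for the terms with h. Where w > \<omega>, the remaining 13/16 E covers E/2 + E/4; elsewhere
      \<psi>^2 pays for g.\<close>
    have t3: "w1 r * (E + (\<psi> r)\<^sup>2 - E / 8 - E / 16) \<ge> w1 r * (E / 2 + g r)"
    proof (rule mult_left_mono)
      show "E / 2 + g r \<le> E + (\<psi> r)\<^sup>2 - E / 8 - E / 16"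
      proof (cases "w r > \<omega>")
        case True
        then show ?thesis using g_le2[OF r True] E zero_le_power2[of "\<psi> r"] by linarith
      next
        case False
        then have "ln ((w r + \<omega>) / \<omega>) \<le> (w r + \<omega>) / \<omega> - 1" using wp[OF r0] \<omega>(1) by (intro ln_le_minus_one) auto
        also have "\<dots> \<le> 1" using False \<omega>(1) by (simp add: divide_le_eq add_divide_distrib)
        finally have "\<beta> * ln ((w r + \<omega>) / \<omega>) \<le> 1 * 1" using \<beta> lnn[OF r0] by (intro mult_mono) auto
        then have ql: "q r \<ge> A - 1" unfolding q_def by simp
        then have "\<psi> r \<ge> A - 2" using ramp_bounds(4)[of "q r"] A unfolding \<psi>_def by linarith
        then have "(A - 2)\<^sup>2 \<le> (\<psi> r)\<^sup>2" using A by (intro power_mono) auto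
        moreover have "1 * (A - 2) \<le> (A - 2) * (A - 2)" using A by (intro mult_right_mono) auto
        ultimately have "A - 2 \<le> (\<psi> r)\<^sup>2" by (simp add: power2_eq_square)
        then show ?thesis using g_le1[OF r] E unfolding A_def by linarith
      qed
    qed (use wb(5)[OF r] in simp)
    have "w1 r * (E / 2 + g r) \<le> w1 r * (E + (\<psi> r)\<^sup>2 - h * \<psi>1 r) + w r * (2 * \<psi> r * \<psi>1 r - h * \<psi>2 r)"
      using t1 t2 t3 by (simp add: algebra_simps)
    then show ?thesis using g[OF r] by (simp add: algebra_simps)
  qed
  \<comment> \<open>R0^\<delta> = 2, so w >= 1/2 beyond R0 and \<psi> vanishes there.\<close>
  define R0 where "R0 = 2 powr (1 / \<delta>)"
  have R0: "R0 > 0" by (simp add: R0_def)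
  have \<psi>R: "\<psi> r = 0" if r: "r \<ge> R0" for r
  proof -
    have rp: "r > 0" using r R0 by linarith
    have "2 = R0 powr \<delta>" using \<delta>(1) by (simp add: R0_def powr_powr)
    also have "\<dots> \<le> (1 + r) powr \<delta>" using r R0 \<delta>(1) by (intro powr_mono2) auto
    finally have "inverse ((1 + r) powr \<delta>) \<le> inverse 2" by (rule le_imp_inverse_le) simp
    then have "(1 + r) powr (- \<delta>) \<le> 1 / 2" by (simp add: powr_minus)
    then have "w r \<ge> 1 / 2" by (simp add: w_def wt_def)
    then have "exp (A / \<beta>) * \<omega> \<le> w r + \<omega>" using \<omega> by (simp only: mult.commute[of _ \<omega>])
    then have "exp (A / \<beta>) \<le> (w r + \<omega>) / \<omega>" by (simp only: pos_le_divide_eq[OF \<omega>(1)])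
    then have "A / \<beta> \<le> ln ((w r + \<omega>) / \<omega>)" using wp[of r] rp \<omega>(1) by (subst ln_ge_iff) auto
    then have "A \<le> ln ((w r + \<omega>) / \<omega>) * \<beta>" by (simp only: pos_divide_le_eq[OF \<beta>(1)])
    then have "q r \<le> 0" by (simp add: q_def mult.commute)
    then show ?thesis by (simp add: \<psi>_def ramp_bounds)
  qed
  have cont: "continuous_on {0..b} \<psi>" for b
    by (rule DERIV_continuous_on[of _ _ \<psi>1]) (use d\<psi>(1) in \<open>auto intro: has_field_derivative_at_within\<close>)
  \<comment> \<open>The primitive starts at 0, so the Carleman weight is at least 1. Its integrand
    extends continuously to the origin.\<close>
  define \<phi> where "\<phi> = (\<lambda>r. integral {0..r} \<psi>)"
  have d\<phi>: "(\<phi> has_real_derivative \<psi> r) (at r)" if r: "r > 0" for r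
  proof -
    have "(\<phi> has_real_derivative \<psi> r) (at r within {0..r+1})"
      unfolding \<phi>_def by (rule integral_has_real_derivative[OF cont]) (use r in auto)
    then show ?thesis using at_within_Icc_at[of 0 r "r + 1"] r by simp
  qed
  have \<phi>0: "0 \<le> \<phi> r" for r
    unfolding \<phi>_def by (rule integral_nonneg) (use integrable_continuous_real[OF cont] \<psi>0 in auto)
  have mono: "\<phi> r \<le> \<phi> r'" if "0 < r" "r \<le> r'" for r r'
    by (rule DERIV_nonneg_imp_nondecreasing[OF that(2)]) (use d\<phi> \<psi>0 that in \<open>meson less_le_trans less_imp_le\<close>)
  have const: "\<phi> r = \<phi> R0" if r: "r \<ge> R0" for r
  proof (cases "r = R0")
    case False
    then have "R0 < r" using r by simp
    then have "\<exists>z. R0 < z \<and> z < r \<and> \<phi> r - \<phi> R0 = (r - R0) * \<psi> z"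
      using R0 by (intro MVT2 d\<phi>) auto
    then show ?thesis using \<psi>R by auto
  qed simp
  have s\<psi>: "smooth_on {0<..} \<psi>"
  proof -
    have "smooth_on {0<..} (\<lambda>r. (w r + \<omega>) / \<omega>)"
      unfolding w_def by (intro smooth_on_divide smooth_on_add smooth_wt smooth_on_const) (use \<omega>(1) in auto)
    then have "smooth_on {0<..} (\<lambda>r. ln ((w r + \<omega>) / \<omega>))"
      by (rule smooth_on_compose[OF smooth_on_ln]) (use wp \<omega>(1) in auto)
    then have "smooth_on {0<..} q" unfolding q_def by (intro smooth_on_diff smooth_on_mult smooth_on_const) auto
    then show ?thesis unfolding \<psi>_def by (rule smooth_on_compose[OF smooth_ramp]) auto
  qed
  have s\<phi>: "smooth_on {0<..} \<phi>" by (rule smooth_on_DERIV_I[OF _ d\<phi> s\<psi>]) auto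
  define B where "B = A + \<beta> / \<omega> + \<phi> R0"
  have \<beta>\<omega>: "\<beta> / \<omega> > 0" using \<beta>(1) \<omega>(1) by simp
  show thesis
  proof (rule that[of \<delta> R0 h0 \<phi> \<psi> \<psi>1 \<psi>2 B])
    show "\<psi> r \<le> B" if "r > 0" for r using \<psi>0(2)[of r] that \<phi>0[of R0] \<beta>\<omega> unfolding B_def by linarith
    show "\<bar>\<psi>1 r\<bar> \<le> B" if r: "r > 0" for r
    proof -
      have "\<beta> / \<omega> * w1 r \<le> \<beta> / \<omega> * 1" using wb(6)[OF r] \<beta>\<omega> by (intro mult_left_mono) auto
      then have "\<bar>\<psi>1 r\<bar> \<le> \<beta> / \<omega>" using \<psi>1b[OF r] by linarith
      then show ?thesis using A \<phi>0[of R0] unfolding B_def by linarith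
    qed
    show "\<phi> R0 \<le> B" using A \<beta>\<omega> unfolding B_def by linarith
    show "\<phi> r \<le> \<phi> R0" if "r > 0" for r
    proof (cases "r \<le> R0")
      case True then show ?thesis using mono[OF that] by simp
    next
      case False then show ?thesis using const[of r] by linarith
    qed
    show "1 + \<delta> \<le> 2 * s" using \<delta>(3) by simp
    show "E / 2 * wt1 \<delta> r + wt1 \<delta> r * (1 + r) powr (- \<delta>0) + wt \<delta> r * (1 + r) powr (- 1 - \<delta>0)
       \<le> wt1 \<delta> r * (E + (\<psi> r)\<^sup>2 - h * \<psi>1 r) + wt \<delta> r * (2 * \<psi> r * \<psi>1 r - h * \<psi>2 r)"
      if "0 < h" "h \<le> h0" "r > 0" for h r using key[OF that] unfolding w_def w1_def .
    show "0 < \<delta>" by (rule \<delta>(1))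
    show "\<delta> \<le> 1" by (rule \<delta>(2))
    show "R0 > 0" by (rule R0)
    show "0 < h0" by (rule h0(1))
    show "h0 \<le> 1" by (rule h0(2))
    show "smooth_on {0<..} \<phi>" by (rule s\<phi>)
    show "(\<phi> has_real_derivative \<psi> r) (at r)" "(\<psi> has_real_derivative \<psi>1 r) (at r)" "(\<psi>1 has_real_derivative \<psi>2 r) (at r)"
       "0 \<le> \<psi> r" "0 \<le> \<phi> r" if "r > 0" for r
      using d\<phi>[OF that] d\<psi>[of r] \<psi>0[of r] \<phi>0[of r] that by auto
    show "\<phi> r = \<phi> R0" if "r \<ge> R0" for r using const[OF that] .
  qed
qed

section \<open>The resolvent estimates\<close>

text \<open>Supplies the locale assumption \<open>V_dist\<close>. Since \<zeta> is nonnegative, the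
  one-sided bound on W can be integrated against it.\<close>

lemma radial_derivative_bound:
  fixes V W :: "'a::euclidean_space \<Rightarrow> real"
  assumes W: "W \<in> Linfty" "has_distributional_radial_derivative V W" and \<delta>: "\<delta> > 0"
    and le: "AE x in lborel. W x \<le> (1 + norm x) powr (- 1 - \<delta>)"
    and \<zeta>: "smooth_on UNIV \<zeta>" "\<And>x. norm x < \<eta> \<Longrightarrow> \<zeta> x = 0" "\<eta> > 0" "\<And>x. norm x > R \<Longrightarrow> \<zeta> x = 0" "\<And>x. 0 \<le> \<zeta> x"
  shows "(\<integral>x. V x * rd \<zeta> x * norm x powr (1 - real DIM('a)) \<partial>lborel)
    \<ge> - (\<integral>x. (1 + norm x) powr (- 1 - \<delta>) * \<zeta> x * norm x powr (1 - real DIM('a)) \<partial>lborel)"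
proof -
  define p where "p = (\<lambda>x::'a. norm x powr (1 - real DIM('a)))"
  have tf: "test_function (- {0}) \<zeta>" by (rule test_function_punctured[OF \<zeta>(1,4,2,3)])
  have df: "\<zeta> differentiable (at x)" for x using \<zeta>(1) unfolding smooth_on_def by (metis Ck_on.simps(2) UNIV_I)
  have "(\<integral>x. V x * rd \<zeta> x * p x \<partial>lborel) = - (\<integral>x. W x * \<zeta> x * p x \<partial>lborel)"
    using W(2)[unfolded has_distributional_radial_derivative_def, rule_format, OF tf] unfolding p_def rd_linear_direction[OF df] .
  moreover have "(\<integral>x. W x * \<zeta> x * p x \<partial>lborel) \<le> (\<integral>x. (1 + norm x) powr (- 1 - \<delta>) * \<zeta> x * p x \<partial>lborel)"
  proof -
    have "smooth_on pct (\<lambda>x. \<zeta> x * p x)"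
      unfolding p_def by (intro smooth_on_mult smooth_on_subset[OF \<zeta>(1)] smooth_radial[OF smooth_on_powr] open_pct) auto
    then have i: "integrable lborel (\<lambda>x. \<zeta> x * p x)"
      by (rule smooth_integrable_pct[OF _ _ \<zeta>(3)]) (use \<zeta>(2,4) in auto)
    have bW: "bdd_meas W" using W(1) by (auto simp: Linfty_def bdd_meas_def)
    have "(1 + norm x) powr (- 1 - \<delta>) \<le> 1" for x :: 'a
      using powr_mono[of "- 1 - \<delta>" 0 "1 + norm x"] \<delta> by (simp add: add_nonneg_eq_0_iff)
    then have bg: "bdd_meas (\<lambda>x::'a. (1 + norm x) powr (- 1 - \<delta>))"
      unfolding bdd_meas_def by (auto intro!: exI[of _ 1])
    show ?thesis
    proof (rule integral_mono_AE)
      show "integrable lborel (\<lambda>x. W x * \<zeta> x * p x)" using bdd_meas_integrable[OF bW i] by (simp add: mult.assoc)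
      show "integrable lborel (\<lambda>x. (1 + norm x) powr (- 1 - \<delta>) * \<zeta> x * p x)"
        using bdd_meas_integrable[OF bg i] by (simp add: mult.assoc)
      show "AE x in lborel. W x * \<zeta> x * p x \<le> (1 + norm x) powr (- 1 - \<delta>) * \<zeta> x * p x"
        using le by eventually_elim (intro mult_right_mono \<zeta>(5), auto simp: p_def)
    qed
  qed
  ultimately show ?thesis unfolding p_def by linarith
qed

lemma L2_opnorm_le:
  assumes "0 \<le> K" "\<And>f. sqi f \<Longrightarrow> sqi (T f)" "\<And>f. sqi f \<Longrightarrow> sqrt (N2 (T f)) \<le> K * sqrt (N2 f)"
  shows "L2_opnorm T \<le> ennreal K"
  unfolding L2_opnorm_def by (rule Inf_lower) (use assms in \<open>auto simp: L2_iff_sqi L2norm_eq\<close>)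

text \<open>If X exceeded the bound, then Y/h <= X, and both terms on the right would be at most
  constants times (Y/h) X; dividing by X contradicts the assumption. The summand 1 in the constant
  ensures Y/h <= X.\<close>

lemma quadratic_bound:
  fixes X Y h :: real
  assumes "0 < \<alpha>" "0 \<le> C1" "0 \<le> C2" "0 \<le> X" "0 \<le> Y" "0 < h"
    and le: "\<alpha> * X\<^sup>2 \<le> C1 / h\<^sup>2 * Y\<^sup>2 + C2 / h * Y * X"
  shows "X \<le> (1 + (C1 + C2) / \<alpha>) / h * Y"
proof (rule ccontr)
  define t where "t = Y / h"
  have t: "t \<ge> 0" using assms by (simp add: t_def)
  assume "\<not> X \<le> (1 + (C1 + C2) / \<alpha>) / h * Y"
  then have gt: "X > t + (C1 + C2) / \<alpha> * t" by (simp add: t_def algebra_simps add_divide_distrib)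
  have nn: "0 \<le> (C1 + C2) / \<alpha> * t" using assms t by simp
  have tX: "t \<le> X" "X > 0" using gt nn t by linarith+
  have "\<alpha> * X\<^sup>2 \<le> C1 * t * t + C2 * t * X" using le by (simp add: t_def power2_eq_square)
  also have "C1 * t * t \<le> C1 * t * X" using tX t assms by (intro mult_left_mono) auto
  finally have "(\<alpha> * X) * X \<le> ((C1 + C2) * t) * X" by (simp add: algebra_simps power2_eq_square)
  then have "\<alpha> * X \<le> (C1 + C2) * t" using tX(2) by simp
  then have "X \<le> (C1 + C2) * t / \<alpha>" using assms(1) by (simp add: pos_le_divide_eq mult.commute)
  then show False using gt t by simp
qed

context carleman
begin

text \<open>Serves both resolvent bounds: \<open>c\<close> is 1 for the global one and the indicator
  of the exterior for the other. \<open>Xl\<close> bounds the Carleman weight from below only where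
  c = 1, so the loss is the square of Xh / Xl, and this ratio is 1 when the weight is constant on
  that set.\<close>

lemma localized_resolvent_estimate:
  fixes c :: "'a \<Rightarrow> real" and g :: "'a \<Rightarrow> complex" and s :: real
  assumes e: "0 < \<epsilon>" and h1: "h \<le> 1" and E: "E > 0" and M: "AE x in lborel. \<bar>V x\<bar> \<le> M" and M0: "0 \<le> M"
    and d: "0 < d" "\<And>r. r > 0 \<Longrightarrow> d * (1 + r) powr (- (2 * s)) \<le> w1 r" and s: "0 \<le> s"
    and c: "c \<in> borel_measurable borel" "\<And>x. c x = 0 \<or> c x = 1"
    and Xl: "0 < Xl" "Xl \<le> Xh" "\<And>x. x \<noteq> 0 \<Longrightarrow> c x = 1 \<Longrightarrow> Xl \<le> Xw x"
    and Xh: "\<And>r. r > 0 \<Longrightarrow> exp (\<phi> r / h) \<le> Xh" and g: "sqi g"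
  defines "v \<equiv> weight s (mult_op c (resolvent (schroedinger h V E) (\<i> * complex_of_real \<epsilon>) (mult_op c (weight s g))))"
  shows "sqi v"
    "sqrt (N2 v) \<le> (1 + (1 / d * (1 / 2 + (N - 1)\<^sup>2 / (2 * E)) + (2 + M + E) / 2) / (E / 8 * d)) / h * ((Xh / Xl)\<^sup>2 * sqrt (N2 g))"
proof -
  define f where "f = mult_op c (weight s g)"
  define u where "u = resolvent (schroedinger h V E) (\<i> * complex_of_real \<epsilon>) f"
  have v_eq: "v = weight s (mult_op c u)" by (simp add: v_def u_def f_def)
  define k where "k = (\<lambda>x::'a. (1 + norm x) powr (- s))"
  have k: "0 < k x" "k x \<le> 1" "(1 + norm x) powr (- (2 * s)) = k x * k x" "(1 + norm x) powr (2 * s) * (k x * k x) = 1" for x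
  proof -
    show "0 < k x" by (simp add: k_def add_nonneg_eq_0_iff)
    show "k x \<le> 1" using powr_mono[of "- s" 0 "1 + norm x"] s by (simp add: k_def add_nonneg_eq_0_iff)
    show "(1 + norm x) powr (- (2 * s)) = k x * k x" by (simp add: k_def powr_add[symmetric])
    show "(1 + norm x) powr (2 * s) * (k x * k x) = 1" by (simp add: k_def powr_add[symmetric] add_nonneg_eq_0_iff)
  qed
  have km: "k \<in> borel_measurable borel" unfolding k_def by measurable
  have c01: "0 \<le> c x" "c x \<le> 1" "\<bar>c x\<bar> = c x" "c x * c x = c x" for x using c(2)[of x] by auto
  have nf: "norm (f x) = c x * (k x * norm (g x))" for x
    using c01 k(1)[of x] by (simp add: f_def mult_op_def weight_def norm_mult k_def)
  have nv: "norm (v x) = k x * (c x * norm (u x))" for x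
    using c01 k(1)[of x] by (simp add: v_eq mult_op_def weight_def norm_mult k_def)
  have ck: "c x * k x \<le> 1" "0 \<le> c x * k x" for x
    using mult_mono[OF c01(2) k(2), of x x] c01(1)[of x] k(1)[of x] by simp_all
  have mult_meas: "mult_op m F \<in> borel_measurable borel" if "m \<in> borel_measurable borel" "F \<in> borel_measurable borel" for m and F :: "'a \<Rightarrow> complex"
    using that unfolding mult_op_def by measurable
  note gm = sqi_measurable[OF g]
  have f: "sqi f" "N2 f \<le> N2 g"
  proof -
    have m: "f \<in> borel_measurable borel"
      unfolding f_def weight_def using mult_meas[OF c(1) mult_meas[OF km gm]] by (simp add: k_def)
    have "norm (f x) \<le> 1 * norm (g x)" for x
      using mult_right_mono[OF ck(1) norm_ge_zero[of "g x"], of x] by (simp add: nf mult.assoc)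
    then have b: "AE x in lborel. norm (f x) \<le> 1 * norm (g x)" by blast
    show "sqi f" "N2 f \<le> N2 g" using sqi_bound[OF g m b] by simp_all
  qed
  obtain U G1 G2 where U: "\<And>n. ccC (U n)" and lim: "lim2 U u" "lim2 (\<lambda>n. QQ h (\<lambda>x. V x - E) (- \<epsilon>) (U n)) f"
    and G: "\<And>b. b \<in> Basis \<Longrightarrow> lim2 (\<lambda>n. pd b (\<lambda>x. Re (U n x))) (G1 b)" "\<And>b. b \<in> Basis \<Longrightarrow> lim2 (\<lambda>n. pd b (\<lambda>x. Im (U n x))) (G2 b)"
  proof -
    have "\<epsilon> \<noteq> 0" using e by simp
    from resolvent_approximation[OF h V this f(1), of E, folded u_def] that show thesis by blast
  qed
  have u: "sqi u" using lim(1) lim2D(2) by blast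
  have v: "sqi v" "N2 v \<le> N2 u"
  proof -
    have m: "v \<in> borel_measurable borel"
      unfolding v_eq weight_def using mult_meas[OF km mult_meas[OF c(1) sqi_measurable[OF u]]] by (simp add: k_def)
    have "norm (v x) \<le> 1 * norm (u x)" for x
      using mult_right_mono[OF ck(1) norm_ge_zero[of "u x"], of x] by (simp add: nv mult_ac)
    then have b: "AE x in lborel. norm (v x) \<le> 1 * norm (u x)" by blast
    show "sqi v" "N2 v \<le> N2 u" using sqi_bound[OF u m b] by simp_all
  qed
  show "sqi v" by (rule v(1))
  define C1 C2 \<alpha> where "C1 = 1 / d * (1 / 2 + (N - 1)\<^sup>2 / (2 * E))" and "C2 = (2 + M + E) / 2" and "\<alpha> = E / 8 * d"
  define X Gn Q where "X = sqrt (N2 v)" and "Gn = sqrt (N2 g)" and "Q = (Xh / Xl)\<^sup>2"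
  have pos: "0 < \<alpha>" "0 \<le> C1" "0 \<le> C2" "0 \<le> X" "0 \<le> Gn" using d E M0 by (auto simp: C1_def C2_def \<alpha>_def X_def Gn_def)
  have Q1: "1 \<le> Q" unfolding Q_def using Xl by (intro one_le_power) simp
  have "X \<le> (1 + (C1 + C2) / \<alpha>) / h * (Q * Gn)"
  proof (cases "\<epsilon> \<le> 1")
    \<comment> \<open>For \<epsilon> > 1 the imaginary part of the energy identity alone bounds u by
      f.\<close>
    case False
    have "1 * N2 u \<le> \<epsilon> * N2 u" using False by (intro mult_right_mono) auto
    also have "\<dots> \<le> (\<integral>x. norm (f x) * norm (u x) \<partial>lborel)"
      by (rule energy_Im_lim[OF _ U lim]) (intro bdd_meas_diff V bdd_meas_const)
    also have "\<dots> \<le> sqrt (N2 f) * sqrt (N2 u)" by (rule cauchy_schwarz_norm[OF f(1) u])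
    finally have le: "sqrt (N2 u) * sqrt (N2 u) \<le> sqrt (N2 f) * sqrt (N2 u)" by simp
    have "a \<le> b" if "a * a \<le> b * a" "0 \<le> a" "0 \<le> b" for a b :: real using that by (cases "a = 0") auto
    from this[OF le] have "sqrt (N2 u) \<le> sqrt (N2 f)" by simp
    then have "X \<le> Gn" unfolding X_def Gn_def using real_sqrt_le_mono[OF v(2)] real_sqrt_le_mono[OF f(2)] by linarith
    also have "\<dots> \<le> (1 + (C1 + C2) / \<alpha>) / h * (Q * Gn)"
    proof -
      have "1 \<le> (1 + (C1 + C2) / \<alpha>) / h" using h h1 pos by (simp add: pos_le_divide_eq add_increasing2)
      from mult_mono[OF this mult_right_mono[OF Q1 pos(5)]] this pos Q1 show ?thesis by simp
    qed
    finally show ?thesis .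
  next
    case True
    have ig: "integrable lborel (\<lambda>x. (norm (g x))\<^sup>2)" by (rule sqi_integrable[OF g])
    have cb: "bdd_meas c" unfolding bdd_meas_def using c(1) c01 by (auto intro!: exI[of _ 1])
    have fg: "(1 + norm x) powr (2 * s) * (norm (f x))\<^sup>2 = c x * (norm (g x))\<^sup>2" for x
    proof -
      have "(1 + norm x) powr (2 * s) * (norm (f x))\<^sup>2 = ((1 + norm x) powr (2 * s) * (k x * k x)) * (c x * c x) * (norm (g x))\<^sup>2"
        by (simp add: nf power2_eq_square mult_ac)
      then show ?thesis unfolding k(4) c01(4) by simp
    qed
    have intf: "integrable lborel (\<lambda>x. (1 + norm x) powr (2 * s) * (norm (f x))\<^sup>2)"
      unfolding fg by (rule bdd_meas_integrable[OF cb ig])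
    have w1p: "0 < w1 r" "1 \<le> w1 r * (1 / d) * (1 + r) powr (2 * s)" if r: "r > 0" for r
    proof -
      have p: "0 < d * (1 + r) powr (- (2 * s))" using d(1) r by simp
      show "0 < w1 r" using p d(2)[OF r] by linarith
      have "1 = (1 + r) powr (- (2 * s)) * (1 + r) powr (2 * s)" using r by (simp add: powr_add[symmetric])
      also have "(1 + r) powr (- (2 * s)) \<le> w1 r * (1 / d)" using d(1) d(2)[OF r] by (simp add: pos_le_divide_eq mult.commute)
      finally show "1 \<le> w1 r * (1 / d) * (1 + r) powr (2 * s)" by (simp add: mult_right_mono)
    qed
    have CE: "E / 8 * (\<integral>x. w1 (norm x) * (Xw x)\<^sup>2 * (norm (u x))\<^sup>2 \<partial>lborel)
      \<le> C1 / h\<^sup>2 * (\<integral>x. (Xw x)\<^sup>2 * (1 + norm x) powr (2 * s) * (norm (f x))\<^sup>2 \<partial>lborel)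
      + Xh\<^sup>2 / (2 * h) * (2 + M + E) * (\<integral>x. norm (f x) * norm (u x) \<partial>lborel)"
      unfolding C1_def by (rule carleman_estimate[OF U lim G e True h1 E M M0 w1p Xh intf])
    have I1: "(\<integral>x. (Xw x)\<^sup>2 * (1 + norm x) powr (2 * s) * (norm (f x))\<^sup>2 \<partial>lborel) \<le> Xh\<^sup>2 * Gn\<^sup>2"
    proof -
      have "(\<integral>x. (Xw x)\<^sup>2 * (1 + norm x) powr (2 * s) * (norm (f x))\<^sup>2 \<partial>lborel) \<le> (\<integral>x. Xh\<^sup>2 * (norm (g x))\<^sup>2 \<partial>lborel)"
      proof (rule integral_mono_AE)
        show "integrable lborel (\<lambda>x. (Xw x)\<^sup>2 * (1 + norm x) powr (2 * s) * (norm (f x))\<^sup>2)"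
          using bdd_meas_integrable[OF weights_bdd(1) bdd_meas_integrable[OF weights_bdd(1) intf]] by (simp add: power2_eq_square mult.assoc)
        show "AE x in lborel. (Xw x)\<^sup>2 * (1 + norm x) powr (2 * s) * (norm (f x))\<^sup>2 \<le> Xh\<^sup>2 * (norm (g x))\<^sup>2"
          using AE_nonzero
        proof eventually_elim
          case (elim x)
          have 1: "(Xw x)\<^sup>2 \<le> Xh\<^sup>2" using Xh[of "norm x"] elim by (intro power_mono) (auto simp: Xw_def)
          have 2: "c x * (norm (g x))\<^sup>2 \<le> 1 * (norm (g x))\<^sup>2" using c01(2) by (intro mult_right_mono) auto
          show ?case unfolding mult.assoc fg using mult_mono[OF 1 2] c01(1)[of x] by simp
        qed
      qed (use ig in simp)
      then show ?thesis by (simp add: Gn_def N2_def[symmetric])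
    qed
    \<comment> \<open>Weight and cutoff move from f to u: |f| |u| = |g| |v| pointwise. So the
      \<epsilon> term sees u only where c = 1 and can be absorbed by X.\<close>
    have I2: "(\<integral>x. norm (f x) * norm (u x) \<partial>lborel) \<le> Gn * X"
    proof -
      have "norm (f x) * norm (u x) = norm (g x) * norm (v x)" for x by (simp add: nf nv mult_ac)
      then show ?thesis using cauchy_schwarz_norm[OF g v(1)] by (simp add: Gn_def X_def)
    qed
    have I3: "d * Xl\<^sup>2 * X\<^sup>2 \<le> (\<integral>x. w1 (norm x) * (Xw x)\<^sup>2 * (norm (u x))\<^sup>2 \<partial>lborel)"
    proof -
      have "(\<integral>x. d * Xl\<^sup>2 * (norm (v x))\<^sup>2 \<partial>lborel) \<le> (\<integral>x. w1 (norm x) * (Xw x)\<^sup>2 * (norm (u x))\<^sup>2 \<partial>lborel)"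
      proof (rule integral_mono_AE)
        show "integrable lborel (\<lambda>x. w1 (norm x) * (Xw x)\<^sup>2 * (norm (u x))\<^sup>2)"
          using bdd_meas_integrable[OF weights_bdd(3) bdd_meas_integrable[OF weights_bdd(1) bdd_meas_integrable[OF weights_bdd(1) sqi_integrable[OF u]]]]
          by (simp add: power2_eq_square mult.assoc)
        show "AE x in lborel. d * Xl\<^sup>2 * (norm (v x))\<^sup>2 \<le> w1 (norm x) * (Xw x)\<^sup>2 * (norm (u x))\<^sup>2"
          using AE_nonzero
        proof eventually_elim
          case (elim x)
          show ?case
          proof (cases "c x = 1")
            case True
            have 1: "Xl\<^sup>2 \<le> (Xw x)\<^sup>2" using Xl(3)[OF elim True] Xl(1) by (intro power_mono) auto
            have 2: "d * (k x * k x) \<le> w1 (norm x)" using d(2)[of "norm x"] elim unfolding k(3) by simp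
            have "d * Xl\<^sup>2 * (norm (v x))\<^sup>2 = (d * (k x * k x)) * Xl\<^sup>2 * (norm (u x))\<^sup>2"
              by (simp add: nv True power2_eq_square mult_ac)
            also have "\<dots> \<le> w1 (norm x) * (Xw x)\<^sup>2 * (norm (u x))\<^sup>2"
              using w1p(1)[of "norm x"] elim by (intro mult_right_mono mult_mono[OF 2 1]) auto
            finally show ?thesis .
          next
            case False
            then have "norm (v x) = 0" using c(2)[of x] by (simp add: nv)
            moreover have "0 < w1 (norm x)" using w1p(1)[of "norm x"] elim by simp
            ultimately show ?thesis by simp
          qed
        qed
      qed (use sqi_integrable[OF v(1)] in simp)
      then show ?thesis by (simp add: X_def N2_def[symmetric])
    qed
    have "Xl\<^sup>2 * (\<alpha> * X\<^sup>2) = E / 8 * (d * Xl\<^sup>2 * X\<^sup>2)" by (simp add: \<alpha>_def)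
    also have "\<dots> \<le> E / 8 * (\<integral>x. w1 (norm x) * (Xw x)\<^sup>2 * (norm (u x))\<^sup>2 \<partial>lborel)"
      using E by (intro mult_left_mono I3) simp
    also note CE
    also have "C1 / h\<^sup>2 * (\<integral>x. (Xw x)\<^sup>2 * (1 + norm x) powr (2 * s) * (norm (f x))\<^sup>2 \<partial>lborel)
      + Xh\<^sup>2 / (2 * h) * (2 + M + E) * (\<integral>x. norm (f x) * norm (u x) \<partial>lborel)
      \<le> C1 / h\<^sup>2 * (Xh\<^sup>2 * Gn\<^sup>2) + Xh\<^sup>2 / (2 * h) * (2 + M + E) * (Gn * X)"
      using pos(2) h M0 E by (intro add_mono mult_left_mono I1 I2) auto
    also have "\<dots> = Xl\<^sup>2 * (C1 / h\<^sup>2 * (Q * Gn\<^sup>2) + C2 / h * (Q * Gn) * X)"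
    proof -
      have XQ: "Xh\<^sup>2 = Xl\<^sup>2 * Q" using Xl(1) by (simp add: Q_def power_divide)
      show ?thesis unfolding XQ C2_def using h by (simp add: field_simps)
    qed
    finally have "\<alpha> * X\<^sup>2 \<le> C1 / h\<^sup>2 * (Q * Gn\<^sup>2) + C2 / h * (Q * Gn) * X"
      using Xl(1) by (simp only: mult_le_cancel_left_pos zero_less_power)
    also have "C1 / h\<^sup>2 * (Q * Gn\<^sup>2) \<le> C1 / h\<^sup>2 * (Q * Gn)\<^sup>2"
    proof -
      have "Q * Gn\<^sup>2 * 1 \<le> Q * Gn\<^sup>2 * Q" using Q1 by (intro mult_left_mono) auto
      then have "Q * Gn\<^sup>2 \<le> (Q * Gn)\<^sup>2" by (simp add: power2_eq_square mult_ac)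
      then show ?thesis using pos(2) by (intro mult_left_mono) auto
    qed
    finally have "\<alpha> * X\<^sup>2 \<le> C1 / h\<^sup>2 * (Q * Gn)\<^sup>2 + C2 / h * (Q * Gn) * X" by simp
    then show ?thesis by (rule quadratic_bound[rotated -1]) (use pos Q1 h in auto)
  qed
  then show "sqrt (N2 v) \<le> (1 + (1 / d * (1 / 2 + (N - 1)\<^sup>2 / (2 * E)) + (2 + M + E) / 2) / (E / 8 * d)) / h * ((Xh / Xl)\<^sup>2 * sqrt (N2 g))"
    unfolding X_def Gn_def Q_def C1_def C2_def \<alpha>_def .
qed

end

theorem mainTheorem1:
  fixes V dV :: "real \<Rightarrow> 'a::euclidean_space \<Rightarrow> real"
    and E \<delta>\<^sub>0 s :: real
  assumes "DIM('a) \<noteq> 2"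
    and "E > 0"
    and "uniformly_bounded_potential V"
    and "\<And>h. h > 0 \<Longrightarrow> dV h \<in> Linfty"
    and "\<And>h. h > 0 \<Longrightarrow> has_distributional_radial_derivative (V h) (dV h)"
    and "\<delta>\<^sub>0 > 0"
    and "\<And>h. h > 0 \<Longrightarrow> AE x in lborel. V h x \<le> (1 + norm x) powr (- \<delta>\<^sub>0)"
    and "\<And>h. h > 0 \<Longrightarrow> AE x in lborel. dV h x \<le> (1 + norm x) powr (- 1 - \<delta>\<^sub>0)"
    and "s > 1 / 2"
  shows "\<exists>C R\<^sub>0 h\<^sub>0 :: real. C > 0 \<and> R\<^sub>0 > 0 \<and> h\<^sub>0 > 0 \<and>
    (\<forall>\<epsilon>>0. \<forall>h. 0 < h \<and> h \<le> h\<^sub>0 \<longrightarrow>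
      L2_opnorm (weight s
          \<circ> resolvent (schroedinger h (V h) E) (\<i> * complex_of_real \<epsilon>)
          \<circ> weight s :: ('a \<Rightarrow> complex) \<Rightarrow> ('a \<Rightarrow> complex)) \<le> ennreal (exp (C / h)) \<and>
      L2_opnorm (weight s \<circ> exterior R\<^sub>0
          \<circ> resolvent (schroedinger h (V h) E) (\<i> * complex_of_real \<epsilon>)
          \<circ> exterior R\<^sub>0 \<circ> weight s :: ('a \<Rightarrow> complex) \<Rightarrow> ('a \<Rightarrow> complex)) \<le> ennreal (C / h))"
proof -
  obtain \<delta> \<phi> \<psi> \<psi>1 \<psi>2 B R0 h0 where \<delta>: "0 < \<delta>" "\<delta> \<le> 1" "1 + \<delta> \<le> 2 * s" and R0: "R0 > 0" and h0: "0 < h0" "h0 \<le> 1"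
    and \<phi>: "smooth_on {0<..} \<phi>"
      "\<And>r. r > 0 \<Longrightarrow> (\<phi> has_real_derivative \<psi> r) (at r)"
      "\<And>r. r > 0 \<Longrightarrow> (\<psi> has_real_derivative \<psi>1 r) (at r)"
      "\<And>r. r > 0 \<Longrightarrow> (\<psi>1 has_real_derivative \<psi>2 r) (at r)"
    and \<psi>: "\<And>r. r > 0 \<Longrightarrow> 0 \<le> \<psi> r" "\<And>r. r > 0 \<Longrightarrow> \<psi> r \<le> B" "\<And>r. r > 0 \<Longrightarrow> \<bar>\<psi>1 r\<bar> \<le> B"
    and \<phi>b: "\<And>r. r > 0 \<Longrightarrow> 0 \<le> \<phi> r" "\<And>r. r > 0 \<Longrightarrow> \<phi> r \<le> \<phi> R0" "\<And>r. r \<ge> R0 \<Longrightarrow> \<phi> r = \<phi> R0" "\<phi> R0 \<le> B"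
    and key: "\<And>h r. 0 < h \<Longrightarrow> h \<le> h0 \<Longrightarrow> r > 0 \<Longrightarrow>
       wt1 \<delta> r * (E + (\<psi> r)\<^sup>2 - h * \<psi>1 r) + wt \<delta> r * (2 * \<psi> r * \<psi>1 r - h * \<psi>2 r)
      \<ge> E / 2 * wt1 \<delta> r + wt1 \<delta> r * (1 + r) powr (- \<delta>\<^sub>0) + wt \<delta> r * (1 + r) powr (- 1 - \<delta>\<^sub>0)"
  proof (rule carleman_weights[OF assms(2,6,9)], goal_cases)
    case (1 \<delta> \<phi> \<psi> \<psi>1 \<psi>2 B R0 h0)
    show ?case by (rule that[of \<delta> R0 h0 \<phi> \<psi> \<psi>1 \<psi>2 B]) (fact 1)+
  qed
  obtain M' where M': "\<And>h. h > 0 \<Longrightarrow> AE x in lborel. \<bar>V h x\<bar> \<le> M'" and Vm: "\<And>h. h > 0 \<Longrightarrow> V h \<in> borel_measurable borel"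
    using assms(3) unfolding uniformly_bounded_potential_def by blast
  define M where "M = \<bar>M'\<bar>"
  have M: "AE x in lborel. \<bar>V h x\<bar> \<le> M" if "h > 0" for h using M'[OF that] by eventually_elim (simp add: M_def)
  have M0: "0 \<le> M" by (simp add: M_def)
  define C3 where "C3 = 1 + (1 / \<delta> * (1 / 2 + (real DIM('a) - 1)\<^sup>2 / (2 * E)) + (2 + M + E) / 2) / (E / 8 * \<delta>)"
  have C3: "C3 \<ge> 1" unfolding C3_def using assms(2) \<delta>(1) M0 by (simp add: add_nonneg_nonneg)
  have f0: "\<phi> R0 \<ge> 0" using \<phi>b(1)[OF R0] .
  \<comment> \<open>The summand 2 \<phi>(R0) accounts for the squared Carleman weight exp (2
    \<phi>(R0) / h) in the first estimate.\<close>
  define C where "C = C3 + 2 * \<phi> R0"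
  have main: "sqi v \<and> sqrt (N2 v) \<le> C3 / h * ((exp (\<phi> R0 / h) / Xl)\<^sup>2 * sqrt (N2 g))"
    if h: "0 < h" "h \<le> h0" and e: "0 < \<epsilon>" and c: "c \<in> borel_measurable borel" "\<And>x. c x = 0 \<or> c x = 1"
      and Xl: "0 < Xl" "Xl \<le> exp (\<phi> R0 / h)" "\<And>x. x \<noteq> 0 \<Longrightarrow> c x = 1 \<Longrightarrow> Xl \<le> exp (\<phi> (norm x) / h)" and g: "sqi g"
      and v: "v = weight s (mult_op c (resolvent (schroedinger h (V h) E) (\<i> * complex_of_real \<epsilon>) (mult_op c (weight s g))))"
    for h \<epsilon> Xl and c :: "'a \<Rightarrow> real" and g v :: "'a \<Rightarrow> complex"
  proof -
    have h1: "h \<le> 1" using h h0 by simp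
    \<comment> \<open>The locale is instantiated for each h, while the weights and their constants
      are the same for all h <= h0. Together with the uniform bound M this makes C independent of
      h.\<close>
    interpret carleman "wt \<delta>" "wt1 \<delta>" "wt2 \<delta>" \<phi> \<psi> \<psi>1 \<psi>2 h E \<delta>\<^sub>0 B "V h"
    proof
      show "(wt \<delta> has_real_derivative wt1 \<delta> r) (at r)" "(wt1 \<delta> has_real_derivative wt2 \<delta> r) (at r)" if "r > 0" for r
        using wt_deriv[of r \<delta>] that by auto
      show "bdd_meas (V h)" unfolding bdd_meas_def using Vm M h(1) by blast
      show "\<bar>\<phi> r\<bar> \<le> B" if "r > 0" for r using \<phi>b(1,2)[OF that] \<phi>b(4) by linarith
    next
      fix \<zeta> :: "'a \<Rightarrow> real" and \<eta> R
      assume z: "smooth_on UNIV \<zeta>" "\<And>x. norm x < \<eta> \<Longrightarrow> \<zeta> x = 0" "\<eta> > 0" "\<And>x. norm x > R \<Longrightarrow> \<zeta> x = 0" "\<And>x. 0 \<le> \<zeta> x"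
      show "(\<integral>x. V h x * rd \<zeta> x * norm x powr (1 - real DIM('a)) \<partial>lborel) \<ge> - (\<integral>x. (1 + norm x) powr (- 1 - \<delta>\<^sub>0) * \<zeta> x * norm x powr (1 - real DIM('a)) \<partial>lborel)"
        by (rule radial_derivative_bound[OF assms(4)[OF h(1)] assms(5)[OF h(1)] assms(6) assms(8)[OF h(1)] z])
    qed (fact h(1) assms(1) smooth_wt \<phi>(1) \<phi>(2) \<phi>(3) \<phi>(4) \<psi> assms(7)[OF h(1)] key[OF h] | rule wt_bounds[OF \<delta>(1,2)] less_imp_le[OF wt_bounds(5)[OF \<delta>(1,2)]], assumption)+
    have d: "\<delta> * (1 + r) powr (- (2 * s)) \<le> wt1 \<delta> r" if "r > 0" for r
      unfolding wt1_def using that \<delta> by (intro mult_left_mono powr_mono) auto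
    have Xh: "exp (\<phi> r / h) \<le> exp (\<phi> R0 / h)" if "r > 0" for r
      using \<phi>b(2)[OF that] h(1) by (simp add: divide_right_mono)
    have s0: "0 \<le> s" using assms(9) by simp
    have Xl': "Xl \<le> Xw x" if "x \<noteq> 0" "c x = 1" for x using Xl(3)[OF that] unfolding Xw_def .
    show ?thesis unfolding v C3_def
      using localized_resolvent_estimate[OF e h1 assms(2) M[OF h(1)] M0 \<delta>(1) d s0 c Xl(1,2) Xl' Xh g] unfolding N_def by blast
  qed
  have bounds: "L2_opnorm (weight s \<circ> resolvent (schroedinger h (V h) E) (\<i> * complex_of_real \<epsilon>)
          \<circ> weight s :: ('a \<Rightarrow> complex) \<Rightarrow> ('a \<Rightarrow> complex)) \<le> ennreal (exp (C / h))"
      "L2_opnorm (weight s \<circ> exterior R0 \<circ> resolvent (schroedinger h (V h) E) (\<i> * complex_of_real \<epsilon>)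
          \<circ> exterior R0 \<circ> weight s :: ('a \<Rightarrow> complex) \<Rightarrow> ('a \<Rightarrow> complex)) \<le> ennreal (C / h)"
    if h: "0 < h" "h \<le> h0" and e: "0 < \<epsilon>" for h \<epsilon>
  proof -
    let ?R = "resolvent (schroedinger h (V h) E) (\<i> * complex_of_real \<epsilon>) :: ('a \<Rightarrow> complex) \<Rightarrow> _"
    let ?X = "exp (\<phi> R0 / h)"
    have X1: "1 \<le> ?X" using f0 h(1) by simp
    \<comment> \<open>The prefactor C3 / h is absorbed into the exponential.\<close>
    have "C3 / h \<le> exp (C3 / h)" using exp_ge_add_one_self[of "C3 / h"] by linarith
    then have "C3 / h * ?X\<^sup>2 \<le> exp (C3 / h) * ?X\<^sup>2" by (rule mult_right_mono) simp
    also have "\<dots> = exp (C / h)"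
      by (simp add: C_def power2_eq_square exp_add[symmetric] add_divide_distrib)
    finally have CC: "C3 / h * ?X\<^sup>2 \<le> exp (C / h)" .
    have one: "mult_op (\<lambda>x. 1) F = F" for F :: "'a \<Rightarrow> complex" by (simp add: mult_op_def)
    have 1: "sqi (weight s (?R (weight s g))) \<and> sqrt (N2 (weight s (?R (weight s g)))) \<le> C3 / h * ((?X / 1)\<^sup>2 * sqrt (N2 g))" if "sqi g" for g
      by (rule main[OF h e, of "\<lambda>x. 1"]) (use X1 that \<phi>b(1) h(1) in \<open>auto simp: one\<close>)
    show "L2_opnorm (weight s \<circ> ?R \<circ> weight s) \<le> ennreal (exp (C / h))"
    proof (rule L2_opnorm_le)
      fix g :: "'a \<Rightarrow> complex" assume g: "sqi g"
      show "sqi ((weight s \<circ> ?R \<circ> weight s) g)" using 1[OF g] by simp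
      have "sqrt (N2 (weight s (?R (weight s g)))) \<le> (C3 / h * ?X\<^sup>2) * sqrt (N2 g)" using 1[OF g] by simp
      also have "\<dots> \<le> exp (C / h) * sqrt (N2 g)" by (intro mult_right_mono CC) simp
      finally show "sqrt (N2 ((weight s \<circ> ?R \<circ> weight s) g)) \<le> exp (C / h) * sqrt (N2 g)" by simp
    qed simp
    let ?T = "\<lambda>g. weight s (exterior R0 (?R (exterior R0 (weight s g))))"
    \<comment> \<open>Beyond R0 the function \<phi> is constant, so the lower and the upper bound of
      the weight are both \<open>?X\<close> and their ratio is 1.\<close>
    have 2: "sqi (?T g) \<and> sqrt (N2 (?T g)) \<le> C3 / h * ((?X / ?X)\<^sup>2 * sqrt (N2 g))" if g: "sqi g" for g
    proof (rule main[OF h e, of "indicator {x. norm x \<ge> R0}"])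
      show "indicator {x::'a. R0 \<le> norm x} \<in> borel_measurable borel" by measurable
      show "indicator {x::'a. R0 \<le> norm x} x = (0::real) \<or> indicator {x::'a. R0 \<le> norm x} x = (1::real)" for x by (simp add: indicator_def)
      show "?X \<le> exp (\<phi> (norm x) / h)" if "indicator {x::'a. R0 \<le> norm x} x = (1::real)" for x
        using \<phi>b(3)[of "norm x"] that by (simp add: indicator_def split: if_splits)
    qed (use g in \<open>auto simp: exterior_def\<close>)
    have "C3 / h \<le> C / h" using f0 h(1) by (simp add: C_def divide_right_mono)
    show "L2_opnorm (weight s \<circ> exterior R0 \<circ> ?R \<circ> exterior R0 \<circ> weight s) \<le> ennreal (C / h)"
    proof (rule L2_opnorm_le)
      show "0 \<le> C / h" using C3 f0 h(1) by (simp add: C_def)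
      fix g :: "'a \<Rightarrow> complex" assume g: "sqi g"
      show "sqi ((weight s \<circ> exterior R0 \<circ> ?R \<circ> exterior R0 \<circ> weight s) g)" using 2[OF g] by simp
      have "sqrt (N2 (?T g)) \<le> C3 / h * sqrt (N2 g)" using 2[OF g] by simp
      also have "\<dots> \<le> C / h * sqrt (N2 g)" by (intro mult_right_mono \<open>C3 / h \<le> C / h\<close>) simp
      finally show "sqrt (N2 ((weight s \<circ> exterior R0 \<circ> ?R \<circ> exterior R0 \<circ> weight s) g)) \<le> C / h * sqrt (N2 g)" by simp
    qed
  qed
  have "C > 0" using C3 f0 by (simp add: C_def)
  then show ?thesis using bounds R0 h0(1) by blast
qed

end
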